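(* The distance distribution of a tree with $n$ vertices can be computed in $O(n\log^2 n)$ time on a log-RAM.
   Context: The distance distribution of a graph $G=(V,E)$ is the sequence $(a_i)_{i\ge1}$ with $a_i=|\{\{u,v\}\subseteq V: d_G(u,v)=i\}|$, where $d_G$ is the shortest-path (number of edges) distance. A log-RAM is a word RAM that additionally supports constant-time arithmetic operations (including multiplication, integer division and modulo) on words of $O(\log n)$ bits. *)

theory Defs
  imports
    Complex_Main
    "HOL-Library.Extended_Nat"
    "HOL-Library.Log_Nat"
    "HOL-Library.Landau_Symbols"
begin

section \<open>Trees and their distance distribution\<close>

text \<open>A simple undirected graph is given by a vertex set \<open>V\<close> and a set \<open>E\<close> of two-element
  subsets of \<open>V\<close>. A walk is the nonempty list of the vertices it visits, so a walk \<open>p\<close> has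
  \<open>length p - 1\<close> edges.\<close>

definition simple_graph :: "'a set \<Rightarrow> 'a set set \<Rightarrow> bool" where
  "simple_graph V E \<longleftrightarrow> finite V \<and> E \<subseteq> {{u, v} | u v. u \<in> V \<and> v \<in> V \<and> u \<noteq> v}"

definition walk_betw :: "'a set \<Rightarrow> 'a set set \<Rightarrow> 'a \<Rightarrow> 'a list \<Rightarrow> 'a \<Rightarrow> bool" where
  "walk_betw V E u p v \<longleftrightarrow>
     p \<noteq> [] \<and> set p \<subseteq> V \<and> hd p = u \<and> last p = v \<and> successively (\<lambda>x y. {x, y} \<in> E) p"

definition connected_graph :: "'a set \<Rightarrow> 'a set set \<Rightarrow> bool" where
  "connected_graph V E \<longleftrightarrow> V \<noteq> {} \<and> (\<forall>u\<in>V. \<forall>v\<in>V. \<exists>p. walk_betw V E u p v)"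

text \<open>The closing edge from the last to the first vertex is not repeated in the list.\<close>

definition is_cycle :: "'a set \<Rightarrow> 'a set set \<Rightarrow> 'a list \<Rightarrow> bool" where
  "is_cycle V E p \<longleftrightarrow>
     length p \<ge> 3 \<and> distinct p \<and> walk_betw V E (hd p) p (last p) \<and> {last p, hd p} \<in> E"

definition is_tree :: "'a set \<Rightarrow> 'a set set \<Rightarrow> bool" where
  "is_tree V E \<longleftrightarrow> simple_graph V E \<and> connected_graph V E \<and> (\<nexists>p. is_cycle V E p)"

text \<open>The infimum over the empty set is \<open>\<infinity>\<close>.\<close>

definition graph_dist :: "'a set \<Rightarrow> 'a set set \<Rightarrow> 'a \<Rightarrow> 'a \<Rightarrow> enat" where
  "graph_dist V E u v = (INF p \<in> {p. walk_betw V E u p v}. enat (length p - 1))"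

definition distance_distribution :: "'a set \<Rightarrow> 'a set set \<Rightarrow> nat \<Rightarrow> nat" where
  "distance_distribution V E i =
     card {{u, v} | u v. u \<in> V \<and> v \<in> V \<and> graph_dist V E u v = enat i}"

text \<open>Hence on \<open>n\<close> vertices the whole sequence is determined by its entries \<open>1, \<dots>, n - 1\<close>.\<close>

lemma distance_distribution_eq_0:
  assumes fin: "finite V" and i: "i \<ge> card V"
  shows "distance_distribution V E i = 0"
proof -
  have False if "graph_dist V E u v = enat i" for u v
  proof -
    let ?A = "(\<lambda>p. enat (length p - 1)) ` {p. walk_betw V E u p v}"
    have "?A \<noteq> {}"
    proof
      assume "?A = {}"
      then have "graph_dist V E u v = \<infinity>"
        unfolding graph_dist_def by (simp only: Inf_enat_def simp_thms if_True)
      with that show False by simp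
    qed
    then have "Inf ?A \<in> ?A" by (metis Inf_enat_def LeastI ex_in_conv)
    then have "enat i \<in> ?A" using that by (simp only: graph_dist_def)
    then obtain p where p: "walk_betw V E u p v" and len: "length p - 1 = i"
      by auto
    have min: "i \<le> length q - 1" if "walk_betw V E u q v" for q
      using INF_lower[of q "{p. walk_betw V E u p v}" "\<lambda>p. enat (length p - 1)"] that
        \<open>graph_dist V E u v = enat i\<close> by (simp add: graph_dist_def)
    have "distinct p"
    proof (rule ccontr)
      assume "\<not> distinct p"
      then obtain xs ys zs y where eq: "p = xs @ [y] @ ys @ [y] @ zs"
        using not_distinct_decomp by blast
      have "walk_betw V E u (xs @ y # zs) v"
        using p unfolding eq walk_betw_def
        by (cases xs) (auto simp: successively_append_iff successively_Cons hd_append split: if_splits)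
      from min[OF this] len show False by (simp add: eq)
    qed
    then have "length p \<le> card V"
      using p fin by (metis card_mono distinct_card walk_betw_def)
    moreover have "length p > 0" using p by (simp add: walk_betw_def)
    ultimately show False using len i by linarith
  qed
  then have "{{u, v} | u v. u \<in> V \<and> v \<in> V \<and> graph_dist V E u v = enat i} = {}" by blast
  then show ?thesis by (simp only: distance_distribution_def card.empty)
qed


section \<open>The log-RAM\<close>

text \<open>A machine with word length \<open>w\<close> stores in each register and each memory cell a natural
  number below \<open>2 ^ w\<close>. A program mentions only finitely many registers; memory is accessed
  indirectly, through an address held in a register. Each instruction takes one time step.\<close>

datatype binop =
  OpAdd | OpSub | OpMul | OpDiv | OpMod | OpAnd | OpOr | OpXor | OpShl | OpShr

type_synonym reg = nat

datatype instr =
    Const reg nat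
  | Bin binop reg reg reg
  | Load reg reg
  | Store reg reg
  | Jump nat
  | JumpEq reg reg nat
  | JumpLess reg reg nat

text \<open>Arithmetic is modulo \<open>2 ^ w\<close>; as in HOL, \<open>a div 0 = 0\<close> and \<open>a mod 0 = a\<close>.\<close>

fun eval_binop :: "nat \<Rightarrow> binop \<Rightarrow> nat \<Rightarrow> nat \<Rightarrow> nat" where
  "eval_binop w OpAdd a b = take_bit w (a + b)"
| "eval_binop w OpSub a b = take_bit w (a + 2 ^ w - b)"
| "eval_binop w OpMul a b = take_bit w (a * b)"
| "eval_binop w OpDiv a b = take_bit w (a div b)"
| "eval_binop w OpMod a b = take_bit w (a mod b)"
| "eval_binop w OpAnd a b = take_bit w (and a b)"
| "eval_binop w OpOr a b = take_bit w (or a b)"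
| "eval_binop w OpXor a b = take_bit w (xor a b)"
| "eval_binop w OpShl a b = take_bit w (push_bit b a)"
| "eval_binop w OpShr a b = take_bit w (drop_bit b a)"

record config =
  pc :: nat
  regs :: "reg \<Rightarrow> nat"
  mem :: "nat \<Rightarrow> nat"

fun exec_instr :: "nat \<Rightarrow> instr \<Rightarrow> config \<Rightarrow> config" where
  "exec_instr w (Const r c) s =
     s\<lparr>pc := pc s + 1, regs := (regs s)(r := take_bit w c)\<rparr>"
| "exec_instr w (Bin f r a b) s =
     s\<lparr>pc := pc s + 1, regs := (regs s)(r := eval_binop w f (regs s a) (regs s b))\<rparr>"
| "exec_instr w (Load r a) s =
     s\<lparr>pc := pc s + 1, regs := (regs s)(r := mem s (regs s a))\<rparr>"
| "exec_instr w (Store a r) s =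
     s\<lparr>pc := pc s + 1, mem := (mem s)(regs s a := regs s r)\<rparr>"
| "exec_instr w (Jump l) s = s\<lparr>pc := l\<rparr>"
| "exec_instr w (JumpEq a b l) s =
     s\<lparr>pc := (if regs s a = regs s b then l else pc s + 1)\<rparr>"
| "exec_instr w (JumpLess a b l) s =
     s\<lparr>pc := (if regs s a < regs s b then l else pc s + 1)\<rparr>"

text \<open>The machine halts by leaving the program; a halted configuration no longer changes.\<close>

definition halted :: "instr list \<Rightarrow> config \<Rightarrow> bool" where
  "halted P s \<longleftrightarrow> length P \<le> pc s"

definition step :: "nat \<Rightarrow> instr list \<Rightarrow> config \<Rightarrow> config" where
  "step w P s = (if halted P s then s else exec_instr w (P ! pc s) s)"

definition initial_config :: "nat \<Rightarrow> nat list \<Rightarrow> config" where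
  "initial_config w xs =
     \<lparr>pc = 0, regs = (\<lambda>_. 0), mem = (\<lambda>i. if i < length xs then take_bit w (xs ! i) else 0)\<rparr>"

text \<open>Started with input \<open>xs\<close> in the first memory cells, the program halts after at most \<open>t\<close>
  steps with output \<open>ys\<close> in the first memory cells.\<close>

definition ram_computes :: "nat \<Rightarrow> instr list \<Rightarrow> nat list \<Rightarrow> nat list \<Rightarrow> nat \<Rightarrow> bool" where
  "ram_computes w P xs ys t \<longleftrightarrow>
     (let s = (step w P ^^ t) (initial_config w xs)
      in halted P s \<and> (\<forall>i < length ys. mem s i = ys ! i))"

text \<open>\<open>floorlog 2 n\<close> is the length of the binary representation of \<open>n\<close>.\<close>

definition log_word_length :: "nat \<Rightarrow> nat \<Rightarrow> nat" where
  "log_word_length k n = k * floorlog 2 n"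


section \<open>Input encoding\<close>

text \<open>The list contains each edge exactly once, in arbitrary order and orientation.\<close>

definition edge_list :: "'a set set \<Rightarrow> ('a \<times> 'a) list \<Rightarrow> bool" where
  "edge_list E es \<longleftrightarrow>
     distinct (map (\<lambda>(u, v). {u, v}) es) \<and> set (map (\<lambda>(u, v). {u, v}) es) = E"

definition encode_graph :: "nat \<Rightarrow> (nat \<times> nat) list \<Rightarrow> nat list" where
  "encode_graph n es = n # concat (map (\<lambda>(u, v). [u, v]) es)"

end

theory Submission
  imports Defs
begin

text \<open>Count ordered pairs: let \<open>D X i\<close> be the number of pairs at distance \<open>i\<close> in a component \<open>X\<close>.
  If \<open>c\<close> is removed from \<open>X\<close>, then \<open>D X = P X c 0 + (\<Sum>u. D (Y u) - P (Y u) u 1)\<close>, where \<open>u\<close> ranges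
  over the neighbours of \<open>c\<close>, \<open>Y u\<close> is the component of \<open>u\<close>, and \<open>P Z v d i\<close> counts the pairs in \<open>Z\<close>
  whose depths below \<open>v\<close>, each increased by \<open>d\<close>, sum to \<open>i\<close>. The numbers \<open>P Z v d\<close> are the
  coefficients of the square of a polynomial of degree at most \<open>card Z\<close>, which a fast Fourier transform
  computes in time \<open>O (card Z * log n)\<close>. Choosing \<open>c\<close> as a centroid at least halves the components, so
  every vertex takes part in \<open>O (log n)\<close> squarings.

  The machine has no complex numbers. The transform uses fixed-point arithmetic whose scale is a
  constant power of \<open>n\<close>: rounding errors grow by a factor of \<open>4\<close> per stage, hence polynomially, and
  numbers still fit into \<open>O (log n)\<close> bits. The roots of unity come from repeatedly halving the
  angle \<open>\<pi> / 2\<close>.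

  The algorithm is written in a small imperative language over the integers, whose compiler to the
  machine preserves results and running times.\<close>

section \<open>Distances and components in trees\<close>

text \<open>Ordered pairs are what squaring a polynomial counts; entries at positive distances are
  halved at the end. Depth sums are at most twice the size of a component, so a transform length
  \<open>N\<close> of at most four times that size suffices, whatever the depth of the whole tree.
  Every \<open>N\<close> is a power of two dividing one order \<open>N0\<close>, between
  \<open>4 * n\<close> and \<open>8 * n\<close>, so a single table of roots, read with stride
  \<open>N0 div N\<close>, serves all squarings. Exactness survives rounding because the cell to be
  read holds \<open>N\<close> times an integer, so an absolute error of \<open>1 / 4\<close> is
  harmless. With counts up to \<open>N0\<close>, spectra up to \<open>N0 ^ 2\<close> and squared
  spectra up to \<open>N0 ^ 4\<close>, the final error is at most \<open>N0 ^ 19 / S\<close>, which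
  leads to the scale \<open>S = N0 ^ 20\<close>. Products reach \<open>S ^ 3\<close>, so words need
  about 60 times the bits of \<open>N0\<close>; 256 times the bits of \<open>n\<close> suffice. The
  term subtracted for a branch is charged to that branch when it is taken from the stack, so each
  component is treated alone: one squaring from its entry vertex, one from its centroid.\<close>

lemma walk_rev: "walk_betw X E u p v \<Longrightarrow> walk_betw X E v (rev p) u"
  by (auto simp: walk_betw_def hd_rev last_rev insert_commute)

text \<open>\<open>tl\<close> drops the shared vertex \<open>v\<close>, which ends \<open>p\<close>
  and starts \<open>q\<close>.\<close>

lemma walk_append:
  assumes "walk_betw X E u p v" "walk_betw X E v q z"
  shows "walk_betw X E u (p @ tl q) z"
proof (cases q)
  case Nil then show ?thesis using assms by (simp add: walk_betw_def)
next
  case (Cons a q')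
  then have "a = v" using assms by (simp add: walk_betw_def)
  then show ?thesis using assms Cons
    by (cases q') (auto simp: walk_betw_def successively_append_iff successively_Cons hd_append last_append)
qed

lemma walk_join: "walk_betw X E u p z \<Longrightarrow> walk_betw X E v q z \<Longrightarrow> \<exists>p. walk_betw X E u p v"
  by (rule exI, rule walk_append[OF _ walk_rev])

lemma walk_mono: "walk_betw X E u p v \<Longrightarrow> X \<subseteq> Y \<Longrightarrow> walk_betw Y E u p v"
  by (auto simp: walk_betw_def)

lemma walk_set: "walk_betw X E u p v \<Longrightarrow> walk_betw (set p) E u p v"
  by (auto simp: walk_betw_def)

lemma walk_ends: "walk_betw X E u p v \<Longrightarrow> u \<in> X \<and> v \<in> X \<and> u \<in> set p \<and> v \<in> set p"
  by (auto simp: walk_betw_def)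

lemma walk_single: "u \<in> X \<Longrightarrow> walk_betw X E u [u] u"
  by (auto simp: walk_betw_def)

lemma walk_snoc: "walk_betw X E u p v \<Longrightarrow> {v, z} \<in> E \<Longrightarrow> z \<in> X \<Longrightarrow> walk_betw X E u (p @ [z]) z"
  by (auto simp: walk_betw_def successively_append_iff)

lemma walk_split:
  assumes "walk_betw X E u (xs @ y # ys) v"
  shows "walk_betw X E u (xs @ [y]) y" "walk_betw X E y (y # ys) v"
proof -
  have s: "set (xs @ y # ys) \<subseteq> X" "hd (xs @ y # ys) = u" "last (xs @ y # ys) = v"
    "successively (\<lambda>x y. {x, y} \<in> E) (xs @ y # ys)"
    using assms by (simp_all only: walk_betw_def)
  show "walk_betw X E y (y # ys) v" using s(1,3,4)
    by (simp add: walk_betw_def successively_append_iff)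
  show "walk_betw X E u (xs @ [y]) y" using s(1,2,4)
    by (auto simp: walk_betw_def successively_append_iff hd_append split: if_splits)
qed

text \<open>As long as a vertex repeats, the segment between two of its occurrences can be cut out,
  which adds no vertex and shortens the walk. The length bound is what lets paths compete with
  arbitrary walks in \<open>dist_path\<close>.\<close>

lemma walk_distinct:
  "walk_betw X E u p v \<Longrightarrow> \<exists>q. walk_betw X E u q v \<and> distinct q \<and> length q \<le> length p \<and> set q \<subseteq> set p"
proof (induction "length p" arbitrary: p rule: less_induct)
  case less
  show ?case
  proof (cases "distinct p")
    case True then show ?thesis using less.prems by blast
  next
    case False
    then obtain xs ys zs y where eq: "p = xs @ [y] @ ys @ [y] @ zs"
      using not_distinct_decomp by blast
    let ?q = "xs @ y # zs"
    have "walk_betw X E u (xs @ [y]) y" "walk_betw X E y (y # zs) v"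
      using walk_split(1)[of X E u xs y "ys @ [y] @ zs" v]
        walk_split(2)[of X E u "xs @ [y] @ ys" y zs v] less.prems eq by auto
    from walk_append[OF this] have "walk_betw X E u ?q v" by simp
    then obtain q where "walk_betw X E u q v" "distinct q" "length q \<le> length ?q" "set q \<subseteq> set ?q"
      using less.hyps[of ?q] eq by auto
    then show ?thesis using eq by (intro exI[of _ q]) auto
  qed
qed

text \<open>Connectivity of the subgraph induced by \<open>X\<close>. Unlike for
  \<open>connected_graph\<close>, the empty set qualifies, so \<open>part_con\<close> holds without
  a side condition.\<close>

definition con :: "'a set set \<Rightarrow> 'a set \<Rightarrow> bool" where
  "con E X \<longleftrightarrow> (\<forall>u\<in>X. \<forall>v\<in>X. \<exists>p. walk_betw X E u p v)"

lemma con_path: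
  "con E X \<Longrightarrow> u \<in> X \<Longrightarrow> v \<in> X \<Longrightarrow> \<exists>p. walk_betw X E u p v \<and> distinct p"
  unfolding con_def using walk_distinct by meson

lemma con_Un:
  assumes "con E X" "con E Y" "z \<in> X" "z \<in> Y"
  shows "con E (X \<union> Y)"
  unfolding con_def
proof (intro ballI)
  have *: "\<exists>p. walk_betw (X \<union> Y) E u p z" if "u \<in> X \<union> Y" for u
    using that assms walk_mono[of X E u _ z "X \<union> Y"] walk_mono[of Y E u _ z "X \<union> Y"]
    unfolding con_def by blast
  fix u v assume "u \<in> X \<union> Y" "v \<in> X \<union> Y"
  then obtain p q where "walk_betw (X \<union> Y) E u p z" "walk_betw (X \<union> Y) E v q z" using * by blast
  then show "\<exists>p. walk_betw (X \<union> Y) E u p v" by (rule walk_join)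
qed

lemma con_single: "con E {u}"
  unfolding con_def using walk_single by fastforce

lemma con_insert:
  assumes "con E X" "v \<in> X" "{v, w} \<in> E"
  shows "con E (insert w X)"
proof -
  have "walk_betw {v, w} E v [v, w] w" "walk_betw {v, w} E w [w, v] v"
    "walk_betw {v, w} E v [v] v" "walk_betw {v, w} E w [w] w"
    using assms(3) by (auto simp: walk_betw_def insert_commute)
  then have "con E {v, w}" unfolding con_def by blast
  from con_Un[OF assms(1) this assms(2)] show ?thesis
    using assms(2) by (simp add: insert_absorb)
qed

lemma con_walk:
  assumes "walk_betw X E u p v" shows "con E (set p)"
proof -
  have "\<exists>q. walk_betw (set p) E u q x" if x: "x \<in> set p" for x
  proof -
    obtain xs ys where "p = xs @ x # ys" using split_list[OF x] by blast
    then show ?thesis using walk_split(1)[of "set p" E u xs x ys v] walk_set[OF assms] by auto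
  qed
  then show ?thesis unfolding con_def using walk_join[OF walk_rev walk_rev] by meson
qed

section \<open>Unique paths and distances in trees\<close>

locale tree =
  fixes V :: "'a set" and E :: "'a set set"
  assumes tree: "is_tree V E"
begin

lemma finV: "finite V" and E_sub: "E \<subseteq> {{u, v} | u v. u \<in> V \<and> v \<in> V \<and> u \<noteq> v}"
  and V_ne: "V \<noteq> {}" and conV: "con E V" and acyclic: "\<not> is_cycle V E p"
  using tree by (auto simp: is_tree_def simple_graph_def connected_graph_def con_def)

lemma edgeD: "{u, v} \<in> E \<Longrightarrow> u \<in> V \<and> v \<in> V \<and> u \<noteq> v"
  using E_sub by (fastforce simp: doubleton_eq_iff)

text \<open>A path inside \<open>X\<close> between two distinct neighbours of \<open>w\<close> would
  be closed to a cycle by \<open>w\<close>. Acyclicity enters the development only here; unique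
  paths, disjoint branches, the edge count and the parent structure kept by the search all rest on
  this lemma.\<close>

lemma unique_nbr:
  assumes X: "con E X" "X \<subseteq> V" and w: "w \<notin> X" and ab: "a \<in> X" "b \<in> X" "{a, w} \<in> E" "{b, w} \<in> E"
  shows "a = b"
proof (rule ccontr)
  assume ne: "a \<noteq> b"
  obtain p where p: "walk_betw X E a p b" "distinct p" using con_path[OF X(1) ab(1,2)] by blast
  have wV: "w \<in> V" using edgeD[OF ab(3)] by blast
  have "length p \<ge> 2"
    using p ne by (cases p; cases "tl p") (auto simp: walk_betw_def)
  moreover have pX: "set p \<subseteq> X" using p(1) by (auto simp: walk_betw_def)
  moreover have "walk_betw V E a (p @ [w]) w"
    using walk_snoc[OF walk_mono[OF p(1) X(2)] ab(4) wV] .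
  moreover have "hd (p @ [w]) = a" using p(1) by (auto simp: walk_betw_def)
  ultimately have "is_cycle V E (p @ [w])"
    using p(2) w ab(3) by (auto simp: is_cycle_def insert_commute)
  then show False using acyclic by blast
qed

text \<open>The two tails are connected with each other through their common end \<open>v\<close>
  and avoid the first vertex \<open>x\<close>. Both of their heads are neighbours of
  \<open>x\<close>, so \<open>unique_nbr\<close> makes the heads equal.\<close>

lemma path_unique:
  "walk_betw V E u p v \<Longrightarrow> distinct p \<Longrightarrow> walk_betw V E u q v \<Longrightarrow> distinct q \<Longrightarrow> p = q"
proof (induction p arbitrary: u q)
  case Nil then show ?case by (simp add: walk_betw_def)
next
  case (Cons x p')
  obtain q' where q: "q = x # q'" using Cons.prems by (cases q) (auto simp: walk_betw_def)
  show ?case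
  proof (cases "p' = [] \<or> q' = []")
    case True
    then show ?thesis using Cons.prems q by (auto simp: walk_betw_def split: if_splits)
  next
    case False
    have w: "walk_betw V E (hd p') p' v" "walk_betw V E (hd q') q' v"
      "{hd p', x} \<in> E" "{hd q', x} \<in> E"
      using Cons.prems False unfolding q by (auto simp: walk_betw_def successively_Cons insert_commute)
    have c: "con E (set p' \<union> set q')"
      using con_Un[OF con_walk[OF w(1)] con_walk[OF w(2)], of v] walk_ends[OF w(1)] walk_ends[OF w(2)] by simp
    have "hd p' = hd q'"
    proof (rule unique_nbr[OF c _ _ _ _ w(3,4)])
      show "set p' \<union> set q' \<subseteq> V" "x \<notin> set p' \<union> set q'"
        using Cons.prems by (auto simp: q walk_betw_def)
    qed (use False in auto)
    then show ?thesis using Cons.IH[of "hd p'" q'] w Cons.prems q by auto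
  qed
qed

definition dst :: "'a \<Rightarrow> 'a \<Rightarrow> nat" where
  "dst u v = the_enat (graph_dist V E u v)"

text \<open>Any competing walk contains a path with the same ends, and that path can only be
  \<open>p\<close>.\<close>

lemma dist_path:
  assumes "walk_betw V E u p v" "distinct p"
  shows "graph_dist V E u v = enat (length p - 1)"
  unfolding graph_dist_def
proof (rule antisym)
  show "(INF p\<in>{p. walk_betw V E u p v}. enat (length p - 1)) \<le> enat (length p - 1)"
    using assms by (intro INF_lower) auto
  show "enat (length p - 1) \<le> (INF p\<in>{p. walk_betw V E u p v}. enat (length p - 1))"
  proof (rule INF_greatest)
    fix q assume "q \<in> {p. walk_betw V E u p v}"
    then obtain q' where "walk_betw V E u q' v" "distinct q'" "length q' \<le> length q"
      using walk_distinct[of V E u q v] by auto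
    then have "length p \<le> length q" using path_unique assms by blast
    then show "enat (length p - 1) \<le> enat (length q - 1)" by simp
  qed
qed

lemma dst_path: "walk_betw V E u p v \<Longrightarrow> distinct p \<Longrightarrow> dst u v = length p - 1"
  by (simp add: dst_def dist_path)

lemma dst_eq: "u \<in> V \<Longrightarrow> v \<in> V \<Longrightarrow> graph_dist V E u v = enat (dst u v)"
  using con_path[OF conV] dist_path by (fastforce simp: dst_def)

lemma dst_sym: "u \<in> V \<Longrightarrow> v \<in> V \<Longrightarrow> dst u v = dst v u"
proof -
  assume "u \<in> V" "v \<in> V"
  then obtain p where p: "walk_betw V E u p v" "distinct p" using con_path[OF conV] by blast
  then show ?thesis using dst_path[OF p] dst_path[OF walk_rev[OF p(1)]] by simp
qed

lemma dst_self [simp]: "u \<in> V \<Longrightarrow> dst u u = 0"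
  using dst_path[OF walk_single] by fastforce

text \<open>The path to \<open>c\<close> inside \<open>P\<close> and the path from \<open>c\<close>
  inside \<open>Q\<close> share only \<open>c\<close>, so their concatenation is again a path and
  its length is the distance.\<close>

lemma dst_join:
  assumes "con E P" "con E Q" "P \<inter> Q = {c}" "P \<subseteq> V" "Q \<subseteq> V" "u \<in> P" "v \<in> Q"
  shows "dst u v = dst u c + dst c v"
proof -
  have c: "c \<in> P" "c \<in> Q" using assms(3) by auto
  obtain p where p: "walk_betw P E u p c" "distinct p" using con_path[OF assms(1,6) c(1)] by blast
  obtain q where q: "walk_betw Q E c q v" "distinct q" using con_path[OF assms(2) c(2) assms(7)] by blast
  have pV: "walk_betw V E u p c" and qV: "walk_betw V E c q v"
    using walk_mono[OF p(1) assms(4)] walk_mono[OF q(1) assms(5)] by auto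
  obtain q' where q': "q = c # q'" using q(1) by (cases q) (auto simp: walk_betw_def)
  have "set p \<inter> set q' \<subseteq> P \<inter> Q" using p(1) q(1) q' by (auto simp: walk_betw_def)
  then have "set p \<inter> set q' = {}" using assms(3) q(2) q' by auto
  then have "distinct (p @ tl q)" using p(2) q(2) q' by auto
  from dst_path[OF walk_append[OF pV qV] this] dst_path[OF pV p(2)] dst_path[OF qV q(2)]
  show ?thesis using p(1) q' by (cases p) (auto simp: walk_betw_def)
qed

lemma dst_edge: "{u, v} \<in> E \<Longrightarrow> dst u v = 1"
  using dst_path[of u "[u, v]" v] edgeD[of u v] by (auto simp: walk_betw_def)

lemma dst_insert:
  assumes "con E X" "X \<subseteq> V" "w \<notin> X" "v \<in> X" "{v, w} \<in> E" "x \<in> X"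
  shows "dst x w = dst x v + 1"
proof -
  have "dst x w = dst x v + dst v w"
    by (rule dst_join[of X "{v, w}"])
      (use assms edgeD[OF assms(5)] con_insert[OF con_single, of v v w E] in \<open>auto simp: insert_commute\<close>)
  then show ?thesis using dst_edge[OF assms(5)] by simp
qed

text \<open>The component of \<open>r\<close> after the vertices in \<open>R\<close> are deleted; it
  is empty when \<open>r\<close> itself is deleted.\<close>

definition part :: "'a set \<Rightarrow> 'a \<Rightarrow> 'a set" where
  "part R r = {v. \<exists>p. walk_betw (V - R) E r p v}"

lemma part_sub: "part R r \<subseteq> V - R"
  using walk_ends by (fastforce simp: part_def)

lemma part_self: "r \<in> V - R \<Longrightarrow> r \<in> part R r"
  using walk_single[of r "V - R" E] unfolding part_def by blast

lemma part_closed: "v \<in> part R r \<Longrightarrow> {v, z} \<in> E \<Longrightarrow> z \<notin> R \<Longrightarrow> z \<in> part R r"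
  using walk_snoc[of "V - R" E r _ v z] edgeD[of v z] unfolding part_def by blast

lemma part_con: "con E (part R r)"
proof -
  have "\<exists>q. walk_betw (part R r) E r q x" if x: "x \<in> part R r" for x
  proof -
    obtain p where p: "walk_betw (V - R) E r p x" using x by (auto simp: part_def)
    have "set p \<subseteq> part R r"
    proof
      fix y assume "y \<in> set p"
      then obtain xs ys where "p = xs @ y # ys" using split_list by fast
      then show "y \<in> part R r" using walk_split(1)[of "V - R" E r xs y ys x] p by (auto simp: part_def)
    qed
    then show ?thesis using walk_mono[OF walk_set[OF p]] by blast
  qed
  then show ?thesis unfolding con_def using walk_join[OF walk_rev walk_rev] by meson
qed

text \<open>Follows a walk vertex by vertex. It serves as the induction principle for components;
  completeness of the search and the bound on centroid branches are proved by it.\<close>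

lemma part_subset:
  assumes "r \<in> S" "\<And>x y. x \<in> S \<Longrightarrow> {x, y} \<in> E \<Longrightarrow> y \<notin> R \<Longrightarrow> y \<in> S"
  shows "part R r \<subseteq> S"
proof
  fix v assume "v \<in> part R r"
  then obtain p where "walk_betw (V - R) E r p v" by (auto simp: part_def)
  then show "v \<in> S"
  proof (induction p arbitrary: v rule: rev_induct)
    case Nil then show ?case by (simp add: walk_betw_def)
  next
    case (snoc y p)
    show ?case
    proof (cases "p = []")
      case True then show ?thesis using snoc.prems assms(1) by (auto simp: walk_betw_def)
    next
      case False
      then have "walk_betw (V - R) E r p (last p)" "{last p, v} \<in> E" "v \<notin> R"
        using snoc.prems by (auto simp: walk_betw_def successively_append_iff)
      then show ?thesis using snoc.IH assms(2) by blast
    qed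
  qed
qed

lemma part_eq:
  assumes "con E X" "r \<in> X" "X \<subseteq> V - R" "\<And>x y. x \<in> X \<Longrightarrow> {x, y} \<in> E \<Longrightarrow> y \<notin> R \<Longrightarrow> y \<in> X"
  shows "X = part R r"
proof
  show "X \<subseteq> part R r"
    using assms(1-3) walk_mono[of X E r _ _ "V - R"] unfolding con_def part_def by blast
  show "part R r \<subseteq> X" using part_subset assms(2,4) by blast
qed

lemma part_cong: "x \<in> part R r \<Longrightarrow> part R x = part R r"
  by (rule part_eq[symmetric, OF part_con _ part_sub]) (auto intro: part_closed)

lemma part_insert_other:
  "r \<in> V - R \<Longrightarrow> c \<notin> part R r \<Longrightarrow> part (insert c R) r = part R r"
  by (rule part_eq[symmetric, OF part_con part_self]) (use part_sub in \<open>auto intro: part_closed\<close>)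

lemma part_empty: "r \<in> V \<Longrightarrow> part {} r = V"
  by (rule part_eq[symmetric]) (auto simp: conV dest: edgeD)

definition nbrs :: "'a set \<Rightarrow> 'a \<Rightarrow> 'a set" where
  "nbrs R c = {u. u \<notin> R \<and> {c, u} \<in> E}"

section \<open>Removing one vertex from a component\<close>

context
  fixes R r c X R'
  defines "X \<equiv> part R r" and "R' \<equiv> insert c R"
  assumes c: "c \<in> X"
begin

lemma nbr_comp:
  assumes u: "u \<in> nbrs R' c"
  shows "u \<in> X" "u \<in> V - R'" "{u, c} \<in> E" "part R' u \<subseteq> X - {c}" "u \<in> part R' u"
proof -
  have 1: "{u, c} \<in> E" "u \<notin> R'" using u by (auto simp: nbrs_def insert_commute)
  then show 2: "{u, c} \<in> E" "u \<in> V - R'" using edgeD by auto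
  show 3: "u \<in> X" using u c part_closed[of c R r u] 1 by (auto simp: nbrs_def X_def R'_def insert_commute)
  show "u \<in> part R' u" using part_self 2 by blast
  have "part R' u \<subseteq> X"
    by (rule part_subset) (use 3 in \<open>auto simp: X_def R'_def intro: part_closed\<close>)
  then show "part R' u \<subseteq> X - {c}" using part_sub[of R' u] by (auto simp: R'_def)
qed

text \<open>Components that meet coincide; \<open>c\<close> would then have two neighbours in one
  connected set that avoids it, against \<open>unique_nbr\<close>.\<close>

lemma nbr_disjoint:
  assumes u: "u \<in> nbrs R' c" "u' \<in> nbrs R' c" "u \<noteq> u'"
  shows "part R' u \<inter> part R' u' = {}"
proof (rule ccontr)
  assume "part R' u \<inter> part R' u' \<noteq> {}"
  then have "part R' u = part R' u'" using part_cong by (metis disjoint_iff)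
  then have "u' \<in> part R' u" using nbr_comp(5)[OF u(2)] by simp
  then have "u = u'"
    by (intro unique_nbr[OF part_con[of R' u], of c])
      (use nbr_comp[OF u(1)] nbr_comp[OF u(2)] part_sub[of R' u] in \<open>auto simp: R'_def\<close>)
  then show False using u(3) by simp
qed

text \<open>A path from \<open>c\<close> to \<open>v\<close> leaves \<open>c\<close> through some
  neighbour and, being distinct, never returns to \<open>c\<close>, so its remainder lives in the
  branch of that neighbour.\<close>

lemma nbr_cover: "X - {c} = (\<Union>u\<in>nbrs R' c. part R' u)"
proof
  show "(\<Union>u\<in>nbrs R' c. part R' u) \<subseteq> X - {c}" using nbr_comp(4) by blast
  show "X - {c} \<subseteq> (\<Union>u\<in>nbrs R' c. part R' u)"
  proof
    fix v assume v: "v \<in> X - {c}"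
    obtain p where p: "walk_betw X E c p v" "distinct p"
      using con_path[OF part_con[of R r]] c v unfolding X_def by blast
    obtain q where q: "p = c # q" "q \<noteq> []" using p(1) v
      by (cases p; cases "tl p") (auto simp: walk_betw_def)
    have q': "{c, hd q} \<in> E" "walk_betw (V - R') E (hd q) q v"
      using p part_sub[of R r] unfolding q(1)
      by (auto simp: walk_betw_def successively_Cons q(2) X_def R'_def)
    moreover have "hd q \<notin> R'" using walk_ends[OF q'(2)] by simp
    ultimately have "hd q \<in> nbrs R' c" "v \<in> part R' (hd q)" by (auto simp: nbrs_def part_def)
    then show "v \<in> (\<Union>u\<in>nbrs R' c. part R' u)" by blast
  qed
qed

lemma finite_nbrs: "finite (nbrs R' c)"
  by (rule finite_subset[OF _ finV]) (auto simp: nbrs_def dest: edgeD)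

lemma dst_nbr_comp:
  assumes u: "u \<in> nbrs R' c" and x: "x \<in> part R' u"
  shows "dst c x = dst u x + 1"
proof -
  have s: "part R' u \<subseteq> V" "c \<notin> part R' u" using part_sub[of R' u] by (auto simp: R'_def)
  then have V: "x \<in> V" "u \<in> V" "c \<in> V" using x nbr_comp(5)[OF u] edgeD[OF nbr_comp(3)[OF u]] by auto
  show ?thesis using dst_insert[OF part_con s nbr_comp(5)[OF u] nbr_comp(3)[OF u] x]
      dst_sym[OF V(1,2)] dst_sym[OF V(1,3)] by simp
qed

text \<open>Different branches, each extended by \<open>c\<close>, meet exactly in \<open>c\<close>,
  so \<open>dst_join\<close> applies. The cases in which an end is \<open>c\<close> itself are
  immediate.\<close>

lemma dst_split:
  assumes "x \<in> X" "y \<in> X" "\<not> (\<exists>u\<in>nbrs R' c. x \<in> part R' u \<and> y \<in> part R' u)"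
  shows "dst x y = dst c x + dst c y"
proof -
  have V: "c \<in> V" "x \<in> V" "y \<in> V" using c assms part_sub[of R r] by (auto simp: X_def)
  consider "x = c" | "y = c" | "x \<noteq> c" "y \<noteq> c" by blast
  then show ?thesis
  proof cases
    case 3
    then obtain u u' where u: "u \<in> nbrs R' c" "x \<in> part R' u" "u' \<in> nbrs R' c" "y \<in> part R' u'"
      using assms nbr_cover by (metis Diff_iff UN_E singletonD)
    then have "u \<noteq> u'" using assms(3) by blast
    then have d: "part R' u \<inter> part R' u' = {}" using nbr_disjoint u by blast
    have "dst x y = dst x c + dst c y"
    proof (rule dst_join)
      show "con E (insert c (part R' u))" "con E (insert c (part R' u'))"
        using con_insert[OF part_con nbr_comp(5)[OF u(1)] nbr_comp(3)[OF u(1)]]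
          con_insert[OF part_con nbr_comp(5)[OF u(3)] nbr_comp(3)[OF u(3)]] by simp_all
      show "insert c (part R' u) \<inter> insert c (part R' u') = {c}"
        using d nbr_comp(4)[OF u(1)] nbr_comp(4)[OF u(3)] by blast
    qed (use u part_sub[of R'] V in auto)
    then show ?thesis using dst_sym[OF V(2,1)] by simp
  qed (use V dst_sym[OF V(2,1)] in auto)
qed

end

section \<open>Counting ordered pairs by distance\<close>

definition pairs_at :: "'a set \<Rightarrow> nat \<Rightarrow> nat" where
  "pairs_at X i = card {(x, y). x \<in> X \<and> y \<in> X \<and> dst x y = i}"

text \<open>Sums of depths rather than distances: two vertices of one branch are counted with the
  length of a detour through \<open>c\<close>. The offset \<open>d = 1\<close> measures depths below
  a branch root \<open>c\<close> from the removed neighbour above it.\<close>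

definition pairs_via :: "'a set \<Rightarrow> 'a \<Rightarrow> nat \<Rightarrow> nat \<Rightarrow> nat" where
  "pairs_via X c d i = card {(x, y). x \<in> X \<and> y \<in> X \<and> (d + dst c x) + (d + dst c y) = i}"

lemma card_pairs_sum:
  assumes "finite X"
  shows "int (card {(x, y). x \<in> X \<and> y \<in> X \<and> f x y}) = (\<Sum>(x, y)\<in>X \<times> X. of_bool (f x y))"
proof -
  have "{(x, y). x \<in> X \<and> y \<in> X \<and> f x y} = {z \<in> X \<times> X. case z of (x, y) \<Rightarrow> f x y}" by auto
  then show ?thesis using assms
    by (simp add: sum.inter_filter[symmetric] of_bool_def if_distrib case_prod_beta Int_def)
qed

text \<open>Compare the indicators of \<open>dst x y = i\<close> and of the detour through
  \<open>c\<close> having length \<open>i\<close>. By \<open>dst_split\<close> they agree unless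
  both vertices lie in one branch; there \<open>dst_nbr_comp\<close> turns depths below
  \<open>c\<close> into depths below \<open>u\<close> plus one. Integers are used because terms are
  subtracted.\<close>

lemma pairs_split:
  assumes c: "c \<in> part R r"
  defines "U \<equiv> nbrs (insert c R) c"
  shows "int (pairs_at (part R r) i) = int (pairs_via (part R r) c 0 i) +
    (\<Sum>u\<in>U. int (pairs_at (part (insert c R) u) i) - int (pairs_via (part (insert c R) u) u 1 i))"
proof -
  let ?X = "part R r" and ?Y = "part (insert c R)"
  have fX: "finite ?X" and fY: "\<And>u. finite (?Y u)" using finite_subset[OF part_sub] finV by auto
  let ?g = "\<lambda>(x, y). of_bool (dst x y = i) - of_bool (dst c x + dst c y = i) :: int"
  have "int (pairs_at ?X i) - int (pairs_via ?X c 0 i) = (\<Sum>z\<in>?X \<times> ?X. ?g z)"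
    unfolding pairs_at_def pairs_via_def card_pairs_sum[OF fX]
    by (simp add: sum_subtractf[symmetric] case_prod_beta)
  also have "\<dots> = (\<Sum>z\<in>(\<Union>u\<in>U. ?Y u \<times> ?Y u). ?g z)"
  proof (rule sum.mono_neutral_right)
    show "(\<Union>u\<in>U. ?Y u \<times> ?Y u) \<subseteq> ?X \<times> ?X" using nbr_comp(4)[OF c] unfolding U_def by blast
    show "\<forall>z\<in>?X \<times> ?X - (\<Union>u\<in>U. ?Y u \<times> ?Y u). ?g z = 0"
      using dst_split[OF c] unfolding U_def by fastforce
  qed (use fX in auto)
  also have "\<dots> = (\<Sum>u\<in>U. \<Sum>z\<in>?Y u \<times> ?Y u. ?g z)"
  proof (rule sum.UNION_disjoint)
    show "\<forall>u\<in>U. \<forall>u'\<in>U. u \<noteq> u' \<longrightarrow> (?Y u \<times> ?Y u) \<inter> (?Y u' \<times> ?Y u') = {}"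
    proof (intro ballI impI)
      fix u u' assume "u \<in> U" "u' \<in> U" "u \<noteq> u'"
      then have "?Y u \<inter> ?Y u' = {}" unfolding U_def by (rule nbr_disjoint[OF c])
      then show "(?Y u \<times> ?Y u) \<inter> (?Y u' \<times> ?Y u') = {}" by (simp add: Times_Int_Times)
    qed
  qed (use finite_nbrs[OF c] fY in \<open>simp_all add: U_def\<close>)
  also have "\<dots> = (\<Sum>u\<in>U. int (pairs_at (?Y u) i) - int (pairs_via (?Y u) u 1 i))"
  proof (rule sum.cong[OF refl])
    fix u assume u: "u \<in> U"
    have "(\<Sum>z\<in>?Y u \<times> ?Y u. ?g z) =
      (\<Sum>(x, y)\<in>?Y u \<times> ?Y u. of_bool (dst x y = i) - of_bool ((1 + dst u x) + (1 + dst u y) = i))"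
      using u dst_nbr_comp[OF c] unfolding U_def by (intro sum.cong) auto
    also have "\<dots> = int (pairs_at (?Y u) i) - int (pairs_via (?Y u) u 1 i)"
      unfolding pairs_at_def pairs_via_def card_pairs_sum[OF fY]
      by (simp add: sum_subtractf[symmetric] case_prod_beta)
    finally show "(\<Sum>z\<in>?Y u \<times> ?Y u. ?g z) = int (pairs_at (?Y u) i) - int (pairs_via (?Y u) u 1 i)" .
  qed
  finally show ?thesis by simp
qed

text \<open>At a positive distance the two ends differ, so every unordered pair arises from exactly
  two ordered ones; at distance zero it would arise from one.\<close>

lemma pairs_at_distribution:
  assumes "i \<ge> 1"
  shows "pairs_at V i = 2 * distance_distribution V E i"
proof -
  let ?Q = "{(x, y). x \<in> V \<and> y \<in> V \<and> dst x y = i}"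
  let ?f = "\<lambda>(x, y). {x, y}"
  have fQ: "finite ?Q" by (rule finite_subset[of _ "V \<times> V"]) (use finV in auto)
  have im: "{{u, v} | u v. u \<in> V \<and> v \<in> V \<and> graph_dist V E u v = enat i} = ?f ` ?Q"
    by (force simp: dst_eq image_iff)
  have fib: "card {z \<in> ?Q. ?f z = e} = 2" if e: "e \<in> ?f ` ?Q" for e
  proof -
    obtain x y where xy: "x \<in> V" "y \<in> V" "dst x y = i" "e = {x, y}" using e by auto
    then have ne: "x \<noteq> y" using assms by auto
    have "{z \<in> ?Q. ?f z = e} = {(x, y), (y, x)}"
      using xy dst_sym by (auto simp: doubleton_eq_iff)
    then show ?thesis using ne by simp
  qed
  have "card ?Q = (\<Sum>e\<in>?f ` ?Q. card {z \<in> ?Q. ?f z = e})"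
    using sum.image_gen[OF fQ, of "\<lambda>_. 1::nat" ?f] by simp
  also have "\<dots> = 2 * card (?f ` ?Q)" using fib by simp
  finally show ?thesis unfolding pairs_at_def distance_distribution_def im .
qed

text \<open>Grow a connected set one vertex at a time: by \<open>unique_nbr\<close> a new vertex
  brings exactly one edge into the set. This fixes the length of the edge list, and hence of the
  input, in terms of \<open>n\<close>.\<close>

lemma card_edges: "card E = card V - 1"
proof -
  have "E \<subseteq> Pow V" using E_sub by auto
  then have finE: "finite E" using finite_subset finV by auto
  have "k \<ge> 1 \<Longrightarrow> k \<le> card V \<Longrightarrow> \<exists>X\<subseteq>V. con E X \<and> card X = k \<and> card {e\<in>E. e \<subseteq> X} = k - 1" for k
  proof (induction k rule: nat_induct_at_least[of 1])
    case base
    obtain x where x: "x \<in> V" using V_ne by blast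
    have "{e\<in>E. e \<subseteq> {x}} = {}" using E_sub by auto
    then show ?case using x con_single[of E x] by (intro exI[of _ "{x}"]) (simp del: empty_Collect_eq)
  next
    case (Suc k)
    then obtain X where X: "X \<subseteq> V" "con E X" "card X = k" "card {e\<in>E. e \<subseteq> X} = k - 1" by auto
    have "X \<noteq> {}" using X(3) Suc by auto
    then obtain x where x: "x \<in> X" by blast
    have "X \<noteq> V" using X(3) Suc by auto
    then have "\<not> part {} x \<subseteq> X" using part_empty[of x] x X(1) by blast
    then obtain v w where vw: "v \<in> X" "{v, w} \<in> E" "w \<notin> X" using part_subset[OF x] by blast
    have "{e\<in>E. e \<subseteq> insert w X} = insert {v, w} {e\<in>E. e \<subseteq> X}"
    proof -
      have "e = {v, w}" if e: "e \<in> E" "e \<subseteq> insert w X" "\<not> e \<subseteq> X" for e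
      proof -
        obtain a b where ab: "e = {a, b}" "a \<noteq> b" using e(1) E_sub by blast
        then obtain z where z: "e = {z, w}" "z \<noteq> w" using e(2,3) by auto
        then show ?thesis using unique_nbr[OF X(2,1) vw(3), of z v] e vw by auto
      qed
      then show ?thesis using vw(1,2) by blast
    qed
    moreover have "{v, w} \<notin> {e\<in>E. e \<subseteq> X}" using vw by auto
    ultimately have "card {e\<in>E. e \<subseteq> insert w X} = k" using X(4) finE Suc by simp
    moreover have "card (insert w X) = Suc k" using finite_subset[OF X(1) finV] X(3) vw(3) by simp
    moreover have "insert w X \<subseteq> V" using X(1) edgeD[OF vw(2)] by auto
    ultimately show ?case using con_insert[OF X(2) vw(1,2)] by (intro exI[of _ "insert w X"]) simp
  qed
  moreover have "1 \<le> card V" using V_ne finV by (simp add: Suc_leI card_gt_0_iff)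
  ultimately obtain X where X: "X \<subseteq> V" "card X = card V" "card {e\<in>E. e \<subseteq> X} = card V - 1"
    by blast
  then have "X = V" using finV card_subset_eq by blast
  moreover have "{e\<in>E. e \<subseteq> V} = E" using E_sub by auto
  ultimately show ?thesis using X(3) by simp
qed

end

section \<open>Rooted subtrees and centroids\<close>

text \<open>The arc with the largest number below \<open>b\<close> leaving \<open>v\<close>, or \<open>0\<close> if there is none;
  arcs are numbered from \<open>1\<close>.\<close>

primrec prev_arc :: "(nat \<Rightarrow> nat) \<Rightarrow> nat \<Rightarrow> nat \<Rightarrow> nat" where
  "prev_arc src v 0 = 0"
| "prev_arc src v (Suc b) = (if 1 \<le> b \<and> src b = v then b else prev_arc src v b)"

definition arcs_below :: "(nat \<Rightarrow> nat) \<Rightarrow> nat \<Rightarrow> nat \<Rightarrow> nat" where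
  "arcs_below src v b = card {e. 1 \<le> e \<and> e < b \<and> src e = v}"

lemma prev_arc_le: "prev_arc src v b \<le> b - 1"
  by (induction b) auto

lemma prev_arc_less: "0 < b \<Longrightarrow> prev_arc src v b < b"
  using prev_arc_le[of src v b] by linarith

lemma prev_arc_src: "prev_arc src v b = 0 \<or> src (prev_arc src v b) = v"
  by (induction b) auto

lemma prev_arc_gap: "prev_arc src v b < e \<Longrightarrow> e < b \<Longrightarrow> src e \<noteq> v"
  by (induction b) (auto simp: less_Suc_eq split: if_splits)

declare prev_arc.simps [simp del]

text \<open>Between the previous arc and \<open>b\<close> no arc leaves \<open>v\<close>. Together
  with \<open>arcs_below_Suc\<close> this says that following one list pointer lowers the count by
  exactly one.\<close>

lemma arcs_below_prev: "arcs_below src v (Suc (prev_arc src v b)) = arcs_below src v b"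
proof -
  have "e \<le> prev_arc src v b" if "e < b" "src e = v" for e
    using prev_arc_gap[of src v b e] that by force
  moreover have "e < b" if "e \<le> prev_arc src v b" "1 \<le> e" for e
    using prev_arc_le[of src v b] that by linarith
  ultimately have "{e. 1 \<le> e \<and> e < Suc (prev_arc src v b) \<and> src e = v} = {e. 1 \<le> e \<and> e < b \<and> src e = v}"
    by (auto simp: less_Suc_eq_le)
  then show ?thesis by (simp add: arcs_below_def)
qed

lemma arcs_below_Suc:
  assumes "1 \<le> e" "src e = v" shows "arcs_below src v (Suc e) = arcs_below src v e + 1"
proof -
  have "{e'. 1 \<le> e' \<and> e' < Suc e \<and> src e' = v} = insert e {e'. 1 \<le> e' \<and> e' < e \<and> src e' = v}"
    using assms by auto
  then show ?thesis by (simp add: arcs_below_def)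
qed

section \<open>Breadth-first search along arc lists\<close>

locale arc_tree = tree "{..<n}" E for n :: nat and E +
  fixes m :: nat and src tgt :: "nat \<Rightarrow> nat"
  assumes arc_edge: "1 \<le> e \<Longrightarrow> e \<le> m \<Longrightarrow> {src e, tgt e} \<in> E"
    and arc_inj: "1 \<le> e \<Longrightarrow> e \<le> m \<Longrightarrow> 1 \<le> e' \<Longrightarrow> e' \<le> m \<Longrightarrow> src e = src e' \<Longrightarrow> tgt e = tgt e' \<Longrightarrow> e = e'"
    and arc_ex: "{u, v} \<in> E \<Longrightarrow> \<exists>e. 1 \<le> e \<and> e \<le> m \<and> src e = u \<and> tgt e = v"
begin

lemma arc_less: "1 \<le> e \<Longrightarrow> e \<le> m \<Longrightarrow> src e < n \<and> tgt e < n \<and> src e \<noteq> tgt e"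
  using edgeD[OF arc_edge] by auto

definition deg :: "nat \<Rightarrow> nat" where "deg v = arcs_below src v (Suc m)"

text \<open>\<open>first_arc\<close> and \<open>next_arc\<close> are the intended contents of list
  heads and links: inserting the arcs at the front in increasing order makes every list run
  downwards, with \<open>0\<close> as the end mark.\<close>

definition first_arc :: "nat \<Rightarrow> nat" where "first_arc v = prev_arc src v (Suc m)"
definition next_arc :: "nat \<Rightarrow> nat" where "next_arc e = prev_arc src (src e) e"

lemma first_arc_le: "first_arc v \<le> m"
  using prev_arc_le[of src v "Suc m"] by (simp add: first_arc_def)

lemma first_arc_src: "first_arc v = 0 \<or> src (first_arc v) = v"
  by (simp add: first_arc_def prev_arc_src)

lemma first_arc_gap: "first_arc v < e \<Longrightarrow> e \<le> m \<Longrightarrow> src e \<noteq> v"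
  using prev_arc_gap[of src v "Suc m" e] by (simp add: first_arc_def)

lemma next_arc_less: "0 < e \<Longrightarrow> next_arc e < e"
  by (simp add: next_arc_def prev_arc_less)

lemma next_arc_src: "next_arc e = 0 \<or> src (next_arc e) = src e"
  by (simp add: next_arc_def prev_arc_src)

lemma next_arc_gap: "next_arc e < e' \<Longrightarrow> e' < e \<Longrightarrow> src e' \<noteq> src e"
  using prev_arc_gap[of src "src e" e e'] by (simp add: next_arc_def)

text \<open>Position \<open>h\<close> of the queue \<open>q\<close> is being expanded,
  \<open>e\<close> is the next arc to inspect there, and \<open>t\<close> vertices have been queued.
  The search keeps no visited marks: it skips only the parent and the deleted vertices
  \<open>R\<close>. This is sound because a queued neighbour of \<open>q h\<close> is its parent or
  one of its children, and by the last conjunct the children found so far stem from arcs above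
  \<open>e\<close>, so the arc \<open>e\<close> leads to none of them.\<close>

definition bfs_inv :: "nat set \<Rightarrow> nat \<Rightarrow> nat \<Rightarrow> nat \<Rightarrow> nat \<Rightarrow> nat \<Rightarrow>
    (nat \<Rightarrow> nat) \<Rightarrow> (nat \<Rightarrow> nat) \<Rightarrow> (nat \<Rightarrow> nat) \<Rightarrow> bool" where
  "bfs_inv R r d0 h e t q p d \<longleftrightarrow>
    1 \<le> t \<and> h \<le> t \<and> q 0 = r \<and> p r = n \<and> r \<in> {..<n} - R \<and>
    inj_on q {..<t} \<and> q ` {..<t} \<subseteq> part R r \<and> con E (q ` {..<t}) \<and>
    (\<forall>k. 0 < k \<and> k < t \<longrightarrow> (\<exists>j<k. j \<le> h \<and> q j = p (q k) \<and> {q j, q k} \<in> E)) \<and>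
    (\<forall>k<t. d (q k) = d0 + dst r (q k)) \<and>
    (\<forall>a<t. \<forall>b<t. {q a, q b} \<in> E \<longrightarrow> p (q a) = q b \<or> p (q b) = q a) \<and>
    (\<forall>k<h. \<forall>z. {q k, z} \<in> E \<longrightarrow> z \<notin> R \<longrightarrow> z \<in> q ` {..<t}) \<and>
    (h < t \<longrightarrow> e \<le> m \<and> (e = 0 \<or> src e = q h) \<and>
      (\<forall>e'. e < e' \<and> e' \<le> m \<and> src e' = q h \<and> tgt e' \<notin> R \<longrightarrow> tgt e' \<in> q ` {..<t}) \<and>
      (\<forall>k. 0 < k \<and> k < t \<and> p (q k) = q h \<longrightarrow> (\<exists>e'>e. e' \<le> m \<and> src e' = q h \<and> tgt e' = q k)))"

lemma bfs_init:
  assumes "r \<in> {..<n} - R"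
  shows "bfs_inv R r d0 0 (first_arc r) 1 (q(0 := r)) (p(r := n)) (d(r := d0))"
proof -
  have "{..<Suc 0} = {0::nat}" by auto
  moreover have "{r, r} \<notin> E" using edgeD[of r r] by auto
  ultimately show ?thesis
    using assms part_self[OF assms] con_single[of E r] first_arc_le[of r] first_arc_src[of r] first_arc_gap[of r]
    by (auto simp: bfs_inv_def)
qed

lemma bfs_next_vertex:
  assumes inv: "bfs_inv R r d0 h 0 t q p d" and h: "h < t"
  shows "bfs_inv R r d0 (Suc h) (first_arc (q (Suc h))) t q p d"
proof -
  have I: "1 \<le> t" "q 0 = r" "p r = n" "r \<in> {..<n} - R"
    "inj_on q {..<t}" "q ` {..<t} \<subseteq> part R r" "con E (q ` {..<t})"
    "\<And>k. 0 < k \<Longrightarrow> k < t \<Longrightarrow> \<exists>j<k. j \<le> h \<and> q j = p (q k) \<and> {q j, q k} \<in> E"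
    "\<forall>k<t. d (q k) = d0 + dst r (q k)"
    "\<forall>a<t. \<forall>b<t. {q a, q b} \<in> E \<longrightarrow> p (q a) = q b \<or> p (q b) = q a"
    "\<And>k z. k < h \<Longrightarrow> {q k, z} \<in> E \<Longrightarrow> z \<notin> R \<Longrightarrow> z \<in> q ` {..<t}"
    "\<And>e'. 0 < e' \<Longrightarrow> e' \<le> m \<Longrightarrow> src e' = q h \<Longrightarrow> tgt e' \<notin> R \<Longrightarrow> tgt e' \<in> q ` {..<t}"
    using inv h unfolding bfs_inv_def by auto
  have 1: "\<exists>j<k. j \<le> Suc h \<and> q j = p (q k) \<and> {q j, q k} \<in> E" if "0 < k" "k < t" for k
    using I(8)[OF that] le_SucI by blast
  have 2: "z \<in> q ` {..<t}" if k: "k < Suc h" "{q k, z} \<in> E" "z \<notin> R" for k z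
  proof (cases "k = h")
    case True
    obtain e where "1 \<le> e" "e \<le> m" "src e = q h" "tgt e = z" using arc_ex k True by blast
    then show ?thesis using I(12)[of e] k(3) by auto
  next
    case False then show ?thesis using I(11)[of k z] k by simp
  qed
  \<comment> \<open>Vacuous: every parent sits at a position at most \<open>h\<close>, so no queued
    vertex has the parent \<open>q (Suc h)\<close> yet.\<close>
  have 3: "\<exists>e'>first_arc (q (Suc h)). e' \<le> m \<and> src e' = q (Suc h) \<and> tgt e' = q k"
    if k: "Suc h < t" "0 < k" "k < t" "p (q k) = q (Suc h)" for k
  proof -
    obtain j where j: "j < k" "j \<le> h" "q j = p (q k)" using I(8)[OF k(2,3)] by blast
    then have "j = Suc h" using I(5) k unfolding inj_on_def by auto
    then show ?thesis using j by simp
  qed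
  have 4: "\<forall>e'. first_arc (q (Suc h)) < e' \<and> e' \<le> m \<and> src e' = q (Suc h) \<and> tgt e' \<notin> R \<longrightarrow>
      tgt e' \<in> q ` {..<t}"
    using first_arc_gap[of "q (Suc h)"] by blast
  show ?thesis unfolding bfs_inv_def
    using I(1-7) I(9,10) h 1 2 3 4 first_arc_le[of "q (Suc h)"] first_arc_src[of "q (Suc h)"]
    by simp
qed

text \<open>The condition \<open>z < n\<close> excludes the dummy parent \<open>n\<close> of the
  root; any other queued vertex has a parent queued before it.\<close>

lemma bfs_parent_in:
  assumes inv: "bfs_inv R r d0 h e t q p d" and "h < t" "z = p (q h)" "z < n"
  shows "z \<in> q ` {..<t}"
proof (cases "h = 0")
  case True then show ?thesis using assms by (auto simp: bfs_inv_def)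
next
  case False
  have "\<forall>k. 0 < k \<and> k < t \<longrightarrow> (\<exists>j<k. j \<le> h \<and> q j = p (q k) \<and> {q j, q k} \<in> E)"
    using inv unfolding bfs_inv_def by simp
  then obtain j where j: "j < h" "q j = p (q h)" using False assms(2) by blast
  then have "z = q j" "j < t" using assms(2,3) by simp_all
  then show ?thesis by simp
qed

lemma bfs_skip:
  assumes inv: "bfs_inv R r d0 h e t q p d" and h: "h < t" "e \<noteq> 0"
    and skip: "tgt e = p (q h) \<or> tgt e \<in> R"
  shows "bfs_inv R r d0 h (next_arc e) t q p d"
proof -
  have e: "e \<le> m" "src e = q h" "1 \<le> e" using inv h by (auto simp: bfs_inv_def)
  have lt: "next_arc e < e" using next_arc_less h by simp
  have 1: "tgt e' \<in> q ` {..<t}"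
    if e': "next_arc e < e'" "e' \<le> m" "src e' = q h" "tgt e' \<notin> R" for e'
  proof (cases "e' = e")
    case True
    then show ?thesis using bfs_parent_in[OF inv h(1)] skip e' arc_less[OF e(3,1)] by auto
  next
    case False
    then have "e < e'" using next_arc_gap[of e e'] e' e by force
    then show ?thesis using inv h(1) e' by (auto simp: bfs_inv_def)
  qed
  have 2: "\<exists>e'>next_arc e. e' \<le> m \<and> src e' = q h \<and> tgt e' = q k"
    if "0 < k" "k < t" "p (q k) = q h" for k
  proof -
    have "\<forall>k. 0 < k \<and> k < t \<and> p (q k) = q h \<longrightarrow> (\<exists>e'>e. e' \<le> m \<and> src e' = q h \<and> tgt e' = q k)"
      using inv h(1) unfolding bfs_inv_def by simp
    then show ?thesis using that lt less_trans by blast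
  qed
  have 3: "next_arc e \<le> m" "next_arc e = 0 \<or> src (next_arc e) = q h"
    using next_arc_src[of e] e lt by auto
  show ?thesis using inv h(1) 1 2 3 unfolding bfs_inv_def by simp
qed

lemma bfs_add:
  assumes inv: "bfs_inv R r d0 h e t q p d" and h: "h < t" "e \<noteq> 0"
    and add: "tgt e \<noteq> p (q h)" "tgt e \<notin> R"
  shows "bfs_inv R r d0 h (next_arc e) (Suc t) (q(t := tgt e)) (p(tgt e := q h)) (d(tgt e := d (q h) + 1))"
    and "tgt e \<notin> q ` {..<t}" "tgt e \<in> part R r"
proof -
  let ?z = "tgt e" and ?Q = "q ` {..<t}"
  have I: "1 \<le> t" "q 0 = r" "p r = n" "r \<in> {..<n} - R"
    "inj_on q {..<t}" "?Q \<subseteq> part R r" "con E ?Q"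
    "\<And>k. 0 < k \<Longrightarrow> k < t \<Longrightarrow> \<exists>j<k. j \<le> h \<and> q j = p (q k) \<and> {q j, q k} \<in> E"
    "\<And>k. k < t \<Longrightarrow> d (q k) = d0 + dst r (q k)"
    "\<And>a b. a < t \<Longrightarrow> b < t \<Longrightarrow> {q a, q b} \<in> E \<Longrightarrow> p (q a) = q b \<or> p (q b) = q a"
    "\<And>k z. k < h \<Longrightarrow> {q k, z} \<in> E \<Longrightarrow> z \<notin> R \<Longrightarrow> z \<in> ?Q"
    "\<And>e'. e < e' \<Longrightarrow> e' \<le> m \<Longrightarrow> src e' = q h \<Longrightarrow> tgt e' \<notin> R \<Longrightarrow> tgt e' \<in> ?Q"
    "\<And>k. 0 < k \<Longrightarrow> k < t \<Longrightarrow> p (q k) = q h \<Longrightarrow> \<exists>e'>e. e' \<le> m \<and> src e' = q h \<and> tgt e' = q k"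
    using inv h unfolding bfs_inv_def by auto
  have e: "e \<le> m" "src e = q h" "1 \<le> e" using inv h by (auto simp: bfs_inv_def)
  have lt: "next_arc e < e" using next_arc_less h by simp
  have edge: "{q h, ?z} \<in> E" using arc_edge[OF e(3,1)] e(2) by simp
  have zn: "?z < n" "?z \<noteq> q h" using arc_less[OF e(3,1)] e(2) by auto
  have qh: "q h \<in> ?Q" "q h \<in> part R r" using h(1) I(6) by auto
  \<comment> \<open>A queued target would be a child of \<open>q h\<close>, hence reached by an arc
    above \<open>e\<close> with the same ends as \<open>e\<close>, and arcs are determined by their
    ends.\<close>
  show new: "?z \<notin> ?Q"
  proof
    assume "?z \<in> ?Q"
    then obtain k where k: "k < t" "q k = ?z" by auto
    then have pk: "p ?z = q h" using I(10)[OF h(1) k(1)] edge add(1) by auto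
    then have "0 < k" using k I(2,3) qh I(6) part_sub[of R r] by (cases k) auto
    then obtain e' where "e' > e" "e' \<le> m" "src e' = q h" "tgt e' = ?z" using I(13) k pk by metis
    then show False using arc_inj[of e e'] e by auto
  qed
  show zp: "?z \<in> part R r" using part_closed[OF qh(2) edge add(2)] .
  have zr: "?z \<noteq> r" using new I(1,2) by (auto simp: image_iff)
  have QV: "?Q \<subseteq> {..<n}" using I(6) part_sub[of R r] by blast
  have im: "(q(t := ?z)) ` {..<Suc t} = insert ?z ?Q" by (auto simp: lessThan_Suc image_iff)
  have qk: "(q(t := ?z)) k = q k \<and> q k \<noteq> ?z" if k: "k < t" for k
  proof -
    have "q k \<in> ?Q" using k by simp
    then have "q k \<noteq> ?z" using new by metis
    then show ?thesis using k by simp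
  qed
  \<comment> \<open>The new vertex is attached to the connected queued set by a single edge; this
    preserves the conjunct on adjacent queued vertices.\<close>
  have nb: "q k = q h" if "k < t" "{q k, ?z} \<in> E" for k
    using unique_nbr[OF I(7) QV new _ qh(1) that(2) edge] that(1) by simp
  let ?q = "q(t := ?z)" and ?p = "p(?z := q h)" and ?d = "d(?z := d (q h) + 1)"
  have 1: "inj_on ?q {..<Suc t}"
  proof (rule inj_onI)
    fix a b assume "a \<in> {..<Suc t}" "b \<in> {..<Suc t}" and eq: "?q a = ?q b"
    then consider "a < t" "b < t" | "a = t" "b < t" | "a < t" "b = t" | "a = t" "b = t" by fastforce
    then show "a = b"
    proof cases
      case 1 then show ?thesis using eq inj_onD[OF I(5), of a b] by simp
    next
      case 2 then show ?thesis using eq qk[of b] by simp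
    next
      case 3 then show ?thesis using eq qk[of a] by simp
    qed simp
  qed
  have 2: "con E (insert ?z ?Q)" by (rule con_insert[OF I(7) qh(1) edge])
  have 3: "\<exists>j<k. j \<le> h \<and> ?q j = ?p (?q k) \<and> {?q j, ?q k} \<in> E" if k: "0 < k" "k < Suc t" for k
  proof (cases "k = t")
    case True then show ?thesis using h(1) edge by (intro exI[of _ h]) auto
  next
    case False
    then have "k < t" using k by simp
    then obtain j where "j < k" "j \<le> h" "q j = p (q k)" "{q j, q k} \<in> E" using I(8) k by blast
    then show ?thesis using \<open>k < t\<close> qk[of k] qk[of j] by (intro exI[of _ j]) auto
  qed
  have 4: "?d (?q k) = d0 + dst r (?q k)" if k: "k < Suc t" for k
  proof (cases "k = t")
    case True
    have "r \<in> ?Q" using I(1,2) by (auto intro!: image_eqI[of _ _ 0])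
    from dst_insert[OF I(7) QV new qh(1) edge this] show ?thesis using True I(9)[OF h(1)] by simp
  next
    case False
    then show ?thesis using I(9)[of k] qk[of k] k by auto
  qed
  have 5: "?p (?q a) = ?q b \<or> ?p (?q b) = ?q a" if ab: "a < Suc t" "b < Suc t" "{?q a, ?q b} \<in> E" for a b
  proof -
    have zz: "{?z, ?z} \<notin> E" using edgeD[of ?z ?z] by auto
    consider "a < t" "b < t" | "a = t" "b < t" | "a < t" "b = t" | "a = t" "b = t" using ab by linarith
    then show ?thesis
    proof cases
      case 1 then show ?thesis using I(10)[of a b] qk[of a] qk[of b] ab(3) by auto
    next
      case 2 then show ?thesis using nb[of b] qk[of b] ab(3) by (auto simp: insert_commute)
    next
      case 3 then show ?thesis using nb[of a] qk[of a] ab(3) by auto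
    next
      case 4 then show ?thesis using zz ab(3) by simp
    qed
  qed
  have 6: "z \<in> insert ?z ?Q" if "k < h" "{?q k, z} \<in> E" "z \<notin> R" for k z
    using I(11)[of k z] qk[of k] that h(1) by auto
  have 7: "tgt e' \<in> insert ?z ?Q"
    if e': "next_arc e < e'" "e' \<le> m" "src e' = q h" "tgt e' \<notin> R" for e'
  proof (cases "e' = e")
    case False
    then have "e < e'" using next_arc_gap[of e e'] e' e by force
    then show ?thesis using I(12) e' by simp
  qed simp
  have 8: "\<exists>e'>next_arc e. e' \<le> m \<and> src e' = q h \<and> tgt e' = ?q k"
    if k: "0 < k" "k < Suc t" "?p (?q k) = q h" for k
  proof (cases "k = t")
    case True then show ?thesis using e lt by (intro exI[of _ e]) auto
  next
    case False
    then have "k < t" using k by simp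
    then obtain e' where "e' > e" "e' \<le> m" "src e' = q h" "tgt e' = q k" using I(13)[of k] k qk[of k] by auto
    then show ?thesis using lt \<open>k < t\<close> by (intro exI[of _ e']) auto
  qed
  have 9: "next_arc e \<le> m" "next_arc e = 0 \<or> src (next_arc e) = q h"
    using next_arc_src[of e] e lt by auto
  have ht: "?q h = q h" "?q 0 = r" "?p r = n" using h(1) I(1-3) zr by auto
  show "bfs_inv R r d0 h (next_arc e) (Suc t) ?q ?p ?d"
    unfolding bfs_inv_def im ht
    using 1 2 3 4 5 6 7 8 9 I(4,6) zp h(1) by (auto simp del: fun_upd_apply)
qed

definition bfs_done :: "nat set \<Rightarrow> nat \<Rightarrow> nat \<Rightarrow> nat \<Rightarrow> (nat \<Rightarrow> nat) \<Rightarrow> (nat \<Rightarrow> nat) \<Rightarrow> (nat \<Rightarrow> nat) \<Rightarrow> bool" where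
  "bfs_done R r d0 s q p d \<longleftrightarrow> inj_on q {..<s} \<and> q ` {..<s} = part R r \<and> 1 \<le> s \<and>
    (\<forall>k<s. d (q k) = d0 + dst r (q k)) \<and> q 0 = r \<and> p r = n \<and>
    (\<forall>k. 0 < k \<and> k < s \<longrightarrow> (\<exists>j<k. q j = p (q k))) \<and>
    (\<forall>a<s. \<forall>b<s. {q a, q b} \<in> E \<longrightarrow> p (q a) = q b \<or> p (q b) = q a)"

lemma bfs_finish:
  assumes inv: "bfs_inv R r d0 t e t q p d"
  shows "bfs_done R r d0 t q p d"
proof -
  have I: "1 \<le> t" "q 0 = r" "q ` {..<t} \<subseteq> part R r"
    "\<And>k z. k < t \<Longrightarrow> {q k, z} \<in> E \<Longrightarrow> z \<notin> R \<Longrightarrow> z \<in> q ` {..<t}"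
    using inv unfolding bfs_inv_def by auto
  have "part R r \<subseteq> q ` {..<t}"
  proof (rule part_subset)
    show "r \<in> q ` {..<t}" using I(1,2) by (auto intro!: image_eqI[of _ _ 0])
  qed (use I(4) in blast)
  then have "q ` {..<t} = part R r" using I(3) by blast
  moreover have "\<forall>k. 0 < k \<and> k < t \<longrightarrow> (\<exists>j<k. j \<le> t \<and> q j = p (q k) \<and> {q j, q k} \<in> E)"
    using inv unfolding bfs_inv_def by simp
  then have "\<exists>j<k. q j = p (q k)" if "0 < k" "k < t" for k using that by blast
  ultimately show ?thesis using inv unfolding bfs_inv_def bfs_done_def by simp
qed

definition weight :: "nat set \<Rightarrow> nat" where "weight X = (\<Sum>v\<in>X. 1 + deg v)"

text \<open>Amortised work left: for each vertex behind position \<open>h\<close> or still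
  undiscovered one unit plus one per arc, and the rest of the current list. The extra
  \<open>1\<close> pays for the step that moves to the next vertex.\<close>

definition bfs_todo :: "nat set \<Rightarrow> nat \<Rightarrow> nat \<Rightarrow> nat \<Rightarrow> nat \<Rightarrow> (nat \<Rightarrow> nat) \<Rightarrow> nat" where
  "bfs_todo R r h e t q = weight (part R r - q ` {..h}) + (if h < t then 1 + arcs_below src (q h) (Suc e) else 0)"

lemma finite_part: "finite (part R r)"
  using finite_subset[OF part_sub] finV by blast

lemma weight_mono: "X \<subseteq> Y \<Longrightarrow> finite Y \<Longrightarrow> weight X \<le> weight Y"
  unfolding weight_def by (intro sum_mono2) auto

lemma weight_remove: "finite X \<Longrightarrow> x \<in> X \<Longrightarrow> weight X = weight (X - {x}) + 1 + deg x"
  unfolding weight_def by (simp add: sum.remove[of X x])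

lemma bfs_todo_init:
  assumes "r \<in> {..<n} - R"
  shows "bfs_todo R r 0 (first_arc r) 1 (q(0 := r)) = weight (part R r)"
  using weight_remove[OF finite_part part_self[OF assms]] arcs_below_prev[of src r "Suc m"]
  by (simp add: bfs_todo_def deg_def first_arc_def)

lemma bfs_todo_vertex:
  assumes inv: "bfs_inv R r d0 h 0 t q p d" and h: "h < t"
  shows "bfs_todo R r (Suc h) (first_arc (q (Suc h))) t q < bfs_todo R r h 0 t q"
proof (cases "Suc h < t")
  case False
  have "weight (part R r - q ` {..Suc h}) \<le> weight (part R r - q ` {..h})"
    by (rule weight_mono) (auto simp: finite_part)
  then show ?thesis using False h by (simp add: bfs_todo_def)
next
  case True
  have inj: "inj_on q {..<t}" and sub: "q ` {..<t} \<subseteq> part R r"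
    using inv by (simp_all add: bfs_inv_def)
  have "q (Suc h) \<in> part R r" using sub True by blast
  moreover have "q (Suc h) \<notin> q ` {..h}"
  proof
    assume "q (Suc h) \<in> q ` {..h}"
    then obtain k where "k \<le> h" "q (Suc h) = q k" by blast
    then show False using inj_onD[OF inj, of "Suc h" k] True by simp
  qed
  moreover have "part R r - q ` {..Suc h} = (part R r - q ` {..h}) - {q (Suc h)}"
    by (auto simp: atMost_Suc)
  ultimately have "weight (part R r - q ` {..h}) = weight (part R r - q ` {..Suc h}) + 1 + deg (q (Suc h))"
    using weight_remove[of "part R r - q ` {..h}" "q (Suc h)"] finite_part by simp
  then show ?thesis using True h arcs_below_prev[of src "q (Suc h)" "Suc m"]
    by (simp add: bfs_todo_def deg_def first_arc_def)
qed

lemma bfs_todo_arc: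
  assumes inv: "bfs_inv R r d0 h e t q p d" and h: "h < t" "e \<noteq> 0" "t \<le> t'" "\<And>k. k < t \<Longrightarrow> q' k = q k"
  shows "bfs_todo R r h (next_arc e) t' q' < bfs_todo R r h e t q"
proof -
  have e: "src e = q h" "1 \<le> e" using inv h by (auto simp: bfs_inv_def)
  have "q' ` {..h} = q ` {..h}" using h by (intro image_cong) auto
  moreover have "arcs_below src (q h) (Suc (next_arc e)) = arcs_below src (q h) e"
    using arcs_below_prev[of src "src e" e] e by (simp add: next_arc_def)
  ultimately show ?thesis using h arcs_below_Suc[OF e(2), of src "q h"] e(1) by (simp add: bfs_todo_def)
qed

lemma bfs_done_card: "bfs_done R r d0 s q p d \<Longrightarrow> card (part R r) = s"
  unfolding bfs_done_def by (metis card_image card_lessThan)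

end

text \<open>\<open>anc pa k x\<close> is the first ancestor of \<open>x\<close> with index at most \<open>k\<close>. Accumulating subtree
  sizes from the last vertex downwards moves the vertices with \<open>anc pa k x = k\<close> to \<open>pa k\<close>.\<close>

function anc :: "(nat \<Rightarrow> nat) \<Rightarrow> nat \<Rightarrow> nat \<Rightarrow> nat" where
  "anc pa k x = (if x \<le> k \<or> \<not> pa x < x then x else anc pa k (pa x))"
  by auto
termination by (relation "measure (\<lambda>(pa, k, x). x)") auto

declare anc.simps [simp del]

lemma anc_low: "x \<le> k \<Longrightarrow> anc pa k x = x"
  by (simp add: anc.simps)

lemma anc_parent: "k < x \<Longrightarrow> pa x < x \<Longrightarrow> anc pa k x = anc pa k (pa x)"
  by (subst anc.simps) simp

lemma anc_le: "(\<And>y. 0 < y \<Longrightarrow> y \<le> x \<Longrightarrow> pa y < y) \<Longrightarrow> anc pa k x \<le> k"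
proof (induction x rule: less_induct)
  case (less x)
  show ?case
  proof (cases "x \<le> k")
    case True then show ?thesis by (simp add: anc_low)
  next
    case False
    then have px: "pa x < x" using less.prems by simp
    have "anc pa k (pa x) \<le> k" by (rule less.IH[OF px]) (use less.prems px in auto)
    then show ?thesis using anc_parent[of k x pa] False px by simp
  qed
qed

text \<open>Lowering the threshold from \<open>Suc k\<close> to \<open>k\<close> affects only the
  vertices whose ancestor was \<open>Suc k\<close>; they move on to its parent, which is the update
  made by \<open>merge_size\<close>.\<close>

lemma anc_step:
  "(\<And>y. 0 < y \<Longrightarrow> y \<le> x \<Longrightarrow> pa y < y) \<Longrightarrow>
   anc pa k x = (if anc pa (Suc k) x = Suc k then pa (Suc k) else anc pa (Suc k) x)"
proof (induction x rule: less_induct)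
  case (less x)
  consider "x \<le> k" | "x = Suc k" | "Suc k < x" by linarith
  then show ?case
  proof cases
    case 1 then show ?thesis by (simp add: anc_low)
  next
    case 2
    then have "pa (Suc k) < Suc k" using less.prems by simp
    then show ?thesis using anc_parent[of k x pa] 2 by (simp add: anc_low)
  next
    case 3
    then have px: "pa x < x" using less.prems by simp
    have "anc pa k (pa x) = (if anc pa (Suc k) (pa x) = Suc k then pa (Suc k) else anc pa (Suc k) (pa x))"
      by (rule less.IH[OF px]) (use less.prems px in auto)
    then show ?thesis
      using anc_parent[of k x pa] anc_parent[of "Suc k" x pa] 3 px by simp
  qed
qed

text \<open>The value stored at \<open>j\<close> after all positions above \<open>k\<close> have
  been merged into their parents. At \<open>j = k\<close> it is the complete subtree size, since
  children have larger positions than parents.\<close>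

definition anc_count :: "(nat \<Rightarrow> nat) \<Rightarrow> nat \<Rightarrow> nat \<Rightarrow> nat \<Rightarrow> nat" where
  "anc_count pa s k j = card {x. x < s \<and> anc pa k x = j}"

lemma anc_count_init: "j < s \<Longrightarrow> anc_count pa s (s - 1) j = 1"
proof -
  assume "j < s"
  then have "{x. x < s \<and> anc pa (s - 1) x = j} = {j}" by (auto simp: anc_low)
  then show ?thesis by (simp add: anc_count_def)
qed

lemma anc_count_step:
  assumes "\<And>y. 0 < y \<Longrightarrow> y < s \<Longrightarrow> pa y < y" "j \<le> k"
  shows "anc_count pa s k j = anc_count pa s (Suc k) j + (if pa (Suc k) = j then anc_count pa s (Suc k) (Suc k) else 0)"
proof -
  have *: "anc pa k x = (if anc pa (Suc k) x = Suc k then pa (Suc k) else anc pa (Suc k) x)" if "x < s" for x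
    using anc_step assms(1) that by simp
  let ?A = "{x. x < s \<and> anc pa (Suc k) x = j}"
  let ?C = "if pa (Suc k) = j then {x. x < s \<and> anc pa (Suc k) x = Suc k} else {}"
  have eq: "{x. x < s \<and> anc pa k x = j} = ?A \<union> ?C" using * assms(2) by auto
  have "card (?A \<union> ?C) = card ?A + card ?C"
    using assms(2) by (intro card_Un_disjoint) auto
  then show ?thesis unfolding anc_count_def eq by simp
qed

lemma anc_count_0:
  assumes "\<And>y. 0 < y \<Longrightarrow> y < s \<Longrightarrow> pa y < y"
  shows "anc_count pa s 0 0 = s"
proof -
  have "{x. x < s \<and> anc pa 0 x = 0} = {..<s}" using anc_le[of _ pa 0] assms by fastforce
  then show ?thesis by (simp add: anc_count_def)
qed

section \<open>The last vertex with a heavy subtree is a centroid\<close>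

context arc_tree
begin

lemma parent_index:
  assumes "bfs_done R r d0 s q p d"
  obtains pa where "\<And>k. 0 < k \<Longrightarrow> k < s \<Longrightarrow> pa k < k \<and> q (pa k) = p (q k)"
proof -
  have "\<forall>k. \<exists>j. 0 < k \<and> k < s \<longrightarrow> j < k \<and> q j = p (q k)" using assms unfolding bfs_done_def by blast
  then obtain pa where "\<forall>k. 0 < k \<and> k < s \<longrightarrow> pa k < k \<and> q (pa k) = p (q k)" by metis
  then show ?thesis using that by blast
qed

text \<open>A branch below \<open>q k\<close> is the subtree of a later position, hence smaller than
  half by \<open>later\<close>. The branch towards the root avoids the subtree of \<open>k\<close>,
  which already holds at least half.\<close>

lemma centroid_balanced:
  assumes bfs: "bfs_done R r d0 s q p d"
    and pa: "\<And>k. 0 < k \<Longrightarrow> k < s \<Longrightarrow> pa k < k \<and> q (pa k) = p (q k)"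
    and k: "k < s" "s \<le> 2 * anc_count pa s k k"
    and later: "\<And>a. k < a \<Longrightarrow> a < s \<Longrightarrow> 2 * anc_count pa s a a < s"
    and u: "u \<in> nbrs (insert (q k) R) (q k)"
  shows "2 * card (part (insert (q k) R) u) \<le> s"
proof -
  let ?c = "q k" and ?R = "insert (q k) R"
  have B: "inj_on q {..<s}" "q ` {..<s} = part R r" "q 0 = r" "p r = n"
    "\<And>a b. a < s \<Longrightarrow> b < s \<Longrightarrow> {q a, q b} \<in> E \<Longrightarrow> p (q a) = q b \<or> p (q b) = q a"
    using bfs by (auto simp: bfs_done_def)
  have qn: "q a < n" if "a < s" for a using B(2) part_sub[of R r] that by blast
  have inj: "a = b" if "q a = q b" "a < s" "b < s" for a b using B(1) that by (auto simp: inj_on_def)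
  have rel: "(0 < b \<and> pa b = a) \<or> (0 < a \<and> pa a = b)" if ab: "a < s" "b < s" "{q a, q b} \<in> E" for a b
  proof -
    have pp: "0 < x \<and> pa x = y" if "p (q x) = q y" "x < s" "y < s" for x y
    proof -
      have "x \<noteq> 0"
      proof
        assume "x = 0"
        then have "n = q y" using that B(3,4) by simp
        then show False using qn[OF that(3)] by simp
      qed
      then show ?thesis using pa[of x] inj[of "pa x" y] that by simp
    qed
    show ?thesis using B(5)[OF ab] pp ab by blast
  qed
  have uX: "u \<in> part R r" "{q k, u} \<in> E"
    using nbr_comp(1)[of ?c R r u] B(2) k u by (auto simp: nbrs_def)
  then obtain a where a: "a < s" "u = q a" using B(2) by auto
  have ne: "a \<noteq> k" using uX(2) a edgeD by auto
  \<comment> \<open>\<open>S\<close> is a set of positions closed under parent and child steps that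
    avoid \<open>k\<close>; it therefore covers the branch of \<open>u\<close>.\<close>
  have bound: "2 * card (part ?R u) \<le> s"
    if S: "S \<subseteq> {..<s}" "a \<in> S" "2 * card S \<le> s"
      "\<And>x b. x \<in> S \<Longrightarrow> b < s \<Longrightarrow> b \<noteq> k \<Longrightarrow> (0 < b \<and> pa b = x) \<or> (0 < x \<and> pa x = b) \<Longrightarrow> b \<in> S" for S
  proof -
    have "part ?R u \<subseteq> q ` S"
    proof (rule part_subset)
      show "u \<in> q ` S" using a S(2) by blast
    next
      fix x y assume x: "x \<in> q ` S" and xy: "{x, y} \<in> E" "y \<notin> ?R"
      obtain x' where x': "x = q x'" "x' \<in> S" using x by blast
      then have xs: "x' < s" using S(1) by auto
      then have "x \<in> part R r" using x'(1) B(2) by blast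
      then have "y \<in> part R r" using part_closed xy by blast
      then obtain b where b: "y = q b" "b < s" using B(2) by auto
      have "b \<noteq> k" using xy(2) b by auto
      then have "b \<in> S" using S(4)[OF x'(2) b(2)] rel[OF xs b(2)] xy(1) x'(1) b(1) by blast
      then show "y \<in> q ` S" using b by blast
    qed
    then have "card (part ?R u) \<le> card S"
      using S(1) finite_subset card_mono[of "q ` S"] card_image_le[of S q] by (meson finite_imageI finite_lessThan le_trans)
    then show ?thesis using S(3) by linarith
  qed
  have less: "pa x < x" if "0 < x" "x < s" for x using pa that by blast
  consider "0 < a" "pa a = k" | "0 < k" "pa k = a" using rel[OF k(1) a(1)] uX(2) a(2) by auto
  then show ?thesis
  proof cases
    case 1
    then have ka: "k < a" using less a by auto
    show ?thesis
    proof (rule bound[of "{x. x < s \<and> anc pa a x = a}"])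
      show "2 * card {x. x < s \<and> anc pa a x = a} \<le> s"
        using later[OF ka a(1)] by (simp add: anc_count_def)
    next
      fix x b assume x: "x \<in> {x. x < s \<and> anc pa a x = a}" and b: "b < s" "b \<noteq> k"
        and xb: "(0 < b \<and> pa b = x) \<or> (0 < x \<and> pa x = b)"
      have ax: "a \<le> x" using x anc_low[of x a pa] by (cases "x \<le> a") auto
      show "b \<in> {x. x < s \<and> anc pa a x = a}"
      proof (cases "0 < b \<and> pa b = x")
        case True
        then show ?thesis using less[of b] anc_parent[of a b pa] x b ax by auto
      next
        case False
        then have px: "0 < x" "pa x = b" using xb by auto
        then have "x \<noteq> a" using 1 b(2) by auto
        then show ?thesis using anc_parent[of a x pa] less[of x] px x ax b by auto
      qed
    qed (use a anc_low[of a a pa] in auto)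
  next
    case 2
    then have ak: "a < k" using less k by auto
    show ?thesis
    proof (rule bound[of "{x. x < s \<and> anc pa k x \<noteq> k}"])
      have eq: "{..<s} = {x. x < s \<and> anc pa k x \<noteq> k} \<union> {x. x < s \<and> anc pa k x = k}" by auto
      have "card {..<s} = card {x. x < s \<and> anc pa k x \<noteq> k} + card {x. x < s \<and> anc pa k x = k}"
        unfolding eq by (rule card_Un_disjoint) auto
      then have "s = card {x. x < s \<and> anc pa k x \<noteq> k} + anc_count pa s k k" by (simp add: anc_count_def)
      then show "2 * card {x. x < s \<and> anc pa k x \<noteq> k} \<le> s" using k(2) by linarith
    next
      fix x b assume x: "x \<in> {x. x < s \<and> anc pa k x \<noteq> k}" and b: "b < s" "b \<noteq> k"
        and xb: "(0 < b \<and> pa b = x) \<or> (0 < x \<and> pa x = b)"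
      have xk: "x \<noteq> k" using x anc_low[of k k pa] by auto
      show "b \<in> {x. x < s \<and> anc pa k x \<noteq> k}"
      proof (cases "b < k")
        case True then show ?thesis using b anc_low[of b k pa] by auto
      next
        case False
        then have kb: "k < b" using b by simp
        show ?thesis
        proof (cases "0 < b \<and> pa b = x")
          case True
          then show ?thesis using less[of b] anc_parent[of k b pa] x b kb by auto
        next
          case False
          then have px: "0 < x" "pa x = b" using xb by auto
          then show ?thesis using anc_parent[of k x pa] less[of x] px x kb b by auto
        qed
      qed
    qed (use a ak anc_low[of a k pa] in auto)
  qed
qed

end

section \<open>The Stockham transform and its rounding errors\<close>

definition om :: "nat \<Rightarrow> nat \<Rightarrow> complex" where
  "om N k = cis (2 * pi * real k / real N)"

lemma om_0 [simp]: "om N 0 = 1"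
  by (simp add: om_def)

lemma norm_om [simp]: "cmod (om N k) = 1"
  by (simp add: om_def)

lemma om_add: "om N (j + k) = om N j * om N k"
  by (simp add: om_def cis_mult distrib_left add_divide_distrib)

lemma om_mult: "om N (j * k) = om N k ^ j"
  by (induction j) (simp_all add: om_add)

lemma om_self: "0 < N \<Longrightarrow> om N N = 1"
  by (simp add: om_def)

lemma om_half: "0 < h \<Longrightarrow> om (2 * h) h = -1"
  by (simp add: om_def)

lemma om_scale: "0 < c \<Longrightarrow> om (N * c) (k * c) = om N k"
  by (simp add: om_def mult.assoc)

lemma om_eq_1:
  assumes "0 < N" "om N k = 1" shows "N dvd k"
proof -
  have "cos (2 * pi * real k / real N) = 1" using arg_cong[OF assms(2), of Re] by (simp add: om_def)
  then obtain z :: int where "2 * pi * real k / real N = of_int z * 2 * pi" using cos_one_2pi_int by auto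
  then have "real k = of_int z * real N" using assms(1) by (simp add: field_simps)
  then have "int k = z * int N"
    by (metis of_int_eq_iff of_int_mult of_int_of_nat_eq)
  then have "int N dvd int k" by simp
  then show ?thesis by simp
qed

text \<open>A geometric sum whose ratio \<open>om N k\<close> is an \<open>N\<close>-th root of
  unity.\<close>

lemma sum_om:
  assumes "0 < N"
  shows "(\<Sum>q<N. om N (q * k)) = (if N dvd k then of_nat N else 0)"
proof (cases "N dvd k")
  case True
  then obtain c where "k = c * N" by (metis dvdE mult.commute)
  then have "om N k = 1" using om_self[OF assms] by (simp add: om_mult)
  then show ?thesis using True by (simp add: om_mult)
next
  case False
  then have "om N k \<noteq> 1" using om_eq_1 assms by blast
  moreover have "om N k ^ N = 1" using om_self[OF assms]
    by (metis mult.commute om_mult power_one)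
  ultimately show ?thesis using False by (simp add: om_mult geometric_sum)
qed

definition dft :: "(nat \<Rightarrow> complex) \<Rightarrow> nat \<Rightarrow> nat \<Rightarrow> complex" where
  "dft a N q = (\<Sum>r<N. a r * om N (q * r))"

lemma dft_count:
  assumes X: "finite X" "\<And>x. x \<in> X \<Longrightarrow> f x < N"
  shows "dft (\<lambda>r. of_nat (card {x\<in>X. f x = r})) N q = (\<Sum>x\<in>X. om N (q * f x))"
proof -
  have "(\<Sum>x\<in>X. om N (q * f x)) = (\<Sum>r\<in>{..<N}. \<Sum>x\<in>{x\<in>X. f x = r}. om N (q * f x))"
    by (rule sum.group[symmetric]) (use X in auto)
  also have "\<dots> = (\<Sum>r\<in>{..<N}. of_nat (card {x\<in>X. f x = r}) * om N (q * r))"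
    by (intro sum.cong refl) simp
  finally show ?thesis by (simp add: dft_def)
qed

text \<open>A second forward transform read at the negated index is the inverse transform.\<close>

lemma dft_square_count:
  assumes X: "finite X" "\<And>x. x \<in> X \<Longrightarrow> 2 * f x < N" and i: "i < N"
  defines "a \<equiv> \<lambda>r. of_nat (card {x\<in>X. f x = r})"
  shows "dft (\<lambda>q. dft a N q ^ 2) N ((N - i) mod N) =
    of_nat (N * card {(x, y). x \<in> X \<and> y \<in> X \<and> f x + f y = i})"
proof -
  have N: "0 < N" using i by simp
  have a: "dft a N q = (\<Sum>x\<in>X. om N (q * f x))" for q
    unfolding a_def by (rule dft_count) (use X in force)+
  let ?i = "(N - i) mod N"
  \<comment> \<open>The sum of two indices is below \<open>N\<close>, so nothing wraps around: being
    congruent to \<open>i\<close> modulo \<open>N\<close> means being equal to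
    \<open>i\<close>.\<close>
  have dv: "N dvd ?i + (f x + f y) \<longleftrightarrow> f x + f y = i" if "x \<in> X" "y \<in> X" for x y
  proof -
    have lt: "f x + f y < N" using X(2)[OF that(1)] X(2)[OF that(2)] by linarith
    have "(?i + (f x + f y)) mod N = (N - i + (f x + f y)) mod N" by (simp add: mod_simps)
    then have "N dvd ?i + (f x + f y) \<longleftrightarrow> N dvd N - i + (f x + f y)" by (simp add: dvd_eq_mod_eq_0)
    also have "\<dots> \<longleftrightarrow> f x + f y = i"
    proof
      assume "N dvd N - i + (f x + f y)"
      then obtain c where c: "N - i + (f x + f y) = N * c" by blast
      have "0 < N * c" "N * c < N * 2" using c lt i by linarith+
      then have "c = 1" by simp
      then show "f x + f y = i" using c i by simp
    qed (use i in simp)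
    finally show ?thesis .
  qed
  have "dft (\<lambda>q. dft a N q ^ 2) N ?i = (\<Sum>q<N. dft a N q ^ 2 * om N (?i * q))"
    by (rule dft_def)
  also have "\<dots> = (\<Sum>q<N. \<Sum>x\<in>X. \<Sum>y\<in>X. om N (q * (?i + (f x + f y))))"
    unfolding a
    by (intro sum.cong refl, simp only: power2_eq_square sum_product sum_distrib_right, intro sum.cong refl)
      (simp add: om_add distrib_left ac_simps sum_distrib_left)
  also have "\<dots> = (\<Sum>x\<in>X. \<Sum>q<N. \<Sum>y\<in>X. om N (q * (?i + (f x + f y))))"
    by (rule sum.swap)
  also have "\<dots> = (\<Sum>x\<in>X. \<Sum>y\<in>X. \<Sum>q<N. om N (q * (?i + (f x + f y))))"
    by (intro sum.cong refl sum.swap)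
  also have "\<dots> = (\<Sum>x\<in>X. \<Sum>y\<in>X. if f x + f y = i then of_nat N else 0)"
    by (intro sum.cong refl) (simp add: sum_om[OF N] dv)
  also have "\<dots> = (\<Sum>z\<in>X \<times> X. if f (fst z) + f (snd z) = i then of_nat N else 0)"
    by (simp add: sum.cartesian_product case_prod_beta)
  also have "\<dots> = (\<Sum>z\<in>{z\<in>X \<times> X. f (fst z) + f (snd z) = i}. of_nat N)"
    by (rule sum.inter_filter[symmetric]) (use X in simp)
  also have "{z\<in>X \<times> X. f (fst z) + f (snd z) = i} = {(x, y). x \<in> X \<and> y \<in> X \<and> f x + f y = i}" by auto
  finally show ?thesis by simp
qed

text \<open>The contents of cell \<open>i = q + s p\<close> after the stage with block length \<open>s\<close> of the
  Stockham variant of the fast Fourier transform.\<close>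

definition stage :: "(nat \<Rightarrow> complex) \<Rightarrow> nat \<Rightarrow> nat \<Rightarrow> nat \<Rightarrow> complex" where
  "stage a N s i = (\<Sum>r<s. a (i div s + (N div s) * r) * om N ((i mod s) * (i div s + (N div s) * r)))"

lemma stage_1: "stage a N 1 i = a i"
  by (simp add: stage_def)

lemma stage_all: "q < N \<Longrightarrow> stage a N N q = dft a N q"
  by (simp add: stage_def dft_def)

lemma sum_lessThan_double: "(\<Sum>r<2 * (s::nat). f r) = (\<Sum>r<s. f (2 * r) + f (2 * r + 1))" for f :: "nat \<Rightarrow> complex"
  by (induction s) (simp_all add: algebra_simps)

text \<open>Splitting the sum over \<open>r < 2 * s\<close> into even and odd \<open>r\<close> gives
  the two cells of the previous stage. In the upper half, shifting the frequency by \<open>s\<close>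
  contributes the factor \<open>om N (s * p)\<close> and the sign \<open>(-1) ^ r\<close>, because
  \<open>om N (s * K) = -1\<close>.\<close>

lemma stage_double:
  assumes q: "q < s" and p: "p < K" and N: "N = 2 * s * K"
  shows "stage a N (2 * s) (q + 2 * s * p) = stage a N s (q + s * p) + stage a N s (q + s * (p + K))"
    and "stage a N (2 * s) (q + s + 2 * s * p) =
      (stage a N s (q + s * p) - stage a N s (q + s * (p + K))) * om N (s * p)"
proof -
  have s: "0 < s" using q by simp
  have d: "N div s = 2 * K" "N div (2 * s) = K" using s N by simp_all
  have idx: "(q + s * p) div s = p" "(q + s * p) mod s = q" "(q + s * (p + K)) div s = p + K"
    "(q + s * (p + K)) mod s = q" "(q + 2 * s * p) div (2 * s) = p" "(q + 2 * s * p) mod (2 * s) = q"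
    "(q + s + 2 * s * p) div (2 * s) = p" "(q + s + 2 * s * p) mod (2 * s) = q + s"
    using q s by simp_all
  let ?f = "\<lambda>r. a (p + K * r) * om N (q * (p + K * r))"
  have A: "stage a N s (q + s * p) = (\<Sum>r<s. ?f (2 * r))"
    unfolding stage_def idx d by (simp add: ac_simps)
  have B: "stage a N s (q + s * (p + K)) = (\<Sum>r<s. ?f (2 * r + 1))"
    unfolding stage_def idx d by (simp add: algebra_simps)
  show "stage a N (2 * s) (q + 2 * s * p) = stage a N s (q + s * p) + stage a N s (q + s * (p + K))"
    unfolding A B stage_def[of a N "2 * s"] idx d by (simp add: sum_lessThan_double sum.distrib)
  have half: "om N (s * K) = -1" using om_half[of "s * K"] s p N by (simp add: ac_simps)
  have tw: "om N ((q + s) * (p + K * r)) = om N (q * (p + K * r)) * om N (s * p) * (-1) ^ r" for r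
  proof -
    have "(q + s) * (p + K * r) = q * (p + K * r) + s * p + r * (s * K)" by (simp add: algebra_simps)
    then show ?thesis using half by (simp only: om_add om_mult[of N r])
  qed
  have "stage a N (2 * s) (q + s + 2 * s * p) =
      (\<Sum>r<s. a (p + K * (2 * r)) * om N ((q + s) * (p + K * (2 * r))) +
        a (p + K * (2 * r + 1)) * om N ((q + s) * (p + K * (2 * r + 1))))"
    unfolding stage_def[of a N "2 * s"] idx d by (simp only: sum_lessThan_double)
  also have "\<dots> = (\<Sum>r<s. (?f (2 * r) - ?f (2 * r + 1)) * om N (s * p))"
    unfolding tw by (intro sum.cong refl) (simp add: algebra_simps)
  also have "\<dots> = (stage a N s (q + s * p) - stage a N s (q + s * (p + K))) * om N (s * p)"
    unfolding A B by (simp only: sum_distrib_right[symmetric] sum_subtractf)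
  finally show "stage a N (2 * s) (q + s + 2 * s * p) =
      (stage a N s (q + s * p) - stage a N s (q + s * (p + K))) * om N (s * p)" .
qed

lemma norm_stage:
  assumes "\<And>r. r < N \<Longrightarrow> cmod (a r) \<le> A" "s dvd N" "0 < s" "i < N" "0 \<le> A"
  shows "cmod (stage a N s i) \<le> real N * A"
proof -
  obtain K where K: "N = s * K" using assms(2) by blast
  have d: "N div s = K" using K assms(3) by simp
  have "i div s < K" using assms(3,4) K by (simp add: less_mult_imp_div_less mult.commute)
  have idx: "i div s + K * r < N" if "r < s" for r
  proof -
    have "i div s + K * r < K + K * r" using \<open>i div s < K\<close> by simp
    also have "\<dots> = K * Suc r" by simp
    also have "\<dots> \<le> K * s" using that by (intro mult_le_mono2) simp
    finally show ?thesis using K by (simp add: mult.commute)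
  qed
  have "cmod (stage a N s i) \<le> (\<Sum>r<s. cmod (a (i div s + K * r) * om N ((i mod s) * (i div s + K * r))))"
    unfolding stage_def d by (rule norm_sum)
  also have "\<dots> \<le> (\<Sum>r<s. A)" using idx assms(1) by (intro sum_mono) (simp add: norm_mult)
  also have "\<dots> = real s * A" by simp
  also have "\<dots> \<le> real N * A" using assms(2,4,5) by (intro mult_right_mono) (auto dest: dvd_imp_le)
  finally show ?thesis .
qed

lemma norm_dft:
  assumes "\<And>r. r < N \<Longrightarrow> cmod (a r) \<le> A" "q < N" "0 \<le> A"
  shows "cmod (dft a N q) \<le> real N * A"
proof -
  have "cmod (stage a N N q) \<le> real N * A" by (rule norm_stage) (use assms in auto)
  then show ?thesis using stage_all[OF assms(2)] by simp
qed

text \<open>Fixed-point complex numbers with scale \<open>S\<close>.\<close>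

definition dec :: "int \<Rightarrow> int \<Rightarrow> int \<Rightarrow> complex" where
  "dec S x y = Complex (of_int x / of_int S) (of_int y / of_int S)"

lemma dec_add: "dec S (a + c) (b + d) = dec S a b + dec S c d"
  and dec_diff: "dec S (a - c) (b - d) = dec S a b - dec S c d"
  by (simp_all add: dec_def complex_eq_iff add_divide_distrib diff_divide_distrib)

lemma dec_int: "0 < S \<Longrightarrow> dec S (S * a) 0 = of_int a"
  by (simp add: dec_def complex_eq_iff)

section \<open>Propagation of rounding errors\<close>

lemma div_error:
  assumes "0 < S" shows "\<bar>real_of_int (z div S) - of_int z / of_int S\<bar> \<le> 1"
proof -
  have "\<bar>real_of_int \<lfloor>real_of_int z / of_int S\<rfloor> - of_int z / of_int S\<bar> \<le> 1" by linarith
  then show ?thesis by (simp only: floor_divide_of_int_eq)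
qed

lemma dec_mult_error:
  assumes S: "0 < S"
  shows "cmod (dec S ((a * c - b * d) div S) ((a * d + b * c) div S) - dec S a b * dec S c d) \<le> 2 / of_int S"
proof -
  let ?S = "real_of_int S"
  have pos: "0 < ?S" using S by simp
  have *: "\<bar>real_of_int (z div S) / ?S - real_of_int z / (?S * ?S)\<bar> \<le> 1 / ?S" for z
  proof -
    have "real_of_int (z div S) / ?S - real_of_int z / (?S * ?S) = (real_of_int (z div S) - of_int z / ?S) / ?S"
      using pos by (simp add: field_simps)
    also have "\<bar>\<dots>\<bar> = \<bar>real_of_int (z div S) - of_int z / ?S\<bar> / ?S" using pos by simp
    also have "\<dots> \<le> 1 / ?S" using div_error[OF S, of z] pos by (intro divide_right_mono) auto
    finally show ?thesis .
  qed
  let ?D = "dec S ((a * c - b * d) div S) ((a * d + b * c) div S) - dec S a b * dec S c d"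
  have RI: "Re ?D = real_of_int ((a * c - b * d) div S) / ?S - real_of_int (a * c - b * d) / (?S * ?S)"
    "Im ?D = real_of_int ((a * d + b * c) div S) / ?S - real_of_int (a * d + b * c) / (?S * ?S)"
    by (simp_all add: dec_def diff_divide_distrib add_divide_distrib)
  have "\<bar>Re ?D\<bar> \<le> 1 / ?S" "\<bar>Im ?D\<bar> \<le> 1 / ?S" unfolding RI by (rule *)+
  then show ?thesis using cmod_le[of ?D] by simp
qed

text \<open>The difference of the inputs carries the error \<open>2 * \<epsilon>\<close> and is
  multiplied by a computed root of norm at most \<open>2\<close>, whence the factor
  \<open>4\<close>. The rest is created in this step: the inexact root acting on a difference of
  norm at most \<open>2 * A\<close>, and the rounding \<open>\<rho>\<close>.\<close>

lemma butterfly_error: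
  assumes "cmod (x' - x) \<le> \<epsilon>" "cmod (y' - y) \<le> \<epsilon>" "cmod (u' - u) \<le> \<delta>" "cmod u = 1" "\<delta> \<le> 1"
    "cmod x \<le> A" "cmod y \<le> A" "cmod (z - (x' - y') * u') \<le> \<rho>"
  shows "cmod (z - (x - y) * u) \<le> 4 * \<epsilon> + (2 * A * \<delta> + \<rho>)"
proof -
  have u': "cmod u' \<le> 2" using norm_triangle_ineq[of "u' - u" u] assms(3-5) by simp
  have d: "cmod ((x' - y') - (x - y)) \<le> 2 * \<epsilon>"
    using norm_triangle_ineq4[of "x' - x" "y' - y"] assms(1,2) by (simp add: algebra_simps)
  have xy: "cmod (x - y) \<le> 2 * A" using norm_triangle_ineq4[of x y] assms(6,7) by simp
  have "(x' - y') * u' - (x - y) * u = ((x' - y') - (x - y)) * u' + (x - y) * (u' - u)"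
    by (simp add: algebra_simps)
  then have "cmod ((x' - y') * u' - (x - y) * u) \<le>
      cmod (((x' - y') - (x - y)) * u') + cmod ((x - y) * (u' - u))"
    by (metis norm_triangle_ineq)
  also have "\<dots> \<le> (2 * \<epsilon>) * 2 + (2 * A) * \<delta>"
    unfolding norm_mult using d xy u' assms(3) order_trans[OF norm_ge_zero assms(1)]
      order_trans[OF norm_ge_zero assms(6)]
    by (intro add_mono mult_mono) auto
  finally have "cmod ((x' - y') * u' - (x - y) * u) \<le> 4 * \<epsilon> + 2 * A * \<delta>" by simp
  then show ?thesis using norm_triangle_ineq[of "z - (x' - y') * u'" "(x' - y') * u' - (x - y) * u"] assms(8)
    by simp
qed

primrec stage_err :: "real \<Rightarrow> real \<Rightarrow> nat \<Rightarrow> real" where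
  "stage_err \<epsilon> \<eta> 0 = \<epsilon>"
| "stage_err \<epsilon> \<eta> (Suc t) = 4 * stage_err \<epsilon> \<eta> t + \<eta>"

text \<open>The recurrence has the fixed point \<open>- \<eta> / 3\<close>, so adding
  \<open>\<eta> / 3\<close> makes it geometric.\<close>

lemma stage_err_bound:
  assumes "0 \<le> \<eta>" shows "stage_err \<epsilon> \<eta> t \<le> 4 ^ t * (\<epsilon> + \<eta>)"
proof -
  have "stage_err \<epsilon> \<eta> t + \<eta> / 3 = 4 ^ t * (\<epsilon> + \<eta> / 3)"
    by (induction t) (simp_all add: algebra_simps)
  moreover have "4 ^ t * (\<epsilon> + \<eta> / 3) \<le> 4 ^ t * (\<epsilon> + \<eta>)" using assms by (intro mult_left_mono) auto
  ultimately show ?thesis using assms by linarith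
qed

text \<open>Before rounding, the error of the square is \<open>(x' - x) * (x' + x)\<close>, and the
  second factor has norm at most \<open>2 * A + 1\<close>.\<close>

lemma square_error:
  assumes "cmod (x' - x) \<le> \<epsilon>" "cmod x \<le> A" "\<epsilon> \<le> 1" "cmod (z - x' * x') \<le> \<rho>"
  shows "cmod (z - x ^ 2) \<le> \<epsilon> * (2 * A + 1) + \<rho>"
proof -
  have "cmod x' \<le> A + 1" using norm_triangle_ineq[of "x' - x" x] assms by simp
  then have "cmod (x' + x) \<le> 2 * A + 1" using norm_triangle_ineq[of x' x] assms(2) by linarith
  then have "cmod ((x' - x) * (x' + x)) \<le> \<epsilon> * (2 * A + 1)"
    unfolding norm_mult using assms(1) order_trans[OF norm_ge_zero assms(1)] by (intro mult_mono) auto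
  moreover have eq: "z - x ^ 2 = (z - x' * x') + (x' - x) * (x' + x)"
    by (simp add: algebra_simps power2_eq_square)
  have "cmod (z - x ^ 2) \<le> cmod (z - x' * x') + cmod ((x' - x) * (x' + x))"
    unfolding eq by (rule norm_triangle_ineq)
  ultimately show ?thesis using assms(4) by linarith
qed

text \<open>The product is split so that the old error meets the exact root \<open>u\<close> of norm
  one. It is passed on without amplification, so errors in a chain of products add up instead of
  multiplying.\<close>

lemma twiddle_error:
  assumes "cmod (x' - x) \<le> \<epsilon>" "cmod x = 1" "cmod u = 1" "\<epsilon> \<le> 1" "cmod (u' - u) \<le> \<delta>"
    "cmod (z - x' * u') \<le> \<rho>"
  shows "cmod (z - x * u) \<le> \<epsilon> + (2 * \<delta> + \<rho>)"
proof -
  have x': "cmod x' \<le> 2" using norm_triangle_ineq[of "x' - x" x] assms by simp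
  have "x' * u' - x * u = (x' - x) * u + x' * (u' - u)" by (simp add: algebra_simps)
  then have "cmod (x' * u' - x * u) \<le> cmod ((x' - x) * u) + cmod (x' * (u' - u))"
    by (metis norm_triangle_ineq)
  also have "\<dots> \<le> \<epsilon> * 1 + 2 * \<delta>" unfolding norm_mult using assms x'
      order_trans[OF norm_ge_zero assms(1)] by (intro add_mono mult_mono) auto
  finally show ?thesis using norm_triangle_ineq[of "z - x' * u'" "x' * u' - x * u"] assms(6) by simp
qed

text \<open>For angles up to \<open>pi / 2\<close> the cosine of the half angle is bounded away from
  zero, so neither the square root nor the division by this cosine amplifies errors by more than a
  constant. The factor \<open>4\<close> matches the growth of \<open>N ^ 2\<close> when
  \<open>N\<close> doubles, on which \<open>near\<close> relies.\<close>

lemma half_angle_error: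
  fixes S c s lo y N :: int and \<theta> \<delta> :: real
  assumes S: "16 \<le> S" and th: "0 \<le> \<theta>" "\<theta> \<le> pi / 2"
    and c: "\<bar>of_int c / of_int S - cos \<theta>\<bar> \<le> \<delta>" and s: "\<bar>of_int s / of_int S - sin \<theta>\<bar> \<le> \<delta>"
    and \<delta>: "\<delta> + 3 / of_int S \<le> 1 / 8"
    and y: "y = (S * S + c * S) div 2" and lo: "0 \<le> lo" "lo * lo \<le> y" "y < (lo + 1) * (lo + 1)"
  shows "\<bar>of_int lo / of_int S - cos (\<theta> / 2)\<bar> \<le> 4 * \<delta> + 16 / of_int S"
    and "\<bar>of_int ((s * S) div (2 * lo)) / of_int S - sin (\<theta> / 2)\<bar> \<le> 4 * \<delta> + 16 / of_int S"
    and "0 < lo"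
proof -
  let ?S = "real_of_int S" and ?C = "cos (\<theta> / 2)" and ?l = "real_of_int lo / real_of_int S"
  define e where "e = \<delta> / 2 + 1 / (?S * ?S)"
  have S0: "0 < ?S" "16 \<le> ?S" using S by simp_all
  have \<delta>0: "0 \<le> \<delta>" using c by linarith
  have cp: "0 \<le> cos \<theta>" using th by (intro cos_ge_zero) auto
  have C2: "?C * ?C = (1 + cos \<theta>) / 2" using cos_double_cos[of "\<theta> / 2"] by (simp add: power2_eq_square)
  have C0: "0 \<le> ?C" using th by (intro cos_ge_zero) auto
  \<comment> \<open>The squared cosine is at least \<open>1 / 2\<close>, and \<open>7 / 10\<close>
    is just below the root of that.\<close>
  have C7: "7 / 10 \<le> ?C"
  proof (rule ccontr)
    assume "\<not> 7 / 10 \<le> ?C"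
    then have "?C * ?C \<le> (7 / 10) * (7 / 10)" using C0 by (intro mult_mono) auto
    then show False using C2 cp by simp
  qed
  have l0: "0 \<le> ?l" using lo(1) S0 by simp
  have yr: "2 * y \<le> S * S + c * S" "S * S + c * S < 2 * y + 2" unfolding y by linarith+
  have "real_of_int (2 * y) \<le> of_int (S * S + c * S)" "real_of_int (S * S + c * S) < of_int (2 * y + 2)"
    using yr by (simp_all only: of_int_le_iff of_int_less_iff)
  then have y1: "2 * of_int y \<le> ?S * ?S + of_int c * ?S" "?S * ?S + of_int c * ?S < 2 * of_int y + 2" by simp_all
  define Y where "Y = of_int y / (?S * ?S)"
  have Y1: "2 * Y \<le> 1 + of_int c / ?S" "1 + of_int c / ?S < 2 * Y + 2 / (?S * ?S)"
  proof -
    have eqs: "(?S * ?S + of_int c * ?S) / (?S * ?S) = 1 + of_int c / ?S"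
      "2 * Y = (2 * of_int y) / (?S * ?S)" "2 * Y + 2 / (?S * ?S) = (2 * of_int y + 2) / (?S * ?S)"
      using S0 by (simp_all add: Y_def field_simps)
    have pos: "0 < ?S * ?S" using S0 by simp
    show "2 * Y \<le> 1 + of_int c / ?S" unfolding eqs(1)[symmetric] eqs(2)
      using y1(1) pos by (intro divide_right_mono) auto
    show "1 + of_int c / ?S < 2 * Y + 2 / (?S * ?S)" unfolding eqs(1)[symmetric] eqs(3)
      using y1(2) pos by (intro divide_strict_right_mono) auto
  qed
  have Ye: "\<bar>Y - ?C * ?C\<bar> \<le> e" using Y1 c unfolding e_def C2 by (simp add: abs_le_iff field_simps)
  have "real_of_int (lo * lo) \<le> of_int y" "real_of_int y < of_int ((lo + 1) * (lo + 1))"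
    using lo by (simp_all only: of_int_le_iff of_int_less_iff)
  then have L: "?l * ?l \<le> Y" "Y < (?l + 1 / ?S) * (?l + 1 / ?S)"
    using S0 unfolding Y_def by (simp_all add: field_simps)
  have e0: "0 \<le> e" using \<delta>0 S0 by (simp add: e_def)
  \<comment> \<open>A gap beyond \<open>e / (7 / 10)\<close> between the roots, multiplied by their
    sum of at least \<open>7 / 10\<close>, would exceed the error \<open>e\<close> of the squares.
    The estimate \<open>down\<close> argues in the same way with the root increased by
    \<open>1 / S\<close>.\<close>
  have up: "?l - ?C \<le> e / (7 / 10)"
  proof (rule ccontr)
    assume n: "\<not> ?l - ?C \<le> e / (7 / 10)"
    have "0 \<le> e / (7 / 10)" using e0 by simp
    then have "0 \<le> ?l - ?C" "7 / 10 \<le> ?l + ?C" using n C7 l0 by linarith+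
    note b = mult_left_mono[OF this(2,1)]
    from n have "e < (?l - ?C) * (7 / 10)" by simp
    also have "\<dots> \<le> (?l - ?C) * (?l + ?C)"
      by (rule b)
    also have "\<dots> = ?l * ?l - ?C * ?C" by (simp add: algebra_simps)
    finally show False using L(1) Ye by linarith
  qed
  have down: "?C - (?l + 1 / ?S) \<le> e / (7 / 10)"
  proof (rule ccontr)
    assume n: "\<not> ?C - (?l + 1 / ?S) \<le> e / (7 / 10)"
    have "0 \<le> e / (7 / 10)" "0 \<le> 1 / ?S" using e0 S0 by simp_all
    then have "0 \<le> ?C - (?l + 1 / ?S)" "7 / 10 \<le> ?C + (?l + 1 / ?S)" using n C7 l0 by linarith+
    note b = mult_left_mono[OF this(2,1)]
    from n have "e < (?C - (?l + 1 / ?S)) * (7 / 10)" by simp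
    also have "\<dots> \<le> (?C - (?l + 1 / ?S)) * (?C + (?l + 1 / ?S))"
      by (rule b)
    also have "\<dots> = ?C * ?C - (?l + 1 / ?S) * (?l + 1 / ?S)" by (simp add: algebra_simps)
    finally show False using L(2) Ye by linarith
  qed
  have S2: "1 / (?S * ?S) \<le> 1 / (16 * ?S)" using S0 by (intro divide_left_mono) auto
  define \<kappa> where "\<kappa> = 1 / ?S"
  have S2': "1 / (?S * ?S) \<le> \<kappa> / 16" using S2 unfolding \<kappa>_def by simp
  have \<kappa>0: "0 < \<kappa>" using S0 by (simp add: \<kappa>_def)
  have lC: "\<bar>?l - ?C\<bar> \<le> \<delta> + 3 * \<kappa>"
    using up down S2' \<delta>0 \<kappa>0 unfolding e_def \<kappa>_def[symmetric] by (simp add: abs_le_iff field_simps)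
  have k16: "16 / ?S = 16 * \<kappa>" by (simp add: \<kappa>_def)
  show "\<bar>?l - ?C\<bar> \<le> 4 * \<delta> + 16 / ?S" unfolding k16 using lC \<delta>0 \<kappa>0 by linarith
  have \<delta>\<kappa>: "\<delta> + 3 * \<kappa> \<le> 1 / 8" using \<delta> by (simp add: \<kappa>_def)
  have l5: "1 / 2 \<le> ?l" using lC C7 \<delta>\<kappa> by linarith
  then show lo0: "0 < lo" using S0 by (cases "lo = 0") (use lo(1) in auto)
  let ?\<sigma> = "of_int s / ?S"
  have sn: "sin \<theta> = 2 * sin (\<theta> / 2) * ?C" using sin_double[of "\<theta> / 2"] by simp
  have \<sigma>b: "\<bar>?\<sigma>\<bar> \<le> 9 / 8" using s abs_sin_le_one[of \<theta>] \<delta>\<kappa> \<kappa>0 by linarith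
  \<comment> \<open>Separates the error of the denominator from that of the numerator;
    \<open>sin \<theta>\<close> is rewritten by the double-angle formula.\<close>
  have eq: "?\<sigma> / (2 * ?l) - sin (\<theta> / 2) = ?\<sigma> * (?C - ?l) / (2 * ?l * ?C) + (?\<sigma> - sin \<theta>) / (2 * ?C)"
  proof -
    have gen: "x / (2 * l) - t = x * (C - l) / (2 * l * C) + (x - 2 * t * C) / (2 * C)"
      if "l \<noteq> 0" "C \<noteq> 0" for x l t C :: real using that by (simp add: field_simps)
    show ?thesis unfolding sn by (rule gen) (use l5 C7 in auto)
  qed
  have b1: "\<bar>?\<sigma> * (?C - ?l) / (2 * ?l * ?C)\<bar> \<le> (9 / 8) * (\<delta> + 3 * \<kappa>) / (2 * (1 / 2) * (7 / 10))"
  proof -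
    have gen: "\<bar>x * (C - l) / (2 * l * C)\<bar> \<le> (9 / 8) * d / (2 * (1 / 2) * (7 / 10))"
      if h: "\<bar>x\<bar> \<le> 9 / 8" "\<bar>l - C\<bar> \<le> d" "1 / 2 \<le> l" "7 / 10 \<le> C" for x C l d :: real
    proof -
      have "\<bar>x * (C - l)\<bar> \<le> (9 / 8) * d"
        unfolding abs_mult using h by (intro mult_mono) auto
      moreover have "(1 / 2) * (7 / 10) \<le> l * C" using h by (intro mult_mono) auto
      then have "2 * (1 / 2) * (7 / 10) \<le> \<bar>2 * l * C\<bar>" by simp
      ultimately show ?thesis unfolding abs_divide by (intro frac_le) auto
    qed
    show ?thesis by (rule gen[OF \<sigma>b lC l5 C7])
  qed
  have b2: "\<bar>(?\<sigma> - sin \<theta>) / (2 * ?C)\<bar> \<le> \<delta> / (2 * (7 / 10))"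
  proof -
    have "2 * (7 / 10) \<le> \<bar>2 * ?C\<bar>" using C7 by simp
    then show ?thesis unfolding abs_divide using s \<delta>0 by (intro frac_le) auto
  qed
  have b3: "\<bar>of_int ((s * S) div (2 * lo)) / ?S - ?\<sigma> / (2 * ?l)\<bar> \<le> \<kappa>"
  proof -
    have "of_int ((s * S) div (2 * lo)) / ?S - ?\<sigma> / (2 * ?l) =
        (of_int ((s * S) div (2 * lo)) - of_int (s * S) / of_int (2 * lo)) / ?S"
      using S0 lo0 by (simp add: field_simps)
    also have "\<bar>\<dots>\<bar> = \<bar>of_int ((s * S) div (2 * lo)) - of_int (s * S) / real_of_int (2 * lo)\<bar> / ?S"
      using S0 by simp
    also have "\<dots> \<le> 1 / ?S"
      using div_error[of "2 * lo" "s * S"] lo0 S0 by (intro divide_right_mono) auto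
    finally show ?thesis by (simp add: \<kappa>_def)
  qed
  have "\<bar>of_int ((s * S) div (2 * lo)) / ?S - sin (\<theta> / 2)\<bar> \<le> \<kappa> + ((9 / 8) * (\<delta> + 3 * \<kappa>) / (2 * (1 / 2) * (7 / 10)) + \<delta> / (2 * (7 / 10)))"
    using b1 b2 b3 eq by linarith
  also have "\<dots> \<le> 4 * \<delta> + 16 * \<kappa>" using \<delta>0 \<kappa>0 by (simp add: field_simps)
  finally show "\<bar>of_int ((s * S) div (2 * lo)) / ?S - sin (\<theta> / 2)\<bar> \<le> 4 * \<delta> + 16 / ?S" by (simp add: \<kappa>_def)
qed

text \<open>Adding \<open>h * S\<close>, half of the divisor \<open>S * N\<close>, turns rounding
  down into rounding to the nearest integer; the deviation of \<open>z\<close> from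
  \<open>S * N * c\<close> is less than \<open>S\<close>, and \<open>h * S\<close> is at least
  \<open>S\<close>.\<close>

lemma round_error:
  fixes z S c N h :: int
  assumes "0 < S" "0 < N" "N = 2 * h" "\<bar>of_int z / of_int S - of_int (N * c)\<bar> < (1 / 2 :: real)"
  shows "(z + h * S) div (S * N) = c"
proof -
  have "\<bar>real_of_int z - of_int (N * c) * of_int S\<bar> < of_int S"
  proof -
    have "\<bar>real_of_int z - of_int (N * c) * of_int S\<bar> = \<bar>of_int z / of_int S - of_int (N * c)\<bar> * of_int S"
    proof -
      have "real_of_int z - of_int (N * c) * of_int S = (of_int z / of_int S - of_int (N * c)) * of_int S"
        using assms(1) by (simp add: field_simps)
      then show ?thesis using assms(1) by (simp add: abs_mult)
    qed
    also have "\<dots> < (1 / 2) * of_int S" using assms(1,4) by (intro mult_strict_right_mono) auto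
    finally show ?thesis using assms(1) by simp
  qed
  then have "\<bar>z - N * c * S\<bar> < S" by (simp flip: of_int_mult of_int_diff of_int_abs of_int_less_iff)
  moreover have "1 \<le> h" using assms by simp
  then have "1 * S \<le> h * S" using assms(1) by (intro mult_right_mono) auto
  ultimately have r: "0 \<le> z + h * S - N * c * S" "z + h * S - N * c * S < S * N"
    using assms(3) by (auto simp: algebra_simps)
  have eq: "z + h * S = (z + h * S - N * c * S) + c * (S * N)" by (simp add: algebra_simps)
  have "(z + h * S) div (S * N) = c + (z + h * S - N * c * S) div (S * N)"
    by (subst eq, rule div_mult_self1) (use assms(1,2) in simp)
  then show ?thesis using div_pos_pos_trivial[OF r] by simp
qed

section \<open>A structured language and its compiler\<close>

text \<open>Values are unbounded integers, which the machine holds modulo \<open>2 ^ w\<close>. Sums and products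
  may therefore overflow; only divisions, comparisons and addresses need operands in range.\<close>

datatype aexp = Cn nat | Vr nat | Op binop aexp aexp | Rd nat aexp

datatype bexp = Less aexp aexp | Eq aexp aexp

datatype com =
    Skip
  | Assign nat aexp (infix "::=" 61)
  | Wr nat aexp aexp
  | Seq com com (infixr ";;" 60)
  | If bexp com com
  | While bexp com

type_synonym vars = "nat \<Rightarrow> int"
type_synonym arrs = "nat \<Rightarrow> nat \<Rightarrow> int"

fun sem_op :: "binop \<Rightarrow> int \<Rightarrow> int \<Rightarrow> int" where
  "sem_op OpAdd a b = a + b"
| "sem_op OpSub a b = a - b"
| "sem_op OpMul a b = a * b"
| "sem_op OpDiv a b = a div b"
| "sem_op OpMod a b = a mod b"
| "sem_op _ a b = 0"

fun ev :: "aexp \<Rightarrow> vars \<Rightarrow> arrs \<Rightarrow> int" where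
  "ev (Cn c) v m = int c"
| "ev (Vr x) v m = v x"
| "ev (Op f a b) v m = sem_op f (ev a v m) (ev b v m)"
| "ev (Rd k a) v m = m k (nat (ev a v m))"

fun bv :: "bexp \<Rightarrow> vars \<Rightarrow> arrs \<Rightarrow> bool" where
  "bv (Less a b) v m = (ev a v m < ev b v m)"
| "bv (Eq a b) v m = (ev a v m = ev b v m)"

text \<open>The variables and the arrays that a command may modify.\<close>

fun wv :: "com \<Rightarrow> nat set" where
  "wv (x ::= a) = {x}"
| "wv (c ;; d) = wv c \<union> wv d"
| "wv (If b c d) = wv c \<union> wv d"
| "wv (While b c) = wv c"
| "wv _ = {}"

fun wa :: "com \<Rightarrow> nat set" where
  "wa (Wr k a b) = {k}"
| "wa (c ;; d) = wa c \<union> wa d"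
| "wa (If b c d) = wa c \<union> wa d"
| "wa (While b c) = wa c"
| "wa _ = {}"

text \<open>Variable \<open>x\<close> lives in register \<open>2 * x\<close>, register \<open>1\<close> holds the memory bound \<open>B\<close>, and the registers
  \<open>2 * t + 1\<close> with \<open>t \<ge> 1\<close> are the evaluation stack. Array \<open>0\<close> starts at address \<open>0\<close> and thus holds
  input and output; the arrays \<open>1, \<dots>, 31\<close> are interleaved above \<open>B\<close>.\<close>

definition addr_code :: "nat \<Rightarrow> nat \<Rightarrow> instr list" where
  "addr_code t k = (if k = 0 then [] else
     [Const (2*t+3) 32, Bin OpMul (2*t+1) (2*t+1) (2*t+3), Const (2*t+3) k,
      Bin OpAdd (2*t+1) (2*t+1) (2*t+3), Bin OpAdd (2*t+1) (2*t+1) 1])"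

text \<open>The machine has no move instruction, so a register is copied by adding it to zero. Level
  \<open>t\<close> of the stack receives the result; the second operand is evaluated one level
  higher.\<close>

fun cexp :: "nat \<Rightarrow> aexp \<Rightarrow> instr list" where
  "cexp t (Cn c) = [Const (2*t+1) c]"
| "cexp t (Vr x) = [Const (2*t+1) 0, Bin OpAdd (2*t+1) (2*t+1) (2*x)]"
| "cexp t (Op f a b) = cexp t a @ cexp (t+1) b @ [Bin f (2*t+1) (2*t+1) (2*t+3)]"
| "cexp t (Rd k a) = cexp t a @ addr_code t k @ [Load (2*t+1) (2*t+1)]"

fun cbexp :: "bexp \<Rightarrow> nat \<Rightarrow> instr list" where
  "cbexp (Less a b) l = cexp 1 a @ cexp 2 b @ [JumpLess 3 5 l]"
| "cbexp (Eq a b) l = cexp 1 a @ cexp 2 b @ [JumpEq 3 5 l]"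

definition acost :: "nat \<Rightarrow> nat" where "acost k = (if k = 0 then 0 else 5)"

fun cost :: "aexp \<Rightarrow> nat" where
  "cost (Cn c) = 1"
| "cost (Vr x) = 2"
| "cost (Op f a b) = cost a + cost b + 1"
| "cost (Rd k a) = cost a + acost k + 1"

fun bcost :: "bexp \<Rightarrow> nat" where
  "bcost (Less a b) = cost a + cost b + 1"
| "bcost (Eq a b) = cost a + cost b + 1"

lemma length_addr_code [simp]: "length (addr_code t k) = acost k"
  by (simp add: addr_code_def acost_def)

lemma length_cexp [simp]: "length (cexp t a) = cost a"
  by (induction a arbitrary: t) auto

lemma length_cbexp [simp]: "length (cbexp b l) = bcost b"
  by (cases b) auto

fun csize :: "com \<Rightarrow> nat" where
  "csize Skip = 0"
| "csize (x ::= a) = cost a + 2"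
| "csize (Wr k a b) = cost a + acost k + cost b + 1"
| "csize (c ;; d) = csize c + csize d"
| "csize (If b c d) = bcost b + csize d + 1 + csize c"
| "csize (While b c) = bcost b + 1 + csize c + 1"

text \<open>Jump targets are absolute, so \<open>p\<close> carries the address of the first
  instruction. Since a test jumps when it holds, the code of the alternative \<open>d\<close>
  precedes that of \<open>c\<close>.\<close>

fun ccom :: "nat \<Rightarrow> com \<Rightarrow> instr list" where
  "ccom p Skip = []"
| "ccom p (x ::= a) = cexp 1 a @ [Const (2*x) 0, Bin OpAdd (2*x) (2*x) 3]"
| "ccom p (Wr k a b) = cexp 1 a @ addr_code 1 k @ cexp 2 b @ [Store 3 5]"
| "ccom p (c ;; d) = ccom p c @ ccom (p + csize c) d"
| "ccom p (If b c d) =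
     (let q = p + bcost b; r = q + csize d + 1
      in cbexp b r @ ccom q d @ [Jump (r + csize c)] @ ccom r c)"
| "ccom p (While b c) =
     (let q = p + bcost b + 1
      in cbexp b q @ [Jump (q + csize c + 1)] @ ccom q c @ [Jump p])"

lemma length_ccom [simp]: "length (ccom p c) = csize c"
  by (induction c arbitrary: p) (auto simp: Let_def)

section \<open>Correctness of the compiler\<close>

definition code_at :: "instr list \<Rightarrow> nat \<Rightarrow> instr list \<Rightarrow> bool" where
  "code_at P p is \<longleftrightarrow> (\<forall>j < length is. p + j < length P \<and> P ! (p + j) = is ! j)"

lemma code_at_Nil [simp]: "code_at P p []"
  by (simp add: code_at_def)

lemma code_at_append [simp]:
  "code_at P p (xs @ ys) \<longleftrightarrow> code_at P p xs \<and> code_at P (p + length xs) ys"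
proof
  assume L: "code_at P p (xs @ ys)"
  show "code_at P p xs \<and> code_at P (p + length xs) ys"
  proof
    show "code_at P p xs" using L by (auto simp: code_at_def nth_append)
    show "code_at P (p + length xs) ys" unfolding code_at_def
    proof (intro allI impI)
      fix j assume "j < length ys"
      then show "p + length xs + j < length P \<and> P ! (p + length xs + j) = ys ! j"
        using L[unfolded code_at_def, rule_format, of "length xs + j"] by (simp add: add.assoc)
    qed
  qed
next
  assume R: "code_at P p xs \<and> code_at P (p + length xs) ys"
  show "code_at P p (xs @ ys)" unfolding code_at_def
  proof (intro allI impI)
    fix j assume j: "j < length (xs @ ys)"
    show "p + j < length P \<and> P ! (p + j) = (xs @ ys) ! j"
    proof (cases "j < length xs")
      case True then show ?thesis using R by (auto simp: code_at_def nth_append)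
    next
      case False
      then show ?thesis using R j
        by (auto simp: code_at_def nth_append dest!: spec[of _ "j - length xs"])
    qed
  qed
qed

lemma code_at_Cons [simp]:
  "code_at P p (i # is) \<longleftrightarrow> p < length P \<and> P ! p = i \<and> code_at P (Suc p) is"
proof -
  have "code_at P p ([i] @ is) \<longleftrightarrow> code_at P p [i] \<and> code_at P (p + length [i]) is"
    by (rule code_at_append)
  then show ?thesis by (simp add: code_at_def)
qed

lemma code_at_self: "code_at (xs @ ys) 0 xs" "code_at (xs @ ys) (length xs) ys"
  by (auto simp: code_at_def nth_append)

text \<open>The largest address in use is that of index \<open>B - 1\<close> in array
  \<open>31\<close>, namely \<open>33 * B - 1\<close>. The surplus makes constants such as
  \<open>32\<close> fit into a word.\<close>

locale machine =
  fixes w B :: nat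
  assumes room: "33 * B + 64 \<le> 2 ^ w"
begin

abbreviation M :: int where "M \<equiv> 2 ^ w"

fun ok_op :: "binop \<Rightarrow> int \<Rightarrow> int \<Rightarrow> bool" where
  "ok_op OpAdd a b = True"
| "ok_op OpSub a b = True"
| "ok_op OpMul a b = True"
| "ok_op OpDiv a b = (0 \<le> a \<and> a < M \<and> 0 \<le> b \<and> b < M)"
| "ok_op OpMod a b = (0 \<le> a \<and> a < M \<and> 0 \<le> b \<and> b < M)"
| "ok_op _ a b = False"

fun ok :: "aexp \<Rightarrow> vars \<Rightarrow> arrs \<Rightarrow> bool" where
  "ok (Cn c) v m = True"
| "ok (Vr x) v m = True"
| "ok (Op f a b) v m = (ok a v m \<and> ok b v m \<and> ok_op f (ev a v m) (ev b v m))"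
| "ok (Rd k a) v m = (k < 32 \<and> ok a v m \<and> 0 \<le> ev a v m \<and> ev a v m < int B)"

definition okw :: "int \<Rightarrow> bool" where "okw z \<longleftrightarrow> 0 \<le> z \<and> z < M"

fun okb :: "bexp \<Rightarrow> vars \<Rightarrow> arrs \<Rightarrow> bool" where
  "okb (Less a b) v m = (ok a v m \<and> ok b v m \<and> okw (ev a v m) \<and> okw (ev b v m))"
| "okb (Eq a b) v m = (ok a v m \<and> ok b v m \<and> okw (ev a v m) \<and> okw (ev b v m))"

text \<open>\<open>big c v m t v' m'\<close>: the command terminates within \<open>t\<close> machine steps.\<close>

inductive big :: "com \<Rightarrow> vars \<Rightarrow> arrs \<Rightarrow> nat \<Rightarrow> vars \<Rightarrow> arrs \<Rightarrow> bool" where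
  Skip: "big Skip v m 0 v m"
| Assign: "ok a v m \<Longrightarrow> big (x ::= a) v m (cost a + 2) (v(x := ev a v m)) m"
| Wr: "k < 32 \<Longrightarrow> ok a v m \<Longrightarrow> 0 \<le> ev a v m \<Longrightarrow> ev a v m < int B \<Longrightarrow> ok b v m \<Longrightarrow>
    big (Wr k a b) v m (csize (Wr k a b)) v (m(k := (m k)(nat (ev a v m) := ev b v m)))"
| Seq: "big c v m t v' m' \<Longrightarrow> big d v' m' t' v'' m'' \<Longrightarrow> big (c ;; d) v m (t + t') v'' m''"
| IfT: "okb b v m \<Longrightarrow> bv b v m \<Longrightarrow> big c v m t v' m' \<Longrightarrow> big (If b c d) v m (bcost b + t) v' m'"
| IfF: "okb b v m \<Longrightarrow> \<not> bv b v m \<Longrightarrow> big d v m t v' m' \<Longrightarrow>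
    big (If b c d) v m (bcost b + t + 1) v' m'"
| WhileF: "okb b v m \<Longrightarrow> \<not> bv b v m \<Longrightarrow> big (While b c) v m (bcost b + 1) v m"
| WhileT: "okb b v m \<Longrightarrow> bv b v m \<Longrightarrow> big c v m t v' m' \<Longrightarrow> big (While b c) v' m' t' v'' m'' \<Longrightarrow>
    big (While b c) v m (bcost b + t + 1 + t') v'' m''"
| Weak: "big c v m t v' m' \<Longrightarrow> t \<le> t' \<Longrightarrow> big c v m t' v' m'"

definition wd :: "int \<Rightarrow> nat" where "wd z = nat (z mod M)"

definition addr :: "nat \<Rightarrow> nat \<Rightarrow> nat" where
  "addr k i = (if k = 0 then i else B + 32 * i + k)"

definition rel :: "vars \<Rightarrow> arrs \<Rightarrow> config \<Rightarrow> bool" where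
  "rel v m s \<longleftrightarrow> (\<forall>x. regs s (2 * x) = wd (v x)) \<and> regs s 1 = B \<and>
     (\<forall>k i. k < 32 \<longrightarrow> i < B \<longrightarrow> mem s (addr k i) = wd (m k i))"

lemma wd_less: "wd z < 2 ^ w"
  by (simp add: wd_def nat_less_iff)

lemma int_wd: "int (wd z) = z mod M"
  by (simp add: wd_def)

lemma wd_eqI: "int a mod M = z mod M \<Longrightarrow> a < 2 ^ w \<Longrightarrow> a = wd z"
proof -
  assume 1: "int a mod M = z mod M" and 2: "a < 2 ^ w"
  have "int a < M" using 2 by (metis of_nat_less_iff of_nat_numeral of_nat_power)
  then have "int a mod M = int a" by simp
  then show ?thesis using 1 by (simp add: wd_def)
qed

lemma wd_small: "0 \<le> z \<Longrightarrow> z < M \<Longrightarrow> wd z = nat z"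
  by (simp add: wd_def)

lemma take_bit_eq_wd: "int a mod M = z mod M \<Longrightarrow> take_bit w a = wd z"
  by (rule wd_eqI) (simp_all add: take_bit_eq_mod zmod_int)

lemma eval_binop_wd:
  assumes "ok_op f a b"
  shows "eval_binop w f (wd a) (wd b) = wd (sem_op f a b)"
  using assms
proof (cases f)
  case OpAdd
  then show ?thesis by (auto intro!: take_bit_eq_wd simp: int_wd mod_simps)
next
  case OpSub
  have "wd b \<le> wd a + 2 ^ w" using wd_less[of b] by linarith
  then have "int (wd a + 2 ^ w - wd b) = a mod M + M - b mod M"
    by (simp add: of_nat_diff int_wd)
  moreover have "(a mod M + M - b mod M) mod M = (a - b) mod M"
    by (metis (no_types, opaque_lifting) add_diff_eq diff_add_eq mod_add_self2 mod_diff_eq)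
  ultimately show ?thesis using OpSub by (auto intro!: take_bit_eq_wd)
next
  case OpMul
  then show ?thesis by (auto intro!: take_bit_eq_wd simp: int_wd mod_simps)
next
  case OpDiv
  then show ?thesis using assms
    by (auto intro!: take_bit_eq_wd simp: wd_small zdiv_int)
next
  case OpMod
  then show ?thesis using assms
    by (auto intro!: take_bit_eq_wd simp: wd_small zmod_int)
qed auto

lemma step_at:
  "pc s < length P \<Longrightarrow> P ! pc s = i \<Longrightarrow> step w P s = exec_instr w i s"
  by (simp add: step_def halted_def)

lemma steps_add: "(step w P ^^ (a + b)) s = (step w P ^^ b) ((step w P ^^ a) s)"
  by (metis add.commute comp_apply funpow_add)

lemma steps_Suc: "(step w P ^^ Suc b) s = (step w P ^^ b) (step w P s)"
  by (simp only: funpow_Suc_right comp_apply)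

fun nonjump :: "instr \<Rightarrow> bool" where
  "nonjump (Jump l) = False" | "nonjump (JumpEq a b l) = False" | "nonjump (JumpLess a b l) = False"
| "nonjump _ = True"

definition straight :: "instr list \<Rightarrow> config \<Rightarrow> config" where
  "straight is s = foldl (\<lambda>s i. exec_instr w i s) s is"

lemma exec_straight:
  "code_at P (pc s) is \<Longrightarrow> \<forall>i\<in>set is. nonjump i \<Longrightarrow> (step w P ^^ length is) s = straight is s"
proof (induction "is" arbitrary: s)
  case Nil then show ?case by (simp add: straight_def)
next
  case (Cons i js)
  have st: "step w P s = exec_instr w i s" using Cons.prems by (simp add: step_at)
  have "pc (exec_instr w i s) = Suc (pc s)" using Cons.prems by (cases i) auto
  then have "(step w P ^^ length js) (exec_instr w i s) = straight js (exec_instr w i s)"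
    using Cons by simp
  then show ?case by (simp only: length_Cons steps_Suc st straight_def foldl.simps)
qed

lemma B_less: "B < 2 ^ w" "32 < (2::nat) ^ w"
  using room by linarith+

lemma int_B_less: "int B < M"
  using B_less(1) by (metis of_nat_less_iff of_nat_numeral of_nat_power)

lemma addr_code_steps:
  assumes "code_at P (pc s) (addr_code t k)" "t \<ge> 1" "regs s 1 = B"
    "regs s (2*t+1) = i" "i < B" "k < 32"
  shows "\<exists>s'. (step w P ^^ length (addr_code t k)) s = s' \<and>
    pc s' = pc s + length (addr_code t k) \<and> mem s' = mem s \<and> regs s' (2*t+1) = addr k i \<and>
    (\<forall>r. r < 2*t+1 \<or> even r \<longrightarrow> regs s' r = regs s r)"
proof (cases "k = 0")
  case True then show ?thesis using assms by (auto simp: addr_code_def addr_def)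
next
  case False
  have b: "i * 32 < 2 ^ w" "i * 32 + k < 2 ^ w" "i * 32 + k + B < 2 ^ w" "k < 2 ^ w"
    using assms room by linarith+
  have tb: "take_bit w (i * 32) = i * 32" "take_bit w (i * 32 + k) = i * 32 + k"
    "take_bit w (i * 32 + k + B) = i * 32 + k + B" "take_bit w k = k" "take_bit w 32 = (32::nat)"
    using b B_less by (simp_all add: take_bit_nat_eq_self_iff)
  show ?thesis using assms False exec_straight[OF assms(1)]
    by (auto simp: addr_code_def straight_def tb addr_def)
qed

text \<open>The frame clause carries the induction: registers below the current stack level and all
  even registers survive, so the first operand and the variables are intact after the second operand
  is evaluated.\<close>

lemma cexp_steps:
  assumes "code_at P (pc s) (cexp t e)" "t \<ge> 1" "rel v m s" "ok e v m"
  shows "\<exists>s'. (step w P ^^ cost e) s = s' \<and>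
    pc s' = pc s + cost e \<and> mem s' = mem s \<and> regs s' (2*t+1) = wd (ev e v m) \<and>
    (\<forall>r. r < 2*t+1 \<or> even r \<longrightarrow> regs s' r = regs s r)"
  using assms
proof (induction e arbitrary: t s)
  case (Cn c)
  then show ?case using exec_straight[OF Cn.prems(1)]
    by (auto simp: straight_def intro: take_bit_eq_wd)
next
  case (Vr x)
  have eq: "(step w P ^^ cost (Vr x)) s = straight (cexp t (Vr x)) s"
    using exec_straight[OF Vr.prems(1)] by (simp add: numeral_2_eq_2 del: funpow.simps)
  have x: "regs s (2 * x) = wd (v x)" using Vr.prems(3) by (simp add: rel_def)
  have "2 * x \<noteq> Suc (2 * t)" by presburger
  then show ?case unfolding eq
    by (auto simp: straight_def x wd_less take_bit_nat_eq_self_iff)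
next
  case (Op f a b)
  obtain s1 where s1: "(step w P ^^ cost a) s = s1" "pc s1 = pc s + cost a" "mem s1 = mem s"
    "regs s1 (2*t+1) = wd (ev a v m)" "\<And>r. r < 2*t+1 \<or> even r \<Longrightarrow> regs s1 r = regs s r"
    using Op.IH(1)[of s t] Op.prems by auto
  have rel1: "rel v m s1" using Op.prems(3) s1 Op.prems(2) by (auto simp: rel_def)
  obtain s2 where s2: "(step w P ^^ cost b) s1 = s2" "pc s2 = pc s1 + cost b" "mem s2 = mem s1"
    "regs s2 (2*t+3) = wd (ev b v m)" "\<And>r. r < 2*t+3 \<or> even r \<Longrightarrow> regs s2 r = regs s1 r"
    using Op.IH(2)[of s1 "t+1"] Op.prems rel1 s1(2) by (auto simp: eval_nat_numeral)
  have st: "step w P s2 = exec_instr w (Bin f (2*t+1) (2*t+1) (2*t+3)) s2"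
    using Op.prems(1) s1(2) s2(2) by (intro step_at) (auto simp: add.assoc)
  have r2: "regs s2 (2*t+1) = wd (ev a v m)" using s2(5) s1(4) by simp
  have e: "eval_binop w f (regs s2 (2*t+1)) (regs s2 (2*t+3)) = wd (ev (Op f a b) v m)"
    using Op.prems(4) unfolding r2 s2(4) by (simp add: eval_binop_wd)
  have "(step w P ^^ cost (Op f a b)) s = exec_instr w (Bin f (2*t+1) (2*t+1) (2*t+3)) s2"
    using st by (simp add: steps_add s1(1) s2(1))
  then show ?case unfolding exec_instr.simps e
    using s1(2,3) s2(2,3) s2(5) s1(5) by auto
next
  case (Rd k a)
  obtain s1 where s1: "(step w P ^^ cost a) s = s1" "pc s1 = pc s + cost a" "mem s1 = mem s"
    "regs s1 (2*t+1) = wd (ev a v m)" "\<And>r. r < 2*t+1 \<or> even r \<Longrightarrow> regs s1 r = regs s r"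
    using Rd.IH(1)[of s t] Rd.prems by auto
  have rel1: "rel v m s1" using Rd.prems(2,3) s1 by (auto simp: rel_def)
  let ?i = "nat (ev a v m)"
  have i: "?i < B" using Rd.prems(4) by auto
  have evB: "0 \<le> ev a v m" "ev a v m < int B" using Rd.prems(4) by auto
  have "wd (ev a v m) = ?i" by (rule wd_small[OF evB(1) less_trans[OF evB(2) int_B_less]])
  with s1 have r1: "regs s1 (2*t+1) = ?i" by simp
  have "\<exists>s'. (step w P ^^ length (addr_code t k)) s1 = s' \<and>
    pc s' = pc s1 + length (addr_code t k) \<and> mem s' = mem s1 \<and> regs s' (2*t+1) = addr k ?i \<and>
    (\<forall>r. r < 2*t+1 \<or> even r \<longrightarrow> regs s' r = regs s1 r)"
    using Rd.prems rel1 s1(2) r1 i by (intro addr_code_steps) (auto simp: rel_def)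
  then obtain s2 where s2: "(step w P ^^ acost k) s1 = s2"
    "pc s2 = pc s1 + acost k" "mem s2 = mem s1" "regs s2 (2*t+1) = addr k ?i"
    "\<And>r. r < 2*t+1 \<or> even r \<Longrightarrow> regs s2 r = regs s1 r" by auto
  have st: "step w P s2 = exec_instr w (Load (2*t+1) (2*t+1)) s2"
    using Rd.prems(1) s1(2) s2(2) by (intro step_at) (auto simp: add.assoc)
  have m2: "mem s2 (addr k ?i) = wd (m k ?i)"
    using rel1 Rd.prems(4) i unfolding rel_def s2(3) by auto
  have "(step w P ^^ cost (Rd k a)) s = exec_instr w (Load (2*t+1) (2*t+1)) s2"
    using st by (simp add: steps_add s1(1) s2(1))
  then show ?case unfolding exec_instr.simps s2(4) m2
    using s1(2,3) s2(2,3) s2(5) s1(5) by auto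
qed

lemma rel_cong: "rel v m s \<Longrightarrow> mem s' = mem s \<Longrightarrow>
    (\<And>r. r < 3 \<or> even r \<Longrightarrow> regs s' r = regs s r) \<Longrightarrow> rel v m s'"
  by (simp add: rel_def)

lemma two_exp_steps:
  assumes "code_at P (pc s) (cexp 1 a @ cexp 2 b)" "rel v m s" "ok a v m" "ok b v m"
  shows "\<exists>s'. (step w P ^^ (cost a + cost b)) s = s' \<and> pc s' = pc s + cost a + cost b \<and>
    rel v m s' \<and> regs s' 3 = wd (ev a v m) \<and> regs s' 5 = wd (ev b v m)"
proof -
  obtain s1 where s1: "(step w P ^^ cost a) s = s1" "pc s1 = pc s + cost a" "mem s1 = mem s"
    "regs s1 3 = wd (ev a v m)" "\<And>r. r < 3 \<or> even r \<Longrightarrow> regs s1 r = regs s r"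
    using cexp_steps[of P s 1 a v m] assms by auto
  have rel1: "rel v m s1" using rel_cong assms s1 by blast
  obtain s2 where s2: "(step w P ^^ cost b) s1 = s2" "pc s2 = pc s1 + cost b" "mem s2 = mem s1"
    "regs s2 5 = wd (ev b v m)" "\<And>r. r < 5 \<or> even r \<Longrightarrow> regs s2 r = regs s1 r"
    using cexp_steps[of P s1 2 b v m] assms rel1 s1(2) by auto
  have rel2: "rel v m s2" using rel_cong[OF rel1 s2(3)] s2(5) by force
  show ?thesis using s1 s2 rel2 by (auto simp: steps_add)
qed

lemma wd_inj: "okw a \<Longrightarrow> okw b \<Longrightarrow> wd a = wd b \<longleftrightarrow> a = b"
  and wd_mono: "okw a \<Longrightarrow> okw b \<Longrightarrow> wd a < wd b \<longleftrightarrow> a < b"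
  by (auto simp: okw_def wd_small)

lemma cbexp_steps:
  assumes "code_at P (pc s) (cbexp b l)" "rel v m s" "okb b v m"
  shows "\<exists>s'. (step w P ^^ bcost b) s = s' \<and> rel v m s' \<and>
    pc s' = (if bv b v m then l else pc s + bcost b)"
proof (cases b)
  case (Less x y)
  obtain s1 where s1: "(step w P ^^ (cost x + cost y)) s = s1" "pc s1 = pc s + cost x + cost y"
    "rel v m s1" "regs s1 3 = wd (ev x v m)" "regs s1 5 = wd (ev y v m)"
    using two_exp_steps[of P s x y v m] assms Less by auto
  have st: "step w P s1 = exec_instr w (JumpLess 3 5 l) s1"
    using assms(1) s1(2) Less by (intro step_at) (auto simp: add.assoc)
  have bc: "bcost b = (cost x + cost y) + 1" using Less by simp
  have "(step w P ^^ bcost b) s = exec_instr w (JumpLess 3 5 l) s1"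
    unfolding bc steps_add[of "cost x + cost y"] s1(1) using st by simp
  moreover have "rel v m (exec_instr w (JumpLess 3 5 l) s1)" by (rule rel_cong[OF s1(3)]) auto
  ultimately show ?thesis using s1(2,4,5) assms(3) Less bc by (simp add: wd_mono)
next
  case (Eq x y)
  obtain s1 where s1: "(step w P ^^ (cost x + cost y)) s = s1" "pc s1 = pc s + cost x + cost y"
    "rel v m s1" "regs s1 3 = wd (ev x v m)" "regs s1 5 = wd (ev y v m)"
    using two_exp_steps[of P s x y v m] assms Eq by auto
  have st: "step w P s1 = exec_instr w (JumpEq 3 5 l) s1"
    using assms(1) s1(2) Eq by (intro step_at) (auto simp: add.assoc)
  have bc: "bcost b = (cost x + cost y) + 1" using Eq by simp
  have "(step w P ^^ bcost b) s = exec_instr w (JumpEq 3 5 l) s1"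
    unfolding bc steps_add[of "cost x + cost y"] s1(1) using st by simp
  moreover have "rel v m (exec_instr w (JumpEq 3 5 l) s1)" by (rule rel_cong[OF s1(3)]) auto
  ultimately show ?thesis using s1(2,4,5) assms(3) Eq bc by (simp add: wd_inj)
qed

text \<open>Array \<open>0\<close> lies below \<open>B\<close> and all others above it; there the
  offset from \<open>B\<close> determines the array by its residue modulo \<open>32\<close>.\<close>

lemma addr_inj:
  assumes "i < B" "j < B" "k < 32" "l < 32"
  shows "addr k i = addr l j \<longleftrightarrow> k = l \<and> i = j"
proof -
  have "32 * i + k = 32 * j + l \<longleftrightarrow> k = l \<and> i = j" using assms(3,4) by presburger
  then show ?thesis unfolding addr_def using assms(1,2) by auto
qed

lemma assign_steps:
  assumes "code_at P (pc s) (ccom p (x ::= a))" "rel v m s" "ok a v m"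
  shows "\<exists>s'. (step w P ^^ csize (x ::= a)) s = s' \<and> pc s' = pc s + csize (x ::= a) \<and>
    rel (v(x := ev a v m)) m s'"
proof -
  obtain s1 where s1: "(step w P ^^ cost a) s = s1" "pc s1 = pc s + cost a" "mem s1 = mem s"
    "regs s1 3 = wd (ev a v m)" "\<And>r. r < 3 \<or> even r \<Longrightarrow> regs s1 r = regs s r"
    using cexp_steps[of P s 1 a v m] assms by auto
  have ca: "code_at P (pc s1) [Const (2*x) 0, Bin OpAdd (2*x) (2*x) 3]"
    using assms(1) s1(2) by auto
  have x3: "2 * x \<noteq> 3" by presburger
  have eq: "(step w P ^^ csize (x ::= a)) s = straight [Const (2*x) 0, Bin OpAdd (2*x) (2*x) 3] s1"
    using exec_straight[OF ca] s1(1) steps_add[of "cost a" 2 P s] by (simp add: numeral_2_eq_2 del: funpow.simps)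
  show ?thesis unfolding eq using s1 assms(2) x3
    by (auto simp: straight_def rel_def wd_less take_bit_nat_eq_self_iff)
qed

lemma wr_steps:
  assumes "code_at P (pc s) (ccom p (Wr k a b))" "rel v m s" "ok a v m" "ok b v m"
    "k < 32" "0 \<le> ev a v m" "ev a v m < int B"
  shows "\<exists>s'. (step w P ^^ csize (Wr k a b)) s = s' \<and> pc s' = pc s + csize (Wr k a b) \<and>
    rel v (m(k := (m k)(nat (ev a v m) := ev b v m))) s'"
proof -
  obtain s1 where s1: "(step w P ^^ cost a) s = s1" "pc s1 = pc s + cost a" "mem s1 = mem s"
    "regs s1 3 = wd (ev a v m)" "\<And>r. r < 3 \<or> even r \<Longrightarrow> regs s1 r = regs s r"
    using cexp_steps[of P s 1 a v m] assms by auto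
  have rel1: "rel v m s1" using rel_cong assms s1 by blast
  let ?i = "nat (ev a v m)"
  have i: "?i < B" using assms by auto
  have evB: "0 \<le> ev a v m" "ev a v m < int B" using assms by auto
  have "wd (ev a v m) = ?i" by (rule wd_small[OF evB(1) less_trans[OF evB(2) int_B_less]])
  with s1 have r1: "regs s1 3 = ?i" by simp
  have B1: "regs s1 1 = B" using rel1 by (simp add: rel_def)
  have ca: "code_at P (pc s1) (addr_code 1 k)" using assms(1) s1(2) by simp
  obtain s2 where s2: "(step w P ^^ acost k) s1 = s2"
    "pc s2 = pc s1 + acost k" "mem s2 = mem s1" "regs s2 3 = addr k ?i"
    "\<And>r. r < 3 \<or> even r \<Longrightarrow> regs s2 r = regs s1 r"
    using addr_code_steps[OF ca _ B1 _ i assms(5)] r1 by auto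
  have rel2: "rel v m s2" using rel_cong rel1 s2 by blast
  obtain s3 where s3: "(step w P ^^ cost b) s2 = s3" "pc s3 = pc s2 + cost b" "mem s3 = mem s2"
    "regs s3 5 = wd (ev b v m)" "\<And>r. r < 5 \<or> even r \<Longrightarrow> regs s3 r = regs s2 r"
    using cexp_steps[of P s2 2 b v m] assms rel2 s1(2) s2(2) by (auto simp: add.assoc)
  have rel3: "rel v m s3" using rel_cong[OF rel2 s3(3)] s3(5) by force
  have st: "step w P s3 = exec_instr w (Store 3 5) s3"
    using assms(1) s1(2) s2(2) s3(2) by (intro step_at) (auto simp: add.assoc)
  have r3: "regs s3 3 = addr k ?i" using s3(5) s2(4) by simp
  have cs: "csize (Wr k a b) = cost a + acost k + cost b + 1" by simp
  have "(step w P ^^ csize (Wr k a b)) s = exec_instr w (Store 3 5) s3"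
    unfolding cs using st by (simp add: steps_add s1(1) s2(1) s3(1))
  moreover have "rel v (m(k := (m k)(?i := ev b v m))) (exec_instr w (Store 3 5) s3)"
    using rel3 i assms(5) by (simp add: rel_def r3 s3(4) addr_inj)
  ultimately show ?thesis using s1(2) s2(2) s3(2) by simp
qed

lemma jump_step:
  "code_at P (pc s) [Jump l] \<Longrightarrow> rel v m s \<Longrightarrow> \<exists>s'. step w P s = s' \<and> pc s' = l \<and> rel v m s'"
  by (simp add: step_at rel_def)

definition reach :: "instr list \<Rightarrow> config \<Rightarrow> nat \<Rightarrow> nat \<Rightarrow> vars \<Rightarrow> arrs \<Rightarrow> bool" where
  "reach P s t p v m \<longleftrightarrow> (\<exists>k s'. k \<le> t \<and> (step w P ^^ k) s = s' \<and> pc s' = p \<and> rel v m s')"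

lemma reach_mono: "reach P s t p v m \<Longrightarrow> t \<le> t' \<Longrightarrow> reach P s t' p v m"
  unfolding reach_def by (blast intro: order_trans)

lemma reach_trans:
  assumes "reach P s t p v m" "\<And>s'. pc s' = p \<Longrightarrow> rel v m s' \<Longrightarrow> reach P s' t' p' v' m'"
  shows "reach P s (t + t') p' v' m'"
proof -
  obtain k s1 where 1: "k \<le> t" "(step w P ^^ k) s = s1" "pc s1 = p" "rel v m s1"
    using assms(1) by (auto simp: reach_def)
  obtain k' s2 where 2: "k' \<le> t'" "(step w P ^^ k') s1 = s2" "pc s2 = p'" "rel v' m' s2"
    using assms(2)[OF 1(3,4)] by (auto simp: reach_def)
  show ?thesis unfolding reach_def
    using 1 2 by (intro exI[of _ "k + k'"] exI[of _ s2]) (auto simp: steps_add)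
qed

lemma reach_cbexp:
  assumes "code_at P p (cbexp b l)" "rel v m s" "okb b v m" "pc s = p"
  shows "reach P s (bcost b) (if bv b v m then l else p + bcost b) v m"
  using cbexp_steps[of P s b l v m] assms unfolding reach_def by blast

lemma reach_jump:
  assumes "code_at P p [Jump l]" "rel v m s" "pc s = p"
  shows "reach P s 1 l v m"
  using jump_step[of P s l v m] assms unfolding reach_def
  by (intro exI[of _ 1]) auto

theorem ccom_correct:
  "big c v m t v' m' \<Longrightarrow> code_at P p (ccom p c) \<Longrightarrow> rel v m s \<Longrightarrow> pc s = p \<Longrightarrow>
   reach P s t (p + csize c) v' m'"
proof (induction c v m t v' m' arbitrary: p s rule: big.induct)
  case (Skip v m)
  then show ?case unfolding reach_def by (intro exI[of _ 0]) auto
next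
  case (Assign a v m x)
  then show ?case using assign_steps[of P s p x a v m] unfolding reach_def
    by (intro exI[of _ "csize (x ::= a)"]) auto
next
  case (Wr k a v m b)
  then show ?case using wr_steps[of P s p k a b v m] unfolding reach_def
    by (intro exI[of _ "csize (Wr k a b)"]) auto
next
  case (Seq c v m t v' m' d t' v'' m'')
  show ?case
  proof (rule reach_trans)
    show "reach P s t (p + csize c) v' m'" using Seq.IH(1) Seq.prems by simp
    fix s' assume "pc s' = p + csize c" "rel v' m' s'"
    then show "reach P s' t' (p + csize (c ;; d)) v'' m''"
      using Seq.IH(2)[of "p + csize c" s'] Seq.prems by (simp add: add.assoc)
  qed
next
  case (IfT b v m c t v' m' d)
  let ?r = "p + bcost b + csize d + 1"
  show ?case
  proof (rule reach_trans)
    show "reach P s (bcost b) ?r v m"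
      using reach_cbexp[of P p b ?r v m s] IfT by (auto simp: Let_def)
    fix s' assume "pc s' = ?r" "rel v m s'"
    then show "reach P s' t (p + csize (If b c d)) v' m'"
      using IfT.IH[of ?r s'] IfT.prems by (auto simp: Let_def ac_simps)
  qed
next
  case (IfF b v m d t v' m' c)
  let ?q = "p + bcost b" and ?r = "p + bcost b + csize d + 1"
  have 1: "reach P s (bcost b) ?q v m"
    using reach_cbexp[of P p b ?r v m s] IfF by (auto simp: Let_def)
  have 2: "reach P s (bcost b + t) (?q + csize d) v' m'"
    by (rule reach_trans[OF 1]) (use IfF in \<open>auto simp: Let_def\<close>)
  show ?case
    by (rule reach_trans[OF 2], rule reach_jump) (use IfF in \<open>auto simp: Let_def ac_simps\<close>)
next
  case (WhileF b v m c)
  let ?q = "p + bcost b + 1"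
  have 1: "reach P s (bcost b) (p + bcost b) v m"
    using reach_cbexp[of P p b ?q v m s] WhileF by (auto simp: Let_def)
  show ?case
    by (rule reach_trans[OF 1], rule reach_jump) (use WhileF in \<open>auto simp: Let_def ac_simps\<close>)
next
  case (WhileT b v m c t v' m' t' v'' m'')
  let ?q = "p + bcost b + 1"
  have 1: "reach P s (bcost b) ?q v m"
    using reach_cbexp[of P p b ?q v m s] WhileT by (auto simp: Let_def)
  have 2: "reach P s (bcost b + t) (?q + csize c) v' m'"
  proof (rule reach_trans[OF 1])
    fix s' assume "pc s' = ?q" "rel v m s'"
    then show "reach P s' t (?q + csize c) v' m'"
      using WhileT.IH(1)[of ?q s'] WhileT.prems by (simp add: Let_def)
  qed
  have 3: "reach P s (bcost b + t + 1) p v' m'"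
    by (rule reach_trans[OF 2], rule reach_jump) (use WhileT in \<open>auto simp: Let_def ac_simps\<close>)
  show ?case
    by (rule reach_trans[OF 3]) (use WhileT in auto)
next
  case (Weak c v m t v' m' t')
  then show ?case using reach_mono by blast
qed

end

section \<open>Running-time rules\<close>

definition same :: "nat set \<Rightarrow> (nat \<Rightarrow> 'a) \<Rightarrow> (nat \<Rightarrow> 'a) \<Rightarrow> bool" where
  "same X f g \<longleftrightarrow> (\<forall>x. x \<notin> X \<longrightarrow> f x = g x)"

lemma sameD: "same X f g \<Longrightarrow> x \<notin> X \<Longrightarrow> f x = g x"
  by (simp add: same_def)

lemma same_refl [simp]: "same X f f"
  by (simp add: same_def)

text \<open>Only meaningful for loop-free commands, as is \<open>wpf\<close> below.\<close>

fun cst :: "com \<Rightarrow> nat" where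
  "cst Skip = 0"
| "cst (x ::= a) = cost a + 2"
| "cst (Wr k a b) = cost a + acost k + cost b + 1"
| "cst (c ;; d) = cst c + cst d"
| "cst (If b c d) = bcost b + max (cst c) (cst d) + 1"
| "cst (While b c) = 0"

context machine
begin

lemma big_same: "big c v m t v' m' \<Longrightarrow> same (wv c) v' v \<and> same (wa c) m' m"
  by (induction rule: big.induct) (auto simp: same_def)

text \<open>One execution within the bound is enough: \<open>ccom_correct\<close> carries it over to
  the machine, whose steps are deterministic.\<close>

definition runs :: "com \<Rightarrow> vars \<Rightarrow> arrs \<Rightarrow> nat \<Rightarrow> (vars \<Rightarrow> arrs \<Rightarrow> bool) \<Rightarrow> bool" where
  "runs c v m t Q \<longleftrightarrow> (\<exists>v' m'. big c v m t v' m' \<and> Q v' m')"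

text \<open>Frame facts come for free when a postcondition is changed, so the lemmas about program
  parts mention only what those parts alter.\<close>

lemma runs_conseq:
  assumes "runs c v m t Q" "t \<le> t'"
    "\<And>v' m'. same (wv c) v' v \<Longrightarrow> same (wa c) m' m \<Longrightarrow> Q v' m' \<Longrightarrow> Q' v' m'"
  shows "runs c v m t' Q'"
proof -
  obtain v' m' where b: "big c v m t v' m'" "Q v' m'" using assms(1) by (auto simp: runs_def)
  then have "big c v m t' v' m'" "same (wv c) v' v" "same (wa c) m' m"
    using big_same[OF b(1)] big.Weak[OF b(1) assms(2)] by auto
  then show ?thesis using assms(3) b(2) unfolding runs_def by blast
qed

lemma runs_seq:
  assumes "runs c v m t (\<lambda>v' m'. runs d v' m' t' Q)"
  shows "runs (c ;; d) v m (t + t') Q"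
  using assms unfolding runs_def by (blast intro: big.Seq)

lemma runs_seqI:
  assumes "runs c v m t R" "t + t' \<le> u"
    "\<And>v' m'. same (wv c) v' v \<Longrightarrow> same (wa c) m' m \<Longrightarrow> R v' m' \<Longrightarrow> runs d v' m' t' Q"
  shows "runs (c ;; d) v m u Q"
  by (rule runs_conseq[OF runs_seq[OF runs_conseq[OF assms(1) order_refl assms(3)]] assms(2)])

fun wpf :: "com \<Rightarrow> (vars \<Rightarrow> arrs \<Rightarrow> bool) \<Rightarrow> vars \<Rightarrow> arrs \<Rightarrow> bool" where
  "wpf Skip Q v m = Q v m"
| "wpf (x ::= a) Q v m = (ok a v m \<and> Q (v(x := ev a v m)) m)"
| "wpf (Wr k a b) Q v m = (k < 32 \<and> ok a v m \<and> 0 \<le> ev a v m \<and> ev a v m < int B \<and> ok b v m \<and>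
     Q v (m(k := (m k)(nat (ev a v m) := ev b v m))))"
| "wpf (c ;; d) Q v m = wpf c (wpf d Q) v m"
| "wpf (If b c d) Q v m = (okb b v m \<and> (if bv b v m then wpf c Q v m else wpf d Q v m))"
| "wpf (While b c) Q v m = False"

lemma wpf_runs: "wpf c Q v m \<Longrightarrow> runs c v m (cst c) Q"
proof (induction c arbitrary: Q v m)
  case Skip then show ?case using big.Skip by (auto simp: runs_def)
next
  case (Assign x a) then show ?case using big.Assign[of a v m x] by (auto simp: runs_def)
next
  case (Wr k a b) then show ?case using big.Wr[of k a v m b] by (auto simp: runs_def)
next
  case (Seq c d)
  have "runs c v m (cst c) (wpf d Q)" using Seq.prems by (intro Seq.IH) simp
  then have "runs c v m (cst c) (\<lambda>v' m'. runs d v' m' (cst d) Q)"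
    by (rule runs_conseq) (auto intro: Seq.IH)
  then show ?case by (simp add: runs_seq)
next
  case (If b c d)
  show ?case
  proof (cases "bv b v m")
    case True
    then have "runs c v m (cst c) Q" using If by simp
    then obtain v' m' where b: "big c v m (cst c) v' m'" "Q v' m'" by (auto simp: runs_def)
    have "big (If b c d) v m (bcost b + cst c) v' m'"
      using If.prems True b by (intro big.IfT) auto
    then have "big (If b c d) v m (cst (If b c d)) v' m'" by (rule big.Weak) simp
    then show ?thesis using b unfolding runs_def by blast
  next
    case False
    then have "runs d v m (cst d) Q" using If by simp
    then obtain v' m' where b: "big d v m (cst d) v' m'" "Q v' m'" by (auto simp: runs_def)
    have "big (If b c d) v m (bcost b + cst d + 1) v' m'"
      using If.prems False b by (intro big.IfF) auto
    then have "big (If b c d) v m (cst (If b c d)) v' m'" by (rule big.Weak) simp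
    then show ?thesis using b unfolding runs_def by blast
  qed
next
  case (While b c) then show ?case by simp
qed

text \<open>The potential \<open>\<Phi>\<close> pays for the running time; since each iteration costs at least one step,
  it also serves as the termination measure.\<close>

lemma runs_while:
  fixes I :: "'g \<Rightarrow> vars \<Rightarrow> arrs \<Rightarrow> bool"
  assumes init: "I g v m"
    and okb: "\<And>g v' m'. I g v' m' \<Longrightarrow> same (wv c) v' v \<Longrightarrow> same (wa c) m' m \<Longrightarrow> okb b v' m'"
    and step: "\<And>g v' m'. I g v' m' \<Longrightarrow> same (wv c) v' v \<Longrightarrow> same (wa c) m' m \<Longrightarrow> bv b v' m' \<Longrightarrow>
      \<exists>t. runs c v' m' t (\<lambda>v'' m''. \<exists>g'. I g' v'' m'' \<and> \<Phi> g' + t + bcost b + 1 \<le> \<Phi> g)"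
  shows "runs (While b c) v m (\<Phi> g + bcost b + 1) (\<lambda>v' m'. \<exists>g'. I g' v' m' \<and> \<not> bv b v' m')"
proof -
  have "\<exists>v'' m''. big (While b c) v' m' (\<Phi> g + bcost b + 1) v'' m'' \<and> (\<exists>g'. I g' v'' m'' \<and> \<not> bv b v'' m'')"
    if "I g v' m'" "same (wv c) v' v" "same (wa c) m' m" for g v' m'
    using that
  proof (induction "\<Phi> g" arbitrary: g v' m' rule: less_induct)
    case less
    show ?case
    proof (cases "bv b v' m'")
      case False
      have "big (While b c) v' m' (bcost b + 1) v' m'"
        using okb[OF less.prems] False by (rule big.WhileF)
      then have "big (While b c) v' m' (\<Phi> g + bcost b + 1) v' m'" by (rule big.Weak) simp
      then show ?thesis using less.prems(1) False by blast
    next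
      case True
      obtain t v1 m1 g1 where 1: "big c v' m' t v1 m1" "I g1 v1 m1" "\<Phi> g1 + t + bcost b + 1 \<le> \<Phi> g"
        using step[OF less.prems True] unfolding runs_def by blast
      have s: "same (wv c) v1 v" "same (wa c) m1 m"
        using big_same[OF 1(1)] less.prems by (auto simp: same_def)
      obtain v2 m2 g2 where 2: "big (While b c) v1 m1 (\<Phi> g1 + bcost b + 1) v2 m2" "I g2 v2 m2"
        "\<not> bv b v2 m2"
        using less.hyps[OF _ 1(2) s] 1(3) by auto
      have "big (While b c) v' m' (bcost b + t + 1 + (\<Phi> g1 + bcost b + 1)) v2 m2"
        by (rule big.WhileT[OF okb[OF less.prems] True 1(1) 2(1)])
      then have "big (While b c) v' m' (\<Phi> g + bcost b + 1) v2 m2"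
        by (rule big.Weak) (use 1(3) in simp)
      then show ?thesis using 2 by blast
    qed
  qed
  from this[OF init same_refl same_refl] show ?thesis unfolding runs_def .
qed

text \<open>Instance of \<open>runs_while\<close> with the iteration number as ghost state and the
  cost of the remaining iterations as potential.\<close>

lemma runs_for:
  assumes init: "I 0 v m"
    and step: "\<And>i v' m'. I i v' m' \<Longrightarrow> i < k \<Longrightarrow> same (wv c) v' v \<Longrightarrow> same (wa c) m' m \<Longrightarrow>
      okb b v' m' \<and> bv b v' m' \<and> runs c v' m' t (I (Suc i))"
    and exit: "\<And>v' m'. I k v' m' \<Longrightarrow> same (wv c) v' v \<Longrightarrow> same (wa c) m' m \<Longrightarrow>
      okb b v' m' \<and> \<not> bv b v' m'"
  shows "runs (While b c) v m (k * (t + bcost b + 1) + bcost b + 1) (I k)"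
proof -
  have "runs (While b c) v m ((k - 0) * (t + bcost b + 1) + bcost b + 1)
     (\<lambda>v' m'. \<exists>g'. (g' \<le> k \<and> I g' v' m') \<and> \<not> bv b v' m')"
  proof (rule runs_while[where \<Phi> = "\<lambda>i. (k - i) * (t + bcost b + 1)" and c = c
        and I = "\<lambda>i v' m'. i \<le> k \<and> I i v' m'" and g = 0])
    show "0 \<le> k \<and> I 0 v m" using init by simp
  next
    fix g v' m' assume *: "g \<le> k \<and> I g v' m'" "same (wv c) v' v" "same (wa c) m' m"
    then show "okb b v' m'" using step[of g v' m'] exit[of v' m'] by (cases "g = k") auto
    assume "bv b v' m'"
    then have gk: "g < k" using * exit[of v' m'] by (cases "g = k") auto
    have "(k - g) * (t + bcost b + 1) = (k - Suc g) * (t + bcost b + 1) + (t + bcost b + 1)"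
      using gk by (simp add: Suc_diff_Suc[symmetric])
    moreover have "runs c v' m' t (I (Suc g))" using step[of g] * gk by blast
    ultimately show "\<exists>ta. runs c v' m' ta (\<lambda>v'' m''. \<exists>g'. (g' \<le> k \<and> I g' v'' m'') \<and>
      (k - g') * (t + bcost b + 1) + ta + bcost b + 1 \<le> (k - g) * (t + bcost b + 1))"
      using gk by (intro exI[of _ t] , elim runs_conseq) (auto intro!: exI[of _ "Suc g"])
  qed
  then show ?thesis
  proof (rule runs_conseq)
    fix v' m' assume s: "same (wv (While b c)) v' v" "same (wa (While b c)) m' m"
    assume "\<exists>g'. (g' \<le> k \<and> I g' v' m') \<and> \<not> bv b v' m'"
    then obtain g where g: "g \<le> k" "I g v' m'" "\<not> bv b v' m'" by blast
    then have "g = k" using step[of g v' m'] s by fastforce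
    then show "I k v' m'" using g by simp
  qed simp
qed

end

section \<open>Squaring polynomials on the machine\<close>

abbreviation eadd (infixl "[+]" 65) where "a [+] b \<equiv> Op OpAdd a b"
abbreviation esub (infixl "[-]" 65) where "a [-] b \<equiv> Op OpSub a b"
abbreviation emul (infixl "[*]" 70) where "a [*] b \<equiv> Op OpMul a b"
abbreviation ediv (infixl "['/]" 70) where "a [/] b \<equiv> Op OpDiv a b"
abbreviation emod (infixl "[%]" 70) where "a [%] b \<equiv> Op OpMod a b"

text \<open>Names of variables begin with \<open>v\<close>, names of arrays with \<open>a\<close>. The arrays \<open>aTR\<close>, \<open>aTI\<close> hold the real
  and imaginary parts of the roots of unity of order \<open>vN0\<close> in fixed-point format with scale \<open>vS\<close>
  (whose square and cube are \<open>vS2\<close>, \<open>vS3\<close>); \<open>aXR\<close>, \<open>aXI\<close> hold the vector of length \<open>vN\<close> to be transformed and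
  \<open>aYR\<close>, \<open>aYI\<close> the output of a stage. The counts are collected in \<open>aW\<close>, with sign \<open>vg\<close>.\<close>

abbreviation (input) "vn \<equiv> 0 :: nat"
abbreviation (input) "vN0 \<equiv> 1 :: nat"
abbreviation (input) "vS \<equiv> 2 :: nat"
abbreviation (input) "vS2 \<equiv> 3 :: nat"
abbreviation (input) "vS3 \<equiv> 4 :: nat"
abbreviation (input) "vN \<equiv> 5 :: nat"
abbreviation (input) "vi \<equiv> 6 :: nat"
abbreviation (input) "vj \<equiv> 7 :: nat"
abbreviation (input) "vh \<equiv> 8 :: nat"
abbreviation (input) "vstr \<equiv> 9 :: nat"
abbreviation (input) "vblk \<equiv> 10 :: nat"
abbreviation (input) "va \<equiv> 11 :: nat"
abbreviation (input) "vb \<equiv> 12 :: nat"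
abbreviation (input) "vc \<equiv> 13 :: nat"
abbreviation (input) "vd \<equiv> 14 :: nat"
abbreviation (input) "vg \<equiv> 15 :: nat"

abbreviation (input) "aTR \<equiv> 3 :: nat"
abbreviation (input) "aTI \<equiv> 4 :: nat"
abbreviation (input) "aXR \<equiv> 5 :: nat"
abbreviation (input) "aXI \<equiv> 6 :: nat"
abbreviation (input) "aYR \<equiv> 7 :: nat"
abbreviation (input) "aYI \<equiv> 8 :: nat"
abbreviation (input) "aW \<equiv> 9 :: nat"

text \<open>Division by the scale rounds towards minus infinity also for negative \<open>e\<close>: adding the
  multiple \<open>S\<^sup>3\<close> of \<open>S\<close> makes the dividend nonnegative.\<close>

definition rescale :: "aexp \<Rightarrow> aexp" where
  "rescale e = (e [+] Vr vS3) [/] Vr vS [-] Vr vS2"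

definition butterfly :: com where
  "butterfly =
    (vj ::= Vr vi [-] (Vr vi [%] Vr vblk);;
     va ::= Rd aXR (Vr vi) [-] Rd aXR (Vr vi [+] Vr vh);;
     vb ::= Rd aXI (Vr vi) [-] Rd aXI (Vr vi [+] Vr vh);;
     vc ::= Rd aTR (Vr vj [*] Vr vstr);;
     vd ::= Rd aTI (Vr vj [*] Vr vstr);;
     Wr aYR (Vr vi [+] Vr vj) (Rd aXR (Vr vi) [+] Rd aXR (Vr vi [+] Vr vh));;
     Wr aYI (Vr vi [+] Vr vj) (Rd aXI (Vr vi) [+] Rd aXI (Vr vi [+] Vr vh));;
     Wr aYR (Vr vi [+] Vr vj [+] Vr vblk) (rescale (Vr va [*] Vr vc [-] Vr vb [*] Vr vd));;
     Wr aYI (Vr vi [+] Vr vj [+] Vr vblk) (rescale (Vr va [*] Vr vd [+] Vr vb [*] Vr vc));;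
     vi ::= Vr vi [+] Cn 1)"

definition copy_back :: com where
  "copy_back =
    (Wr aXR (Vr vi) (Rd aYR (Vr vi));; Wr aXI (Vr vi) (Rd aYI (Vr vi));; vi ::= Vr vi [+] Cn 1)"

definition fft_stage :: com where
  "fft_stage =
    (((vi ::= Cn 0;; While (Less (Vr vi) (Vr vh)) butterfly);;
      (vi ::= Cn 0;; While (Less (Vr vi) (Vr vN)) copy_back));;
     vblk ::= Vr vblk [+] Vr vblk)"

definition fft :: com where
  "fft =
    ((vh ::= Vr vN [/] Cn 2;; vstr ::= Vr vN0 [/] Vr vN;; vblk ::= Cn 1);;
     While (Less (Vr vblk) (Vr vN)) fft_stage)"

text \<open>The imaginary part is kept as a sum of two products, so that
  \<open>dec_mult_error\<close> fits with both factors equal.\<close>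

definition square :: com where
  "square =
    (va ::= Rd aXR (Vr vi);; vb ::= Rd aXI (Vr vi);;
     Wr aXR (Vr vi) (rescale (Vr va [*] Vr va [-] Vr vb [*] Vr vb));;
     Wr aXI (Vr vi) (rescale (Vr va [*] Vr vb [+] Vr vb [*] Vr va));;
     vi ::= Vr vi [+] Cn 1)"

text \<open>The index is negated because both transforms evaluate at the same roots of unity. After \<open>fft\<close>, \<open>vh\<close>
  is half the length \<open>vN\<close>, so that adding \<open>vh * vS\<close> rounds to the nearest integer.\<close>

definition accumulate :: com where
  "accumulate =
    (vj ::= (Vr vN [-] Vr vi) [%] Vr vN;;
     Wr aW (Vr vi) (Rd aW (Vr vi) [+]
       Vr vg [*] ((Rd aXR (Vr vj) [+] Vr vh [*] Vr vS) [/] (Vr vS [*] Vr vN)));;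
     vi ::= Vr vi [+] Cn 1)"

definition convolve :: com where
  "convolve =
    (fft;; (vi ::= Cn 0;; While (Less (Vr vi) (Vr vN)) square);;
     fft;; (vi ::= Cn 0;; While (Less (Vr vi) (Vr vN)) accumulate))"

lemma wv_butterfly: "wv butterfly = {6, 7, 11, 12, 13, 14}"
  and wa_butterfly: "wa butterfly = {7, 8}"
  and wv_copy_back: "wv copy_back = {6}" and wa_copy_back: "wa copy_back = {5, 6}"
  and wv_square: "wv square = {6, 11, 12}" and wa_square: "wa square = {5, 6}"
  and wv_accumulate: "wv accumulate = {6, 7}" and wa_accumulate: "wa accumulate = {9}"
  by (auto simp: butterfly_def copy_back_def square_def accumulate_def)

lemma wv_fft_stage: "wv fft_stage = {6, 7, 10, 11, 12, 13, 14}"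
  and wa_fft_stage: "wa fft_stage = {5, 6, 7, 8}"
  by (auto simp: fft_stage_def wv_butterfly wa_butterfly wv_copy_back wa_copy_back)

lemma wv_fft: "wv fft = {6, 7, 8, 9, 10, 11, 12, 13, 14}" and wa_fft: "wa fft = {5, 6, 7, 8}"
  by (auto simp: fft_def wv_fft_stage wa_fft_stage)

lemma wv_convolve: "wv convolve = {6, 7, 8, 9, 10, 11, 12, 13, 14}"
  and wa_convolve: "wa convolve = {5, 6, 7, 8, 9}"
  by (auto simp: convolve_def wv_fft wa_fft wv_square wa_square wv_accumulate wa_accumulate)

lemma cst_butterfly: "cst butterfly \<le> 250" and cst_copy_back: "cst copy_back \<le> 80"
  and cst_square: "cst square \<le> 150" and cst_accumulate: "cst accumulate \<le> 150"
  by (simp_all add: butterfly_def copy_back_def square_def accumulate_def rescale_def acost_def)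

lemma dec_bound:
  assumes "0 < S" "cmod (dec S x y) \<le> K"
  shows "\<bar>real_of_int x\<bar> \<le> K * of_int S" "\<bar>real_of_int y\<bar> \<le> K * of_int S"
proof -
  have "\<bar>real_of_int x / of_int S\<bar> \<le> K" "\<bar>real_of_int y / of_int S\<bar> \<le> K"
    using abs_Re_le_cmod[of "dec S x y"] abs_Im_le_cmod[of "dec S x y"] assms(2) by (auto simp: dec_def)
  then show "\<bar>real_of_int x\<bar> \<le> K * of_int S" "\<bar>real_of_int y\<bar> \<le> K * of_int S"
    using assms(1) by (simp_all add: abs_divide divide_le_eq)
qed

text \<open>Keeps the dividends of \<open>rescale\<close> in range: with coordinates bounded by
  \<open>S * S * S\<close> in absolute value, the added offset makes them nonnegative, and by
  \<open>S_M\<close> they stay below the word bound.\<close>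

lemma product_bound:
  fixes a b c d S :: int and K L :: real
  assumes S: "0 < S" and K: "0 \<le> K" "0 \<le> L" "2 * (K * L) \<le> of_int S"
    and ab: "\<bar>real_of_int a\<bar> \<le> K * of_int S" "\<bar>real_of_int b\<bar> \<le> K * of_int S"
    and cd: "\<bar>real_of_int c\<bar> \<le> L * of_int S" "\<bar>real_of_int d\<bar> \<le> L * of_int S"
  shows "\<bar>a * c - b * d\<bar> \<le> S * S * S" "\<bar>a * d + b * c\<bar> \<le> S * S * S"
proof -
  have *: "\<bar>real_of_int x * real_of_int y\<bar> \<le> (K * of_int S) * (L * of_int S)"
    if "\<bar>real_of_int x\<bar> \<le> K * of_int S" "\<bar>real_of_int y\<bar> \<le> L * of_int S" for x y :: int
    unfolding abs_mult using that S K by (intro mult_mono) auto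
  have "(2 * (K * L)) * (of_int S * of_int S) \<le> real_of_int S * (of_int S * of_int S)"
    using K S by (intro mult_right_mono) auto
  then have "2 * ((K * of_int S) * (L * of_int S)) \<le> real_of_int (S * S * S)" by (simp add: ac_simps)
  then have "\<bar>real_of_int (a * c - b * d)\<bar> \<le> real_of_int (S * S * S)"
    "\<bar>real_of_int (a * d + b * c)\<bar> \<le> real_of_int (S * S * S)"
    using *[OF ab(1) cd(1)] *[OF ab(2) cd(2)] *[OF ab(1) cd(2)] *[OF ab(2) cd(1)] by simp_all
  then show "\<bar>a * c - b * d\<bar> \<le> S * S * S" "\<bar>a * d + b * c\<bar> \<le> S * S * S"
    by (simp_all only: of_int_abs[symmetric] of_int_le_iff)
qed

lemma rescale_value:
  fixes z S :: int
  assumes "0 < S" shows "(z + S * S * S) div S - S * S = z div S"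
  using assms by simp

text \<open>\<open>N0\<close> is the order of the tabulated roots of unity. The exponent \<open>20\<close> leaves room for the growth of
  errors to a power of \<open>N0\<close>; by \<open>S_M\<close>, numbers up to \<open>S\<^sup>3\<close> still fit into
  a word after \<open>rescale\<close> has added its offset.\<close>

locale fixed_point = machine w B for w B +
  fixes N0 :: nat and S :: int
  assumes S_def: "S = int N0 ^ 20" and N0_4: "4 \<le> N0" and S_M: "2 * (S * S * S) < M" and N0_B: "N0 \<le> B"
begin

lemma N0_real: "4 \<le> real N0"
  using N0_4 by simp

lemma S_real: "real_of_int S = real N0 ^ 20" by (simp add: S_def)

lemma pow_le: "i \<le> j \<Longrightarrow> real N0 ^ i \<le> real N0 ^ j"
  using N0_4 by (intro power_increasing) auto

lemma S_pos: "0 < S" using N0_4 by (simp add: S_def)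

definition scale_regs :: "vars \<Rightarrow> bool" where
  "scale_regs v \<longleftrightarrow> v vN0 = int N0 \<and> v vS = S \<and> v vS2 = S * S \<and> v vS3 = S * S * S"

definition twiddles :: "arrs \<Rightarrow> bool" where
  "twiddles m \<longleftrightarrow> (\<forall>k<N0. cmod (dec S (m aTR k) (m aTI k) - om N0 k) \<le> real N0 ^ 5 / of_int S)"

lemma S3_M: "\<bar>z\<bar> \<le> S * S * S \<Longrightarrow> 0 \<le> z + S * S * S \<and> z + S * S * S < M"
  using S_M by linarith

lemma S_lt_M: "S < M"
proof -
  have 1: "1 \<le> S" using S_pos by linarith
  have "1 * S \<le> S * S" using 1 by (intro mult_right_mono) auto
  moreover have "1 * (S * S) \<le> S * (S * S)" using 1 by (intro mult_right_mono) auto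
  ultimately have "S \<le> S * S * S" by (simp only: mult.assoc)
  then show ?thesis using S_M S_pos by linarith
qed

lemma B_M: "int B < M" by (rule int_B_less)

text \<open>The part \<open>2 * A * \<delta> + \<rho>\<close> of \<open>butterfly_error\<close>,
  with the bound \<open>real N * A\<close> of \<open>norm_stage\<close> on stage values, the
  tolerance of \<open>twiddles\<close> for \<open>\<delta>\<close> and the rounding of one product
  for \<open>\<rho>\<close>.\<close>

definition err1 :: "nat \<Rightarrow> real \<Rightarrow> real" where
  "err1 N A = 2 * (real N * A) * (real N0 ^ 5 / of_int S) + 2 / of_int S"

lemma butterfly_wpf:
  assumes N: "N = 2 * s * K" "0 < s" "N dvd N0" and i: "i < s * K"
    and v: "v vi = int i" "v vh = int (s * K)" "v vblk = int s" "v vstr = int (N0 div N)" "scale_regs v"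
    and tw: "twiddles m"
    and x: "\<And>k. k < N \<Longrightarrow> cmod (dec S (m aXR k) (m aXI k) - stage a N s k) \<le> \<epsilon>" "\<epsilon> \<le> 1"
    and A: "\<And>r. r < N \<Longrightarrow> cmod (a r) \<le> A" "0 \<le> A" "8 * (real N * A + 1) \<le> of_int S"
  defines "good \<equiv> \<lambda>k y z. cmod (dec S y z - stage a N (2 * s) k) \<le> 4 * \<epsilon> + err1 N A"
    and "j \<equiv> i - i mod s"
  shows "wpf butterfly (\<lambda>v' m'. v' vi = int (Suc i) \<and> (\<exists>y1 y2 z1 z2. good (i + j) y1 y2 \<and> good (i + j + s) z1 z2 \<and>
     m' aYR = (m aYR)(i + j := y1, i + j + s := z1) \<and> m' aYI = (m aYI)(i + j := y2, i + j + s := z2))) v m"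
proof -
  have c: "v vN0 = int N0" "v vS = S" "v vS2 = S * S" "v vS3 = S * S * S"
    using v(5) by (simp_all add: scale_regs_def)
  obtain str where str: "N0 = N * str" using N(3) by blast
  have K0: "0 < K" using i by (cases K) auto
  have N0p: "0 < N" using N K0 by simp
  have strd: "N0 div N = str" using str N0p by simp
  have str0: "0 < str" using str N0_4 by (cases str) auto
  define q p where "q = i mod s" and "p = i div s"
  have q: "q < s" and p: "p < K" and ip: "i = q + s * p" and jp: "j = s * p"
    using N(2) i by (simp_all add: q_def p_def j_def minus_mod_eq_mult_div less_mult_imp_div_less mult.commute)
  have ih: "i + s * K = q + s * (p + K)" by (simp add: ip distrib_left)
  have iN: "i < N" "i + s * K < N" "i + j < N" "i + j + s < N"
  proof -
    have "s * Suc p \<le> s * K" using p by (intro mult_le_mono2) simp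
    then have "s * p + s \<le> s * K" by simp
    then show "i < N" "i + s * K < N" "i + j < N" "i + j + s < N" using N i ip jp q by linarith+
  qed
  have "j \<le> i" unfolding j_def by simp
  then have jN: "j * str < N0" using str iN(1) str0 by simp
  have NB: "N \<le> B" using N0_B str str0 by (cases str) auto
  have idx: "int i < int B" "int i + int (s * K) < int B" "int i + int j < int B"
    "int i + int j + int s < int B" "int (j * str) < int B"
    using iN NB jN N0_B by linarith+
  let ?x = "dec S (m aXR i) (m aXI i)" and ?y = "dec S (m aXR (i + s * K)) (m aXI (i + s * K))"
    and ?u = "dec S (m aTR (j * str)) (m aTI (j * str))"
  have X: "cmod (?x - stage a N s i) \<le> \<epsilon>" and Y: "cmod (?y - stage a N s (i + s * K)) \<le> \<epsilon>"
    using x(1) iN by blast+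
  have sN: "s dvd N" using N(1) by simp
  have nX: "cmod (stage a N s i) \<le> real N * A" "cmod (stage a N s (i + s * K)) \<le> real N * A"
    by (rule norm_stage[OF A(1) sN N(2) iN(1) A(2)], assumption)
      (rule norm_stage[OF A(1) sN N(2) iN(2) A(2)], assumption)
  have U: "cmod (?u - om N j) \<le> real N0 ^ 5 / of_int S"
  proof -
    have "om N0 (j * str) = om N j" using om_scale[OF str0, of N j] by (simp add: str)
    moreover have "cmod (?u - om N0 (j * str)) \<le> real N0 ^ 5 / of_int S"
      using tw jN unfolding twiddles_def by blast
    ultimately show ?thesis by (simp only:)
  qed
  have d1: "real N0 ^ 5 / of_int S \<le> 1"
  proof -
    have "0 < real N0 ^ 20" using N0_real by simp
    then show ?thesis using pow_le[of 5 20] by (simp add: S_real divide_le_eq)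
  qed
  have nx: "cmod ?x \<le> real N * A + 1" "cmod ?y \<le> real N * A + 1" "cmod ?u \<le> 2"
    using norm_triangle_ineq[of "?x - stage a N s i" "stage a N s i"]
      norm_triangle_ineq[of "?y - stage a N s (i + s * K)" "stage a N s (i + s * K)"]
      norm_triangle_ineq[of "?u - om N j" "om N j"] X Y U x(2) nX d1 by simp_all
  let ?k1 = "i + j" and ?k2 = "i + j + s"
  have k1: "?k1 = q + 2 * s * p" and k2: "?k2 = q + s + 2 * s * p" using ip jp by simp_all
  define da db where "da = m aXR i - m aXR (i + s * K)" and "db = m aXI i - m aXI (i + s * K)"
  define tc td where "tc = m aTR (j * str)" and "td = m aTI (j * str)"
  have dd: "dec S da db = ?x - ?y" unfolding da_def db_def by (rule dec_diff)
  have "cmod (dec S da db) \<le> 2 * (real N * A + 1)"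
    unfolding dd mult_2 by (rule order_trans[OF norm_triangle_ineq4 add_mono[OF nx(1,2)]])
  \<comment> \<open>The difference is bounded by \<open>2 * (real N * A + 1)\<close> and the root by
    \<open>2\<close>; together with the \<open>2\<close> in \<open>product_bound\<close> this
    explains the factor \<open>8\<close> in the hypothesis on \<open>A\<close>.\<close>
  from dec_bound[OF S_pos this] dec_bound[OF S_pos nx(3)]
  have pb: "\<bar>da * tc - db * td\<bar> \<le> S * S * S" "\<bar>da * td + db * tc\<bar> \<le> S * S * S"
    using product_bound[OF S_pos, of "2 * (real N * A + 1)" 2 da db tc td] A(2,3) by (auto simp: tc_def td_def)
  note g = S3_M[OF pb(1)] S3_M[OF pb(2)]
  let ?y1 = "m aXR i + m aXR (i + s * K)" and ?y2 = "m aXI i + m aXI (i + s * K)"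
  let ?z1 = "(da * tc - db * td) div S" and ?z2 = "(da * td + db * tc) div S"
  have e0: "0 \<le> \<epsilon>" using order_trans[OF norm_ge_zero X] .
  have er: "0 \<le> err1 N A" using A(2) S_pos by (simp add: err1_def)
  have good1: "good ?k1 ?y1 ?y2"
  proof -
    have "dec S ?y1 ?y2 - stage a N (2 * s) ?k1 =
        (?x - stage a N s i) + (?y - stage a N s (i + s * K))"
      unfolding k1 stage_double(1)[OF q p N(1)] dec_add ih[symmetric] ip[symmetric] by simp
    then have "cmod (dec S ?y1 ?y2 - stage a N (2 * s) ?k1) \<le> \<epsilon> + \<epsilon>"
      using norm_triangle_ineq[of "?x - stage a N s i" "?y - stage a N s (i + s * K)"] X Y by simp
    then show ?thesis using e0 er by (simp add: good_def)
  qed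
  have good2: "good ?k2 ?z1 ?z2"
  proof -
    have st: "stage a N (2 * s) ?k2 = (stage a N s i - stage a N s (i + s * K)) * om N j"
    proof -
      have "stage a N (2 * s) ?k2 = stage a N (2 * s) (q + s + 2 * s * p)" by (simp only: k2)
      also have "\<dots> = (stage a N s (q + s * p) - stage a N s (q + s * (p + K))) * om N (s * p)"
        by (rule stage_double(2)[OF q p N(1)])
      finally show ?thesis by (simp only: ip[symmetric] ih[symmetric] jp)
    qed
    have "cmod (dec S ?z1 ?z2 - (?x - ?y) * ?u) \<le> 2 / of_int S"
      using dec_mult_error[OF S_pos, of da tc db td] unfolding dd tc_def td_def .
    from butterfly_error[OF X Y U _ d1 nX this] show ?thesis
      unfolding good_def st err1_def by simp
  qed
  have jj: "int i - int i mod int s = int j" unfolding j_def by (simp add: of_nat_diff zmod_int)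
  have Mi: "int i < M" "int s < M" using idx B_M by linarith+
  then have Mn: "i < 2 ^ w" "s < 2 ^ w" "i < B" using idx(1) by simp_all
  have nn: "nat (int i + (int s * int K)) = i + s * K" "nat (int j * int str) = j * str"
    "nat (int i + int j) = i + j" "nat (int i + int j + int s) = i + j + s"
    by (simp_all flip: of_nat_mult of_nat_add)
  have idx': "int i + int s * int K < int B" "int j * int str < int B" using idx by simp_all
  have r1: "(da * tc - db * td + S * S * S) div S - S * S = ?z1"
    and r2: "(da * td + db * tc + S * S * S) div S - S * S = ?z2" by (rule rescale_value[OF S_pos])+
  show ?thesis
    unfolding butterfly_def rescale_def
    using good1 good2
    by (simp add: v c strd jj Mi Mn nn idx idx' da_def[symmetric] db_def[symmetric] tc_def[symmetric] td_def[symmetric]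
        g r1[simplified] r2[simplified] S_pos less_imp_le[OF S_pos] S_lt_M) (use good1 good2 in blast)
qed

lemma wpf_mono: "wpf c Q v m \<Longrightarrow> (\<And>v' m'. Q v' m' \<Longrightarrow> Q' v' m') \<Longrightarrow> wpf c Q' v m"
proof (induction c arbitrary: Q Q' v m)
  case (Seq c d)
  have "wpf c (wpf d Q) v m" using Seq.prems(1) by simp
  then have "wpf c (wpf d Q') v m" by (rule Seq.IH(1)) (rule Seq.IH(2)[OF _ Seq.prems(2)])
  then show ?case by simp
next
  case (If b c d)
  show ?case
  proof (cases "bv b v m")
    case True
    then have "wpf c Q v m" using If.prems(1) by simp
    then have "wpf c Q' v m" by (rule If.IH(1)) (rule If.prems(2))
    then show ?thesis using True If.prems(1) by simp
  next
    case False
    then have "wpf d Q v m" using If.prems(1) by simp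
    then have "wpf d Q' v m" by (rule If.IH(2)) (rule If.prems(2))
    then show ?thesis using False If.prems(1) by simp
  qed
qed auto

lemma runs_wpf_le: "wpf c Q v m \<Longrightarrow> cst c \<le> t \<Longrightarrow> runs c v m t Q"
  by (rule runs_conseq[OF wpf_runs])

lemma butterfly_loop:
  assumes N: "N = 2 * s * K" "0 < s" "N dvd N0"
    and v: "v vh = int (s * K)" "v vblk = int s" "v vstr = int (N0 div N)" "scale_regs v"
    and tw: "twiddles m"
    and x: "\<And>k. k < N \<Longrightarrow> cmod (dec S (m aXR k) (m aXI k) - stage a N s k) \<le> \<epsilon>" "\<epsilon> \<le> 1"
    and A: "\<And>r. r < N \<Longrightarrow> cmod (a r) \<le> A" "0 \<le> A" "8 * (real N * A + 1) \<le> of_int S"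
  shows "runs (vi ::= Cn 0;; While (Less (Vr vi) (Vr vh)) butterfly) v m (s * K * 256 + 9)
    (\<lambda>v' m'. \<forall>k<N. cmod (dec S (m' aYR k) (m' aYI k) - stage a N (2 * s) k) \<le> 4 * \<epsilon> + err1 N A)"
proof -
  define good where "good m' k \<longleftrightarrow> cmod (dec S (m' aYR k) (m' aYI k) - stage a N (2 * s) k) \<le> 4 * \<epsilon> + err1 N A"
    for m' :: arrs and k
  let ?j = "\<lambda>i. i - i mod s"
  let ?I = "\<lambda>i v' m'. v' vi = int i \<and> (\<forall>i'<i. good m' (i' + ?j i') \<and> good m' (i' + ?j i' + s))"
  have NB: "N \<le> B" using dvd_imp_le[OF N(3)] N0_4 N0_B by linarith
  have sK: "int s * int K < M" "\<And>i. i < s * K \<Longrightarrow> int i < M"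
  proof -
    have "s * K \<le> B" using N(1) NB by linarith
    then have "int (s * K) < M" using B_M by linarith
    then show "int s * int K < M" "\<And>i. i < s * K \<Longrightarrow> int i < M" by (simp, linarith)
  qed
  let ?v = "v(vi := 0)"
  have loop: "runs (While (Less (Vr vi) (Vr vh)) butterfly) ?v m (s * K * (250 + bcost (Less (Vr vi) (Vr vh)) + 1) + bcost (Less (Vr vi) (Vr vh)) + 1) (?I (s * K))"
  proof (rule runs_for)
    show "?I 0 ?v m" by simp
  next
    fix i v' m' assume I: "?I i v' m'" and i: "i < s * K"
      and sv: "same (wv butterfly) v' ?v" and sm: "same (wa butterfly) m' m"
    have v': "v' vh = int (s * K)" "v' vblk = int s" "v' vstr = int (N0 div N)" "scale_regs v'"
      using v sv unfolding wv_butterfly scale_regs_def by (simp_all add: sameD[OF sv[unfolded wv_butterfly]])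
    have m': "m' aXR = m aXR" "m' aXI = m aXI" "m' aTR = m aTR" "m' aTI = m aTI"
      by (simp_all add: sameD[OF sm[unfolded wa_butterfly]])
    have tw': "twiddles m'" using tw by (simp add: twiddles_def m')
    have iB: "int i < M" "int s * int K < M" "int i < int s * int K"
      using i sK by (simp_all flip: of_nat_mult)
    have "wpf butterfly (?I (Suc i)) v' m'"
    proof (rule wpf_mono[OF butterfly_wpf[OF N i _ v' tw' _ x(2) A]])
      show "v' vi = int i" using I by simp
      show "k < N \<Longrightarrow> cmod (dec S (m' aXR k) (m' aXI k) - stage a N s k) \<le> \<epsilon>" for k
        using x(1) by (simp add: m')
    next
      fix w n assume P: "w vi = int (Suc i) \<and> (\<exists>y1 y2 z1 z2.
        cmod (dec S y1 y2 - stage a N (2 * s) (i + ?j i)) \<le> 4 * \<epsilon> + err1 N A \<and>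
        cmod (dec S z1 z2 - stage a N (2 * s) (i + ?j i + s)) \<le> 4 * \<epsilon> + err1 N A \<and>
        n aYR = (m' aYR)(i + ?j i := y1, i + ?j i + s := z1) \<and>
        n aYI = (m' aYI)(i + ?j i := y2, i + ?j i + s := z2))"
      then obtain y1 y2 z1 z2 where g:
        "cmod (dec S y1 y2 - stage a N (2 * s) (i + ?j i)) \<le> 4 * \<epsilon> + err1 N A"
        "cmod (dec S z1 z2 - stage a N (2 * s) (i + ?j i + s)) \<le> 4 * \<epsilon> + err1 N A"
        "n aYR = (m' aYR)(i + ?j i := y1, i + ?j i + s := z1)"
        "n aYI = (m' aYI)(i + ?j i := y2, i + ?j i + s := z2)" by blast
      \<comment> \<open>A cell that is written again receives another good value, so cells once good
        stay good.\<close>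
      have keep: "good n k" if "good m' k" for k
        using that g unfolding good_def by (cases "k = i + ?j i"; cases "k = i + ?j i + s") simp_all
      have new: "good n (i + ?j i)" "good n (i + ?j i + s)"
        using g N(2) unfolding good_def by simp_all
      show "?I (Suc i) w n" using P I keep new by (auto simp: less_Suc_eq)
    qed
    then show "okb (Less (Vr vi) (Vr vh)) v' m' \<and> bv (Less (Vr vi) (Vr vh)) v' m' \<and> runs butterfly v' m' 250 (?I (Suc i))"
      using I i v' iB runs_wpf_le[OF _ cst_butterfly] by (simp add: okw_def)
  next
    fix v' m' assume I: "?I (s * K) v' m'" and sv: "same (wv butterfly) v' ?v" and sm: "same (wa butterfly) m' m"
    have "v' vh = int (s * K)" using v sameD[OF sv[unfolded wv_butterfly]] by simp
    then show "okb (Less (Vr vi) (Vr vh)) v' m' \<and> \<not> bv (Less (Vr vi) (Vr vh)) v' m'"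
      using I sK by (simp add: okw_def)
  qed
  \<comment> \<open>Every cell is a target: its offset \<open>r\<close> in a block of length
    \<open>2 * s\<close> is either \<open>q\<close> or \<open>q + s\<close> with
    \<open>q < s\<close>.\<close>
  have all: "\<forall>k<N. good m' k" if "\<forall>i'<s * K. good m' (i' + ?j i') \<and> good m' (i' + ?j i' + s)" for m'
  proof (intro allI impI)
    fix k assume k: "k < N"
    define p r where "p = k div (2 * s)" and "r = k mod (2 * s)"
    have kk: "k = r + 2 * s * p" and r: "r < 2 * s" using N(2) by (simp_all add: p_def r_def)
    have p: "p < K" unfolding p_def using k N by (simp add: less_mult_imp_div_less ac_simps)
    define q where "q = (if r < s then r else r - s)"
    have q: "q < s" using r by (auto simp: q_def)
    have "s * Suc p \<le> s * K" using p by (intro mult_le_mono2) simp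
    then have i: "q + s * p < s * K" using q by simp
    have j: "?j (q + s * p) = s * p" using q by simp
    have g: "good m' ((q + s * p) + s * p)" "good m' ((q + s * p) + s * p + s)"
      using that[rule_format, OF i] unfolding j by blast+
    have e: "(q + s * p) + s * p = q + 2 * s * p" "(q + s * p) + s * p + s = q + s + 2 * s * p" by simp_all
    note g[unfolded e(2), unfolded e(1)]
    moreover have "k = q + 2 * s * p \<or> k = q + s + 2 * s * p" using kk by (auto simp: q_def)
    ultimately show "good m' k" by blast
  qed
  show ?thesis
  proof (rule runs_seqI[OF runs_wpf_le[where Q = "\<lambda>v' m'. v' = ?v \<and> m' = m" and t = 3]])
    show "wpf (vi ::= Cn 0) (\<lambda>v' m'. v' = ?v \<and> m' = m) v m" by simp
    show "cst (vi ::= Cn 0) \<le> 3" by simp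
    fix v' m' assume e: "v' = ?v \<and> m' = m"
    show "runs (While (Less (Vr vi) (Vr vh)) butterfly) v' m' (s * K * 256 + 6)
      (\<lambda>v' m'. \<forall>k<N. cmod (dec S (m' aYR k) (m' aYI k) - stage a N (2 * s) k) \<le> 4 * \<epsilon> + err1 N A)"
      unfolding e[THEN conjunct1] e[THEN conjunct2]
    proof (rule runs_conseq[OF loop])
      fix v2 m2 assume "?I (s * K) v2 m2"
      then have "\<forall>k<N. good m2 k" using all by blast
      then show "\<forall>k<N. cmod (dec S (m2 aYR k) (m2 aYI k) - stage a N (2 * s) k) \<le> 4 * \<epsilon> + err1 N A"
        by (simp only: good_def)
    qed simp
  qed simp
qed

lemma copy_loop:
  assumes "v vN = int N" "N \<le> B"
  shows "runs (vi ::= Cn 0;; While (Less (Vr vi) (Vr vN)) copy_back) v m (N * 86 + 9)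
    (\<lambda>v' m'. \<forall>k<N. m' aXR k = m aYR k \<and> m' aXI k = m aYI k)"
proof -
  let ?I = "\<lambda>i v' m'. v' vi = int i \<and> (\<forall>k<i. m' aXR k = m aYR k \<and> m' aXI k = m aYI k)"
  let ?v = "v(vi := 0)"
  have loop: "runs (While (Less (Vr vi) (Vr vN)) copy_back) ?v m (N * (80 + bcost (Less (Vr vi) (Vr vN)) + 1) + bcost (Less (Vr vi) (Vr vN)) + 1) (?I N)"
  proof (rule runs_for)
    show "?I 0 ?v m" by simp
  next
    fix i v' m' assume I: "?I i v' m'" and i: "i < N"
      and sv: "same (wv copy_back) v' ?v" and sm: "same (wa copy_back) m' m"
    have v': "v' vN = int N" using assms(1) sameD[OF sv[unfolded wv_copy_back]] by simp
    have m': "m' aYR = m aYR" "m' aYI = m aYI" using sameD[OF sm[unfolded wa_copy_back]] by simp_all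
    have b: "int i < int B" "int i < M" "int N < M" using i assms(2) B_M by linarith+
    have "wpf copy_back (?I (Suc i)) v' m'"
      using I b by (simp add: copy_back_def less_Suc_eq m')
    then show "okb (Less (Vr vi) (Vr vN)) v' m' \<and> bv (Less (Vr vi) (Vr vN)) v' m' \<and> runs copy_back v' m' 80 (?I (Suc i))"
      using I i v' b runs_wpf_le[OF _ cst_copy_back] by (simp add: okw_def)
  next
    fix v' m' assume I: "?I N v' m'" and sv: "same (wv copy_back) v' ?v"
    have "v' vN = int N" using assms(1) sameD[OF sv[unfolded wv_copy_back]] by simp
    moreover have "int N < M" using assms(2) B_M by linarith
    ultimately show "okb (Less (Vr vi) (Vr vN)) v' m' \<and> \<not> bv (Less (Vr vi) (Vr vN)) v' m'"
      using I by (simp add: okw_def)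
  qed
  show ?thesis
  proof (rule runs_seqI[OF runs_wpf_le[where Q = "\<lambda>v' m'. v' = ?v \<and> m' = m" and t = 3]])
    show "wpf (vi ::= Cn 0) (\<lambda>v' m'. v' = ?v \<and> m' = m) v m" by simp
    show "cst (vi ::= Cn 0) \<le> 3" by simp
    fix v' m' assume "v' = ?v \<and> m' = m"
    then show "runs (While (Less (Vr vi) (Vr vN)) copy_back) v' m' (N * 86 + 6)
      (\<lambda>v' m'. \<forall>k<N. m' aXR k = m aYR k \<and> m' aXI k = m aYI k)"
      using loop by (auto elim!: runs_conseq)
  qed simp
qed

lemma runs_stage:
  assumes N: "N = 2 * s * K" "0 < s" "N dvd N0"
    and v: "v vN = int N" "v vh = int (N div 2)" "v vblk = int s" "v vstr = int (N0 div N)" "scale_regs v"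
    and tw: "twiddles m"
    and x: "\<And>k. k < N \<Longrightarrow> cmod (dec S (m aXR k) (m aXI k) - stage a N s k) \<le> \<epsilon>" "\<epsilon> \<le> 1"
    and A: "\<And>r. r < N \<Longrightarrow> cmod (a r) \<le> A" "0 \<le> A" "8 * (real N * A + 1) \<le> of_int S"
  shows "runs fft_stage v m (N * 300 + 100) (\<lambda>v' m'. v' vblk = int (2 * s) \<and>
     (\<forall>k<N. cmod (dec S (m' aXR k) (m' aXI k) - stage a N (2 * s) k) \<le> 4 * \<epsilon> + err1 N A))"
proof -
  have NB: "N \<le> B" using dvd_imp_le[OF N(3)] N0_4 N0_B by linarith
  have h: "v vh = int (s * K)" using v(2) N(1) by simp
  let ?L1 = "vi ::= Cn 0;; While (Less (Vr vi) (Vr vh)) butterfly"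
  let ?L2 = "vi ::= Cn 0;; While (Less (Vr vi) (Vr vN)) copy_back"
  let ?L3 = "vblk ::= Vr vblk [+] Vr vblk"
  let ?Q = "\<lambda>v' m'. v' vblk = int (2 * s) \<and>
     (\<forall>k<N. cmod (dec S (m' aXR k) (m' aXI k) - stage a N (2 * s) k) \<le> 4 * \<epsilon> + err1 N A)"
  have "runs ((?L1;; ?L2);; ?L3) v m (N * 300 + 100) ?Q"
  proof (rule runs_seqI[where t' = 20])
    show "runs (?L1;; ?L2) v m (s * K * 256 + 9 + (N * 86 + 9)) (\<lambda>v' m'. v' vblk = int s \<and>
      (\<forall>k<N. cmod (dec S (m' aXR k) (m' aXI k) - stage a N (2 * s) k) \<le> 4 * \<epsilon> + err1 N A))"
    proof (rule runs_seqI[OF butterfly_loop[OF N h v(3-5) tw x A] order_refl])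
      fix v1 m1 assume sv: "same (wv ?L1) v1 v"
        and g: "\<forall>k<N. cmod (dec S (m1 aYR k) (m1 aYI k) - stage a N (2 * s) k) \<le> 4 * \<epsilon> + err1 N A"
      have v1: "v1 vN = int N" "v1 vblk = int s" using v sv by (simp_all add: same_def wv_butterfly)
      show "runs ?L2 v1 m1 (N * 86 + 9) (\<lambda>v' m'. v' vblk = int s \<and>
        (\<forall>k<N. cmod (dec S (m' aXR k) (m' aXI k) - stage a N (2 * s) k) \<le> 4 * \<epsilon> + err1 N A))"
        by (rule runs_conseq[OF copy_loop[of v1 N m1, OF v1(1) NB] order_refl])
          (use g v1(2) in \<open>simp add: same_def wv_copy_back\<close>)
    qed
    fix v2 m2 assume "v2 vblk = int s \<and>
      (\<forall>k<N. cmod (dec S (m2 aXR k) (m2 aXI k) - stage a N (2 * s) k) \<le> 4 * \<epsilon> + err1 N A)"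
    then show "runs ?L3 v2 m2 20 ?Q" by (intro runs_wpf_le) auto
  qed (use N in simp)
  then show ?thesis unfolding fft_stage_def .
qed

lemma stage_err_mono: "0 \<le> \<epsilon> \<Longrightarrow> 0 \<le> \<eta> \<Longrightarrow> i \<le> j \<Longrightarrow> stage_err \<epsilon> \<eta> i \<le> stage_err \<epsilon> \<eta> j"
proof -
  assume h: "0 \<le> \<epsilon>" "0 \<le> \<eta>" "i \<le> j"
  have "0 \<le> stage_err \<epsilon> \<eta> k" for k by (induction k) (use h in auto)
  then have "stage_err \<epsilon> \<eta> k \<le> stage_err \<epsilon> \<eta> (Suc k)" for k
    using h(2) by (simp add: add_increasing2 le_add_same_cancel1 dual_order.trans[of _ "1 * stage_err \<epsilon> \<eta> k"])
  then show ?thesis using h(3) by (rule lift_Suc_mono_le)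
qed

lemma err1_nonneg: "0 \<le> A \<Longrightarrow> 0 \<le> err1 N A"
  using S_pos by (simp add: err1_def)

text \<open>A stage requires its input error to be at most \<open>1\<close>. Because
  \<open>stage_err\<close> does not decrease from stage to stage, demanding this of the final error
  covers all stages.\<close>

lemma runs_fft:
  assumes N: "N = 2 ^ L" "1 \<le> L" "N dvd N0"
    and v: "v vN = int N" "scale_regs v"
    and tw: "twiddles m"
    and x: "\<And>k. k < N \<Longrightarrow> cmod (dec S (m aXR k) (m aXI k) - a k) \<le> \<epsilon>" "stage_err \<epsilon> (err1 N A) L \<le> 1"
    and A: "\<And>r. r < N \<Longrightarrow> cmod (a r) \<le> A" "0 \<le> A" "8 * (real N * A + 1) \<le> of_int S"
  shows "runs fft v m (L * (N * 300 + 106) + 40) (\<lambda>v' m'. v' vh = int (N div 2) \<and>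
     (\<forall>q<N. cmod (dec S (m' aXR q) (m' aXI q) - dft a N q) \<le> stage_err \<epsilon> (err1 N A) L))"
proof -
  have NB: "N \<le> N0" "N \<le> B" using dvd_imp_le[OF N(3)] N0_4 N0_B by linarith+
  have NM: "int N < M" "int N0 < M" using NB N0_B B_M by linarith+
  have Np: "0 < N" using N(1) by simp
  let ?e = "stage_err \<epsilon> (err1 N A)"
  have \<epsilon>0: "0 \<le> \<epsilon>" using order_trans[OF norm_ge_zero x(1)[OF Np]] .
  have e1: "?e t \<le> 1" if "t \<le> L" for t
    using stage_err_mono[OF \<epsilon>0 err1_nonneg[OF A(2)] that, of N] x(2) by linarith
  let ?P = "vh ::= Vr vN [/] Cn 2;; vstr ::= Vr vN0 [/] Vr vN;; vblk ::= Cn 1"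
  let ?I = "\<lambda>t v' m'. v' vblk = int (2 ^ t) \<and>
     (\<forall>k<N. cmod (dec S (m' aXR k) (m' aXI k) - stage a N (2 ^ t) k) \<le> ?e t)"
  let ?b = "Less (Vr vblk) (Vr vN)"
  have "runs (?P;; While ?b fft_stage) v m (L * (N * 300 + 106) + 40) (\<lambda>v' m'. v' vh = int (N div 2) \<and>
     (\<forall>q<N. cmod (dec S (m' aXR q) (m' aXI q) - dft a N q) \<le> ?e L))"
  proof (rule runs_seqI[OF runs_wpf_le[where t = 30 and
        Q = "\<lambda>v' m'. v' = v(vh := int (N div 2), vstr := int (N0 div N), vblk := 1) \<and> m' = m"]])
    have "2 < M" using NM N0_4 by linarith
    then show "wpf ?P (\<lambda>v' m'. v' = v(vh := int (N div 2), vstr := int (N0 div N), vblk := 1) \<and> m' = m) v m"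
      using v NM by (simp add: scale_regs_def zdiv_int)
    fix v1 m1 assume v1m: "v1 = v(vh := int (N div 2), vstr := int (N0 div N), vblk := 1) \<and> m1 = m"
    have v1: "v1 vN = int N" "v1 vh = int (N div 2)" "v1 vstr = int (N0 div N)" "scale_regs v1"
      using v v1m by (simp_all add: scale_regs_def)
    have "runs (While ?b fft_stage) v1 m1 (L * (N * 300 + 100 + bcost ?b + 1) + bcost ?b + 1) (?I L)"
    proof (rule runs_for)
      show "?I 0 v1 m1" using x(1) v1m by (simp add: stage_1[unfolded One_nat_def])
    next
      fix t v' m' assume I: "?I t v' m'" and t: "t < L"
        and sv: "same (wv fft_stage) v' v1" and sm: "same (wa fft_stage) m' m1"
      have v': "v' vN = int N" "v' vh = int (N div 2)" "v' vstr = int (N0 div N)" "scale_regs v'"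
        using v1 sv by (simp_all add: scale_regs_def same_def wv_fft_stage)
      have tw': "twiddles m'" using tw sm v1m by (simp add: twiddles_def same_def wa_fft_stage)
      have N': "N = 2 * 2 ^ t * 2 ^ (L - Suc t)" using N(1) t
        by (metis Suc_leI le_add_diff_inverse power_Suc power_add)
      have lt: "2 ^ t < N" using N(1) t by simp
      then have tM: "int (2 ^ t) < M" "int (2 ^ t) < int N" using NM by linarith+
      have "runs fft_stage v' m' (N * 300 + 100) (?I (Suc t))"
        by (rule runs_conseq[OF runs_stage[OF N' _ N(3) v'(1,2) _ v'(3,4) tw' _ _ A, where \<epsilon> = "?e t"]])
          (use I e1[of t] t in auto)
      then show "okb ?b v' m' \<and> bv ?b v' m' \<and> runs fft_stage v' m' (N * 300 + 100) (?I (Suc t))"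
        using I v' tM NM by (simp add: okw_def)
    next
      fix v' m' assume I: "?I L v' m'" and sv: "same (wv fft_stage) v' v1"
      have "v' vN = int N" using v1 sv by (simp add: same_def wv_fft_stage)
      then show "okb ?b v' m' \<and> \<not> bv ?b v' m'" using I NM N(1) by (simp add: okw_def)
    qed
    then show "runs (While ?b fft_stage) v1 m1 (L * (N * 300 + 106) + 6) (\<lambda>v' m'. v' vh = int (N div 2) \<and>
     (\<forall>q<N. cmod (dec S (m' aXR q) (m' aXI q) - dft a N q) \<le> ?e L))"
      by (rule runs_conseq) (use v1 in \<open>auto simp: same_def wv_fft_stage N(1)[symmetric] stage_all\<close>)
  qed auto
  then show ?thesis unfolding fft_def .
qed

lemma count_loop_reg:
  assumes b: "b = Less (Vr vi) (Vr x)" "x \<noteq> vi" and NB: "N \<le> B" and vN: "v x = int N" "x \<notin> wv c"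
    and I0: "I 0 (v(vi := 0)) m"
    and step: "\<And>i v' m'. I i v' m' \<Longrightarrow> i < N \<Longrightarrow> v' vi = int i \<Longrightarrow> v' x = int N \<Longrightarrow>
      same (wv c) v' (v(vi := 0)) \<Longrightarrow> same (wa c) m' m \<Longrightarrow>
      wpf c (\<lambda>v'' m''. I (Suc i) v'' m'' \<and> v'' vi = int (Suc i)) v' m'"
    and t: "cst c \<le> t"
  shows "runs (vi ::= Cn 0;; While b c) v m (N * (t + 6) + 9) (I N)"
proof -
  let ?v = "v(vi := 0)"
  have NM: "int N < M" using NB B_M by linarith
  have loop: "runs (While b c) ?v m (N * (t + bcost b + 1) + bcost b + 1) (\<lambda>v' m'. I N v' m' \<and> v' vi = int N)"
  proof (rule runs_for[where I = "\<lambda>i v' m'. I i v' m' \<and> v' vi = int i"])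
    show "I 0 ?v m \<and> ?v vi = int 0" using I0 by simp
  next
    fix i v' m' assume I: "I i v' m' \<and> v' vi = int i" and i: "i < N"
      and s: "same (wv c) v' ?v" "same (wa c) m' m"
    have vN': "v' x = int N" using sameD[OF s(1) vN(2)] vN(1) b(2) by simp
    have "wpf c (\<lambda>v'' m''. I (Suc i) v'' m'' \<and> v'' vi = int (Suc i)) v' m'"
      using step[OF _ i _ vN' s] I by blast
    then have r: "runs c v' m' t (\<lambda>v'' m''. I (Suc i) v'' m'' \<and> v'' vi = int (Suc i))"
      by (rule runs_wpf_le[OF _ t])
    have "int i < M" "int i < int N" using i NM by linarith+
    then show "okb b v' m' \<and> bv b v' m' \<and> runs c v' m' t (\<lambda>v'' m''. I (Suc i) v'' m'' \<and> v'' vi = int (Suc i))"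
      using r I vN' NM by (simp add: b(1) okw_def)
  next
    fix v' m' assume I: "I N v' m' \<and> v' vi = int N" and s: "same (wv c) v' ?v"
    show "okb b v' m' \<and> \<not> bv b v' m'"
      using I sameD[OF s vN(2)] vN(1) NM b(2) by (simp add: b(1) okw_def)
  qed
  show ?thesis
  proof (rule runs_seqI[OF runs_wpf_le[where Q = "\<lambda>v' m'. v' = ?v \<and> m' = m" and t = 3]])
    show "wpf (vi ::= Cn 0) (\<lambda>v' m'. v' = ?v \<and> m' = m) v m" by simp
    show "cst (vi ::= Cn 0) \<le> 3" by simp
    fix v' m' assume "v' = ?v \<and> m' = m"
    then show "runs (While b c) v' m' (N * (t + 6) + 6) (I N)"
      using loop by (auto elim!: runs_conseq simp: b(1))
  qed simp
qed

lemma five_neq_six: "(5::nat) \<noteq> 6" by simp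

lemmas count_loop = count_loop_reg[where x = vN, OF _ five_neq_six]

lemma square_loop:
  assumes v: "v vN = int N" "scale_regs v" and NB: "N \<le> B"
    and x: "\<And>k. k < N \<Longrightarrow> cmod (dec S (m aXR k) (m aXI k) - f k) \<le> \<epsilon>" "\<epsilon> \<le> 1"
    and A: "\<And>k. k < N \<Longrightarrow> cmod (f k) \<le> A" "0 \<le> A" "2 * ((A + 1) * (A + 1)) \<le> of_int S"
  shows "runs (vi ::= Cn 0;; While (Less (Vr vi) (Vr vN)) square) v m (N * 156 + 9)
    (\<lambda>v' m'. \<forall>k<N. cmod (dec S (m' aXR k) (m' aXI k) - f k ^ 2) \<le> \<epsilon> * (2 * A + 1) + 2 / of_int S)"
proof -
  define good where "good y z k \<longleftrightarrow> cmod (dec S y z - f k ^ 2) \<le> \<epsilon> * (2 * A + 1) + 2 / of_int S" for y z k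
  let ?I = "\<lambda>i v' m'. (\<forall>k<i. good (m' aXR k) (m' aXI k) k) \<and>
    (\<forall>k\<ge>i. m' aXR k = m aXR k \<and> m' aXI k = m aXI k)"
  have "runs (vi ::= Cn 0;; While (Less (Vr vi) (Vr vN)) square) v m (N * (150 + 6) + 9) (?I N)"
  proof (rule count_loop[where I = ?I and v = v, OF refl NB v(1) _ _ _ cst_square])
    show "vN \<notin> wv square" by (simp add: wv_square)
    show "?I 0 (v(vi := 0)) m" by simp
    fix i v' m' assume I: "?I i v' m'" and i: "i < N" and vi: "v' vi = int i"
      and sv: "same (wv square) v' (v(vi := 0))"
    have c: "v' vS = S" "v' vS2 = S * S" "v' vS3 = S * S * S"
      using v sv by (simp_all add: scale_regs_def same_def wv_square)
    have iB: "int i < int B" and iBn: "i < B" using i NB by linarith+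
    define p q where "p = m aXR i" and "q = m aXI i"
    have pq: "m' aXR i = p" "m' aXI i = q" using I by (simp_all add: p_def q_def)
    have X: "cmod (dec S p q - f i) \<le> \<epsilon>" using x(1)[OF i] by (simp add: p_def q_def)
    have "cmod (dec S p q) \<le> A + 1"
      using norm_triangle_ineq[of "dec S p q - f i" "f i"] X x(2) A(1)[OF i] by simp
    from dec_bound[OF S_pos this]
    have pb: "\<bar>p * p - q * q\<bar> \<le> S * S * S" "\<bar>p * q + q * p\<bar> \<le> S * S * S"
      using product_bound[OF S_pos _ _ A(3), of p q p q] A(2) by auto
    note g = S3_M[OF pb(1)] S3_M[OF pb(2)]
    have new: "good ((p * p - q * q) div S) ((p * q + q * p) div S) i"
      unfolding good_def by (rule square_error[OF X A(1)[OF i] x(2) dec_mult_error[OF S_pos]])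
    have r: "(p * p - q * q + S * S * S) div S - S * S = (p * p - q * q) div S"
      "(p * q + q * p + S * S * S) div S - S * S = (p * q + q * p) div S" by (rule rescale_value[OF S_pos])+
    show "wpf square (\<lambda>v'' m''. ?I (Suc i) v'' m'' \<and> v'' vi = int (Suc i)) v' m'"
      unfolding square_def rescale_def
      using I new
      by (simp add: c vi iB iBn pq g g[simplified] r[simplified] less_imp_le[OF S_pos] S_lt_M less_Suc_eq)
  qed
  then show ?thesis by (rule runs_conseq) (auto simp: good_def)
qed

lemma accumulate_loop:
  assumes v: "v vN = int N" "v vh = int h" "scale_regs v" and N: "N = 2 * h" "1 \<le> h" "N \<le> N0"
    and x: "\<And>k. k < N \<Longrightarrow> cmod (dec S (m aXR k) (m aXI k) - f k) \<le> 1 / 4"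
    and f: "\<And>i. i < N \<Longrightarrow> f ((N - i) mod N) = of_nat (N * c i)" "\<And>i. i < N \<Longrightarrow> c i \<le> N0 ^ 2"
  shows "runs (vi ::= Cn 0;; While (Less (Vr vi) (Vr vN)) accumulate) v m (N * 156 + 9)
    (\<lambda>v' m'. (\<forall>i<N. m' aW i = m aW i + v vg * int (c i)) \<and> (\<forall>i\<ge>N. m' aW i = m aW i))"
proof -
  let ?I = "\<lambda>i v' m'. (\<forall>k<i. m' aW k = m aW k + v vg * int (c k)) \<and> (\<forall>k\<ge>i. m' aW k = m aW k)"
  have NB: "N \<le> B" using N N0_B by simp
  have "runs (vi ::= Cn 0;; While (Less (Vr vi) (Vr vN)) accumulate) v m (N * (150 + 6) + 9) (?I N)"
  proof (rule count_loop[where I = ?I and v = v, OF refl NB v(1) _ _ _ cst_accumulate])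
    show "vN \<notin> wv accumulate" by (simp add: wv_accumulate)
    show "?I 0 (v(vi := 0)) m" by simp
    fix i v' m' assume I: "?I i v' m'" and i: "i < N" and vi: "v' vi = int i" and vN: "v' vN = int N"
      and sv: "same (wv accumulate) v' (v(vi := 0))" and sm: "same (wa accumulate) m' m"
    have cc: "v' vS = S" "v' vh = int h" "v' vg = v vg"
      using v sv by (simp_all add: scale_regs_def same_def wv_accumulate)
    have m': "m' aXR = m aXR" using sm by (simp add: same_def wa_accumulate)
    define j where "j = (N - i) mod N"
    have j: "j < N" using i by (simp add: j_def)
    have jj: "(int N - int i) mod int N = int j" using i by (simp add: j_def of_nat_diff zmod_int)
    have jj': "- int i mod int N = int j" using jj by simp
    have B': "int i < int B" "int j < int B" "int N < M" "int N - int i < M" "0 \<le> int N - int i"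
      using i j NB B_M by linarith+
    have Bn: "i < B" "j < B" "N < 2 ^ w" using i j NB B'(3) by (linarith, linarith, simp)
    define z where "z = m aXR j"
    have fj: "f j = of_nat (N * c i)" using f(1)[OF i] by (simp add: j_def)
    have "\<bar>Re (dec S z (m aXI j) - f j)\<bar> \<le> 1 / 4"
      using x[OF j] abs_Re_le_cmod order_trans unfolding z_def by blast
    then have zr: "\<bar>of_int z / of_int S - of_int (int N * int (c i))\<bar> \<le> (1 / 4 :: real)"
      unfolding fj by (simp add: dec_def)
    have val: "(z + int h * S) div (S * int N) = int (c i)"
      by (rule round_error[OF S_pos _ _ order_le_less_trans[OF zr]]) (use N in auto)
    have "int N * int (c i) \<le> int N0 * int N0 ^ 2"
      using N(3) f(2)[OF i] by (intro mult_mono) (auto simp flip: of_nat_power)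
    have Sr: "0 < real_of_int S" using S_pos by simp
    have zb: "real_of_int z \<le> (of_int (int N * int (c i)) + 1) * of_int S"
      "- real_of_int S \<le> of_int z"
    proof -
      have "of_int z / of_int S \<le> real_of_int (int N * int (c i)) + 1" using zr by linarith
      then show "real_of_int z \<le> (of_int (int N * int (c i)) + 1) * of_int S"
        using Sr by (simp add: divide_le_eq)
      have "0 \<le> real_of_int (int N * int (c i))" by simp
      then have "- 1 \<le> real_of_int z / of_int S" using zr by linarith
      then show "- real_of_int S \<le> of_int z" using Sr by (simp add: le_divide_eq)
    qed
    have zb': "z \<le> (int N * int (c i) + 1) * S" "- S \<le> z"
    proof -
      have "real_of_int z \<le> real_of_int ((int N * int (c i) + 1) * S)" using zb(1) by simp
      then show "z \<le> (int N * int (c i) + 1) * S" by (simp only: of_int_le_iff)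
      have "real_of_int (- S) \<le> real_of_int z" using zb(2) by simp
      then show "- S \<le> z" by (simp only: of_int_le_iff)
    qed
    have hS: "1 * S \<le> int h * S" using N(2) S_pos by (intro mult_right_mono) auto
    \<comment> \<open>Multiplied by \<open>S\<close>, this bounds the dividend of the rounding step
      by \<open>S * S\<close>, which is below the word bound. It rests on
      \<open>c i \<le> N0 ^ 2\<close>.\<close>
    have big: "int N * int (c i) + 1 + int h \<le> S"
    proof -
      have n0: "4 \<le> int N0" using N0_4 by simp
      have "int N * int (c i) \<le> int N0 ^ 3"
        using \<open>int N * int (c i) \<le> int N0 * int N0 ^ 2\<close> by (simp add: eval_nat_numeral)
      moreover have "1 \<le> int N0 ^ 3" "int h \<le> int N0 ^ 3"
      proof -
        show "1 \<le> int N0 ^ 3" using n0 by (simp add: one_le_power)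
        have "int N0 ^ 1 \<le> int N0 ^ 3" using n0 by (intro power_increasing) auto
        then show "int h \<le> int N0 ^ 3" using N by simp
      qed
      moreover have "4 * int N0 ^ 3 \<le> int N0 * int N0 ^ 3" using n0 by (intro mult_right_mono) auto
      moreover have "int N0 ^ 4 \<le> int N0 ^ 20" using n0 by (intro power_increasing) auto
      ultimately show ?thesis by (simp add: S_def eval_nat_numeral)
    qed
    have "(int N * int (c i) + 1 + int h) * S \<le> S * S" using big S_pos by (intro mult_right_mono) auto
    then have up: "z + int h * S \<le> S * S" using zb'(1) by (simp add: algebra_simps)
    have SS: "S * S < M"
    proof -
      have "1 * (S * S) \<le> S * (S * S)" using S_pos by (intro mult_right_mono) auto
      then have "S * S \<le> S * S * S" by (simp only: mult.assoc)
      moreover have "0 < S * S * S" using S_pos by simp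
      ultimately show ?thesis using S_M by linarith
    qed
    have NS: "S * int N < M"
    proof -
      have "int N0 ^ 1 \<le> int N0 ^ 20" using N0_4 by (intro power_increasing) auto
      then have "int N \<le> S" using N(3) by (simp add: S_def)
      then have "S * int N \<le> S * S" using S_pos by (intro mult_left_mono) auto
      then show ?thesis using SS by linarith
    qed
    have g: "0 \<le> z + int h * S" "z + int h * S < M" using zb'(2) hS up SS by linarith+
    show "wpf accumulate (\<lambda>v'' m''. ?I (Suc i) v'' m'' \<and> v'' vi = int (Suc i)) v' m'"
      unfolding accumulate_def
      using I i by (simp add: cc vi vN jj jj' B' Bn m' z_def[symmetric] g NS val less_Suc_eq S_pos less_imp_le[OF S_pos])
  qed
  then show ?thesis by (rule runs_conseq) auto
qed

lemma pow4: "4 * real N0 ^ k \<le> real N0 ^ Suc k" and pow1: "1 \<le> real N0 ^ k"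
proof -
  have "4 * real N0 ^ k \<le> real N0 * real N0 ^ k" using N0_real by (intro mult_right_mono) auto
  then show "4 * real N0 ^ k \<le> real N0 ^ Suc k" by simp
  show "1 \<le> real N0 ^ k" using N0_real by (simp add: one_le_power)
qed

text \<open>Error budget with \<open>x = N0\<close>: counts are at most \<open>x\<close>, their
  transform at most \<open>x ^ 2\<close>, its square at most \<open>x ^ 4\<close>. The errors are
  bounded by \<open>x ^ 10 / S\<close> after the first transform, \<open>x ^ 13 / S\<close> after
  squaring and \<open>x ^ 19 / S\<close> after the second transform. With \<open>S = x ^ 20\<close>
  and \<open>x \<ge> 4\<close> the last one is at most \<open>1 / 4\<close>, as
  \<open>accumulate_loop\<close> requires.\<close>

lemma runs_convolve:
  assumes N: "N = 2 ^ L" "1 \<le> L" "N dvd N0"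
    and v: "v vN = int N" "scale_regs v" and tw: "twiddles m"
    and X: "finite X" "card X \<le> N0" "\<And>x. x \<in> X \<Longrightarrow> 2 * f x < N"
    and x: "\<And>k. k < N \<Longrightarrow> m aXR k = S * int (card {x\<in>X. f x = k}) \<and> m aXI k = 0"
  shows "runs convolve v m ((L + 1) * N * 2000) (\<lambda>v' m'.
     \<forall>i. m' aW i = m aW i + (if i < N then v vg * int (card {(x, y). x \<in> X \<and> y \<in> X \<and> f x + f y = i}) else 0))"
proof -
  define c where "c i = card {(x, y). x \<in> X \<and> y \<in> X \<and> f x + f y = i}" for i
  define a where "a = (\<lambda>r. of_nat (card {x\<in>X. f x = r}) :: complex)"
  define h where "h = N div 2"
  have N2: "2 \<le> N" using N(1,2) by (cases L) auto
  have h: "N = 2 * h" "1 \<le> h" using N(1,2) N2 unfolding h_def by (cases L; simp)+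
  have NN0: "N \<le> N0" "N \<le> B" using dvd_imp_le[OF N(3)] N0_4 N0_B by linarith+
  have NrN0: "real N \<le> real N0" using NN0 by simp
  let ?x = "real N0"
  have S0: "0 < real_of_int S" using S_pos by simp
  have N2x: "real N ^ 2 \<le> ?x ^ 2" using NrN0 by (intro power_mono) auto
  \<comment> \<open>An error factor of \<open>4\<close> in each of \<open>L\<close> stages amounts
    to \<open>N ^ 2\<close> altogether.\<close>
  have L4: "4 ^ L = real N ^ 2" using N(1)
  proof -
    have "(4 :: real) ^ L = (2 * 2) ^ L" by simp
    also have "\<dots> = 2 ^ L * 2 ^ L" by (rule power_mult_distrib)
    finally show ?thesis using N(1) by (simp add: power2_eq_square)
  qed
  have a1: "cmod (a r) \<le> ?x" for r
  proof -
    have "card {x\<in>X. f x = r} \<le> card X" by (rule card_mono) (use X in auto)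
    then show ?thesis unfolding a_def using X(2) by simp
  qed
  have na: "real N * ?x \<le> ?x ^ 2" using NrN0 by (simp add: power2_eq_square mult_right_mono)
  define e1 where "e1 = stage_err 0 (err1 N ?x) L"
  have er1: "err1 N ?x \<le> ?x ^ 8 / of_int S"
  proof -
    have "(real N * ?x) * ?x ^ 5 \<le> ?x ^ 2 * ?x ^ 5" using na by (intro mult_right_mono) auto
    then have "2 * ((real N * ?x) * ?x ^ 5) + 2 \<le> ?x ^ 8"
      using pow4[of 7] pow1[of 7] by (simp add: power_add[symmetric])
    then have "(2 * ((real N * ?x) * ?x ^ 5) + 2) / of_int S \<le> ?x ^ 8 / of_int S"
      using S0 by (intro divide_right_mono) auto
    then show ?thesis by (simp add: err1_def add_divide_distrib mult.assoc)
  qed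
  have e1: "e1 \<le> ?x ^ 10 / of_int S"
  proof -
    have "e1 \<le> real N ^ 2 * err1 N ?x"
      using stage_err_bound[OF err1_nonneg, of ?x 0 N L] unfolding e1_def L4 by simp
    also have "\<dots> \<le> ?x ^ 2 * (?x ^ 8 / of_int S)" using N2x er1 err1_nonneg[of ?x N] by (intro mult_mono) auto
    also have "\<dots> = ?x ^ 10 / of_int S" by (simp add: power_add[symmetric])
    finally show ?thesis .
  qed
  have xS: "?x ^ k / of_int S \<le> 1" if "k \<le> 20" for k
    using pow_le[OF that] S0 by (simp add: S_real divide_le_eq)
  have e1': "e1 \<le> 1" using e1 xS[of 10] by simp
  define b where "b q = dft a N q ^ 2" for q
  have nd: "cmod (dft a N q) \<le> ?x ^ 2" if "q < N" for q
    using norm_dft[of N a ?x q] a1 that na by fastforce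
  have nb: "cmod (b q) \<le> ?x ^ 4" if "q < N" for q
    using power_mono[OF nd[OF that], of 2] by (simp add: b_def norm_power power_mult[symmetric])
  define e2 where "e2 = e1 * (2 * ?x ^ 2 + 1) + 2 / of_int S"
  have e10: "0 \<le> e1"
  proof -
    have "0 \<le> stage_err 0 (err1 N ?x) 0" by simp
    also have "\<dots> \<le> stage_err 0 (err1 N ?x) L" by (rule stage_err_mono) (use err1_nonneg in auto)
    finally show ?thesis by (simp add: e1_def)
  qed
  have e2: "e2 \<le> ?x ^ 13 / of_int S"
  proof -
    have "e1 * (2 * ?x ^ 2 + 1) \<le> (?x ^ 10 / of_int S) * (3 * ?x ^ 2)"
      using e1 e10 pow1[of 2] by (intro mult_mono) auto
    also have "\<dots> = 3 * ?x ^ 12 / of_int S" by (simp add: power_add[symmetric])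
    finally have "e2 \<le> (3 * ?x ^ 12 + 2) / of_int S" unfolding e2_def by (simp add: add_divide_distrib)
    also have "\<dots> \<le> ?x ^ 13 / of_int S"
    proof (rule divide_right_mono)
      have "2 \<le> ?x ^ 12" using pow4[of 11] pow1[of 11] by simp
      then show "3 * ?x ^ 12 + 2 \<le> ?x ^ 13" using pow4[of 12] by simp
    qed (use S0 in simp)
    finally show ?thesis .
  qed
  define e3 where "e3 = stage_err e2 (err1 N (?x ^ 4)) L"
  have er2: "err1 N (?x ^ 4) \<le> ?x ^ 11 / of_int S"
  proof -
    have "(real N * ?x ^ 4) * ?x ^ 5 \<le> (?x * ?x ^ 4) * ?x ^ 5" using NrN0 by (intro mult_right_mono) auto
    also have "\<dots> = ?x ^ 10" by (simp add: power_add[symmetric] flip: power_Suc)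
    finally have "2 * ((real N * ?x ^ 4) * ?x ^ 5) + 2 \<le> ?x ^ 11"
      using pow4[of 10] pow1[of 10] by simp
    then have "(2 * ((real N * ?x ^ 4) * ?x ^ 5) + 2) / of_int S \<le> ?x ^ 11 / of_int S"
      using S0 by (intro divide_right_mono) auto
    then show ?thesis by (simp add: err1_def add_divide_distrib mult.assoc)
  qed
  have e3: "e3 \<le> 1 / 4"
  proof -
    have "e3 \<le> real N ^ 2 * (e2 + err1 N (?x ^ 4))"
      using stage_err_bound[OF err1_nonneg, of "?x ^ 4" e2 N L] unfolding e3_def L4 by simp
    also have "\<dots> \<le> ?x ^ 2 * (?x ^ 13 / of_int S + ?x ^ 11 / of_int S)"
      using N2x e2 er2 err1_nonneg[of "?x ^ 4" N] e10 S0
      by (intro mult_mono add_mono) (auto simp: e2_def)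
    also have "\<dots> = (?x ^ 15 + ?x ^ 13) / of_int S"
      by (simp add: power_add[symmetric] distrib_left add_divide_distrib)
    also have "\<dots> \<le> (?x ^ 19) / of_int S"
      using pow4[of 15] pow_le[of 13 15] pow_le[of 16 19] S0 pow1[of 15] by (intro divide_right_mono) auto
    also have "\<dots> \<le> (of_int S / 4) / of_int S"
      using pow4[of 19] S0 by (intro divide_right_mono) (auto simp: S_real)
    finally show ?thesis using S0 by simp
  qed
  let ?L1 = "vi ::= Cn 0;; While (Less (Vr vi) (Vr vN)) square"
  let ?L2 = "vi ::= Cn 0;; While (Less (Vr vi) (Vr vN)) accumulate"
  let ?R = "\<lambda>v' m'. \<forall>i. m' aW i = m aW i + (if i < N then v vg * int (c i) else 0)"
  have A1: "8 * (real N * ?x + 1) \<le> of_int S"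
    using na pow4[of 2] pow4[of 3] pow_le[of 4 20] pow1[of 2] by (simp add: S_real)
  have A2: "2 * ((?x ^ 2 + 1) * (?x ^ 2 + 1)) \<le> of_int S"
  proof -
    have "(?x ^ 2 + 1) * (?x ^ 2 + 1) \<le> (2 * ?x ^ 2) * (2 * ?x ^ 2)"
      using pow1[of 2] by (intro mult_mono) auto
    also have "\<dots> = 4 * ?x ^ 4" by (simp add: power_add[symmetric])
    finally show ?thesis using pow4[of 4] pow4[of 5] pow_le[of 6 20] pow1[of 5] by (simp add: S_real)
  qed
  have A3: "8 * (real N * ?x ^ 4 + 1) \<le> of_int S"
  proof -
    have "real N * ?x ^ 4 \<le> ?x * ?x ^ 4" using NrN0 by (intro mult_right_mono) auto
    also have "\<dots> = ?x ^ 5" by (simp flip: power_Suc)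
    finally show ?thesis using pow4[of 5] pow4[of 6] pow_le[of 7 20] pow1[of 5] by (simp add: S_real)
  qed
  have c1: "c i \<le> N0 ^ 2" for i
  proof -
    have "c i \<le> card (X \<times> X)" unfolding c_def by (rule card_mono) (use X(1) in auto)
    also have "\<dots> = card X * card X" by (simp add: card_cartesian_product)
    also have "\<dots> \<le> N0 * N0" using X(2) by (intro mult_le_mono)
    finally show ?thesis by (simp add: power2_eq_square)
  qed
  have res: "dft b N ((N - i) mod N) = of_nat (N * c i)" if "i < N" for i
    unfolding b_def c_def a_def by (rule dft_square_count[OF X(1,3) that])
  let ?T = "L * (N * 300 + 106) + 40"
  have "runs convolve v m (?T + (N * 156 + 9 + (?T + (N * 156 + 9)))) ?R"
    unfolding convolve_def
  proof (rule runs_seqI[OF _ order_refl])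
    show "runs fft v m ?T (\<lambda>v' m'. v' vh = int (N div 2) \<and>
      (\<forall>q<N. cmod (dec S (m' aXR q) (m' aXI q) - dft a N q) \<le> e1))"
      unfolding e1_def
    proof (rule runs_fft[OF N v tw _ _ a1 _ A1])
      show "cmod (dec S (m aXR k) (m aXI k) - a k) \<le> 0" if "k < N" for k
        using x[OF that] dec_int[OF S_pos] by (simp add: a_def)
    qed (use e1' in \<open>simp_all add: e1_def\<close>)
    fix v1 m1 assume s1: "same (wv fft) v1 v" "same (wa fft) m1 m"
      and q1: "v1 vh = int (N div 2) \<and> (\<forall>q<N. cmod (dec S (m1 aXR q) (m1 aXI q) - dft a N q) \<le> e1)"
    have v1: "v1 vN = int N" "scale_regs v1" "v1 vg = v vg" and m1: "m1 aW = m aW" "twiddles m1"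
      using v s1 tw by (simp_all add: scale_regs_def same_def wv_fft wa_fft twiddles_def)
    show "runs (?L1;; fft;; ?L2) v1 m1 (N * 156 + 9 + (?T + (N * 156 + 9))) ?R"
    proof (rule runs_seqI[OF square_loop[where f = "dft a N" and \<epsilon> = e1 and A = "?x ^ 2", OF v1(1,2) NN0(2) _ e1' nd _ A2] order_refl])
      fix v2 m2 assume s2: "same (wv ?L1) v2 v1" "same (wa ?L1) m2 m1"
        and q2: "\<forall>k<N. cmod (dec S (m2 aXR k) (m2 aXI k) - dft a N k ^ 2) \<le> e1 * (2 * ?x ^ 2 + 1) + 2 / of_int S"
      have v2: "v2 vN = int N" "scale_regs v2" "v2 vg = v vg" and m2: "m2 aW = m aW" "twiddles m2"
        using v1 m1 s2 by (simp_all add: scale_regs_def same_def wv_square wa_square twiddles_def)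
      show "runs (fft;; ?L2) v2 m2 (?T + (N * 156 + 9)) ?R"
      proof (rule runs_seqI[OF _ order_refl])
        show "runs fft v2 m2 ?T (\<lambda>v' m'. v' vh = int (N div 2) \<and>
          (\<forall>q<N. cmod (dec S (m' aXR q) (m' aXI q) - dft b N q) \<le> e3))"
          unfolding e3_def
        proof (rule runs_fft[OF N v2(1,2) m2(2) _ _ nb _ A3])
          show "cmod (dec S (m2 aXR k) (m2 aXI k) - b k) \<le> e2" if "k < N" for k
            using q2 that by (simp add: b_def e2_def)
        qed (use e3 in \<open>simp_all add: e3_def\<close>)
        fix v3 m3 assume s3: "same (wv fft) v3 v2" "same (wa fft) m3 m2"
          and q3: "v3 vh = int (N div 2) \<and> (\<forall>q<N. cmod (dec S (m3 aXR q) (m3 aXI q) - dft b N q) \<le> e3)"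
        have v3: "v3 vN = int N" "scale_regs v3" "v3 vg = v vg" "v3 vh = int h" and m3: "m3 aW = m aW"
          using v2 m2 s3 q3 by (simp_all add: scale_regs_def same_def wv_fft wa_fft h_def)
        have "runs ?L2 v3 m3 (N * 156 + 9) (\<lambda>v' m'. (\<forall>i<N. m' aW i = m3 aW i + v3 vg * int (c i)) \<and> (\<forall>i\<ge>N. m' aW i = m3 aW i))"
          by (rule accumulate_loop[where f = "dft b N", OF v3(1,4,2) h NN0(1) _ res c1])
            (use q3 e3 in \<open>auto intro: order_trans\<close>)
        then show "runs ?L2 v3 m3 (N * 156 + 9) ?R"
          by (rule runs_conseq) (auto simp: m3 v3(3))
      qed
    qed (use q1 in auto)
  qed
  then show ?thesis
  proof (rule runs_conseq)
    have "L * N \<ge> L * 2" using N2 by (intro mult_le_mono2)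
    moreover have "L * (N * 300 + 106) = 300 * (L * N) + 106 * L" "(L + 1) * N * 2000 = 2000 * (L * N) + 2000 * N"
      by (simp_all add: algebra_simps)
    ultimately show "?T + (N * 156 + 9 + (?T + (N * 156 + 9))) \<le> (L + 1) * N * 2000"
      using N2 by linarith
  qed (simp add: c_def)
qed

end

section \<open>Adjacency lists and roots of unity\<close>

abbreviation (input) "vs \<equiv> 16 :: nat"
abbreviation (input) "aIn \<equiv> 0 :: nat"
abbreviation (input) "aHead \<equiv> 1 :: nat"
abbreviation (input) "aNext \<equiv> 2 :: nat"

text \<open>Puts the arc \<open>vi + 1\<close> in front of the list of its source. The source is the
  other end of the edge: entry \<open>vi + 2\<close> for an odd arc number, entry \<open>vi\<close>
  for an even one.\<close>

definition link :: com where
  "link =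
    (If (Eq (Vr vi [%] Cn 2) (Cn 0)) (va ::= Rd aIn (Vr vi [+] Cn 2)) (va ::= Rd aIn (Vr vi));;
     Wr aNext (Vr vi [+] Cn 1) (Rd aHead (Vr va));;
     Wr aHead (Vr va) (Vr vi [+] Cn 1);;
     vi ::= Vr vi [+] Cn 1)"

definition build :: com where
  "build =
    ((vn ::= Rd aIn (Cn 0);; vN ::= Vr vn [+] Vr vn [-] Cn 2);;
     (vi ::= Cn 0;; While (Less (Vr vi) (Vr vN)) link))"

text \<open>\<open>vc = 0\<close> and \<open>vs = S\<close> are the exact cosine and sine of the
  quarter turn, where the halving starts with \<open>vN = 4\<close>. The scale
  \<open>N0 ^ 20\<close> is computed as the fifth power of \<open>N0 ^ 4\<close>.\<close>

definition choose_scale :: com where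
  "choose_scale =
    (vN0 ::= Cn 4;; While (Less (Vr vN0) (Cn 4 [*] Vr vn)) (vN0 ::= Vr vN0 [+] Vr vN0);;
     (va ::= Vr vN0 [*] Vr vN0;; va ::= Vr va [*] Vr va;;
      vS ::= Vr va [*] Vr va [*] Vr va [*] Vr va [*] Vr va;;
      vS2 ::= Vr vS [*] Vr vS;; vS3 ::= Vr vS2 [*] Vr vS;;
      vc ::= Cn 0;; vs ::= Vr vS;; vN ::= Cn 4))"

text \<open>The pair \<open>(vc, vs)\<close> represents cosine and sine of \<open>2 * \<pi> / vN\<close>. The halved angle has cosine
  \<open>sqrt ((1 + cos x) / 2)\<close>, found by bisection, and sine \<open>sin x / (2 * cos (x / 2))\<close>.\<close>

definition bisect :: com where
  "bisect =
    (vj ::= (Vr vb [+] Vr vd) [/] Cn 2;;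
     If (Less (Vr va) (Vr vj [*] Vr vj)) (vd ::= Vr vj) (vb ::= Vr vj))"

definition half_angle :: com where
  "half_angle =
    (((va ::= (Vr vS2 [+] Vr vc [*] Vr vS) [/] Cn 2;; vb ::= Cn 0;; vd ::= Cn 2 [*] Vr vS);;
      While (Less (Vr vb [+] Cn 1) (Vr vd)) bisect);;
     (vc ::= Vr vb;; vs ::= (Vr vs [*] Vr vS) [/] (Cn 2 [*] Vr vb);; vN ::= Vr vN [+] Vr vN))"

definition tabulate :: com where
  "tabulate =
    (Wr aTR (Vr vi) (Vr va);; Wr aTI (Vr vi) (Vr vb);;
     vj ::= rescale (Vr va [*] Vr vc [-] Vr vb [*] Vr vs);;
     vb ::= rescale (Vr va [*] Vr vs [+] Vr vb [*] Vr vc);;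
     va ::= Vr vj;; vi ::= Vr vi [+] Cn 1)"

definition setup_tables :: com where
  "setup_tables =
    (build;; choose_scale;; While (Less (Vr vN) (Vr vN0)) half_angle;;
     (va ::= Vr vS;; vb ::= Cn 0);; (vi ::= Cn 0;; While (Less (Vr vi) (Vr vN)) tabulate))"

lemma wv_link: "wv link = {6, 11}" and wa_link: "wa link = {1, 2}"
  and wv_bisect: "wv bisect = {7, 12, 14}" and wa_bisect: "wa bisect = {}"
  and wv_tabulate: "wv tabulate = {6, 7, 11, 12}" and wa_tabulate: "wa tabulate = {3, 4}"
  by (auto simp: link_def bisect_def tabulate_def)

lemma wv_half_angle: "wv half_angle = {5, 7, 11, 12, 13, 14, 16}" and wa_half_angle: "wa half_angle = {}"
  by (auto simp: half_angle_def wv_bisect wa_bisect)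

lemma wv_build: "wv build = {0, 5, 6, 11}" and wa_build: "wa build = {1, 2}"
  and wv_choose_scale: "wv choose_scale = {1, 2, 3, 4, 5, 11, 13, 16}" and wa_choose_scale: "wa choose_scale = {}"
  by (auto simp: build_def choose_scale_def wv_link wa_link)

lemma wa_setup_tables: "wa setup_tables = {1, 2, 3, 4}"
  by (auto simp: setup_tables_def wa_build wa_choose_scale wa_half_angle wa_tabulate)

lemma cst_link: "cst link \<le> 100" and cst_bisect: "cst bisect \<le> 60" and cst_tabulate: "cst tabulate \<le> 150"
  by (simp_all add: link_def bisect_def tabulate_def rescale_def acost_def)

text \<open>Entries \<open>2 * j + 1\<close> and \<open>2 * j + 2\<close> of the input are the ends of one edge; arc \<open>e\<close> points to entry \<open>e\<close>.\<close>

locale solver = fixed_point w B N0 S + arc_tree n E arcs src tgt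
  for w B N0 and S :: int and n E arcs src tgt +
  fixes inp :: "nat \<Rightarrow> nat" and k0 :: nat
  assumes n1: "1 \<le> n" and arcs: "arcs = 2 * (n - 1)" and B: "B = 8 * n" and N0: "N0 = 4 * 2 ^ k0" and k0: "n \<le> 2 ^ k0" "k0 = 0 \<or> 2 ^ (k0 - 1) < n"
    and src: "src e = inp (if odd e then e + 1 else e - 1)" and tgt: "tgt e = inp e"
begin

lemma runs_build:
  assumes inp: "\<And>i. i \<le> arcs \<Longrightarrow> m aIn i = int (inp i)" "inp 0 = n" and m1: "\<And>u. m aHead u = 0"
  shows "runs build v m (2 * n * 106 + 40) (\<lambda>v' m'. v' vn = int n \<and>
    (\<forall>u<n. m' aHead u = int (first_arc u)) \<and> (\<forall>e. 1 \<le> e \<longrightarrow> e \<le> arcs \<longrightarrow> m' aNext e = int (next_arc e)))"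
proof -
  let ?v = "v(vn := int n, vN := int arcs)"
  let ?I = "\<lambda>i v' m'. (\<forall>u<n. m' aHead u = int (prev_arc src u (Suc i))) \<and>
    (\<forall>e. 1 \<le> e \<longrightarrow> e \<le> i \<longrightarrow> m' aNext e = int (next_arc e))"
  have aB: "arcs \<le> B" using B arcs by simp
  have loop: "runs (vi ::= Cn 0;; While (Less (Vr vi) (Vr vN)) link) ?v m (arcs * (100 + 6) + 9) (?I arcs)"
  proof (rule count_loop[where I = ?I and v = ?v, OF refl aB _ _ _ _ cst_link])
    show "vN \<notin> wv link" by (simp add: wv_link)
    show "?I 0 (?v(vi := 0)) m" using m1 by (simp add: prev_arc.simps)
    fix i v' m' assume I: "?I i v' m'" and i: "i < arcs" and vi: "v' vi = int i"
      and sm: "same (wa link) m' m"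
    have m0: "m' aIn = m aIn" using sm by (simp add: same_def wa_link)
    let ?e = "Suc i"
    have e: "1 \<le> ?e" "?e \<le> arcs" using i by simp_all
    have sn: "src ?e < n" using arc_less[OF e] by simp
    have iB: "int i + 2 < int B" "i < B" using i B arcs by linarith+
    have i2: "even i \<Longrightarrow> i + 2 \<le> arcs" using i arcs by presburger
    have M2: "int i < M" "2 < M" using iB B_M by linarith+
    then have iw: "i < 2 ^ w" "1 + int i < int B" using iB by simp_all
    have srcv: "even i \<Longrightarrow> m aIn (i + 2) = int (src ?e)" "odd i \<Longrightarrow> m aIn i = int (src ?e)"
      using inp(1)[of "i + 2"] inp(1)[of i] i2 i by (simp_all add: src)
    have par: "int i mod 2 = 0 \<longleftrightarrow> even i" by presburger
    have okm: "okw (int i mod 2)" "okw 0" using M2 by (simp_all add: okw_def)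
    have n2: "nat (int i + 2) = i + 2" "nat (1 + int i) = Suc i" "nat (int i + 1) = Suc i" by simp_all
    have nxt: "next_arc ?e = prev_arc src (src ?e) ?e" by (simp add: next_arc_def)
    have snB: "int (src ?e) < int B" "src ?e < B" using sn B by linarith+
    have hd: "m' aHead (src ?e) = int (prev_arc src (src ?e) ?e)" using I sn by blast
    have post: "?I ?e w (m'(aNext := (m' aNext)(?e := m' aHead (src ?e)), aHead := (m' aHead)(src ?e := 1 + int i)))" for w
      using I hd nxt by (auto simp: prev_arc.simps(2)[of src _ "Suc i"] le_Suc_eq)
    show "wpf link (\<lambda>v'' m''. ?I (Suc i) v'' m'' \<and> v'' vi = int (Suc i)) v' m'"
      using post srcv
      by (cases "even i")
       (simp_all add: link_def vi m0 iB iw M2 par okm n2 snB add.commute[of _ "1::int"] par[unfolded even_iff_mod_2_eq_zero])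
  qed simp
  show ?thesis unfolding build_def
  proof (rule runs_seqI[OF runs_wpf_le[where Q = "\<lambda>v' m'. v' = ?v \<and> m' = m" and t = 30]])
    have "0 < B" using B n1 by simp
    then show "wpf (vn ::= Rd aIn (Cn 0);; vN ::= Vr vn [+] Vr vn [-] Cn 2) (\<lambda>v' m'. v' = ?v \<and> m' = m) v m"
      using inp(1)[of 0] inp(2) n1 by (simp add: of_nat_diff arcs)
    fix v' m' assume e: "v' = ?v \<and> m' = m"
    show "runs (vi ::= Cn 0;; While (Less (Vr vi) (Vr vN)) link) v' m' (2 * n * 106 + 9) (\<lambda>v' m'. v' vn = int n \<and>
    (\<forall>u<n. m' aHead u = int (first_arc u)) \<and> (\<forall>e. 1 \<le> e \<longrightarrow> e \<le> arcs \<longrightarrow> m' aNext e = int (next_arc e)))"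
      unfolding e[THEN conjunct1] e[THEN conjunct2]
    proof (rule runs_conseq[OF loop])
      show "arcs * (100 + 6) + 9 \<le> 2 * n * 106 + 9" using arcs by simp
      fix v2 m2 assume "?I arcs v2 m2" "same (wv (vi ::= Cn 0;; While (Less (Vr vi) (Vr vN)) link)) v2 ?v"
      then show "v2 vn = int n \<and> (\<forall>u<n. m2 aHead u = int (first_arc u)) \<and>
        (\<forall>e. 1 \<le> e \<longrightarrow> e \<le> arcs \<longrightarrow> m2 aNext e = int (next_arc e))"
        unfolding first_arc_def by (simp add: same_def wv_link)
    qed
  qed (simp_all add: acost_def)
qed

lemma N0_le: "N0 \<le> 8 * n"
proof (cases k0)
  case 0 then show ?thesis using N0 n1 by simp
next
  case (Suc k) then show ?thesis using N0 k0(2) by simp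
qed

lemma runs_choose_scale:
  assumes v: "v vn = int n"
  shows "runs choose_scale v m (k0 * 30 + 200)
    (\<lambda>v' m'. scale_regs v' \<and> v' vc = 0 \<and> v' vs = S \<and> v' vN = 4)"
proof -
  let ?b = "Less (Vr vN0) (Cn 4 [*] Vr vn)" and ?c = "vN0 ::= Vr vN0 [+] Vr vN0"
  let ?v = "v(vN0 := 4)"
  let ?I = "\<lambda>i v' m'. v' vN0 = int (4 * 2 ^ i)"
  have BM: "int (8 * n) < M" "int N0 < M" using B_M B N0_B by linarith+
  have loop: "runs (While ?b ?c) ?v m (k0 * (20 + bcost ?b + 1) + bcost ?b + 1) (?I k0)"
  proof (rule runs_for)
    fix i v' m' assume I: "?I i v' m'" and i: "i < k0" and sv: "same (wv ?c) v' ?v"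
    have vn: "v' vn = int n" using v sv by (simp add: same_def)
    have "(2::nat) ^ i \<le> 2 ^ (k0 - 1)" using i by (intro power_increasing) auto
    also have "\<dots> < n" using k0(2) i by simp
    finally have l2: "2 ^ i < n" .
    then have lt: "int (4 * 2 ^ i) < int (4 * n)" by linarith
    then have "int (4 * 2 ^ i) < M" using BM(1) by linarith
    then have lM: "4 * 2 ^ i < M" by simp
    then show "okb ?b v' m' \<and> bv ?b v' m' \<and> runs ?c v' m' 20 (?I (Suc i))"
      using I vn BM lM l2 runs_wpf_le[of ?c "?I (Suc i)" v' m' 20] by (auto simp: okw_def)
  next
    fix v' m' assume I: "?I k0 v' m'" and sv: "same (wv ?c) v' ?v"
    have vn: "v' vn = int n" using v sv by (simp add: same_def)
    have "int (4 * n) \<le> int (4 * 2 ^ k0)" using k0(1) by simp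
    then show "okb ?b v' m' \<and> \<not> bv ?b v' m'" using I vn BM N0 by (simp add: okw_def)
  qed simp
  let ?T = "va ::= Vr vN0 [*] Vr vN0;; va ::= Vr va [*] Vr va;;
      vS ::= Vr va [*] Vr va [*] Vr va [*] Vr va [*] Vr va;;
      vS2 ::= Vr vS [*] Vr vS;; vS3 ::= Vr vS2 [*] Vr vS;;
      vc ::= Cn 0;; vs ::= Vr vS;; vN ::= Cn 4"
  show ?thesis unfolding choose_scale_def
  proof (rule runs_seqI[OF runs_wpf_le[where Q = "\<lambda>v' m'. v' = ?v \<and> m' = m" and t = 3]])
    fix v' m' assume e: "v' = ?v \<and> m' = m"
    show "runs (While ?b ?c;; ?T) v' m' (k0 * 30 + 160) (\<lambda>v' m'. scale_regs v' \<and> v' vc = 0 \<and> v' vs = S \<and> v' vN = 4)"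
      unfolding e[THEN conjunct1] e[THEN conjunct2]
    proof (rule runs_seqI[OF loop])
      fix v1 m1 assume "?I k0 v1 m1"
      then have N0v: "v1 vN0 = int N0" using N0 by simp
      show "runs ?T v1 m1 100 (\<lambda>v' m'. scale_regs v' \<and> v' vc = 0 \<and> v' vs = S \<and> v' vN = 4)"
      proof (rule runs_wpf_le)
        let ?X = "int N0 * int N0 * (int N0 * int N0)"
        have S: "?X * ?X * ?X * ?X * ?X = S" by (simp add: S_def eval_nat_numeral mult.assoc)
        show "wpf ?T (\<lambda>v' m'. scale_regs v' \<and> v' vc = 0 \<and> v' vs = S \<and> v' vN = 4) v1 m1"
          by (simp only: wpf.simps ok.simps ev.simps sem_op.simps ok_op.simps fun_upd_apply N0v S)
            (simp add: scale_regs_def N0v[unfolded One_nat_def], simp only: S simp_thms)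
      qed simp
    qed simp
  qed simp_all
qed

text \<open>Bisection starts with an interval of length \<open>2 * S\<close>; as this is a power of
  two, every halving is exact and the number of iterations is logarithmic in
  \<open>n\<close>.\<close>

lemma S_pow2: "2 * S = 2 ^ (20 * (k0 + 2) + 1)"
proof -
  have "int N0 = 2 ^ (k0 + 2)" using N0 by simp
  then have "int N0 ^ 20 = 2 ^ ((k0 + 2) * 20)" by (simp only: power_mult)
  then have "2 * S = 2 ^ Suc ((k0 + 2) * 20)" by (simp only: S_def power_Suc)
  then show ?thesis by (simp only: mult.commute[of "k0 + 2"] Suc_eq_plus1)
qed

lemma S_16: "16 \<le> S"
proof -
  have "int N0 ^ 2 \<le> int N0 ^ 20" using N0_4 by (intro power_increasing) auto
  moreover have "4 * 4 \<le> int N0 * int N0" using N0_4 by (intro mult_mono) auto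
  ultimately show ?thesis by (simp add: S_def power2_eq_square)
qed

lemma S2_M: "4 * (S * S) < M"
proof -
  have "16 * (S * S) \<le> S * (S * S)" using S_16 by (intro mult_right_mono) auto
  then have "16 * (S * S) \<le> S * S * S" by (simp only: mult.assoc)
  moreover have "0 < S * S" using S_pos by simp
  ultimately show ?thesis using S_M by linarith
qed

lemma runs_bisect:
  assumes v: "v va = y" "v vb = 0" "v vd = 2 * S" and y: "0 \<le> y" "y < 4 * (S * S)"
  shows "runs (While (Less (Vr vb [+] Cn 1) (Vr vd)) bisect) v m ((20 * (k0 + 2) + 1) * 70 + 20)
    (\<lambda>v' m'. 0 \<le> v' vb \<and> v' vb * v' vb \<le> y \<and> y < (v' vb + 1) * (v' vb + 1) \<and> v' vb \<le> 2 * S)"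
proof -
  define J where "J = 20 * (k0 + 2) + 1"
  let ?b = "Less (Vr vb [+] Cn 1) (Vr vd)"
  let ?I = "\<lambda>i v' m'. v' vd = v' vb + 2 ^ (J - i) \<and> 0 \<le> v' vb \<and> v' vb * v' vb \<le> y \<and> y < v' vd * v' vd \<and> v' vd \<le> 2 * S"
  have SM: "2 * S < M" using S2_M S_16 mult_right_mono[of 16 S S] S_pos by linarith
  have loop: "runs (While ?b bisect) v m (J * (60 + bcost ?b + 1) + bcost ?b + 1) (?I J)"
  proof (rule runs_for[where I = ?I])
    have "2 ^ J = 2 * S" using S_pow2 by (simp only: J_def)
    then show "?I 0 v m" using v y S_pos by simp
  next
    fix i v' m' assume I: "?I i v' m'" and i: "i < J" and sv: "same (wv bisect) v' v"
    have va: "v' va = y" using v sv by (simp add: same_def wv_bisect)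
    define lo hi where "lo = v' vb" and "hi = v' vd"
    define d :: int where "d = 2 ^ (J - Suc i)"
    have "J - i = Suc (J - Suc i)" using i by simp
    then have "(2::int) ^ (J - i) = 2 * d" by (simp add: d_def)
    then have L: "hi = lo + 2 * d" "0 \<le> lo" "lo * lo \<le> y" "y < hi * hi" "hi \<le> 2 * S"
    proof -
      assume d2: "(2::int) ^ (J - i) = 2 * d"
      have "v' vd = v' vb + 2 ^ (J - i)" "0 \<le> v' vb" "v' vb * v' vb \<le> y" "y < v' vd * v' vd" "v' vd \<le> 2 * S"
        using I by blast+
      then show "hi = lo + 2 * d" "0 \<le> lo" "lo * lo \<le> y" "y < hi * hi" "hi \<le> 2 * S"
        by (simp_all only: lo_def hi_def d2)
    qed
    have d1: "1 \<le> d" by (simp add: d_def)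
    have mid: "(lo + hi) div 2 = lo + d" using L(1) by simp
    have "(lo + d) * (lo + d) \<le> (2 * S) * (2 * S)" using L d1 by (intro mult_mono) auto
    then have sq: "(lo + d) * (lo + d) < M" "0 \<le> (lo + d) * (lo + d)" using S2_M L d1 by simp_all
    have yM: "y < M" using y S2_M by linarith
    have sumM: "lo + hi < M" "2 < M"
      using L S2_M S_16 mult_right_mono[of 16 S S] d1 by linarith+
    have "wpf bisect (?I (Suc i)) v' m'"
      using L d1 sq yM y sumM
      by (simp add: bisect_def va lo_def[symmetric] hi_def[symmetric] mid d_def[symmetric] okw_def)
    then show "okb ?b v' m' \<and> bv ?b v' m' \<and> runs bisect v' m' 60 (?I (Suc i))"
      using L d1 SM runs_wpf_le[OF _ cst_bisect] by (simp add: okw_def lo_def[symmetric] hi_def[symmetric])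
  next
    fix v' m' assume I: "?I J v' m'"
    then show "okb ?b v' m' \<and> \<not> bv ?b v' m'" using SM by (simp add: okw_def)
  qed
  then show ?thesis
  proof (rule runs_conseq)
    show "J * (60 + bcost ?b + 1) + bcost ?b + 1 \<le> (20 * (k0 + 2) + 1) * 70 + 20" by (simp add: J_def)
    fix v' m' assume I: "?I J v' m'"
    then have "v' vd = v' vb + 1" by simp
    then show "0 \<le> v' vb \<and> v' vb * v' vb \<le> y \<and> y < (v' vb + 1) * (v' vb + 1) \<and> v' vb \<le> 2 * S"
      using I by (metis (no_types, lifting) add_increasing2 le_add_same_cancel1 order_trans zero_le_one)
  qed
qed

text \<open>The tolerance vanishes at \<open>N = 4\<close>, where the start values are exact, and
  survives halving the angle: \<open>4 * (N ^ 2 - 16) + 16 \<le> (2 * N) ^ 2 - 16\<close>.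
  Nonnegativity keeps the values fit for division.\<close>

definition near :: "int \<Rightarrow> real \<Rightarrow> nat \<Rightarrow> bool" where
  "near c x N \<longleftrightarrow> 0 \<le> c \<and> \<bar>of_int c / of_int S - x\<bar> \<le> (real N ^ 2 - 16) / of_int S"

lemma near_bound:
  assumes "near c x N" "N \<le> N0" "\<bar>x\<bar> \<le> 1"
  shows "c \<le> 2 * S"
proof -
  have S0: "0 < real_of_int S" using S_pos by simp
  have "real N ^ 2 \<le> real N0 ^ 2" using assms(2) by (intro power_mono) auto
  moreover have "real N0 ^ 2 \<le> real N0 ^ 20" by (rule pow_le) simp
  ultimately have "real N ^ 2 - 16 \<le> of_int S" unfolding S_real by linarith
  then have "(real N ^ 2 - 16) / of_int S \<le> 1" using S0 by (simp add: divide_le_eq)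
  then have "of_int c / of_int S \<le> (2::real)" using assms(1,3) unfolding near_def by linarith
  then have "real_of_int c \<le> of_int (2 * S)" using S0 by (simp add: divide_le_eq)
  then show ?thesis by (simp only: of_int_le_iff)
qed

lemma runs_half_angle:
  assumes N: "4 \<le> N" "2 * N \<le> N0" and v: "v vN = int N" "scale_regs v"
    and c: "near (v vc) (cos (2 * pi / real N)) N" and s: "near (v vs) (sin (2 * pi / real N)) N"
  shows "runs half_angle v m (k0 * 1400 + 3200) (\<lambda>v' m'. v' vN = int (2 * N) \<and>
    near (v' vc) (cos (2 * pi / real (2 * N))) (2 * N) \<and> near (v' vs) (sin (2 * pi / real (2 * N))) (2 * N))"
proof -
  have r: "v vS = S" "v vS2 = S * S" using v by (simp_all add: scale_regs_def)
  define c0 s0 where "c0 = v vc" and "s0 = v vs"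
  have NN0: "N \<le> N0" using N by simp
  have cb: "0 \<le> c0" "c0 \<le> 2 * S" "0 \<le> s0" "s0 \<le> 2 * S"
    using near_bound[OF c NN0] near_bound[OF s NN0] c s by (auto simp: near_def c0_def s0_def)
  define y where "y = (S * S + c0 * S) div 2"
  have "c0 * S \<le> (2 * S) * S" using cb S_pos by (intro mult_right_mono) auto
  then have cS: "c0 * S \<le> 2 * (S * S)" by simp
  have "s0 * S \<le> (2 * S) * S" using cb S_pos by (intro mult_right_mono) auto
  then have sS: "s0 * S \<le> 2 * (S * S)" by simp
  have pos: "0 \<le> c0 * S" "0 < S * S" "0 \<le> s0 * S" using cb S_pos by simp_all
  have y: "0 \<le> y" "y < 4 * (S * S)" using pos cS unfolding y_def by linarith+
  have yg: "S * S + c0 * S < M" "0 \<le> S * S + c0 * S" "s0 * S < M" using pos cS sS S2_M by linarith+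
  have SM: "4 * S < M" "2 < M" using S2_M S_16 mult_right_mono[of 16 S S] S_pos by linarith+
  let ?P = "va ::= (Vr vS2 [+] Vr vc [*] Vr vS) [/] Cn 2;; vb ::= Cn 0;; vd ::= Cn 2 [*] Vr vS"
  let ?W = "While (Less (Vr vb [+] Cn 1) (Vr vd)) bisect"
  let ?F = "vc ::= Vr vb;; vs ::= (Vr vs [*] Vr vS) [/] (Cn 2 [*] Vr vb);; vN ::= Vr vN [+] Vr vN"
  let ?v = "v(va := y, vb := 0, vd := 2 * S)"
  show ?thesis unfolding half_angle_def
  proof (rule runs_seqI)
    show "runs (?P;; ?W) v m (60 + ((20 * (k0 + 2) + 1) * 70 + 20)) (\<lambda>v' m'. 0 \<le> v' vb \<and>
       v' vb * v' vb \<le> y \<and> y < (v' vb + 1) * (v' vb + 1) \<and> v' vb \<le> 2 * S \<and> v' vN = int N \<and> v' vs = s0 \<and> v' vS = S)"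
    proof (rule runs_seqI[OF runs_wpf_le[where Q = "\<lambda>v' m'. v' = ?v \<and> m' = m" and t = 60] order_refl])
      show "wpf ?P (\<lambda>v' m'. v' = ?v \<and> m' = m) v m"
        using yg SM by (simp add: r c0_def[symmetric] y_def[symmetric])
      fix v1 m1 assume e: "v1 = ?v \<and> m1 = m"
      show "runs ?W v1 m1 ((20 * (k0 + 2) + 1) * 70 + 20) (\<lambda>v' m'. 0 \<le> v' vb \<and>
       v' vb * v' vb \<le> y \<and> y < (v' vb + 1) * (v' vb + 1) \<and> v' vb \<le> 2 * S \<and> v' vN = int N \<and> v' vs = s0 \<and> v' vS = S)"
        unfolding e[THEN conjunct1] e[THEN conjunct2]
        by (rule runs_conseq[OF runs_bisect[of ?v y, OF _ _ _ y] order_refl])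
          (use v r in \<open>auto simp: same_def wv_bisect s0_def\<close>)
    qed simp
    fix v1 m1 assume q: "0 \<le> v1 vb \<and> v1 vb * v1 vb \<le> y \<and> y < (v1 vb + 1) * (v1 vb + 1) \<and> v1 vb \<le> 2 * S \<and>
      v1 vN = int N \<and> v1 vs = s0 \<and> v1 vS = S"
    define lo where "lo = v1 vb"
    have lo: "0 \<le> lo" "lo * lo \<le> y" "y < (lo + 1) * (lo + 1)" "lo \<le> 2 * S" using q by (simp_all add: lo_def)
    let ?th = "2 * pi / real N" and ?\<delta> = "(real N ^ 2 - 16) / of_int S"
    have S0: "0 < real_of_int S" using S_pos by simp
    have "2 * pi / real N \<le> 2 * pi / 4" using N(1) by (intro divide_left_mono) auto
    then have th: "0 \<le> ?th" "?th \<le> pi / 2" by simp_all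
    have \<delta>: "?\<delta> + 3 / of_int S \<le> 1 / 8"
    proof -
      have "real N ^ 2 \<le> real N0 ^ 2" using NN0 by (intro power_mono) auto
      moreover have "real N0 ^ 4 \<le> real N0 ^ 20" "4 * real N0 ^ 2 \<le> real N0 ^ 3" "4 * real N0 ^ 3 \<le> real N0 ^ 4"
        using pow4[of 2] pow4[of 3] pow_le[of 4 20] by simp_all
      ultimately have "8 * real N ^ 2 - 104 \<le> of_int S" using zero_le_power2[of "real N0"] unfolding S_real by linarith
      then have "(real N ^ 2 - 16 + 3) / of_int S \<le> (of_int S / 8) / of_int S"
        using S0 by (intro divide_right_mono) simp_all
      then show ?thesis using S0 by (simp only: add_divide_distrib) simp
    qed
    have ce: "\<bar>of_int c0 / of_int S - cos ?th\<bar> \<le> ?\<delta>" "\<bar>of_int s0 / of_int S - sin ?th\<bar> \<le> ?\<delta>"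
      using c s by (auto simp: near_def c0_def s0_def)
    note ha = half_angle_error[OF S_16 th ce \<delta> y_def lo(1-3)]
    have \<delta>': "4 * ?\<delta> + 16 / of_int S \<le> (real (2 * N) ^ 2 - 16) / of_int S"
    proof -
      have gen: "4 * (a / s) + 16 / s = (4 * a + 16) / s" for a s :: real
        by (simp add: add_divide_distrib)
      have "4 * ?\<delta> + 16 / of_int S = (4 * (real N ^ 2 - 16) + 16) / of_int S" by (rule gen)
      also have "\<dots> \<le> (real (2 * N) ^ 2 - 16) / of_int S"
        using S0 by (intro divide_right_mono) (auto simp: power_mult_distrib)
      finally show ?thesis .
    qed
    have th2: "?th / 2 = 2 * pi / real (2 * N)" by simp
    have nc: "near lo (cos (2 * pi / real (2 * N))) (2 * N)"
      using ha(1) \<delta>' lo(1) unfolding th2 near_def by (auto intro: order_trans)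
    have ns: "near (s0 * S div (2 * lo)) (sin (2 * pi / real (2 * N))) (2 * N)"
      using ha(2) \<delta>' ha(3) pos(3) unfolding th2 near_def by (auto intro: order_trans simp: pos_imp_zdiv_nonneg_iff)
    have "wpf ?F (\<lambda>v' m'. v' vN = int (2 * N) \<and>
      near (v' vc) (cos (2 * pi / real (2 * N))) (2 * N) \<and> near (v' vs) (sin (2 * pi / real (2 * N))) (2 * N)) v1 m1"
    proof -
      have "2 * lo < M" using lo(4) SM by linarith
      then show ?thesis using nc ns q yg pos lo(1) by (simp add: lo_def[symmetric])
    qed
    then show "runs ?F v1 m1 60 (\<lambda>v' m'. v' vN = int (2 * N) \<and>
      near (v' vc) (cos (2 * pi / real (2 * N))) (2 * N) \<and> near (v' vs) (sin (2 * pi / real (2 * N))) (2 * N))"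
      by (rule runs_wpf_le) simp
  qed simp
qed

text \<open>There are \<open>k0\<close> halvings with a number of bisection steps linear in
  \<open>k0\<close> each, so the basic angle costs only polylogarithmic time.\<close>

lemma runs_angles:
  assumes v: "v vN = 4" "scale_regs v" "v vc = 0" "v vs = S"
  shows "runs (While (Less (Vr vN) (Vr vN0)) half_angle) v m (k0 * (k0 * 1400 + 3210) + 10) (\<lambda>v' m'. v' vN = int N0 \<and>
    near (v' vc) (cos (2 * pi / real N0)) N0 \<and> near (v' vs) (sin (2 * pi / real N0)) N0)"
proof -
  let ?b = "Less (Vr vN) (Vr vN0)"
  let ?I = "\<lambda>i v' m'. v' vN = int (4 * 2 ^ i) \<and>
    near (v' vc) (cos (2 * pi / real (4 * 2 ^ i))) (4 * 2 ^ i) \<and> near (v' vs) (sin (2 * pi / real (4 * 2 ^ i))) (4 * 2 ^ i)"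
  have N0M: "int N0 < M" using N0_B B_M by linarith
  have "runs (While ?b half_angle) v m (k0 * (k0 * 1400 + 3200 + bcost ?b + 1) + bcost ?b + 1) (?I k0)"
  proof (rule runs_for)
    show "?I 0 v m" using v S_pos by (simp add: near_def)
  next
    fix i v' m' assume I: "?I i v' m'" and i: "i < k0" and sv: "same (wv half_angle) v' v"
    have v': "scale_regs v'" "v' vN0 = int N0" using v sv by (simp_all add: scale_regs_def same_def wv_half_angle)
    have "(2::nat) ^ Suc i \<le> 2 ^ k0" using i by (intro power_increasing) auto
    then have le: "2 * (4 * 2 ^ i) \<le> N0" using N0 by simp
    have "4 * 2 ^ i < N0" using le zero_less_power[of "2::nat" i] by linarith
    then have "int (4 * 2 ^ i) < int N0" by (simp only: of_nat_less_iff)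
    moreover have "runs half_angle v' m' (k0 * 1400 + 3200) (?I (Suc i))"
      using runs_half_angle[of "4 * 2 ^ i" v' m', OF _ le _ v'(1)] I by (simp add: mult.assoc mult.left_commute)
    moreover have "okw (v' vN)"
    proof -
      have "int (4 * 2 ^ i) < M" using \<open>int (4 * 2 ^ i) < int N0\<close> N0M by linarith
      moreover have "v' vN = int (4 * 2 ^ i)" using I by blast
      ultimately show ?thesis by (simp only: okw_def of_nat_0_le_iff)
    qed
    moreover have "okw (v' vN0)" using v' N0M by (simp add: okw_def)
    moreover have "v' vN < v' vN0" using I v'(2) \<open>int (4 * 2 ^ i) < int N0\<close> by simp
    ultimately show "okb ?b v' m' \<and> bv ?b v' m' \<and> runs half_angle v' m' (k0 * 1400 + 3200) (?I (Suc i))"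
      by simp
  next
    fix v' m' assume I: "?I k0 v' m'" and sv: "same (wv half_angle) v' v"
    have "v' vN0 = int N0" using v sv by (simp_all add: scale_regs_def same_def wv_half_angle)
    then show "okb ?b v' m' \<and> \<not> bv ?b v' m'" using I N0M N0 by (simp add: okw_def)
  qed
  then show ?thesis by (rule runs_conseq) (simp add: algebra_simps, simp add: N0)
qed

text \<open>By \<open>twiddle_error\<close> each product adds at most \<open>\<rho>\<close>, so
  entry \<open>i\<close> is off by at most \<open>real i * \<rho>\<close>. As \<open>\<rho>\<close>
  is of order \<open>N0 ^ 2 / S\<close>, plain repeated multiplication meets the tolerance
  \<open>N0 ^ 5 / S\<close> of \<open>twiddles\<close>.\<close>

lemma runs_table:
  assumes v: "v vN = int N0" "scale_regs v" "v va = S" "v vb = 0"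
    and c: "near (v vc) (cos (2 * pi / real N0)) N0" and s: "near (v vs) (sin (2 * pi / real N0)) N0"
  shows "runs (vi ::= Cn 0;; While (Less (Vr vi) (Vr vN)) tabulate) v m (N0 * 156 + 9) (\<lambda>v' m'. twiddles m')"
proof -
  let ?x = "real N0"
  have S0: "0 < real_of_int S" using S_pos by simp
  define c0 s0 where "c0 = v vc" and "s0 = v vs"
  define \<delta> where "\<delta> = 2 * (?x ^ 2 / of_int S)"
  define \<rho> where "\<rho> = 2 * \<delta> + 2 / of_int S"
  have cb: "0 \<le> c0" "c0 \<le> 2 * S" "0 \<le> s0" "s0 \<le> 2 * S"
    using near_bound[OF c] near_bound[OF s] c s by (auto simp: near_def c0_def s0_def)
  have u: "cmod (dec S c0 s0 - om N0 1) \<le> \<delta>"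
  proof -
    have e: "(?x ^ 2 - 16) / of_int S \<le> ?x ^ 2 / of_int S" using S0 by (intro divide_right_mono) auto
    have "\<bar>Re (dec S c0 s0 - om N0 1)\<bar> \<le> ?x ^ 2 / of_int S" "\<bar>Im (dec S c0 s0 - om N0 1)\<bar> \<le> ?x ^ 2 / of_int S"
      using c s e by (auto simp: near_def c0_def s0_def dec_def om_def intro: order_trans)
    then show ?thesis using cmod_le[of "dec S c0 s0 - om N0 1"] by (simp add: \<delta>_def)
  qed
  have \<rho>0: "0 \<le> \<rho>" using S0 by (simp add: \<rho>_def \<delta>_def)
  have \<rho>x: "?x * \<rho> \<le> ?x ^ 5 / of_int S"
  proof -
    have "?x * (4 * ?x ^ 2 + 2) \<le> ?x * ?x ^ 4"
      using pow4[of 2] pow4[of 3] pow1[of 3] by (intro mult_left_mono) auto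
    then have "?x * (4 * ?x ^ 2 + 2) / of_int S \<le> ?x ^ 5 / of_int S"
      using S0 by (intro divide_right_mono) (simp_all flip: power_Suc)
    then show ?thesis by (simp add: \<rho>_def \<delta>_def add_divide_distrib distrib_left)
  qed
  have small: "?x ^ 5 / of_int S \<le> 1" using pow_le[of 5 20] S0 by (simp add: S_real divide_le_eq)
  have i\<rho>: "real i * \<rho> \<le> ?x ^ 5 / of_int S" if "i < N0" for i
    using mult_right_mono[of "real i" ?x \<rho>] that \<rho>0 \<rho>x by simp
  let ?I = "\<lambda>i v' m'. cmod (dec S (v' va) (v' vb) - om N0 i) \<le> real i * \<rho> \<and>
    (\<forall>k<i. cmod (dec S (m' aTR k) (m' aTI k) - om N0 k) \<le> ?x ^ 5 / of_int S)"
  have loop: "runs (vi ::= Cn 0;; While (Less (Vr vi) (Vr vN)) tabulate) v m (N0 * (150 + 6) + 9) (?I N0)"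
  proof (rule count_loop[where I = ?I and v = v, OF refl N0_B v(1) _ _ _ cst_tabulate])
    show "vN \<notin> wv tabulate" by (simp add: wv_tabulate)
    show "?I 0 (v(vi := 0)) m" using v(3,4) dec_int[OF S_pos, of 1] by simp
    fix i v' m' assume I: "?I i v' m'" and i: "i < N0" and vi: "v' vi = int i"
      and sv: "same (wv tabulate) v' (v(vi := 0))"
    have r: "v' vS = S" "v' vS2 = S * S" "v' vS3 = S * S * S" "v' vc = c0" "v' vs = s0"
      using v sv by (simp_all add: scale_regs_def same_def wv_tabulate c0_def s0_def)
    define p q where "p = v' va" and "q = v' vb"
    have X: "cmod (dec S p q - om N0 i) \<le> real i * \<rho>" using I by (simp add: p_def q_def)
    have le1: "real i * \<rho> \<le> 1" using i\<rho>[OF i] small by linarith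
    have "cmod (dec S p q) \<le> 2" using norm_triangle_ineq[of "dec S p q - om N0 i" "om N0 i"] X le1 by simp
    from dec_bound[OF S_pos this] have pq: "\<bar>real_of_int p\<bar> \<le> 2 * of_int S" "\<bar>real_of_int q\<bar> \<le> 2 * of_int S" .
    have "\<bar>real_of_int c0\<bar> \<le> 2 * of_int S" "\<bar>real_of_int s0\<bar> \<le> 2 * of_int S"
    proof -
      have "real_of_int c0 \<le> of_int (2 * S)" "real_of_int s0 \<le> of_int (2 * S)"
        using cb by (simp_all only: of_int_le_iff)
      then show "\<bar>real_of_int c0\<bar> \<le> 2 * of_int S" "\<bar>real_of_int s0\<bar> \<le> 2 * of_int S" using cb by simp_all
    qed
    note b = product_bound[OF S_pos _ _ _ pq this]
    have S8: "2 * (2 * 2) \<le> real_of_int S" using S_16 by simp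
    have pb: "\<bar>p * c0 - q * s0\<bar> \<le> S * S * S" "\<bar>p * s0 + q * c0\<bar> \<le> S * S * S"
      using b[OF _ _ S8] by simp_all
    note g = S3_M[OF pb(1)] S3_M[OF pb(2)]
    have iB: "int i < int B" and iBn: "i < B" using i N0_B by linarith+
    have new: "cmod (dec S ((p * c0 - q * s0) div S) ((p * s0 + q * c0) div S) - om N0 (Suc i)) \<le> real (Suc i) * \<rho>"
    proof -
      have "cmod (dec S ((p * c0 - q * s0) div S) ((p * s0 + q * c0) div S) - om N0 i * om N0 1) \<le> real i * \<rho> + (2 * \<delta> + 2 / of_int S)"
        by (rule twiddle_error[OF X _ _ le1 u dec_mult_error[OF S_pos]]) simp_all
      moreover have "om N0 i * om N0 1 = om N0 (Suc i)" using om_add[of N0 i 1] by simp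
      ultimately show ?thesis by (simp add: \<rho>_def[symmetric] distrib_right)
    qed
    have rs: "(p * c0 - q * s0 + S * S * S) div S - S * S = (p * c0 - q * s0) div S"
      "(p * s0 + q * c0 + S * S * S) div S - S * S = (p * s0 + q * c0) div S" by (rule rescale_value[OF S_pos])+
    have cur: "cmod (dec S p q - om N0 i) \<le> ?x ^ 5 / of_int S" using X i\<rho>[OF i] by linarith
    show "wpf tabulate (\<lambda>v'' m''. ?I (Suc i) v'' m'' \<and> v'' vi = int (Suc i)) v' m'"
      unfolding tabulate_def rescale_def
      using I new cur
      by (simp add: r vi iB iBn p_def[symmetric] q_def[symmetric] g g[simplified] rs[simplified]
          less_imp_le[OF S_pos] S_lt_M less_Suc_eq)
  qed
  then show ?thesis by (rule runs_conseq) (simp_all add: twiddles_def)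
qed

lemma runs_setup:
  assumes inp: "\<And>i. i \<le> arcs \<Longrightarrow> m aIn i = int (inp i)" "inp 0 = n" and m1: "\<And>u. m aHead u = 0"
  shows "runs setup_tables v m (n * 1600 + (k0 + 1) * (k0 + 1) * 4000) (\<lambda>v' m'. v' vn = int n \<and>
    (\<forall>u<n. m' aHead u = int (first_arc u)) \<and> (\<forall>e. 1 \<le> e \<longrightarrow> e \<le> arcs \<longrightarrow> m' aNext e = int (next_arc e)) \<and>
    scale_regs v' \<and> twiddles m')"
proof -
  let ?G = "\<lambda>v' m'. v' vn = int n \<and> (\<forall>u<n. m' aHead u = int (first_arc u)) \<and>
    (\<forall>e. 1 \<le> e \<longrightarrow> e \<le> arcs \<longrightarrow> m' aNext e = int (next_arc e))"
  let ?L1 = "While (Less (Vr vN) (Vr vN0)) half_angle" and ?P = "va ::= Vr vS;; vb ::= Cn 0"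
  let ?L2 = "vi ::= Cn 0;; While (Less (Vr vi) (Vr vN)) tabulate"
  let ?R = "\<lambda>v' m'. ?G v' m' \<and> scale_regs v' \<and> twiddles m'"
  have "runs setup_tables v m ((2 * n * 106 + 40) + ((k0 * 30 + 200) + ((k0 * (k0 * 1400 + 3210) + 10) + (20 + (N0 * 156 + 9))))) ?R"
    unfolding setup_tables_def
  proof (rule runs_seqI[OF runs_build[OF inp m1] order_refl])
    fix v1 m1 assume g: "?G v1 m1"
    show "runs (choose_scale;; ?L1;; ?P;; ?L2) v1 m1
      ((k0 * 30 + 200) + ((k0 * (k0 * 1400 + 3210) + 10) + (20 + (N0 * 156 + 9)))) ?R"
    proof (rule runs_seqI[OF runs_choose_scale order_refl])
      show "v1 vn = int n" using g by simp
      fix v2 m2 assume s: "same (wv choose_scale) v2 v1" "same (wa choose_scale) m2 m1"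
        and q: "scale_regs v2 \<and> v2 vc = 0 \<and> v2 vs = S \<and> v2 vN = 4"
      have g2: "?G v2 m2" using g s by (simp add: same_def wv_choose_scale wa_choose_scale)
      show "runs (?L1;; ?P;; ?L2) v2 m2 ((k0 * (k0 * 1400 + 3210) + 10) + (20 + (N0 * 156 + 9))) ?R"
      proof (rule runs_seqI[OF runs_angles order_refl])
        fix v3 m3 assume s: "same (wv ?L1) v3 v2" "same (wa ?L1) m3 m2"
          and q3: "v3 vN = int N0 \<and> near (v3 vc) (cos (2 * pi / real N0)) N0 \<and> near (v3 vs) (sin (2 * pi / real N0)) N0"
        have g3: "?G v3 m3" "scale_regs v3" using g2 q s by (simp_all add: same_def wv_half_angle wa_half_angle scale_regs_def)
        let ?v = "v3(va := S, vb := 0)"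
        show "runs (?P;; ?L2) v3 m3 (20 + (N0 * 156 + 9)) ?R"
        proof (rule runs_seqI[OF runs_wpf_le[where Q = "\<lambda>v' m'. v' = ?v \<and> m' = m3" and t = 20] order_refl])
          show "wpf ?P (\<lambda>v' m'. v' = ?v \<and> m' = m3) v3 m3" using g3(2) by (simp add: scale_regs_def)
          fix v4 m4 assume e: "v4 = ?v \<and> m4 = m3"
          show "runs ?L2 v4 m4 (N0 * 156 + 9) ?R"
            unfolding e[THEN conjunct1] e[THEN conjunct2]
          proof (rule runs_conseq[OF runs_table order_refl])
            show "scale_regs ?v" using g3(2) by (simp add: scale_regs_def)
            fix v5 m5 assume "same (wv ?L2) v5 ?v" "same (wa ?L2) m5 m3" "twiddles m5"
            then show "?R v5 m5" using g3 by (simp add: same_def wv_tabulate wa_tabulate scale_regs_def)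
          qed (use q3 in simp_all)
        qed simp
      qed (use q in simp_all)
    qed
  qed
  then show ?thesis
    by (rule runs_conseq) (use N0_le n1 in \<open>simp_all add: algebra_simps\<close>)
qed

end

section \<open>Counting pairs in one component\<close>

text \<open>Breadth-first search from \<open>vr\<close> fills \<open>aQ\<close> with the visited vertices, \<open>aP\<close> with their parents and
  \<open>aD\<close> with their depths, counted from \<open>vd0\<close>; \<open>vt\<close> is the number of visited vertices. Removed vertices
  are marked in \<open>aRm\<close>. The dummy parent of the root is \<open>n\<close>.\<close>

abbreviation (input) "vt \<equiv> 17 :: nat"
abbreviation (input) "vhd \<equiv> 18 :: nat"
abbreviation (input) "vr \<equiv> 19 :: nat"
abbreviation (input) "vd0 \<equiv> 20 :: nat"
abbreviation (input) "ve \<equiv> 21 :: nat"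
abbreviation (input) "vu \<equiv> 22 :: nat"
abbreviation (input) "vw \<equiv> 23 :: nat"
abbreviation (input) "vk \<equiv> 26 :: nat"
abbreviation (input) "aQ \<equiv> 10 :: nat"
abbreviation (input) "aP \<equiv> 11 :: nat"
abbreviation (input) "aD \<equiv> 12 :: nat"
abbreviation (input) "aSz \<equiv> 13 :: nat"
abbreviation (input) "aRm \<equiv> 14 :: nat"

definition bfs_start :: com where
  "bfs_start =
    (Wr aQ (Cn 0) (Vr vr);; Wr aP (Vr vr) (Vr vn);; Wr aD (Vr vr) (Vr vd0);;
     vt ::= Cn 1;; vhd ::= Cn 0;; vu ::= Vr vr;; ve ::= Rd aHead (Vr vr))"

definition bfs_step :: com where
  "bfs_step =
    If (Eq (Vr ve) (Cn 0))
      (vhd ::= Vr vhd [+] Cn 1;;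
       If (Less (Vr vhd) (Vr vt)) (vu ::= Rd aQ (Vr vhd);; ve ::= Rd aHead (Vr vu)) Skip)
      (vw ::= Rd aIn (Vr ve);;
       If (Eq (Vr vw) (Rd aP (Vr vu))) Skip
         (If (Eq (Rd aRm (Vr vw)) (Cn 0))
           (Wr aP (Vr vw) (Vr vu);; Wr aD (Vr vw) (Rd aD (Vr vu) [+] Cn 1);;
            Wr aQ (Vr vt) (Vr vw);; vt ::= Vr vt [+] Cn 1)
           Skip);;
       ve ::= Rd aNext (Vr ve))"

definition bfs :: com where
  "bfs = (bfs_start;; While (Less (Vr vhd) (Vr vt)) bfs_step)"

text \<open>With an offset of at most \<open>1\<close>, depths are at most \<open>vt\<close>, so a
  length above \<open>2 * vt\<close> keeps the square from wrapping around. Doubling from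
  \<open>4\<close> ends at no more than four times \<open>vt\<close>.\<close>

definition choose_length :: com where
  "choose_length = (vN ::= Cn 4;; While (Less (Vr vN) (Vr vt [+] Vr vt [+] Cn 1)) (vN ::= Vr vN [+] Vr vN))"

definition clear :: com where
  "clear = (Wr aXR (Vr vi) (Cn 0);; Wr aXI (Vr vi) (Cn 0);; vi ::= Vr vi [+] Cn 1)"

definition tally :: com where
  "tally =
    (vj ::= Rd aD (Rd aQ (Vr vi));; Wr aXR (Vr vj) (Rd aXR (Vr vj) [+] Vr vS);; vi ::= Vr vi [+] Cn 1)"

definition add_pairs :: com where
  "add_pairs =
    (bfs;; choose_length;; (vi ::= Cn 0;; While (Less (Vr vi) (Vr vN)) clear);;
     (vi ::= Cn 0;; While (Less (Vr vi) (Vr vt)) tally);; convolve)"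

definition unit_sizes :: com where
  "unit_sizes = (Wr aSz (Rd aQ (Vr vi)) (Cn 1);; vi ::= Vr vi [+] Cn 1)"

definition merge_size :: com where
  "merge_size =
    (vu ::= Rd aQ (Vr vk);; vw ::= Rd aP (Vr vu);;
     Wr aSz (Vr vw) (Rd aSz (Vr vw) [+] Rd aSz (Vr vu));; vk ::= Vr vk [-] Cn 1)"

text \<open>The last vertex of the search order whose subtree contains at least half of the component is a
  centroid.\<close>

definition find_centroid :: com where
  "find_centroid =
    ((vi ::= Cn 0;; While (Less (Vr vi) (Vr vt)) unit_sizes);; vk ::= Vr vt [-] Cn 1;;
     While (Less (Cn 2 [*] Rd aSz (Rd aQ (Vr vk))) (Vr vt)) merge_size;; vr ::= Rd aQ (Vr vk))"

lemma wv_bfs_step: "wv bfs_step = {17, 18, 21, 22, 23}" and wa_bfs_step: "wa bfs_step = {10, 11, 12}"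
  by (auto simp: bfs_step_def)

lemma wv_bfs: "wv bfs = {17, 18, 21, 22, 23}" and wa_bfs: "wa bfs = {10, 11, 12}"
  by (auto simp: bfs_def bfs_start_def wv_bfs_step wa_bfs_step)

lemma wv_choose_length: "wv choose_length = {5}" and wa_choose_length: "wa choose_length = {}"
  and wv_clear: "wv clear = {6}" and wa_clear: "wa clear = {5, 6}"
  and wv_tally: "wv tally = {6, 7}" and wa_tally: "wa tally = {5}"
  and wv_unit_sizes: "wv unit_sizes = {6}" and wa_unit_sizes: "wa unit_sizes = {13}"
  and wv_merge_size: "wv merge_size = {22, 23, 26}" and wa_merge_size: "wa merge_size = {13}"
  by (auto simp: choose_length_def clear_def tally_def unit_sizes_def merge_size_def)

lemma wv_add_pairs: "wv add_pairs = {5, 6, 7, 8, 9, 10, 11, 12, 13, 14, 17, 18, 21, 22, 23}"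
  and wa_add_pairs: "wa add_pairs = {5, 6, 7, 8, 9, 10, 11, 12}"
  by (auto simp: add_pairs_def wv_bfs wa_bfs wv_choose_length wa_choose_length wv_clear wa_clear
      wv_tally wa_tally wv_convolve wa_convolve)

lemma wv_find_centroid: "wv find_centroid = {6, 19, 22, 23, 26}" and wa_find_centroid: "wa find_centroid = {13}"
  by (auto simp: find_centroid_def wv_unit_sizes wa_unit_sizes wv_merge_size wa_merge_size)

lemma cst_bfs_step: "cst bfs_step \<le> 200" and cst_clear: "cst clear \<le> 50" and cst_tally: "cst tally \<le> 100"
  and cst_unit_sizes: "cst unit_sizes \<le> 60" and cst_merge_size: "cst merge_size \<le> 120"
  by (simp_all add: bfs_step_def clear_def tally_def unit_sizes_def merge_size_def acost_def)

text \<open>The search arrays are not cleared between searches. Nonnegativity of their stale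
  contents lets them be read as functions into \<open>nat\<close>, as \<open>bfs_inv\<close>
  expects.\<close>

definition nat_array :: "(nat \<Rightarrow> int) \<Rightarrow> bool" where
  "nat_array f \<longleftrightarrow> (\<forall>i. 0 \<le> f i)"

lemma nat_arrayE:
  assumes "nat_array f" obtains g where "f = (\<lambda>i. int (g i))"
proof
  show "f = (\<lambda>i. int (nat (f i)))" using assms by (auto simp: nat_array_def)
qed

lemma int_fun_upd: "(\<lambda>i. int (g i))(x := int y) = (\<lambda>i. int ((g(x := y)) i))"
  by auto

context solver
begin

definition graph_ok :: "nat set \<Rightarrow> vars \<Rightarrow> arrs \<Rightarrow> bool" where
  "graph_ok R v m \<longleftrightarrow> v vn = int n \<and> (\<forall>u<n. m aHead u = int (first_arc u)) \<and>
    (\<forall>e. 1 \<le> e \<longrightarrow> e \<le> arcs \<longrightarrow> m aNext e = int (next_arc e) \<and> m aIn e = int (tgt e)) \<and>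
    (\<forall>u<n. m aRm u = (if u \<in> R then 1 else 0)) \<and> nat_array (m aQ) \<and> nat_array (m aP) \<and> nat_array (m aD)"

text \<open>Once the queue is exhausted, \<open>ve\<close> and \<open>vu\<close> hold stale values,
  hence the condition in the last line.\<close>

definition bfs_state :: "nat set \<Rightarrow> nat \<Rightarrow> nat \<Rightarrow> nat \<times> nat \<times> nat \<times> (nat \<Rightarrow> nat) \<times> (nat \<Rightarrow> nat) \<times> (nat \<Rightarrow> nat) \<Rightarrow>
    vars \<Rightarrow> arrs \<Rightarrow> bool" where
  "bfs_state R r d0 g v m \<longleftrightarrow> (case g of (h, e, t, q, p, d) \<Rightarrow> bfs_inv R r d0 h e t q p d \<and>
    v vhd = int h \<and> v vt = int t \<and> m aQ = (\<lambda>i. int (q i)) \<and> m aP = (\<lambda>i. int (p i)) \<and> m aD = (\<lambda>i. int (d i)) \<and>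
    (h < t \<longrightarrow> v ve = int e \<and> v vu = int (q h)))"

lemma bfs_bounds:
  assumes inv: "bfs_inv R r d0 h e t q p d" and h: "h < t"
  shows "t \<le> n" "q h < n" "e \<le> arcs" "p (q h) \<le> n" "\<And>k. k < t \<Longrightarrow> q k < n"
proof -
  have i: "inj_on q {..<t}" "q ` {..<t} \<subseteq> part R r" "q 0 = r" "p r = n"
    "\<forall>k. 0 < k \<and> k < t \<longrightarrow> (\<exists>j<k. j \<le> h \<and> q j = p (q k) \<and> {q j, q k} \<in> E)"
    using inv by (simp_all add: bfs_inv_def)
  have sub: "q ` {..<t} \<subseteq> {..<n}" using i(2) part_sub[of R r] by blast
  show "t \<le> n" using card_inj_on_le[OF i(1) sub] by simp
  show qn: "\<And>k. k < t \<Longrightarrow> q k < n" using sub by blast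
  then show "q h < n" using h by blast
  show "e \<le> arcs" using inv h by (simp add: bfs_inv_def)
  show "p (q h) \<le> n"
  proof (cases "h = 0")
    case False
    then obtain j where "j < h" "q j = p (q h)" using i(5) h by blast
    then show ?thesis using qn[of j] h by simp
  qed (use i in simp)
qed

lemma runs_bfs:
  assumes g: "graph_ok R v m" and r: "v vr = int r" "r \<in> {..<n} - R" and d0: "v vd0 = int d0"
  shows "runs bfs v m (weight (part R r) * 210 + 100) (\<lambda>v' m'. \<exists>q p d. bfs_done R r d0 (card (part R r)) q p d \<and>
    v' vt = int (card (part R r)) \<and> m' aQ = (\<lambda>i. int (q i)) \<and> m' aP = (\<lambda>i. int (p i)) \<and> m' aD = (\<lambda>i. int (d i)))"
proof -
  let ?b = "Less (Vr vhd) (Vr vt)"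
  have rn: "r < n" using r by simp
  have nB: "int n < int B" "int n < M" using B n1 B_M by linarith+
  have nw: "n < 2 ^ w" using nB(2) by simp
  obtain q0 p0 d0' where a: "m aQ = (\<lambda>i. int (q0 i))" "m aP = (\<lambda>i. int (p0 i))" "m aD = (\<lambda>i. int (d0' i))"
    using g nat_arrayE unfolding graph_ok_def by metis
  let ?g = "(0, first_arc r, 1, q0(0 := r), p0(r := n), d0'(r := d0))"
  have gr: "v vn = int n" "m aHead r = int (first_arc r)" using g rn by (simp_all add: graph_ok_def)
  have start: "wpf bfs_start (\<lambda>v' m'. bfs_state R r d0 ?g v' m' \<and> same {17, 18, 21, 22, 23} v' v \<and> same {10, 11, 12} m' m) v m"
    using bfs_init[OF r(2), of d0 q0 p0 d0'] rn nB
    by (simp add: bfs_start_def bfs_state_def r d0 gr gr(2)[unfolded One_nat_def] a int_fun_upd same_def)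
  have T: "cst bfs_start \<le> 60" by (simp add: bfs_start_def acost_def)
  show ?thesis unfolding bfs_def
  proof (rule runs_seqI[OF runs_wpf_le[OF start T]])
    fix v1 m1 assume s1: "bfs_state R r d0 ?g v1 m1 \<and> same {17, 18, 21, 22, 23} v1 v \<and> same {10, 11, 12} m1 m"
    let ?Phi = "\<lambda>(h, e, t, q, p, d). bfs_todo R r h e t q * 210"
    have "runs (While ?b bfs_step) v1 m1 (?Phi ?g + bcost ?b + 1) (\<lambda>v' m'. \<exists>g'. bfs_state R r d0 g' v' m' \<and> \<not> bv ?b v' m')"
    proof (rule runs_while)
      show "bfs_state R r d0 ?g v1 m1" using s1 by blast
    next
      fix g v' m' assume st: "bfs_state R r d0 g v' m'"
        and sv: "same (wv bfs_step) v' v1" and sm: "same (wa bfs_step) m' m1"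
      obtain h e t q p d where g: "g = (h, e, t, q, p, d)" by (cases g)
      have I: "bfs_inv R r d0 h e t q p d" "v' vhd = int h" "v' vt = int t" "m' aQ = (\<lambda>i. int (q i))"
        "m' aP = (\<lambda>i. int (p i))" "m' aD = (\<lambda>i. int (d i))" "h < t \<Longrightarrow> v' ve = int e \<and> v' vu = int (q h)"
        using st by (simp_all add: bfs_state_def g)
      have ht: "h \<le> t" "1 \<le> t" using I(1) by (simp_all add: bfs_inv_def)
      have tn: "t \<le> n"
      proof -
        have "inj_on q {..<t}" "q ` {..<t} \<subseteq> {..<n}" using I(1) part_sub[of R r] by (auto simp: bfs_inv_def)
        then show ?thesis using card_inj_on_le[of q "{..<t}" "{..<n}"] by simp
      qed
      have tM: "int h < M" "int t < M" using ht tn nB by linarith+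
      then show "okb ?b v' m'" using I by (simp add: okw_def)
      assume "bv ?b v' m'"
      then have h: "h < t" using I by simp
      note b = bfs_bounds[OF I(1) h]
      have m1: "m1 aHead = m aHead" "m1 aNext = m aNext" "m1 aIn = m aIn" "m1 aRm = m aRm"
        using s1 by (simp_all add: same_def)
      have m': "m' aHead = m aHead" "m' aNext = m aNext" "m' aIn = m aIn" "m' aRm = m aRm"
        using sm m1 by (simp_all add: same_def wa_bfs_step)
      note m' = m' m'(1)[unfolded One_nat_def]
      have vv: "v' ve = int e" "v' vu = int (q h)" using I(7) h by simp_all
      have hd: "\<And>u. u < n \<Longrightarrow> m aHead u = int (first_arc u)" and rm: "\<And>u. u < n \<Longrightarrow> m aRm u = (if u \<in> R then 1 else 0)"
        and nx: "\<And>e. 1 \<le> e \<Longrightarrow> e \<le> arcs \<Longrightarrow> m aNext e = int (next_arc e) \<and> m aIn e = int (tgt e)"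
        using assms(1) by (simp_all add: graph_ok_def)
      have "arcs < B" using B arcs n1 by linarith
      then have eB: "int e < int B" "e < B" "e < 2 ^ w" using b(3) B_less(1) by linarith+
      have qB: "q h < B" "int (q h) < int B" using b(2) nB by linarith+
      have one: "0 < M" by simp
      have w2: "(1::int) < M" using nB(2) n1 by linarith
      have "\<exists>g'. wpf bfs_step (bfs_state R r d0 g') v' m' \<and> ?Phi g' + 200 + bcost ?b + 1 \<le> ?Phi g"
      proof (cases "e = 0")
        case True
        note nv = bfs_next_vertex[OF I(1)[unfolded True] h] and td = bfs_todo_vertex[OF I(1)[unfolded True] h]
        let ?g = "(Suc h, first_arc (q (Suc h)), t, q, p, d)"
        have hM: "Suc h < 2 ^ w" "1 + int h < M" "int t < M" "Suc h < t \<Longrightarrow> 1 + int h < int B" using h tn nw nB by linarith+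
        have tw: "t < 2 ^ w" using tn nw by linarith
        have "wpf bfs_step (bfs_state R r d0 ?g) v' m'"
        proof (cases "Suc h < t")
          case True
          have "q (Suc h) < B" "int (q (Suc h)) < int B" using b(5)[OF True] nB by linarith+
          then show ?thesis
            using nv \<open>e = 0\<close> True hM(4) hd[OF b(5)[OF True]] one
            by (simp add: hM(1-3) tw bfs_step_def bfs_state_def I vv m' okw_def add.commute[of _ "1::int"] nat_add_distrib)
        next
          case False
          then have "Suc h = t" using h by simp
          then show ?thesis
            using nv \<open>e = 0\<close> False one
            by (simp add: hM(1-3) tw bfs_step_def bfs_state_def I vv m' okw_def add.commute[of _ "1::int"] nat_add_distrib)
        qed
        then show ?thesis using td True by (intro exI[of _ ?g]) (simp add: g)
      next
        case False
        then have e1: "1 \<le> e" by simp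
        have tg: "tgt e < n" using arc_less[OF e1 b(3)] by simp
        have tgB: "int (tgt e) < int B" "tgt e < B" "tgt e < 2 ^ w" using tg nB nw by linarith+
        have pw: "p (q h) < 2 ^ w" using b(4) nw by linarith
        have nxe: "m aNext e = int (next_arc e)" "m aIn e = int (tgt e)" using nx[OF e1 b(3)] by simp_all
        show ?thesis
        proof (cases "tgt e = p (q h) \<or> tgt e \<in> R")
          case True
          note sk = bfs_skip[OF I(1) h False True] and td = bfs_todo_arc[OF I(1) h False order_refl, of q]
          let ?g = "(h, next_arc e, t, q, p, d)"
          have "wpf bfs_step (bfs_state R r d0 ?g) v' m'"
            using sk True False eB qB tgB pw one w2
            by (auto simp: bfs_step_def bfs_state_def I vv m' okw_def nxe rm[OF tg])
          then show ?thesis using td by (intro exI[of _ ?g]) (simp add: g)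
        next
          case nsk: False
          then have ns: "tgt e \<noteq> p (q h)" "tgt e \<notin> R" by simp_all
          note ad = bfs_add[OF I(1) h False ns]
          have td: "bfs_todo R r h (next_arc e) (Suc t) (q(t := tgt e)) < bfs_todo R r h e t q"
            by (rule bfs_todo_arc[OF I(1) h False]) auto
          have "Suc t \<le> n" using bfs_bounds(1)[OF ad(1)] h by simp
          then have tB: "t < B" "int t < int B" using nB by linarith+
          let ?g = "(h, next_arc e, Suc t, q(t := tgt e), p(tgt e := q h), d(tgt e := d (q h) + 1))"
          have neq: "tgt e \<noteq> q h" using ad(2) h by auto
          have "wpf bfs_step (bfs_state R r d0 ?g) v' m'"
            using ad(1) ns False eB qB tgB pw one w2 tB neq h
            by (simp add: bfs_step_def bfs_state_def I vv m' okw_def nxe rm[OF tg] fun_eq_iff)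
          then show ?thesis using td by (intro exI[of _ ?g]) (simp add: g)
        qed
      qed
      then obtain g' where g': "wpf bfs_step (bfs_state R r d0 g') v' m'" "?Phi g' + 200 + bcost ?b + 1 \<le> ?Phi g" by blast
      show "\<exists>ta. runs bfs_step v' m' ta (\<lambda>v'' m''. \<exists>g'. bfs_state R r d0 g' v'' m'' \<and> ?Phi g' + ta + bcost ?b + 1 \<le> ?Phi g)"
        by (rule exI[of _ 200], rule runs_conseq[OF runs_wpf_le[OF g'(1) cst_bfs_step] order_refl]) (use g'(2) in blast)
    qed
    then show "runs (While ?b bfs_step) v1 m1 (weight (part R r) * 210 + 40) (\<lambda>v' m'. \<exists>q p d. bfs_done R r d0 (card (part R r)) q p d \<and>
    v' vt = int (card (part R r)) \<and> m' aQ = (\<lambda>i. int (q i)) \<and> m' aP = (\<lambda>i. int (p i)) \<and> m' aD = (\<lambda>i. int (d i)))"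
    proof (rule runs_conseq)
      show "?Phi ?g + bcost ?b + 1 \<le> weight (part R r) * 210 + 40"
        using bfs_todo_init[OF r(2), of q0] by simp
      fix v' m' assume "\<exists>g'. bfs_state R r d0 g' v' m' \<and> \<not> bv ?b v' m'"
      then obtain h e t q p d where st: "bfs_state R r d0 (h, e, t, q, p, d) v' m'" "\<not> bv ?b v' m'" by auto
      then have I: "bfs_inv R r d0 h e t q p d" "v' vhd = int h" "v' vt = int t"
        by (simp_all add: bfs_state_def)
      have "h = t" using I st(2) by (simp add: bfs_inv_def)
      then have "bfs_done R r d0 t q p d" using bfs_finish I(1) by simp
      moreover from this have "card (part R r) = t" by (rule bfs_done_card)
      ultimately show "\<exists>q p d. bfs_done R r d0 (card (part R r)) q p d \<and>
        v' vt = int (card (part R r)) \<and> m' aQ = (\<lambda>i. int (q i)) \<and> m' aP = (\<lambda>i. int (p i)) \<and> m' aD = (\<lambda>i. int (d i))"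
        using st(1) by (auto simp: bfs_state_def)
    qed
  qed simp
qed

text \<open>The path from \<open>r\<close> to \<open>x\<close> stays in the component, and its
  vertices are distinct.\<close>

lemma dst_less_card:
  assumes "r \<in> {..<n} - R" "x \<in> part R r" shows "dst r x < card (part R r)"
proof -
  obtain p where p: "walk_betw (part R r) E r p x" "distinct p"
    using con_path[OF part_con part_self[OF assms(1)] assms(2)] by blast
  have "walk_betw {..<n} E r p x" using walk_mono[OF p(1)] part_sub[of R r] by blast
  then have "dst r x = length p - 1" by (rule dst_path[OF _ p(2)])
  moreover have "length p \<le> card (part R r)"
    using p card_mono[OF finite_part, of "set p"] distinct_card[OF p(2)] by (auto simp: walk_betw_def)
  moreover have "0 < length p" using p(1) by (simp add: walk_betw_def)
  ultimately show ?thesis by linarith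
qed

lemma card_part_le: "card (part R r) \<le> n"
  using card_mono[of "{..<n}" "part R r"] part_sub[of R r] by auto

lemma runs_choose_length:
  assumes v: "v vt = int t" and t: "1 \<le> t" "t \<le> n"
  obtains i where "i \<le> k0" "2 * t < 4 * 2 ^ i" "4 * 2 ^ i \<le> 4 * t"
    "runs choose_length v m (i * 40 + 40) (\<lambda>v' m'. v' vN = int (4 * 2 ^ i))"
proof -
  let ?P = "\<lambda>i. 2 * t < 4 * 2 ^ i"
  have ex: "?P k0" using t k0(1) by linarith
  define i where "i = (LEAST i. ?P i)"
  have i: "?P i" "i \<le> k0" using LeastI[of ?P, OF ex] Least_le[of ?P, OF ex] by (simp_all add: i_def)
  have less: "\<not> ?P j" if "j < i" for j using not_less_Least that unfolding i_def by blast
  have up: "4 * 2 ^ i \<le> 4 * t"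
  proof (cases i)
    case 0 then show ?thesis using t by simp
  next
    case (Suc j) then show ?thesis using less[of j] by simp
  qed
  let ?b = "Less (Vr vN) (Vr vt [+] Vr vt [+] Cn 1)" and ?c = "vN ::= Vr vN [+] Vr vN"
  let ?v = "v(vN := 4)"
  let ?I = "\<lambda>i v' m'. v' vN = int (4 * 2 ^ i)"
  have BM: "int (8 * n) < M" using B_M B by linarith
  have loop: "runs (While ?b ?c) ?v m (i * (20 + bcost ?b + 1) + bcost ?b + 1) (?I i)"
  proof (rule runs_for[where I = ?I])
    fix j v' m' assume I: "?I j v' m'" and j: "j < i" and sv: "same (wv ?c) v' ?v"
    have vt: "v' vt = int t" using v sv by (simp add: same_def)
    have l: "int (4 * 2 ^ j) \<le> int (2 * t)" using less[OF j] by (simp only: of_nat_le_iff not_less)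
    have okw: "okw (v' vN)" "okw (v' vt + v' vt + 1)" using I vt l t BM unfolding okw_def by linarith+
    have "v' vN < v' vt + v' vt + 1" using I l vt by simp
    then show "okb ?b v' m' \<and> bv ?b v' m' \<and> runs ?c v' m' 20 (?I (Suc j))"
      using I okw runs_wpf_le[of ?c "?I (Suc j)" v' m' 20] by simp
  next
    fix v' m' assume I: "?I i v' m'" and sv: "same (wv ?c) v' ?v"
    have vt: "v' vt = int t" using v sv by (simp add: same_def)
    have "int (4 * 2 ^ i) \<le> int (4 * t)" using up by (simp only: of_nat_le_iff)
    then have okw: "okw (v' vN)" "okw (v' vt + v' vt + 1)" using I vt t BM unfolding okw_def by linarith+
    have "int (2 * t) < int (4 * 2 ^ i)" using i(1) by (simp only: of_nat_less_iff)
    then have "\<not> v' vN < v' vt + v' vt + 1" using I vt by simp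
    then show "okb ?b v' m' \<and> \<not> bv ?b v' m'" using okw by simp
  qed simp
  have "runs choose_length v m (i * 40 + 40) (?I i)" unfolding choose_length_def
  proof (rule runs_seqI[OF runs_wpf_le[where Q = "\<lambda>v' m'. v' = ?v \<and> m' = m" and t = 3]])
    fix v' m' assume e: "v' = ?v \<and> m' = m"
    show "runs (While ?b ?c) v' m' (i * 40 + 30) (?I i)"
      unfolding e[THEN conjunct1] e[THEN conjunct2] by (rule runs_conseq[OF loop]) simp_all
  qed simp_all
  then show ?thesis using that i up by blast
qed

lemma runs_clear:
  assumes "v vN = int N" "N \<le> B"
  shows "runs (vi ::= Cn 0;; While (Less (Vr vi) (Vr vN)) clear) v m (N * 56 + 9)
    (\<lambda>v' m'. \<forall>k<N. m' aXR k = 0 \<and> m' aXI k = 0)"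
proof -
  let ?I = "\<lambda>i (v' :: vars) (m' :: arrs). \<forall>k<i. m' aXR k = 0 \<and> m' aXI k = 0"
  have "runs (vi ::= Cn 0;; While (Less (Vr vi) (Vr vN)) clear) v m (N * (50 + 6) + 9)
    (?I N)"
  proof (rule count_loop[where I = ?I and v = v, OF refl assms(2,1) _ _ _ cst_clear])
    show "vN \<notin> wv clear" by (simp add: wv_clear)
    fix i and v' :: vars and m' :: arrs assume "\<forall>k<i. m' aXR k = 0 \<and> m' aXI k = 0" "i < N" "v' vi = int i"
    then show "wpf clear (\<lambda>v'' m''. (\<forall>k<Suc i. m'' aXR k = 0 \<and> m'' aXI k = 0) \<and> v'' vi = int (Suc i)) v' m'"
      using assms(2) by (simp add: clear_def less_Suc_eq)
  qed simp
  then show ?thesis by simp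
qed

lemma runs_tally:
  assumes v: "v vt = int t" "v vS = S" and q: "m aQ = (\<lambda>i. int (q i))" and d: "m aD = (\<lambda>i. int (d i))"
    and b: "t \<le> B" "\<And>i. i < t \<Longrightarrow> q i < B" "\<And>i. i < t \<Longrightarrow> d (q i) < N" "N \<le> B"
    and z: "\<And>k. k < N \<Longrightarrow> m aXR k = 0 \<and> m aXI k = 0"
  shows "runs (vi ::= Cn 0;; While (Less (Vr vi) (Vr vt)) tally) v m (t * 106 + 9)
    (\<lambda>v' m'. \<forall>k<N. m' aXR k = S * int (card {i. i < t \<and> d (q i) = k}) \<and> m' aXI k = 0)"
proof -
  let ?I = "\<lambda>j v' m'. \<forall>k<N. m' aXR k = S * int (card {i. i < j \<and> d (q i) = k}) \<and> m' aXI k = 0"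
  have "runs (vi ::= Cn 0;; While (Less (Vr vi) (Vr vt)) tally) v m (t * (100 + 6) + 9) (?I t)"
  proof (rule count_loop_reg[where x = vt and I = ?I and v = v, OF refl _ b(1) v(1) _ _ _ cst_tally])
    show "?I 0 (v(vi := 0)) m" using z by simp
    fix j v' m' assume I: "?I j v' m'" and j: "j < t" and vi: "v' vi = int j"
      and sv: "same (wv tally) v' (v(vi := 0))" and sm: "same (wa tally) m' m"
    have s: "v' vS = S" "m' aQ = (\<lambda>i. int (q i))" "m' aD = (\<lambda>i. int (d i))"
      using v q d sv sm by (simp_all add: same_def wv_tally wa_tally)
    have jb: "j < B" "q j < B" "d (q j) < B" "d (q j) < N" using j b(1,4) b(2)[OF j] b(3)[OF j] by simp_all
    have c: "card {i. i < Suc j \<and> d (q i) = k} = card {i. i < j \<and> d (q i) = k} + (if k = d (q j) then 1 else 0)" for k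
    proof -
      have "{i. i < Suc j \<and> d (q i) = k} = {i. i < j \<and> d (q i) = k} \<union> (if k = d (q j) then {j} else {})"
        by (auto simp: less_Suc_eq)
      then show ?thesis by simp
    qed
    show "wpf tally (\<lambda>v'' m''. ?I (Suc j) v'' m'' \<and> v'' vi = int (Suc j)) v' m'"
      using I jb unfolding c by (simp add: tally_def vi s distrib_left)
  qed (simp_all add: wv_tally)
  then show ?thesis by simp
qed

text \<open>The second half of the postcondition exposes the search, because
  \<open>find_centroid\<close> reuses its order and its parents.\<close>

lemma runs_add_pairs:
  assumes g: "graph_ok R v m" and r: "v vr = int r" "r \<in> {..<n} - R" and d0: "v vd0 = int d0" "d0 \<le> 1"
    and c: "scale_regs v" "twiddles m"
  shows "runs add_pairs v m (weight (part R r) * (k0 + 3) * 9000) (\<lambda>v' m'.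
    (\<forall>i. m' aW i = m aW i + v vg * int (pairs_via (part R r) r d0 i)) \<and>
    (\<exists>q p d. bfs_done R r d0 (card (part R r)) q p d \<and>
    v' vt = int (card (part R r)) \<and> m' aQ = (\<lambda>i. int (q i)) \<and> m' aP = (\<lambda>i. int (p i)) \<and> m' aD = (\<lambda>i. int (d i))))"
proof -
  let ?X = "part R r" and ?t = "card (part R r)"
  have t1: "1 \<le> ?t" using finite_part[of R r] part_self[OF r(2)] by (metis One_nat_def Suc_leI card_gt_0_iff empty_iff)
  have tn: "?t \<le> n" by (rule card_part_le)
  have wt: "?t \<le> weight ?X" unfolding weight_def card_eq_sum by (rule sum_mono) simp
  define f where "f x = d0 + dst r x" for x
  let ?D = "\<lambda>v' m'. \<exists>q p d. bfs_done R r d0 ?t q p d \<and> v' vt = int ?t \<and>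
    m' aQ = (\<lambda>i. int (q i)) \<and> m' aP = (\<lambda>i. int (p i)) \<and> m' aD = (\<lambda>i. int (d i))"
  let ?L1 = "vi ::= Cn 0;; While (Less (Vr vi) (Vr vN)) clear"
  let ?L2 = "vi ::= Cn 0;; While (Less (Vr vi) (Vr vt)) tally"
  let ?R = "\<lambda>v' m'. (\<forall>i. m' aW i = m aW i + v vg * int (pairs_via ?X r d0 i)) \<and> ?D v' m'"
  \<comment> \<open>The length enters the time bound and must be named before the run. A dummy store
    supplies the exponent; the inequalities determine it, so it agrees with the one met in the
    actual run (\<open>ii\<close> below).\<close>
  obtain i where i: "i \<le> k0" "2 * ?t < 4 * 2 ^ i" "4 * 2 ^ i \<le> 4 * ?t"
    using runs_choose_length[of "\<lambda>_. int ?t" ?t, OF refl t1 tn] by blast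
  define N where "N = (4 * 2 ^ i :: nat)"
  have NL: "N = 2 ^ (i + 2)" by (simp add: N_def power_add)
  have Nd: "N dvd N0" unfolding N_def N0 using i(1) by (intro mult_dvd_mono le_imp_power_dvd) auto
  have NB: "N \<le> B" using dvd_imp_le[OF Nd] N0_4 N0_B by linarith
  have fb: "2 * f x < N" if "x \<in> ?X" for x
    using dst_less_card[OF r(2) that] d0(2) i(2) by (simp add: f_def N_def)
  have T: "(weight ?X * 210 + 100) + ((k0 * 40 + 40) + ((N * 56 + 9) + ((?t * 106 + 9) + (i + 2 + 1) * N * 2000)))
    \<le> weight ?X * (k0 + 3) * 9000"
  proof -
    have "(i + 2 + 1) * N \<le> (k0 + 3) * (4 * weight ?X)"
      using i(1,3) wt by (intro mult_le_mono) (auto simp: N_def)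
    also have "\<dots> = 4 * (weight ?X * (k0 + 3))" by simp
    finally have a: "(i + 2 + 1) * N * 2000 \<le> 8000 * (weight ?X * (k0 + 3))" by linarith
    have N4: "N \<le> 4 * weight ?X" using i(3) wt by (simp add: N_def)
    have w1: "1 \<le> weight ?X" using t1 wt by linarith
    have "k0 * 1 \<le> k0 * weight ?X" using w1 by (intro mult_le_mono2)
    then have b: "k0 \<le> k0 * weight ?X" by simp
    have e: "weight ?X * (k0 + 3) = k0 * weight ?X + 3 * weight ?X" by (simp add: algebra_simps)
    have gen: "W * 210 + 100 + (k * 40 + 40 + (N * 56 + 9 + (t * 106 + 9 + P))) \<le> kW * 9000 + W * 27000"
      if "P \<le> 8000 * kW + 24000 * W" "k \<le> kW" "N \<le> 4 * W" "1 \<le> W" "t \<le> W" for P kW W k N t :: nat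
      using that by linarith
    have a': "(i + 2 + 1) * N * 2000 \<le> 8000 * (k0 * weight ?X) + 24000 * weight ?X"
      using a unfolding e by simp
    have "(k0 * weight ?X + 3 * weight ?X) * 9000 = k0 * weight ?X * 9000 + weight ?X * 27000"
      by (simp add: distrib_right)
    then show ?thesis unfolding e using gen[OF a' b N4 w1 wt] by (simp only:)
  qed
  have "runs add_pairs v m ((weight ?X * 210 + 100) + ((k0 * 40 + 40) + ((N * 56 + 9) + ((?t * 106 + 9) + (i + 2 + 1) * N * 2000)))) ?R"
    unfolding add_pairs_def
  proof (rule runs_seqI[OF runs_bfs[OF g r d0(1)] order_refl])
    fix v1 m1 assume s1: "same (wv bfs) v1 v" "same (wa bfs) m1 m" and D1: "?D v1 m1"
    have c1: "scale_regs v1" "twiddles m1" "v1 vg = v vg" "m1 aW = m aW"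
      using c s1 by (simp_all add: scale_regs_def twiddles_def same_def wv_bfs wa_bfs)
    have vt1: "v1 vt = int ?t" using D1 by blast
    obtain i' where i': "2 * ?t < 4 * 2 ^ i'" "4 * 2 ^ i' \<le> 4 * ?t" "i' \<le> k0"
      "runs choose_length v1 m1 (i' * 40 + 40) (\<lambda>v' m'. v' vN = int (4 * 2 ^ i'))"
      using runs_choose_length[where v = v1 and t = ?t and m = m1, OF vt1 t1 tn] by blast
    have ii: "i' = i"
    proof -
      have "(2::nat) * 2 ^ i' \<le> 2 * ?t" "?t < 2 * 2 ^ i" "(2::nat) * 2 ^ i \<le> 2 * ?t" "?t < 2 * 2 ^ i'" using i i' by linarith+
      then have "(2::nat) ^ i' < 2 ^ Suc i" "(2::nat) ^ i < 2 ^ Suc i'" by simp_all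
      then have "i' < Suc i" "i < Suc i'" by (simp_all only: power_strict_increasing_iff one_less_numeral_iff semiring_norm)
      then show ?thesis by simp
    qed
    have len: "runs choose_length v1 m1 (k0 * 40 + 40) (\<lambda>v' m'. v' vN = int N)"
      by (rule runs_conseq[OF i'(4)]) (use i(1) in \<open>simp_all add: ii N_def\<close>)
    show "runs (choose_length;; ?L1;; ?L2;; convolve) v1 m1
      ((k0 * 40 + 40) + ((N * 56 + 9) + ((?t * 106 + 9) + (i + 2 + 1) * N * 2000))) ?R"
    proof (rule runs_seqI[OF len order_refl])
      fix v2 m2 assume s2: "same (wv choose_length) v2 v1" "same (wa choose_length) m2 m1" and N2: "v2 vN = int N"
      have c2: "scale_regs v2" "twiddles m2" "v2 vg = v vg" "m2 aW = m aW" and D2: "?D v2 m2"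
        using c1 D1 s2 by (simp_all add: scale_regs_def twiddles_def same_def wv_choose_length wa_choose_length)
      show "runs (?L1;; ?L2;; convolve) v2 m2 ((N * 56 + 9) + ((?t * 106 + 9) + (i + 2 + 1) * N * 2000)) ?R"
      proof (rule runs_seqI[OF runs_clear[where v = v2 and N = N and m = m2, OF N2 NB] order_refl])
        fix v3 m3 assume s3: "same (wv ?L1) v3 v2" "same (wa ?L1) m3 m2"
          and z: "\<forall>k<N. m3 aXR k = 0 \<and> m3 aXI k = 0"
        have c3: "scale_regs v3" "twiddles m3" "v3 vg = v vg" "m3 aW = m aW" "v3 vN = int N" and D3: "?D v3 m3"
          using c2 D2 N2 s3 by (simp_all add: scale_regs_def twiddles_def same_def wv_clear wa_clear)
        obtain q p d where q: "bfs_done R r d0 ?t q p d" "v3 vt = int ?t" "m3 aQ = (\<lambda>i. int (q i))" "m3 aD = (\<lambda>i. int (d i))"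
          using D3 by blast
        have qX: "q j \<in> ?X" "d (q j) = f (q j)" if "j < ?t" for j
          using q(1) that by (auto simp: bfs_done_def f_def)
        have qB: "q j < B" if "j < ?t" for j using qX(1)[OF that] part_sub[of R r] B by fastforce
        have dN: "d (q j) < N" if "j < ?t" for j using fb[OF qX(1)[OF that]] qX(2)[OF that] by simp
        \<comment> \<open>Counts over queue positions become counts over vertices, since
          \<open>q\<close> enumerates the component injectively.\<close>
        have card: "card {j. j < ?t \<and> d (q j) = k} = card {x\<in>?X. f x = k}" for k
        proof -
          have im: "q ` {..<?t} = ?X" and inj: "inj_on q {..<?t}" using q(1) by (simp_all add: bfs_done_def)
          have eq: "q ` {j. j < ?t \<and> d (q j) = k} = {x\<in>?X. f x = k}"
          proof (intro equalityI subsetI)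
            fix x assume "x \<in> q ` {j. j < ?t \<and> d (q j) = k}"
            then obtain j where "j < ?t" "d (q j) = k" "x = q j" by blast
            then show "x \<in> {x\<in>?X. f x = k}" using qX[of j] by simp
          next
            fix x assume x: "x \<in> {x\<in>?X. f x = k}"
            then have "x \<in> q ` {..<?t}" using im by simp
            then obtain j where "j < ?t" "x = q j" by blast
            then show "x \<in> q ` {j. j < ?t \<and> d (q j) = k}" using qX(2)[of j] x by simp
          qed
          have "inj_on q {j. j < ?t \<and> d (q j) = k}" by (rule inj_on_subset[OF inj]) auto
          from card_image[OF this] show ?thesis by (simp only: eq)
        qed
        have tB: "?t \<le> B" using tn B by simp
        have S3: "v3 vS = S" using c3(1) by (simp add: scale_regs_def)
        have z': "\<And>k. k < N \<Longrightarrow> m3 aXR k = 0 \<and> m3 aXI k = 0" using z by blast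
        show "runs (?L2;; convolve) v3 m3 ((?t * 106 + 9) + (i + 2 + 1) * N * 2000) ?R"
        proof (rule runs_seqI[OF runs_tally[where v = v3 and m = m3 and N = N, OF q(2) S3 q(3,4) tB qB dN NB z'] order_refl])
          fix v4 m4 assume s4: "same (wv ?L2) v4 v3" "same (wa ?L2) m4 m3"
            and x: "\<forall>k<N. m4 aXR k = S * int (card {i. i < ?t \<and> d (q i) = k}) \<and> m4 aXI k = 0"
          have c4: "scale_regs v4" "twiddles m4" "v4 vg = v vg" "m4 aW = m aW" "v4 vN = int N" and D4: "?D v4 m4"
            using c3 D3 s4 by (simp_all add: scale_regs_def twiddles_def same_def wv_tally wa_tally)
          have Xc: "card ?X \<le> N0" using tn k0(1) N0 by linarith
          have x': "m4 aXR k = S * int (card {x\<in>?X. f x = k}) \<and> m4 aXI k = 0" if "k < N" for k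
            using x that by (simp add: card)
          have "1 \<le> i + 2" by simp
          note cv = runs_convolve[where v = v4 and m = m4, OF NL this Nd c4(5,1,2) finite_part Xc fb x']
          show "runs convolve v4 m4 ((i + 2 + 1) * N * 2000) ?R"
          proof (rule runs_conseq[OF cv order_refl])
            fix v5 m5 assume s5: "same (wv convolve) v5 v4" "same (wa convolve) m5 m4"
              and W: "\<forall>i. m5 aW i = m4 aW i + (if i < N then v4 vg * int (card {(x, y). x \<in> ?X \<and> y \<in> ?X \<and> f x + f y = i}) else 0)"
            have D5: "?D v5 m5" using D4 s5 by (simp add: same_def wv_convolve wa_convolve)
            have pv: "pairs_via ?X r d0 j = card {(x, y). x \<in> ?X \<and> y \<in> ?X \<and> f x + f y = j}" for j
              by (simp add: pairs_via_def f_def)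
            have "pairs_via ?X r d0 j = 0" if "\<not> j < N" for j
            proof -
              have "f x + f y < N" if "x \<in> ?X" "y \<in> ?X" for x y using fb[OF that(1)] fb[OF that(2)] by linarith
              then have "{(x, y). x \<in> ?X \<and> y \<in> ?X \<and> f x + f y = j} = {}" using that by auto
              then show ?thesis unfolding pv by (simp only: card.empty)
            qed
            then have "\<forall>i. m5 aW i = m aW i + v vg * int (pairs_via ?X r d0 i)"
              using W by (auto simp: c4 pv)
            then show "?R v5 m5" using D5 by blast
          qed
        qed
      qed
    qed
  qed
  then show ?thesis by (rule runs_conseq) (use T in auto)
qed

end

section \<open>Centroid decomposition\<close>

abbreviation (input) "vsp \<equiv> 24 :: nat"
abbreviation (input) "vsg \<equiv> 25 :: nat"
abbreviation (input) "aSt \<equiv> 15 :: nat"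

text \<open>The stack \<open>aSt\<close> holds one root of every remaining component. Every component except the whole tree
  first contributes its negative term, rooted at the neighbour of the removed centroid; \<open>vsg\<close> is \<open>0\<close> for
  the whole tree and \<open>1\<close> afterwards.\<close>

definition pop :: com where
  "pop =
    (vsp ::= Vr vsp [-] Cn 1;; vr ::= Rd aSt (Vr vsp);; vd0 ::= Cn 1;;
     vg ::= Cn 0 [-] Vr vsg;; vsg ::= Cn 1)"

definition push :: com where
  "push =
    (vw ::= Rd aIn (Vr ve);;
     If (Eq (Rd aRm (Vr vw)) (Cn 0)) (Wr aSt (Vr vsp) (Vr vw);; vsp ::= Vr vsp [+] Cn 1) Skip;;
     ve ::= Rd aNext (Vr ve))"

definition process :: com where
  "process =
    (pop;; add_pairs;; find_centroid;; (vd0 ::= Cn 0;; vg ::= Cn 1);; add_pairs;;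
     (Wr aRm (Vr vr) (Cn 1);; ve ::= Rd aHead (Vr vr));; While (Less (Cn 0) (Vr ve)) push)"

text \<open>The input array is overwritten with the output, which is safe once all searches are
  over. Cell \<open>i\<close> receives the entry for distance \<open>i + 1\<close>, and ordered
  pairs are halved.\<close>

definition emit :: com where
  "emit = (Wr aIn (Vr vi) (Rd aW (Vr vi [+] Cn 1) [/] Cn 2);; vi ::= Vr vi [+] Cn 1)"

definition solve :: com where
  "solve =
    (setup_tables;; (Wr aSt (Cn 0) (Cn 0);; vsp ::= Cn 1;; vsg ::= Cn 0);;
     While (Less (Cn 0) (Vr vsp)) process;;
     vN ::= Vr vn [-] Cn 1;; (vi ::= Cn 0;; While (Less (Vr vi) (Vr vN)) emit))"

lemma wv_push: "wv push = {21, 23, 24}" and wa_push: "wa push = {15}"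
  and wv_emit: "wv emit = {6}" and wa_emit: "wa emit = {0}"
  by (auto simp: push_def emit_def)

lemma cst_push: "cst push \<le> 100" and cst_emit: "cst emit \<le> 60"
  by (simp_all add: push_def emit_def acost_def)

lemma anc_count_le: "anc_count pa s k j \<le> s"
proof -
  have "anc_count pa s k j \<le> card {..<s}" unfolding anc_count_def by (rule card_mono) auto
  then show ?thesis by simp
qed

context solver
begin

lemma runs_find_centroid:
  assumes bfs: "bfs_done R r d0 s q p d" and v: "v vt = int s"
    and q: "m aQ = (\<lambda>i. int (q i))" and p: "m aP = (\<lambda>i. int (p i))"
  shows "runs find_centroid v m (s * 210 + 100) (\<lambda>v' m'. \<exists>k<s. v' vr = int (q k) \<and>
    (\<forall>u\<in>nbrs (insert (q k) R) (q k). 2 * card (part (insert (q k) R) u) \<le> s))"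
proof -
  have inj: "inj_on q {..<s}" and s1: "1 \<le> s" and im: "q ` {..<s} = part R r" using bfs by (simp_all add: bfs_done_def)
  have sn: "s \<le> n" using bfs_done_card[OF bfs] card_part_le[of R r] by simp
  have nB: "int n < int B" "int (8 * n) < M" using B n1 B_M by linarith+
  have qn: "q i < n" if "i < s" for i using im part_sub[of R r] that by blast
  have qB: "q i < B" if "i < s" for i using qn[OF that] B by simp
  obtain pa where pa: "\<And>k. 0 < k \<Longrightarrow> k < s \<Longrightarrow> pa k < k \<and> q (pa k) = p (q k)"
    using parent_index[OF bfs] by blast
  let ?L1 = "vi ::= Cn 0;; While (Less (Vr vi) (Vr vt)) unit_sizes"
  let ?I1 = "\<lambda>i (v' :: vars) (m' :: arrs). \<forall>j<i. m' aSz (q j) = 1"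
  have sB: "s \<le> B" using sn B by simp
  have L1: "runs ?L1 v m (s * (60 + 6) + 9) (?I1 s)"
  proof (rule count_loop_reg[where x = vt and I = ?I1 and v = v, OF refl _ sB v _ _ _ cst_unit_sizes])
    fix i and v' :: vars and m' :: arrs
    assume I: "?I1 i v' m'" and i: "i < s" and vi: "v' vi = int i" and sm: "same (wa unit_sizes) m' m"
    have mq: "m' aQ = (\<lambda>i. int (q i))" using q sm by (simp add: same_def wa_unit_sizes)
    show "wpf unit_sizes (\<lambda>v'' m''. ?I1 (Suc i) v'' m'' \<and> v'' vi = int (Suc i)) v' m'"
      using I i sB qB[OF i] by (auto simp: unit_sizes_def vi mq less_Suc_eq)
  qed (simp_all add: wv_unit_sizes)
  let ?b = "Less (Cn 2 [*] Rd aSz (Rd aQ (Vr vk))) (Vr vt)"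
  let ?I = "\<lambda>k v' m'. k < s \<and> v' vk = int k \<and> (\<forall>j\<le>k. m' aSz (q j) = int (anc_count pa s k j)) \<and>
     (\<forall>a. k < a \<longrightarrow> a < s \<longrightarrow> 2 * anc_count pa s a a < s)"
  let ?R = "\<lambda>v' m'. \<exists>k<s. v' vr = int (q k) \<and>
    (\<forall>u\<in>nbrs (insert (q k) R) (q k). 2 * card (part (insert (q k) R) u) \<le> s)"
  show ?thesis unfolding find_centroid_def
  proof (rule runs_seqI[OF L1])
    fix v1 m1 assume s1': "same (wv ?L1) v1 v" "same (wa ?L1) m1 m" and sz: "?I1 s v1 m1"
    have v1: "v1 vt = int s" "m1 aQ = (\<lambda>i. int (q i))" "m1 aP = (\<lambda>i. int (p i))"
      using v q p s1' by (simp_all add: same_def wv_unit_sizes wa_unit_sizes)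
    let ?v = "v1(vk := int (s - 1))"
    show "runs (vk ::= Vr vt [-] Cn 1;; While ?b merge_size;; vr ::= Rd aQ (Vr vk)) v1 m1 (s * 140 + 70) ?R"
    proof (rule runs_seqI[OF runs_wpf_le[where Q = "\<lambda>v' m'. v' = ?v \<and> m' = m1" and t = 10]])
      show "wpf (vk ::= Vr vt [-] Cn 1) (\<lambda>v' m'. v' = ?v \<and> m' = m1) v1 m1"
        using v1 s1 by (simp add: of_nat_diff)
      fix v' m' assume e: "v' = ?v \<and> m' = m1"
      have W: "runs (While ?b merge_size) ?v m1 ((s - 1) * 140 + bcost ?b + 1) (\<lambda>v' m'. \<exists>k. ?I k v' m' \<and> \<not> bv ?b v' m')"
      proof (rule runs_while[where I = ?I and \<Phi> = "\<lambda>k. k * 140"])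
        have "m1 aSz (q j) = int (anc_count pa s (s - 1) j)" if "j \<le> s - 1" for j
        proof -
          have "j < s" using that s1 by linarith
          then show ?thesis using anc_count_init[of j s pa] sz by simp
        qed
        moreover have "\<not> (s - 1 < a \<and> a < s)" for a by linarith
        ultimately show "?I (s - 1) ?v m1" using s1 by auto
      next
        fix k v' m' assume I: "?I k v' m'" and sv: "same (wv merge_size) v' ?v" and sm: "same (wa merge_size) m' m1"
        have v': "v' vt = int s" "m' aQ = (\<lambda>i. int (q i))" "m' aP = (\<lambda>i. int (p i))" "v' vk = int k"
          using v1 sv sm I by (simp_all add: same_def wv_merge_size wa_merge_size)
        have k: "k < s" and szk: "m' aSz (q k) = int (anc_count pa s k k)" using I by simp_all
        have kB: "k < B" "q k < B" using k sB qB by simp_all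
        have aM: "2 * int (anc_count pa s k k) < M" "int s < M"
          using anc_count_le[of pa s k k] sn nB by linarith+
        then have sw: "s < 2 ^ w" by simp
        show "okb ?b v' m'" using kB szk by (simp add: v' okw_def aM(1) sw)
        assume "bv ?b v' m'"
        then have lt: "2 * anc_count pa s k k < s" using szk by (simp add: v')
        \<comment> \<open>The subtree of the root is the whole component, so the loop stops at
          position \<open>0\<close> at the latest and never follows the dummy parent.\<close>
        have "k \<noteq> 0"
        proof
          assume "k = 0"
          then have "anc_count pa s k k = s" using anc_count_0[of s pa] pa by simp
          then show False using lt by simp
        qed
        then obtain k' where k': "k = Suc k'" by (cases k) auto
        define a where "a = pa k"
        have a: "a < k" "q a = p (q k)" using pa[of k] k \<open>k \<noteq> 0\<close> by (simp_all add: a_def)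
        have pq: "p (q k) = q a" using a by simp
        have szj: "m' aSz (q j) = int (anc_count pa s k j)" if "j \<le> k" for j using I that by blast
        have aB: "q a < B" using qB[of a] a k by simp
        have step: "anc_count pa s k' j = anc_count pa s k j + (if a = j then anc_count pa s k k else 0)" if "j \<le> k'" for j
          using anc_count_step[of s pa j k'] pa that by (simp add: k' a_def)
        have upd: "((m' aSz)(q a := m' aSz (q a) + m' aSz (q k))) (q j) = int (anc_count pa s k' j)" if "j \<le> k'" for j
        proof -
          have "q j = q a \<longleftrightarrow> j = a" using inj that a(1) k k' by (auto simp: inj_on_def)
          then show ?thesis using step[OF that] szj[of j] szj[of a] szj[of k] a(1) that k' by auto
        qed
        have lat: "2 * anc_count pa s a' a' < s" if "k' < a'" "a' < s" for a'
          using I lt that k' by (cases "a' = k") auto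
        have nk: "nat (1 + int k') = Suc k'" by simp
        have "wpf merge_size (?I k') v' m'"
          using upd lat kB aB k k' by (simp add: merge_size_def v' nk pq[unfolded k'])
        from runs_wpf_le[OF this cst_merge_size]
        show "\<exists>t. runs merge_size v' m' t (\<lambda>v'' m''. \<exists>g'. ?I g' v'' m'' \<and> g' * 140 + t + bcost ?b + 1 \<le> k * 140)"
          by (intro exI[of _ 120], elim runs_conseq) (auto simp: k' acost_def intro!: exI[of _ k'])
      qed
      show "runs (While ?b merge_size;; vr ::= Rd aQ (Vr vk)) v' m' (s * 140 + 55) ?R"
        unfolding e[THEN conjunct1] e[THEN conjunct2]
      proof (rule runs_seqI[OF W])
        fix v2 m2 assume s2: "same (wv (While ?b merge_size)) v2 ?v" "same (wa (While ?b merge_size)) m2 m1"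
          and ex: "\<exists>k. ?I k v2 m2 \<and> \<not> bv ?b v2 m2"
        have v2: "v2 vt = int s" "m2 aQ = (\<lambda>i. int (q i))"
          using v1 s2 by (simp_all add: same_def wv_merge_size wa_merge_size)
        obtain k where k: "?I k v2 m2" "\<not> bv ?b v2 m2" using ex by blast
        then have ks: "k < s" "s \<le> 2 * anc_count pa s k k" by (simp_all add: v2)
        have "\<forall>u\<in>nbrs (insert (q k) R) (q k). 2 * card (part (insert (q k) R) u) \<le> s"
          using centroid_balanced[OF bfs pa ks] k(1) by blast
        then have "wpf (vr ::= Rd aQ (Vr vk)) ?R v2 m2"
          using k(1) ks sB by (auto simp: v2)
        then show "runs (vr ::= Rd aQ (Vr vk)) v2 m2 10 ?R" by (rule runs_wpf_le) (simp add: acost_def)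
      qed (use s1 in \<open>simp add: acost_def\<close>)
    qed simp_all
  qed simp
qed

definition stack_ok :: "nat set \<Rightarrow> nat list \<Rightarrow> bool" where
  "stack_ok R rs \<longleftrightarrow> distinct rs \<and> set rs \<subseteq> {..<n} - R \<and>
    (\<forall>x\<in>set rs. \<forall>y\<in>set rs. x \<noteq> y \<longrightarrow> part R x \<inter> part R y = {})"

lemma stack_length: "stack_ok R rs \<Longrightarrow> length rs \<le> n"
  using card_mono[of "{..<n}" "set rs"] distinct_card[of rs] by (auto simp: stack_ok_def)

text \<open>Replacing a component by its parts around a centroid decreases the logarithm at each of its
  vertices by at least one, so the potential drops by the weight of the component.\<close>

definition potential :: "nat set \<Rightarrow> nat list \<Rightarrow> nat" where
  "potential R rs = (\<Sum>x\<in>set rs. weight (part R x) * floorlog 2 (card (part R x)))"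

section \<open>Replacing a component on the stack by its branches\<close>

context
  fixes R rs r c us
  assumes ok: "stack_ok R (rs @ [r])" and c: "c \<in> part R r"
    and us: "distinct us" "set us = nbrs (insert c R) c"
begin

lemma other_part: "x \<in> set rs \<Longrightarrow> part (insert c R) x = part R x"
proof -
  assume x: "x \<in> set rs"
  then have "x \<noteq> r" "x \<in> {..<n} - R" "part R x \<inter> part R r = {}" using ok by (auto simp: stack_ok_def)
  then show ?thesis using part_insert_other c by blast
qed

lemma rs_us_disjoint: "set rs \<inter> set us = {}"
proof -
  have "x \<notin> set us" if x: "x \<in> set rs" for x
  proof
    assume "x \<in> set us"
    then have "x \<in> part R r" using nbr_comp(1)[OF c] us by blast
    moreover have "x \<in> part R x" "part R x \<inter> part R r = {}" using x ok part_self by (auto simp: stack_ok_def)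
    ultimately show False by blast
  qed
  then show ?thesis by blast
qed

lemma stack_ok_step: "stack_ok (insert c R) (rs @ us)"
proof -
  have d: "distinct (rs @ us)" using ok us rs_us_disjoint by (auto simp: stack_ok_def)
  have "x \<noteq> c" if "x \<in> set rs" for x
  proof -
    have "x \<in> part R x" "part R x \<inter> part R r = {}" using that ok part_self by (auto simp: stack_ok_def)
    then show ?thesis using c by blast
  qed
  then have s1: "set rs \<subseteq> {..<n} - insert c R" using ok by (auto simp: stack_ok_def)
  have s2: "set us \<subseteq> {..<n} - insert c R" using nbr_comp(2)[OF c] us by blast
  have p: "part (insert c R) x \<inter> part (insert c R) y = {}"
    if xy: "x \<in> set (rs @ us)" "y \<in> set (rs @ us)" "x \<noteq> y" for x y
  proof -
    have in_r: "part (insert c R) u \<subseteq> part R r" if "u \<in> set us" for u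
      using nbr_comp(4)[OF c] us that by blast
    have ds: "part R z \<inter> part R r = {}" if "z \<in> set rs" for z using ok that by (auto simp: stack_ok_def)
    consider "x \<in> set rs" "y \<in> set rs" | "x \<in> set rs" "y \<in> set us" | "x \<in> set us" "y \<in> set rs" | "x \<in> set us" "y \<in> set us"
      using xy by auto
    then show ?thesis
    proof cases
      case 1 then show ?thesis using other_part ok xy(3) by (simp add: stack_ok_def)
    next
      case 2 then show ?thesis using other_part[of x] in_r[of y] ds[of x] by blast
    next
      case 3 then show ?thesis using other_part[of y] in_r[of x] ds[of y] by blast
    next
      case 4 then show ?thesis using nbr_disjoint[OF c, of x y] us xy(3) by blast
    qed
  qed
  show ?thesis unfolding stack_ok_def using d s1 s2 p by auto
qed

lemma sum_step:
  fixes g :: "nat set \<Rightarrow> nat \<Rightarrow> int"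
  shows "(\<Sum>x\<in>set (rs @ us). g (part (insert c R) x) x) =
    (\<Sum>x\<in>set rs. g (part R x) x) + (\<Sum>u\<in>nbrs (insert c R) c. g (part (insert c R) u) u)"
proof -
  have "(\<Sum>x\<in>set (rs @ us). g (part (insert c R) x) x) =
      (\<Sum>x\<in>set rs. g (part (insert c R) x) x) + (\<Sum>u\<in>set us. g (part (insert c R) u) u)"
    using rs_us_disjoint by (simp add: sum.union_disjoint)
  then show ?thesis using other_part us(2) by simp
qed

lemma sum_pop:
  fixes g :: "nat set \<Rightarrow> nat \<Rightarrow> int"
  shows "(\<Sum>x\<in>set (rs @ [r]). g (part R x) x) = (\<Sum>x\<in>set rs. g (part R x) x) + g (part R r) r"
  using ok by (simp add: stack_ok_def)

text \<open>A branch has at most half the size, hence a \<open>floorlog\<close> smaller by at least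
  one. The branches are disjoint subsets of the component, so their weights add up to no more than
  its weight.\<close>

lemma potential_step:
  assumes bal: "\<And>u. u \<in> nbrs (insert c R) c \<Longrightarrow> 2 * card (part (insert c R) u) \<le> card (part R r)"
  shows "potential (insert c R) (rs @ us) + weight (part R r) \<le> potential R (rs @ [r])"
proof -
  let ?X = "part R r" and ?Y = "part (insert c R)" and ?U = "nbrs (insert c R) c"
  have r: "r \<notin> set rs" "r \<in> {..<n} - R" using ok by (auto simp: stack_ok_def)
  have card1: "1 \<le> card ?X" using part_self[OF r(2)] finite_part[of R r] by (metis One_nat_def Suc_leI card_gt_0_iff empty_iff)
  have fl: "floorlog 2 (card ?X) = floorlog 2 (card ?X div 2) + 1"
    using card1 by (subst compute_floorlog) simp
  have le: "floorlog 2 (card (?Y u)) \<le> floorlog 2 (card ?X div 2)" if "u \<in> ?U" for u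
    using bal[OF that] by (intro floorlog_mono) simp
  have "(\<Sum>u\<in>?U. weight (?Y u) * floorlog 2 (card (?Y u))) \<le> (\<Sum>u\<in>?U. weight (?Y u) * floorlog 2 (card ?X div 2))"
    using le by (intro sum_mono mult_le_mono2)
  also have "\<dots> = (\<Sum>u\<in>?U. weight (?Y u)) * floorlog 2 (card ?X div 2)" by (simp add: sum_distrib_right)
  also have "(\<Sum>u\<in>?U. weight (?Y u)) = weight (\<Union>u\<in>?U. ?Y u)"
    unfolding weight_def
    by (rule sum.UNION_disjoint[symmetric]) (use finite_nbrs[OF c] finite_part nbr_disjoint[OF c] in auto)
  also have "\<dots> * floorlog 2 (card ?X div 2) \<le> weight ?X * floorlog 2 (card ?X div 2)"
    using nbr_comp(4)[OF c] finite_part[of R r] by (intro mult_le_mono1 weight_mono) auto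
  finally have a: "(\<Sum>u\<in>?U. weight (?Y u) * floorlog 2 (card (?Y u))) + weight ?X \<le> weight ?X * floorlog 2 (card ?X)"
    by (simp add: fl)
  have b: "potential (insert c R) (rs @ us) = (\<Sum>x\<in>set rs. weight (part R x) * floorlog 2 (card (part R x))) +
      (\<Sum>u\<in>?U. weight (?Y u) * floorlog 2 (card (?Y u)))"
    unfolding potential_def using rs_us_disjoint other_part us(2) finite_nbrs[OF c] by (simp add: sum.union_disjoint)
  have d: "potential R (rs @ [r]) = (\<Sum>x\<in>set rs. weight (part R x) * floorlog 2 (card (part R x))) +
      weight ?X * floorlog 2 (card ?X)"
    unfolding potential_def using r(1) by simp
  show ?thesis unfolding b d using a by simp
qed

end

lemma runs_push:
  assumes c: "c < n" and v: "v ve = int (first_arc c)" "v vsp = int (length rs)"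
    and st: "\<And>i. i < length rs \<Longrightarrow> m aSt i = int (rs ! i)"
    and ar: "\<And>e. 1 \<le> e \<Longrightarrow> e \<le> arcs \<Longrightarrow> m aNext e = int (next_arc e) \<and> m aIn e = int (tgt e)"
    and rm: "\<And>u. u < n \<Longrightarrow> m aRm u = (if u \<in> R then 1 else 0)"
    and rs: "distinct rs" "set rs \<subseteq> {..<n}" "set rs \<inter> nbrs R c = {}"
  shows "runs (While (Less (Cn 0) (Vr ve)) push) v m (deg c * 110 + 10) (\<lambda>v' m'. \<exists>us. distinct us \<and> set us = nbrs R c \<and>
    v' vsp = int (length (rs @ us)) \<and> (\<forall>i<length (rs @ us). m' aSt i = int ((rs @ us) ! i)))"
proof -
  let ?b = "Less (Cn 0) (Vr ve)"
  \<comment> \<open>The neighbours behind the arcs inspected so far; by \<open>arc_inj\<close> none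
    of them is met twice.\<close>
  define pushed where "pushed e = {tgt e' | e'. e < e' \<and> e' \<le> arcs \<and> src e' = c \<and> tgt e' \<notin> R}" for e
  let ?I = "\<lambda>(e, us) v' m'. e \<le> arcs \<and> (e = 0 \<or> src e = c) \<and> v' ve = int e \<and> distinct us \<and> set us = pushed e \<and>
    v' vsp = int (length (rs @ us)) \<and> (\<forall>i<length (rs @ us). m' aSt i = int ((rs @ us) ! i))"
  let ?Phi = "\<lambda>(e, us :: nat list). arcs_below src c (Suc e) * 110"
  have nB: "int n < int B" "int n < M" "arcs < B" using B arcs n1 B_M by linarith+
  have sub: "pushed e \<subseteq> nbrs R c" for e
  proof
    fix x assume "x \<in> pushed e"
    then obtain e' where "e < e'" "e' \<le> arcs" "src e' = c" "tgt e' \<notin> R" "x = tgt e'" by (auto simp: pushed_def)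
    then show "x \<in> nbrs R c" using arc_edge[of e'] by (simp add: nbrs_def)
  qed
  have "runs (While ?b push) v m (?Phi (first_arc c, []) + bcost ?b + 1) (\<lambda>v' m'. \<exists>g. ?I g v' m' \<and> \<not> bv ?b v' m')"
  proof (rule runs_while[where I = ?I and \<Phi> = ?Phi])
    have "pushed (first_arc c) = {}" using first_arc_gap[of c] by (auto simp: pushed_def)
    then show "?I (first_arc c, []) v m" using v st first_arc_le first_arc_src by simp
  next
    fix g v' m' assume Ig: "?I g v' m'" and sm: "same (wa push) m' m"
    obtain e us where g: "g = (e, us)" by (cases g)
    have I: "e \<le> arcs" "e = 0 \<or> src e = c" "v' ve = int e" "distinct us" "set us = pushed e"
      "v' vsp = int (length (rs @ us))" "\<forall>i<length (rs @ us). m' aSt i = int ((rs @ us) ! i)"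
      using Ig by (simp_all add: g)
    have eM: "e < 2 ^ w" using I(1) nB(3) B_less(1) by linarith
    show "okb ?b v' m'" using I(3) eM by (simp add: okw_def)
    assume "bv ?b v' m'"
    then have e1: "1 \<le> e" using I(3) by simp
    then have se: "src e = c" using I(2) by simp
    have tg: "tgt e < n" using arc_less[OF e1 I(1)] by simp
    have tgB: "tgt e < B" "int (tgt e) < int B" using tg nB by linarith+
    have m': "m' aNext = m aNext" "m' aIn = m aIn" "m' aRm = m aRm" using sm by (simp_all add: same_def wa_push)
    have nx: "m aNext e = int (next_arc e)" "m aIn e = int (tgt e)" using ar[OF e1 I(1)] by simp_all
    have eB: "e < B" using I(1) nB(3) by linarith
    have one: "(1::int) < M" using nB(2) n1 by linarith
    have dn: "pushed (next_arc e) = pushed e \<union> (if tgt e \<in> R then {} else {tgt e})"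
    proof -
      have "e' = e \<or> e < e'" if "next_arc e < e'" "src e' = c" for e'
        using next_arc_gap[of e e'] that se by force
      then show ?thesis using next_arc_less[of e] e1 I(1) se by (auto simp: pushed_def intro: less_trans)
    qed
    have ne: "next_arc e \<le> arcs" "next_arc e = 0 \<or> src (next_arc e) = c"
      using next_arc_less[of e] next_arc_src[of e] e1 I(1) se by auto
    have ph: "arcs_below src c (Suc e) = arcs_below src c (Suc (next_arc e)) + 1"
      using arcs_below_prev[of src c e] arcs_below_Suc[of e src c] e1 se by (simp add: next_arc_def)
    have "\<exists>g'. wpf push (?I g') v' m' \<and> ?Phi g' + 100 + bcost ?b + 1 \<le> ?Phi g"
    proof (cases "tgt e \<in> R")
      case True
      have "wpf push (?I (next_arc e, us)) v' m'"
        using I dn ne True eB tgB one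
        by (simp add: push_def m' nx rm[OF tg] okw_def)
      then show ?thesis using ph by (intro exI[of _ "(next_arc e, us)"]) (simp add: g)
    next
      case False
      have new: "tgt e \<notin> pushed e"
      proof
        assume "tgt e \<in> pushed e"
        then obtain e' where "e < e'" "e' \<le> arcs" "src e' = c" "tgt e = tgt e'" by (auto simp: pushed_def)
        then show False using arc_inj[of e e'] e1 I(1) se by simp
      qed
      have dist: "distinct (rs @ us @ [tgt e])" and sub': "set (rs @ us @ [tgt e]) \<subseteq> {..<n}"
      proof -
        have "tgt e \<in> nbrs R c" using arc_edge[OF e1 I(1)] se False by (simp add: nbrs_def)
        then show "distinct (rs @ us @ [tgt e])" using I(4,5) rs sub[of e] new by auto
        have "nbrs R c \<subseteq> {..<n}" using edgeD by (auto simp: nbrs_def)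
        then show "set (rs @ us @ [tgt e]) \<subseteq> {..<n}" using rs(2) I(5) sub[of e] tg by auto
      qed
      have "length (rs @ us @ [tgt e]) \<le> n"
        using card_mono[OF _ sub'] distinct_card[OF dist] by simp
      then have lB: "length rs + length us < B" using nB by simp
      have app: "\<forall>i<length (rs @ us @ [tgt e]). ((m' aSt)(length rs + length us := int (tgt e))) i = int ((rs @ us @ [tgt e]) ! i)"
        using I(7) by (auto simp: nth_append less_Suc_eq)
      have lB': "int (length rs) + int (length us) < int B" using lB by linarith
      have len: "nat (int (length rs) + int (length us)) = length rs + length us" by simp
      have "wpf push (?I (next_arc e, us @ [tgt e])) v' m'"
        using I dn ne False eB tgB one app lB new
        by (simp add: push_def m' nx rm[OF tg] okw_def lB' len ac_simps)
      then show ?thesis using ph by (intro exI[of _ "(next_arc e, us @ [tgt e])"]) (simp add: g)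
    qed
    then obtain g' where g': "wpf push (?I g') v' m'" "?Phi g' + 100 + bcost ?b + 1 \<le> ?Phi g" by blast
    show "\<exists>ta. runs push v' m' ta (\<lambda>v'' m''. \<exists>g'. ?I g' v'' m'' \<and> ?Phi g' + ta + bcost ?b + 1 \<le> ?Phi g)"
      by (rule exI[of _ 100], rule runs_conseq[OF runs_wpf_le[OF g'(1) cst_push] order_refl]) (use g'(2) in blast)
  qed
  then show ?thesis
  proof (rule runs_conseq)
    show "?Phi (first_arc c, []) + bcost ?b + 1 \<le> deg c * 110 + 10"
      using arcs_below_prev[of src c "Suc arcs"] by (simp add: deg_def first_arc_def)
    fix v' m' assume "\<exists>g. ?I g v' m' \<and> \<not> bv ?b v' m'"
    then obtain e us where I: "?I (e, us) v' m'" "\<not> bv ?b v' m'" by auto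
    then have e0: "e = 0" by simp
    have "nbrs R c \<subseteq> pushed 0"
    proof
      fix x assume x: "x \<in> nbrs R c"
      then obtain e' where "1 \<le> e'" "e' \<le> arcs" "src e' = c" "tgt e' = x" using arc_ex[of c x] by (auto simp: nbrs_def)
      then show "x \<in> pushed 0" using x by (auto simp: pushed_def nbrs_def)
    qed
    then have "set us = nbrs R c" using I(1) sub[of 0] e0 by auto
    then show "\<exists>us. distinct us \<and> set us = nbrs R c \<and> v' vsp = int (length (rs @ us)) \<and>
      (\<forall>i<length (rs @ us). m' aSt i = int ((rs @ us) ! i))" using I(1) by auto
  qed
qed

lemma graph_ok_frame:
  assumes "graph_ok R v m" "v' vn = v vn" "m' 0 = m 0" "m' 1 = m 1" "m' 2 = m 2" "m' aRm = m aRm"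
    "nat_array (m' aQ)" "nat_array (m' aP)" "nat_array (m' aD)"
  shows "graph_ok R v' m'"
  using assms unfolding graph_ok_def by simp

lemma nat_array_int: "nat_array (\<lambda>i. int (g i))"
  by (simp add: nat_array_def)

text \<open>The counts in \<open>aW\<close> plus the contributions still owed by the components on
  the stack give the final result. A branch also owes its negative term of
  \<open>pairs_split\<close>; the initial tree (\<open>\<sigma> = 0\<close>) does not. Since
  \<open>\<sigma> = 0\<close> allows at most one stack entry, switching to
  \<open>\<sigma> = 1\<close> affects no entry that remains.\<close>

definition main_inv :: "nat set \<Rightarrow> nat list \<Rightarrow> nat \<Rightarrow> vars \<Rightarrow> arrs \<Rightarrow> bool" where
  "main_inv R rs \<sigma> v m \<longleftrightarrow> graph_ok R v m \<and> scale_regs v \<and> twiddles m \<and>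
    v vsp = int (length rs) \<and> (\<forall>i<length rs. m aSt i = int (rs ! i)) \<and> v vsg = int \<sigma> \<and> stack_ok R rs \<and>
    (\<sigma> = 1 \<or> length rs \<le> 1) \<and>
    (\<forall>i. m aW i + (\<Sum>x\<in>set rs. int (pairs_at (part R x) i) - int \<sigma> * int (pairs_via (part R x) x 1 i)) =
      int (pairs_at {..<n} i))"

text \<open>The first squaring starts at the entry vertex \<open>r\<close> with offset
  \<open>1\<close> and settles the negative term; its search also yields the centroid
  \<open>c\<close>, from which the second squaring supplies the positive term. By
  \<open>pairs_split\<close> the component is thereby traded for its branches.\<close>

lemma runs_process:
  assumes inv: "main_inv R (rs @ [r]) \<sigma> v m"
  shows "runs process v m (weight (part R r) * (k0 + 3) * 20000) (\<lambda>v' m'. \<exists>c us. main_inv (insert c R) (rs @ us) 1 v' m' \<and>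
    potential (insert c R) (rs @ us) + weight (part R r) \<le> potential R (rs @ [r]))"
proof -
  let ?X = "part R r" and ?s = "card (part R r)" and ?W = "weight (part R r)"
  let ?A = "weight (part R r) * (k0 + 3) * 9000"
  have g: "graph_ok R v m" and sc: "scale_regs v" "twiddles m" and sp: "v vsp = int (length rs + 1)"
    and st: "\<And>i. i < length rs + 1 \<Longrightarrow> m aSt i = int ((rs @ [r]) ! i)" and sg: "v vsg = int \<sigma>" and ok: "stack_ok R (rs @ [r])"
    and eq: "\<And>i. m aW i + (\<Sum>x\<in>set (rs @ [r]). int (pairs_at (part R x) i) - int \<sigma> * int (pairs_via (part R x) x 1 i)) =
      int (pairs_at {..<n} i)"
    and \<sigma>: "\<sigma> = 1 \<or> rs = []"
    using inv by (simp_all add: main_inv_def)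
  have r: "r \<in> {..<n} - R" and rd: "distinct rs" "set rs \<subseteq> {..<n}" using ok by (auto simp: stack_ok_def)
  have rX: "r \<in> ?X" using part_self[OF r] .
  have s1: "1 \<le> ?s" using rX finite_part[of R r] by (metis One_nat_def Suc_leI card_gt_0_iff empty_iff)
  have sW: "?s \<le> ?W" unfolding weight_def card_eq_sum by (rule sum_mono) simp
  have lenB: "length rs < B" using stack_length[OF ok] B by simp
  have nB: "n \<le> B" "int n < M" using B B_M by linarith+
  let ?v = "v(vsp := int (length rs), vr := int r, vd0 := 1, vg := - int \<sigma>, vsg := 1)"
  let ?set = "vd0 ::= Cn 0;; vg ::= Cn 1"
  let ?mark = "Wr aRm (Vr vr) (Cn 1);; ve ::= Rd aHead (Vr vr)"
  let ?push = "While (Less (Cn 0) (Vr ve)) push"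
  let ?Q = "\<lambda>v' m'. \<exists>c us. main_inv (insert c R) (rs @ us) 1 v' m' \<and>
    potential (insert c R) (rs @ us) + ?W \<le> potential R (rs @ [r])"
  let ?T7 = "?W * 110 + 10"
  have "runs process v m (60 + (?A + ((?s * 210 + 100) + (20 + (?A + (30 + ?T7)))))) ?Q"
    unfolding process_def
  proof (rule runs_seqI[OF runs_wpf_le[where Q = "\<lambda>v' m'. v' = ?v \<and> m' = m" and t = 60] order_refl])
    show "wpf pop (\<lambda>v' m'. v' = ?v \<and> m' = m) v m"
      using st[of "length rs"] lenB by (simp add: pop_def sp sg)
    show "cst pop \<le> 60" by (simp add: pop_def acost_def)
    fix v1 m1 assume e1: "v1 = ?v \<and> m1 = m"
    have g1: "graph_ok R v1 m1" using g e1 by (simp add: graph_ok_def)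
    have sc1: "scale_regs v1" "twiddles m1" using sc e1 by (simp_all add: scale_regs_def)
    have vr1: "v1 vr = int r" "v1 vd0 = int 1" "v1 vg = - int \<sigma>" "v1 vsp = int (length rs)" "v1 vsg = 1" using e1 by simp_all
    show "runs (add_pairs;; find_centroid;; ?set;; add_pairs;; ?mark;; ?push) v1 m1
      (?A + ((?s * 210 + 100) + (20 + (?A + (30 + ?T7))))) ?Q"
    proof (rule runs_seqI[OF runs_add_pairs[OF g1 vr1(1) r vr1(2) order_refl sc1] order_refl])
      fix v2 m2 assume f2: "same (wv add_pairs) v2 v1" "same (wa add_pairs) m2 m1"
        and q2: "(\<forall>i. m2 aW i = m1 aW i + v1 vg * int (pairs_via ?X r 1 i)) \<and>
          (\<exists>q p d. bfs_done R r 1 ?s q p d \<and> v2 vt = int ?s \<and> m2 aQ = (\<lambda>i. int (q i)) \<and>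
            m2 aP = (\<lambda>i. int (p i)) \<and> m2 aD = (\<lambda>i. int (d i)))"
      obtain q p d where B2: "bfs_done R r 1 ?s q p d" "v2 vt = int ?s" "m2 aQ = (\<lambda>i. int (q i))"
        "m2 aP = (\<lambda>i. int (p i))" "m2 aD = (\<lambda>i. int (d i))" using q2 by blast
      have W2: "m2 aW i = m aW i - int \<sigma> * int (pairs_via ?X r 1 i)" for i using q2 e1 vr1 by simp
      have g2: "graph_ok R v2 m2"
        by (rule graph_ok_frame[OF g1]) (use f2 B2 nat_array_int in \<open>simp_all add: same_def wv_add_pairs wa_add_pairs\<close>)
      have k2: "scale_regs v2" "twiddles m2" "v2 vsp = int (length rs)" "v2 vsg = 1" "m2 aSt = m aSt"
        using f2 sc1 vr1 e1 by (simp_all add: same_def wv_add_pairs wa_add_pairs scale_regs_def twiddles_def)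
      have fc: "runs find_centroid v2 m2 (?s * 210 + 100) (\<lambda>v' m'. \<exists>k<?s. v' vr = int (q k) \<and>
          (\<forall>u\<in>nbrs (insert (q k) R) (q k). 2 * card (part (insert (q k) R) u) \<le> ?s))"
        using runs_find_centroid[where v = v2 and m = m2, OF B2(1) B2(2) B2(3) B2(4)] .
      show "runs (find_centroid;; ?set;; add_pairs;; ?mark;; ?push) v2 m2
        ((?s * 210 + 100) + (20 + (?A + (30 + ?T7)))) ?Q"
      proof (rule runs_seqI[OF fc order_refl])
        fix v3 m3 assume f3: "same (wv find_centroid) v3 v2" "same (wa find_centroid) m3 m2"
          and q3: "\<exists>k<?s. v3 vr = int (q k) \<and>
            (\<forall>u\<in>nbrs (insert (q k) R) (q k). 2 * card (part (insert (q k) R) u) \<le> ?s)"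
        obtain c where c: "c \<in> ?X" "v3 vr = int c" "\<And>u. u \<in> nbrs (insert c R) c \<Longrightarrow> 2 * card (part (insert c R) u) \<le> ?s"
        proof -
          obtain k where k: "k < ?s" "v3 vr = int (q k)"
            "\<forall>u\<in>nbrs (insert (q k) R) (q k). 2 * card (part (insert (q k) R) u) \<le> ?s" using q3 by (elim exE conjE)
          have "q ` {..<?s} = ?X" using B2(1) by (simp add: bfs_done_def)
          then have "q k \<in> ?X" using k(1) by blast
          then show thesis using that[of "q k"] k(2,3) by simp
        qed
        have cR: "c \<in> {..<n} - R" using c(1) part_sub[of R r] by blast
        then have cn: "c < n" by simp
        have Xc: "part R c = ?X" by (rule part_cong[OF c(1)])
        let ?v4 = "v3(vd0 := 0, vg := 1)"
        show "runs (?set;; add_pairs;; ?mark;; ?push) v3 m3 (20 + (?A + (30 + ?T7))) ?Q"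
        proof (rule runs_seqI[OF runs_wpf_le[where Q = "\<lambda>v' m'. v' = ?v4 \<and> m' = m3" and t = 20] order_refl])
          fix v4 m4 assume e4: "v4 = ?v4 \<and> m4 = m3"
          have k4: "scale_regs v4" "twiddles m4" "v4 vsp = int (length rs)" "v4 vsg = 1" "m4 aSt = m aSt" "m4 aW = m2 aW"
            using f3 k2 e4 by (simp_all add: same_def wv_find_centroid wa_find_centroid scale_regs_def twiddles_def)
          have g4: "graph_ok R v4 m4"
            by (rule graph_ok_frame[OF g2]) (use f3 e4 B2 nat_array_int in \<open>simp_all add: same_def wv_find_centroid wa_find_centroid\<close>)
          have vr4: "v4 vr = int c" "v4 vd0 = int 0" "v4 vg = 1" using e4 c(2) by simp_all
          have A': "runs add_pairs v4 m4 ?A (\<lambda>v' m'. (\<forall>i. m' aW i = m4 aW i + v4 vg * int (pairs_via ?X c 0 i)) \<and>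
            (\<exists>q p d. bfs_done R c 0 ?s q p d \<and> v' vt = int ?s \<and> m' aQ = (\<lambda>i. int (q i)) \<and>
              m' aP = (\<lambda>i. int (p i)) \<and> m' aD = (\<lambda>i. int (d i))))"
            using runs_add_pairs[OF g4 vr4(1) cR vr4(2) _ k4(1,2)] unfolding Xc by simp
          show "runs (add_pairs;; ?mark;; ?push) v4 m4 (?A + (30 + ?T7)) ?Q"
          proof (rule runs_seqI[OF A' order_refl])
            fix v5 m5 assume f5: "same (wv add_pairs) v5 v4" "same (wa add_pairs) m5 m4"
              and q5: "(\<forall>i. m5 aW i = m4 aW i + v4 vg * int (pairs_via ?X c 0 i)) \<and>
                (\<exists>q p d. bfs_done R c 0 ?s q p d \<and> v5 vt = int ?s \<and> m5 aQ = (\<lambda>i. int (q i)) \<and>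
                m5 aP = (\<lambda>i. int (p i)) \<and> m5 aD = (\<lambda>i. int (d i)))"
            have na: "nat_array (m5 aQ)" "nat_array (m5 aP)" "nat_array (m5 aD)" using q5 nat_array_int by auto
            have W5: "m5 aW i = m aW i - int \<sigma> * int (pairs_via ?X r 1 i) + int (pairs_via ?X c 0 i)" for i
              using q5 vr4 k4(6) W2 by simp
            have k5: "scale_regs v5" "twiddles m5" "v5 vsp = int (length rs)" "v5 vsg = 1" "m5 aSt = m aSt" "v5 vr = int c"
              using f5 k4 vr4 by (simp_all add: same_def wv_add_pairs wa_add_pairs scale_regs_def twiddles_def)
            have g5: "graph_ok R v5 m5"
              by (rule graph_ok_frame[OF g4]) (use f5 na in \<open>simp_all add: same_def wv_add_pairs wa_add_pairs\<close>)
            let ?v6 = "v5(ve := int (first_arc c))" and ?m6 = "m5(aRm := (m5 aRm)(c := 1))"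
            show "runs (?mark;; ?push) v5 m5 (30 + ?T7) ?Q"
            proof (rule runs_seqI[OF runs_wpf_le[where Q = "\<lambda>v' m'. v' = ?v6 \<and> m' = ?m6" and t = 30] order_refl])
              have "m5 aHead c = int (first_arc c)" using g5 cn by (simp add: graph_ok_def)
              then have hd: "m5 (Suc 0) c = int (first_arc c)" by simp
              have "c < B" using cn nB by simp
              then show "wpf ?mark (\<lambda>v' m'. v' = ?v6 \<and> m' = ?m6) v5 m5"
                using cn nB by (simp add: k5(6) hd)
              fix v6 m6 assume e6: "v6 = ?v6 \<and> m6 = ?m6"
              have g6: "graph_ok (insert c R) v6 m6"
                using g5 e6 cn by (auto simp: graph_ok_def)
              have k6: "scale_regs v6" "twiddles m6" "v6 vsp = int (length rs)" "v6 vsg = 1" "m6 aSt = m aSt" "m6 aW = m5 aW"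
                "v6 ve = int (first_arc c)"
                using e6 k5 by (simp_all add: scale_regs_def twiddles_def)
              have degW: "deg c \<le> ?W" using weight_remove[OF finite_part c(1)] by linarith
              have disj: "set rs \<inter> nbrs (insert c R) c = {}"
              proof -
                have "x \<notin> nbrs (insert c R) c" if x: "x \<in> set rs" for x
                proof
                  assume "x \<in> nbrs (insert c R) c"
                  then have "x \<in> ?X" by (rule nbr_comp(1)[OF c(1)])
                  moreover have "x \<in> part R x" "part R x \<inter> ?X = {}" using x ok part_self by (auto simp: stack_ok_def)
                  ultimately show False by blast
                qed
                then show ?thesis by blast
              qed
              have P: "runs ?push v6 m6 (deg c * 110 + 10) (\<lambda>v' m'. \<exists>us. distinct us \<and> set us = nbrs (insert c R) c \<and>
                v' vsp = int (length (rs @ us)) \<and> (\<forall>i<length (rs @ us). m' aSt i = int ((rs @ us) ! i)))"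
              proof (rule runs_push[where v = v6 and m = m6, OF cn k6(7,3) _ _ _ rd disj])
                fix i assume "i < length rs"
                then show "m6 aSt i = int (rs ! i)" using st[of i] k6(5) by (simp add: nth_append)
              qed (use g6 in \<open>auto simp: graph_ok_def\<close>)
              show "runs ?push v6 m6 ?T7 ?Q"
              proof (rule runs_conseq[OF P])
                show "deg c * 110 + 10 \<le> ?T7" using degW by simp
                fix v7 m7 assume f7: "same (wv ?push) v7 v6" "same (wa ?push) m7 m6"
                  and q7: "\<exists>us. distinct us \<and> set us = nbrs (insert c R) c \<and>
                    v7 vsp = int (length (rs @ us)) \<and> (\<forall>i<length (rs @ us). m7 aSt i = int ((rs @ us) ! i))"
                then obtain us where us: "distinct us" "set us = nbrs (insert c R) c"
                  "v7 vsp = int (length (rs @ us))" "\<forall>i<length (rs @ us). m7 aSt i = int ((rs @ us) ! i)" by blast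
                have k7: "scale_regs v7" "twiddles m7" "v7 vsg = int 1" "m7 aW = m5 aW"
                  using f7 k6 by (simp_all add: same_def wv_push wa_push scale_regs_def twiddles_def)
                have g7: "graph_ok (insert c R) v7 m7"
                  using g6 f7 by (simp add: graph_ok_def same_def wv_push wa_push)
                have "m7 aW i + (\<Sum>x\<in>set (rs @ us). int (pairs_at (part (insert c R) x) i) -
                    int 1 * int (pairs_via (part (insert c R) x) x 1 i)) = int (pairs_at {..<n} i)" for i
                proof -
                  let ?h = "\<lambda>\<tau> Y x. int (pairs_at Y i) - int \<tau> * int (pairs_via Y x 1 i)"
                  have "(\<Sum>x\<in>set rs. ?h 1 (part R x) x) = (\<Sum>x\<in>set rs. ?h \<sigma> (part R x) x)"
                    using \<sigma> by auto
                  moreover have "(\<Sum>x\<in>set (rs @ us). ?h 1 (part (insert c R) x) x) =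
                      (\<Sum>x\<in>set rs. ?h 1 (part R x) x) + (\<Sum>u\<in>nbrs (insert c R) c. ?h 1 (part (insert c R) u) u)"
                    by (rule sum_step[OF ok c(1) us(1,2)])
                  moreover have "(\<Sum>x\<in>set (rs @ [r]). ?h \<sigma> (part R x) x) =
                      (\<Sum>x\<in>set rs. ?h \<sigma> (part R x) x) + ?h \<sigma> ?X r"
                    by (rule sum_pop[OF ok c(1) us(1,2)])
                  moreover have "int (pairs_at ?X i) = int (pairs_via ?X c 0 i) +
                      (\<Sum>u\<in>nbrs (insert c R) c. ?h 1 (part (insert c R) u) u)"
                    using pairs_split[OF c(1), of i] by simp
                  ultimately show ?thesis using eq[of i] unfolding k7(4) W5 by linarith
                qed
                then have "main_inv (insert c R) (rs @ us) 1 v7 m7"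
                  unfolding main_inv_def using g7 k7 us stack_ok_step[OF ok c(1) us(1,2)] by simp
                then show "?Q v7 m7" using potential_step[OF ok c(1) us(1,2) c(3)] by blast
              qed
            qed (simp add: acost_def)
          qed
        qed simp_all
      qed
    qed
  qed
  then show ?thesis
  proof (rule runs_conseq)
    have "1 * ?W \<le> ?W * (k0 + 3)" "3 * ?W \<le> ?W * (k0 + 3)" by (simp_all add: algebra_simps)
    then show "60 + (?A + ((?s * 210 + 100) + (20 + (?A + (30 + ?T7))))) \<le> ?W * (k0 + 3) * 20000"
      using s1 sW by linarith
  qed
qed

end

section \<open>The complete program\<close>

context solver
begin

text \<open>Every arc is counted in the degree of its source, and there are
  \<open>2 * (n - 1)\<close> arcs.\<close>

lemma weight_all: "weight {..<n} \<le> 3 * n"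
proof -
  have "(\<Sum>v<n. deg v) = (\<Sum>v\<in>{..<n}. \<Sum>e\<in>{e\<in>{1..arcs}. src e = v}. 1)"
    unfolding deg_def arcs_below_def by (intro sum.cong refl) (auto intro!: arg_cong[of _ _ card])
  also have "\<dots> = (\<Sum>e\<in>{1..arcs}. 1)"
    by (rule sum.group) (use arc_less in auto)
  finally have "(\<Sum>v<n. deg v) = arcs" by simp
  then show ?thesis unfolding weight_def sum.distrib using arcs by simp
qed

text \<open>The halving in \<open>emit\<close> and the identification of memory words with output
  entries both require that the counts do not overflow.\<close>

lemma pairs_at_less: "int (pairs_at {..<n} i) < M"
proof -
  have "pairs_at {..<n} i \<le> card ({..<n} \<times> {..<n})" unfolding pairs_at_def by (rule card_mono) auto
  then have "pairs_at {..<n} i \<le> n * n" by simp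
  also have "\<dots> \<le> N0 * N0" using k0(1) N0 by (intro mult_le_mono) linarith+
  also have "\<dots> = N0 ^ 2" by (simp add: power2_eq_square)
  also have "\<dots> \<le> N0 ^ 20" using N0_4 by (intro power_increasing) auto
  finally have "int (pairs_at {..<n} i) \<le> S" unfolding S_def by (simp flip: of_nat_power)
  then show ?thesis using S_lt_M by linarith
qed

lemma runs_main:
  assumes inv: "main_inv R rs \<sigma> v m"
  shows "runs (While (Less (Cn 0) (Vr vsp)) process) v m (potential R rs * ((k0 + 3) * 20010) + 5)
    (\<lambda>v' m'. v' vn = int n \<and> (\<forall>i. m' aW i = int (pairs_at {..<n} i)))"
proof -
  let ?b = "Less (Cn 0) (Vr vsp)"
  let ?I = "\<lambda>(R, rs, \<sigma>). main_inv R rs \<sigma>"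
  let ?Phi = "\<lambda>(R, rs, \<sigma> :: nat). potential R rs * ((k0 + 3) * 20010)"
  have nM: "int n < M" using B B_M by linarith
  have "runs (While ?b process) v m (?Phi (R, rs, \<sigma>) + bcost ?b + 1) (\<lambda>v' m'. \<exists>g. ?I g v' m' \<and> \<not> bv ?b v' m')"
  proof (rule runs_while[where I = ?I and \<Phi> = ?Phi])
    show "?I (R, rs, \<sigma>) v m" using inv by simp
  next
    fix g v' m' assume Ig: "?I g v' m'"
    obtain R rs \<sigma> where g: "g = (R, rs, \<sigma>)" by (cases g)
    have I: "main_inv R rs \<sigma> v' m'" using Ig g by simp
    have sp: "v' vsp = int (length rs)" and ok: "stack_ok R rs" using I by (simp_all add: main_inv_def)
    have "int (length rs) < M" using stack_length[OF ok] nM by linarith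
    then have "length rs < 2 ^ w" by simp
    then show "okb ?b v' m'" using sp by (simp add: okw_def)
    assume "bv ?b v' m'"
    then have "rs \<noteq> []" using sp by auto
    then obtain rs' r where rs: "rs = rs' @ [r]" by (cases rs rule: rev_cases) auto
    have r: "r \<in> {..<n} - R" using ok rs by (auto simp: stack_ok_def)
    let ?W = "weight (part R r)"
    have W1: "1 \<le> ?W" using weight_remove[OF finite_part part_self[OF r]] by linarith
    let ?t = "?W * (k0 + 3) * 20000"
    have "runs process v' m' ?t (\<lambda>v'' m''. \<exists>g'. ?I g' v'' m'' \<and> ?Phi g' + ?t + bcost ?b + 1 \<le> ?Phi g)"
    proof (rule runs_conseq[OF runs_process[OF I[unfolded rs]] order_refl])
      fix v'' m'' assume "\<exists>c us. main_inv (insert c R) (rs' @ us) 1 v'' m'' \<and>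
        potential (insert c R) (rs' @ us) + ?W \<le> potential R (rs' @ [r])"
      then obtain c us where q: "main_inv (insert c R) (rs' @ us) 1 v'' m''"
        "potential (insert c R) (rs' @ us) + ?W \<le> potential R (rs' @ [r])" by blast
      have "(potential (insert c R) (rs' @ us) + ?W) * ((k0 + 3) * 20010) \<le> potential R (rs' @ [r]) * ((k0 + 3) * 20010)"
        using q(2) by (intro mult_le_mono1)
      moreover have "(potential (insert c R) (rs' @ us) + ?W) * ((k0 + 3) * 20010) =
        potential (insert c R) (rs' @ us) * ((k0 + 3) * 20010) + (?t + 10 * (?W * (k0 + 3)))" by (simp add: algebra_simps)
      moreover have "1 * 1 \<le> ?W * (k0 + 3)" using W1 by (intro mult_le_mono) auto
      moreover have "bcost ?b = 4" by simp
      ultimately have "potential (insert c R) (rs' @ us) * ((k0 + 3) * 20010) + ?t + bcost ?b + 1 \<le>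
        potential R (rs' @ [r]) * ((k0 + 3) * 20010)" by linarith
      note step = conjI[OF q(1) this]
      show "\<exists>g'. ?I g' v'' m'' \<and> ?Phi g' + ?t + bcost ?b + 1 \<le> ?Phi g"
        unfolding g rs by (rule exI[of _ "(insert c R, rs' @ us, 1)"]) (unfold prod.case, rule step)
    qed
    then show "\<exists>t. runs process v' m' t (\<lambda>v'' m''. \<exists>g'. ?I g' v'' m'' \<and> ?Phi g' + t + bcost ?b + 1 \<le> ?Phi g)"
      by (rule exI[of _ ?t])
  qed
  then show ?thesis
  proof (rule runs_conseq)
    fix v' m' assume "\<exists>g. ?I g v' m' \<and> \<not> bv ?b v' m'"
    then obtain R rs \<sigma> where I: "main_inv R rs \<sigma> v' m'" "\<not> bv ?b v' m'" by auto
    then have "rs = []" by (simp add: main_inv_def)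
    then show "v' vn = int n \<and> (\<forall>i. m' aW i = int (pairs_at {..<n} i))"
      using I(1) by (simp add: main_inv_def graph_ok_def)
  qed simp
qed

lemma runs_emit:
  assumes v: "v vN = int (n - 1)" and W: "\<And>i. m aW i = int (pairs_at {..<n} i)"
  shows "runs (vi ::= Cn 0;; While (Less (Vr vi) (Vr vN)) emit) v m (n * 66 + 9)
    (\<lambda>v' m'. \<forall>i<n - 1. m' aIn i = int (distance_distribution {..<n} E (Suc i)))"
proof -
  let ?I = "\<lambda>i (v' :: vars) (m' :: arrs). \<forall>j<i. m' aIn j = int (distance_distribution {..<n} E (Suc j))"
  have nB: "n - 1 \<le> B" using B by simp
  have "(2::int) < M" using S_16 S_lt_M by linarith
  then have "runs (vi ::= Cn 0;; While (Less (Vr vi) (Vr vN)) emit) v m ((n - 1) * (60 + 6) + 9) (?I (n - 1))"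
  proof (intro count_loop[where I = ?I and v = v, OF refl nB v _ _ _ cst_emit])
    assume two: "(2::int) < M"
    fix i and v' :: vars and m' :: arrs
    assume I: "?I i v' m'" and i: "i < n - 1" and vi: "v' vi = int i" and sm: "same (wa emit) m' m"
    have w: "m' aW (Suc i) = 2 * int (distance_distribution {..<n} E (Suc i))"
      using W[of "Suc i"] pairs_at_distribution[of "Suc i"] sm by (simp add: same_def wa_emit)
    have "2 * int (distance_distribution {..<n} E (Suc i)) < M"
      using pairs_at_less[of "Suc i"] pairs_at_distribution[of "Suc i"] by simp
    moreover have "i < B" "1 + int i < int B" using i B by linarith+
    moreover have "nat (int i + 1) = Suc i" "nat (1 + int i) = Suc i" by simp_all
    ultimately show "wpf emit (\<lambda>v'' m''. ?I (Suc i) v'' m'' \<and> v'' vi = int (Suc i)) v' m'"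
      using I by (simp add: emit_def vi w two less_Suc_eq add.commute[of _ "1::int"])
  qed (simp_all add: wv_emit)
  then show ?thesis by (rule runs_conseq) simp_all
qed

theorem runs_solve:
  assumes inp: "\<And>i. i \<le> arcs \<Longrightarrow> m aIn i = int (inp i)" "inp 0 = n" and z: "\<And>k i. 1 \<le> k \<Longrightarrow> m k i = 0"
  shows "runs solve v m (n * 1700 + (k0 + 1) * (k0 + 1) * 4000 + 3 * n * floorlog 2 n * ((k0 + 3) * 20010) + 100)
    (\<lambda>v' m'. \<forall>i<n - 1. m' aIn i = int (distance_distribution {..<n} E (Suc i)))"
proof -
  let ?init = "Wr aSt (Cn 0) (Cn 0);; vsp ::= Cn 1;; vsg ::= Cn 0"
  let ?W = "While (Less (Cn 0) (Vr vsp)) process" and ?out = "vN ::= Vr vn [-] Cn 1"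
  let ?L = "vi ::= Cn 0;; While (Less (Vr vi) (Vr vN)) emit"
  let ?R = "\<lambda>v' m'. \<forall>i<n - 1. m' aIn i = int (distance_distribution {..<n} E (Suc i))"
  let ?P = "potential {} [0] * ((k0 + 3) * 20010) + 5"
  have m1: "m aHead u = 0" for u using z[of 1] by simp
  have part0: "part {} 0 = {..<n}" using part_empty[of 0] n1 by simp
  have "runs solve v m ((n * 1600 + (k0 + 1) * (k0 + 1) * 4000) + (30 + (?P + (10 + (n * 66 + 9))))) ?R"
    unfolding solve_def
  proof (rule runs_seqI[OF runs_setup[OF inp m1] order_refl])
    fix v1 m1 assume f1: "same (wa setup_tables) m1 m"
      and q1: "v1 vn = int n \<and> (\<forall>u<n. m1 aHead u = int (first_arc u)) \<and>
        (\<forall>e. 1 \<le> e \<longrightarrow> e \<le> arcs \<longrightarrow> m1 aNext e = int (next_arc e)) \<and> scale_regs v1 \<and> twiddles m1"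
    have z1: "m1 k i = 0" if "5 \<le> k" for k i
      using z[of k i] that f1 by (simp add: same_def wa_setup_tables)
    have in1: "m1 aIn e = int (tgt e)" if "e \<le> arcs" for e
      using inp(1)[OF that] f1 by (simp add: same_def wa_setup_tables tgt)
    let ?v = "v1(vsp := 1, vsg := 0)" and ?m = "m1(aSt := (m1 aSt)(0 := 0))"
    show "runs (?init;; ?W;; ?out;; ?L) v1 m1 (30 + (?P + (10 + (n * 66 + 9)))) ?R"
    proof (rule runs_seqI[OF runs_wpf_le[where Q = "\<lambda>v' m'. v' = ?v \<and> m' = ?m" and t = 30] order_refl])
      have "0 < B" using B n1 by simp
      then show "wpf ?init (\<lambda>v' m'. v' = ?v \<and> m' = ?m) v1 m1" by simp
      fix v2 m2 assume e2: "v2 = ?v \<and> m2 = ?m"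
      have g: "graph_ok {} v2 m2"
        using q1 in1 z1 e2 unfolding graph_ok_def by (auto simp: nat_array_def)
      have s: "stack_ok {} [0]" using n1 by (simp add: stack_ok_def)
      have "main_inv {} [0] 0 v2 m2"
        unfolding main_inv_def using g s q1 e2 z1 part0 by (simp add: scale_regs_def twiddles_def)
      then show "runs (?W;; ?out;; ?L) v2 m2 (?P + (10 + (n * 66 + 9))) ?R"
      proof (rule runs_seqI[OF runs_main order_refl])
        fix v3 m3 assume q3: "v3 vn = int n \<and> (\<forall>i. m3 aW i = int (pairs_at {..<n} i))"
        let ?v3 = "v3(vN := int (n - 1))"
        show "runs (?out;; ?L) v3 m3 (10 + (n * 66 + 9)) ?R"
        proof (rule runs_seqI[OF runs_wpf_le[where Q = "\<lambda>v' m'. v' = ?v3 \<and> m' = m3" and t = 10] order_refl])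
          show "wpf ?out (\<lambda>v' m'. v' = ?v3 \<and> m' = m3) v3 m3" using q3 n1 by (simp add: of_nat_diff)
          fix v4 m4 assume e4: "v4 = ?v3 \<and> m4 = m3"
          show "runs ?L v4 m4 (n * 66 + 9) ?R"
            by (rule runs_emit) (use e4 q3 in auto)
        qed simp
      qed
    qed (simp add: acost_def)
  qed
  then show ?thesis
  proof (rule runs_conseq)
    have "potential {} [0] = weight {..<n} * floorlog 2 n" by (simp add: potential_def part0)
    also have "\<dots> \<le> 3 * n * floorlog 2 n" using weight_all by (intro mult_le_mono1)
    finally have "potential {} [0] * ((k0 + 3) * 20010) \<le> 3 * n * floorlog 2 n * ((k0 + 3) * 20010)"
      by (rule mult_le_mono1)
    then show "(n * 1600 + (k0 + 1) * (k0 + 1) * 4000) + (30 + (?P + (10 + (n * 66 + 9)))) \<le>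
      n * 1700 + (k0 + 1) * (k0 + 1) * 4000 + 3 * n * floorlog 2 n * ((k0 + 3) * 20010) + 100" by linarith
  qed
qed

end

lemma encode_graph_nth:
  "j < length es \<Longrightarrow> encode_graph n es ! (2 * j + 1) = fst (es ! j) \<and> encode_graph n es ! (2 * j + 2) = snd (es ! j)"
proof (induction es arbitrary: j n)
  case (Cons e es)
  then show ?case by (cases j; cases e) (auto simp: encode_graph_def)
qed simp

lemma length_encode_graph: "length (encode_graph n es) = 1 + 2 * length es"
  by (induction es) (auto simp: encode_graph_def)

definition arc_tgt :: "nat list \<Rightarrow> nat \<Rightarrow> nat" where "arc_tgt xs e = xs ! e"
definition arc_src :: "nat list \<Rightarrow> nat \<Rightarrow> nat" where
  "arc_src xs e = xs ! (if odd e then e + 1 else e - 1)"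

text \<open>Each edge occupies two consecutive entries and yields two opposite arcs. Distinctness of
  the edge list makes the edge behind a pair of ends unique, and since the ends differ, their order
  tells the two arcs apart.\<close>

lemma arc_tree_encode:
  assumes "is_tree {..<n} E" "edge_list E es"
  shows "arc_tree n E (2 * length es) (arc_src (encode_graph n es)) (arc_tgt (encode_graph n es))"
    and "length es = n - 1" and "1 \<le> n"
proof -
  interpret T: tree "{..<n}" E by unfold_locales (rule assms(1))
  let ?xs = "encode_graph n es" and ?f = "\<lambda>(u, v). {u, v :: nat}"
  have es: "distinct (map ?f es)" "set (map ?f es) = E" using assms(2) by (simp_all add: edge_list_def)
  show "1 \<le> n" using T.V_ne by (cases n) auto
  have "card E = length es" using distinct_card[OF es(1)] es(2) by simp
  then show "length es = n - 1" using T.card_edges by simp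
  have arc: "\<exists>j<length es. {arc_src ?xs e, arc_tgt ?xs e} = ?f (es ! j) \<and>
      (e = 2 * j + 1 \<and> arc_tgt ?xs e = fst (es ! j) \<and> arc_src ?xs e = snd (es ! j) \<or>
       e = 2 * j + 2 \<and> arc_tgt ?xs e = snd (es ! j) \<and> arc_src ?xs e = fst (es ! j))"
    if e: "1 \<le> e" "e \<le> 2 * length es" for e
  proof (cases "odd e")
    case True
    then obtain j where j: "e = 2 * j + 1" by (elim oddE)
    then have "j < length es" using e by simp
    then show ?thesis using encode_graph_nth[of j es n] j
      by (intro exI[of _ j]) (auto simp: arc_src_def arc_tgt_def case_prod_beta)
  next
    case False
    then obtain i where "e = 2 * i" by (auto elim: evenE)
    then obtain j where j: "e = 2 * j + 2" using e by (cases i) auto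
    then have "j < length es" using e by simp
    then show ?thesis using encode_graph_nth[of j es n] j
      by (intro exI[of _ j]) (auto simp: arc_src_def arc_tgt_def case_prod_beta)
  qed
  show "arc_tree n E (2 * length es) (arc_src ?xs) (arc_tgt ?xs)"
  proof unfold_locales
    fix e assume "1 \<le> e" "e \<le> 2 * length es"
    then obtain j where "j < length es" "{arc_src ?xs e, arc_tgt ?xs e} = ?f (es ! j)" using arc by blast
    then show "{arc_src ?xs e, arc_tgt ?xs e} \<in> E" using es(2) by (metis length_map nth_map nth_mem)
  next
    fix e e' assume h: "1 \<le> e" "e \<le> 2 * length es" "1 \<le> e'" "e' \<le> 2 * length es"
      "arc_src ?xs e = arc_src ?xs e'" "arc_tgt ?xs e = arc_tgt ?xs e'"
    obtain j where j: "j < length es" "{arc_src ?xs e, arc_tgt ?xs e} = ?f (es ! j)"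
      "e = 2 * j + 1 \<and> arc_tgt ?xs e = fst (es ! j) \<and> arc_src ?xs e = snd (es ! j) \<or>
       e = 2 * j + 2 \<and> arc_tgt ?xs e = snd (es ! j) \<and> arc_src ?xs e = fst (es ! j)" using arc[OF h(1,2)] by blast
    obtain j' where j': "j' < length es" "{arc_src ?xs e', arc_tgt ?xs e'} = ?f (es ! j')"
      "e' = 2 * j' + 1 \<and> arc_tgt ?xs e' = fst (es ! j') \<and> arc_src ?xs e' = snd (es ! j') \<or>
       e' = 2 * j' + 2 \<and> arc_tgt ?xs e' = snd (es ! j') \<and> arc_src ?xs e' = fst (es ! j')" using arc[OF h(3,4)] by blast
    have "map ?f es ! j = map ?f es ! j'" using j j' h by simp
    then have jj: "j = j'" using nth_eq_iff_index_eq[OF es(1), of j j'] j(1) j'(1) by (simp only: length_map)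
    have "?f (es ! j) \<in> E" using es(2) j(1) by (metis length_map nth_map nth_mem)
    then have "fst (es ! j) \<noteq> snd (es ! j)" using T.edgeD by (auto simp: case_prod_beta)
    then show "e = e'" using j(3) j'(3) jj h(5,6) by auto
  next
    fix u v assume "{u, v} \<in> E"
    then obtain j where j: "j < length es" "?f (es ! j) = {u, v}" using es(2) by (auto simp: in_set_conv_nth)
    then have "es ! j = (u, v) \<or> es ! j = (v, u)" by (cases "es ! j") (auto simp: doubleton_eq_iff)
    then show "\<exists>e. 1 \<le> e \<and> e \<le> 2 * length es \<and> arc_src ?xs e = u \<and> arc_tgt ?xs e = v"
    proof
      assume "es ! j = (u, v)"
      then show ?thesis using encode_graph_nth[OF j(1), of n] j(1)
        by (intro exI[of _ "2 * j + 2"]) (simp add: arc_src_def arc_tgt_def)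
    next
      assume "es ! j = (v, u)"
      then show ?thesis using encode_graph_nth[OF j(1), of n] j(1)
        by (intro exI[of _ "2 * j + 1"]) (simp add: arc_src_def arc_tgt_def)
    qed
  qed
qed

text \<open>Register \<open>1\<close> receives the memory bound \<open>8 * n\<close>.\<close>

definition prologue :: "instr list" where
  "prologue = [Const 1 0, Load 1 1, Bin OpAdd 1 1 1, Bin OpAdd 1 1 1, Bin OpAdd 1 1 1]"

definition program :: "instr list" where
  "program = prologue @ ccom 5 solve"

definition run_time :: "nat \<Rightarrow> nat" where
  "run_time n = 300000 * n * (floorlog 2 n)\<^sup>2"

lemma halted_steps: "halted P s \<Longrightarrow> (step w P ^^ k) s = s"
  by (induction k) (simp_all add: step_def)

lemma run_time_bigo: "(\<lambda>n. real (run_time n)) \<in> O(\<lambda>n. real n * (log 2 (real n))\<^sup>2)"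
\<comment> \<open>From \<open>n \<ge> 2\<close> on, \<open>floorlog 2 n\<close> is at most twice the
  logarithm, so squaring multiplies the constant of \<open>run_time\<close> by
  \<open>4\<close>.\<close>
proof (rule bigoI[where c = 1200000])
  show "\<forall>\<^sub>F n in sequentially. norm (real (run_time n)) \<le> 1200000 * norm (real n * (log 2 (real n))\<^sup>2)"
    unfolding eventually_sequentially
  proof (intro exI[of _ 2] allI impI)
    fix n :: nat assume n: "2 \<le> n"
    then have l1: "1 \<le> log 2 (real n)" by simp
    have "real (floorlog 2 n) \<le> log 2 (real n) + 1"
      using n l1 by (simp add: floorlog_def of_nat_nat)
    then have "real (floorlog 2 n) \<le> 2 * log 2 (real n)" using l1 by linarith
    then have "(real (floorlog 2 n))\<^sup>2 \<le> (2 * log 2 (real n))\<^sup>2" by (intro power_mono) auto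
    then have "real n * (real (floorlog 2 n))\<^sup>2 \<le> real n * (2 * log 2 (real n))\<^sup>2" by (intro mult_left_mono) auto
    then show "norm (real (run_time n)) \<le> 1200000 * norm (real n * (log 2 (real n))\<^sup>2)"
      by (simp add: run_time_def power_mult_distrib)
  qed
qed

text \<open>The summands are at most 1700, 16000, 240120 and 105 times \<open>n * (l * l)\<close>,
  in total below 300000 times.\<close>

lemma time_bound:
  fixes n k l :: nat
  assumes "1 \<le> n" "1 \<le> l" "k \<le> l"
  shows "5 + (n * 1700 + (k + 1) * (k + 1) * 4000 + 3 * n * l * ((k + 3) * 20010) + 100) \<le> 300000 * n * l\<^sup>2"
proof -
  have a: "(k + 1) * (k + 1) \<le> (2 * l) * (2 * l)" using assms by (intro mult_le_mono) auto
  have b: "n * l * (k + 3) \<le> n * l * (4 * l)" using assms by (intro mult_le_mono2) simp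
  have c: "1 * (l * l) \<le> n * (l * l)" using assms by (intro mult_le_mono1)
  have "1 * 1 \<le> l * l" using assms by (intro mult_le_mono)
  then have d: "n * 1 \<le> n * (l * l)" by (intro mult_le_mono2) simp
  define X where "X = n * (l * l)"
  have "(k + 1) * (k + 1) \<le> 4 * X"
    using a c unfolding X_def by linarith
  moreover have "n * l * (k + 3) \<le> 4 * X" using b by (simp add: X_def ac_simps)
  moreover have "n \<le> X" using d by (simp add: X_def)
  moreover have "3 * n * l * ((k + 3) * 20010) = 60030 * (n * l * (k + 3))" by simp
  moreover have "300000 * n * l\<^sup>2 = 300000 * X" by (simp add: X_def power2_eq_square)
  ultimately show ?thesis using assms(1) by linarith
qed

lemma program_correct:
  assumes tree: "is_tree {..<n} E" and es: "edge_list E es"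
  shows "ram_computes (log_word_length 256 n) program (encode_graph n es)
    (map (distance_distribution {..<n} E) [1..<n]) (run_time n)"
proof -
  note at = arc_tree_encode[OF tree es]
  have n1: "1 \<le> n" and les: "length es = n - 1" using at by simp_all
  define l where "l = floorlog 2 n"
  define w where "w = 256 * l"
  define X where "X = (2::nat) ^ l"
  have X: "n < X" "2 \<le> X" and l1: "1 \<le> l"
  proof -
    show "n < X" using floorlog_bounds[of n 2] n1 by (simp add: X_def l_def)
    then have "X \<noteq> 1" using n1 by linarith
    then show "1 \<le> l" unfolding X_def by (cases l) auto
    then have "(2::nat) ^ 1 \<le> 2 ^ l" by (intro power_increasing) auto
    then show "2 \<le> X" by (simp add: X_def)
  qed
  have Xw: "2 ^ w = X ^ 256" by (simp add: X_def w_def power_mult[symmetric] mult.commute)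
  \<comment> \<open>Since \<open>X\<close> is at least \<open>2\<close>, constant factors can be
    absorbed into its exponent; words hold all numbers below \<open>X ^ 256\<close>.\<close>
  have Xk: "2 ^ k * X ^ j \<le> X ^ (k + j)" for k j
    using X(2) by (simp add: power_add power_mono)
  define k0 where "k0 = (LEAST k. n \<le> 2 ^ k)"
  have ex: "n \<le> 2 ^ l" using X(1) by (simp add: X_def)
  have k0: "n \<le> 2 ^ k0" "k0 \<le> l" "k0 = 0 \<or> 2 ^ (k0 - 1) < n"
  proof -
    show "n \<le> 2 ^ k0" unfolding k0_def by (rule LeastI[of _ l]) (rule ex)
    show "k0 \<le> l" unfolding k0_def by (rule Least_le) (rule ex)
    show "k0 = 0 \<or> 2 ^ (k0 - 1) < n"
    proof (cases "k0 = 0")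
      case False
      then have "k0 - 1 < k0" by simp
      then have "\<not> n \<le> 2 ^ (k0 - 1)" unfolding k0_def by (rule not_less_Least)
      then show ?thesis by simp
    qed simp
  qed
  define N0 where "N0 = (4 * 2 ^ k0 :: nat)"
  have N0n: "N0 \<le> 8 * n"
  proof (cases k0)
    case 0 then show ?thesis using n1 by (simp add: N0_def)
  next
    case (Suc k) then show ?thesis using k0(3) by (simp add: N0_def)
  qed
  define S where "S = int N0 ^ 20"
  let ?xs = "encode_graph n es"
  interpret solver w "8 * n" N0 S n E "2 * length es" "arc_src ?xs" "arc_tgt ?xs" "\<lambda>i. ?xs ! i" k0
  proof (intro solver.intro fixed_point.intro machine.intro fixed_point_axioms.intro solver_axioms.intro at(1))
    have "33 * (8 * n) + 64 \<le> 2 ^ 9 * X" using X by simp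
    also have "\<dots> \<le> X ^ 10" using Xk[of 9 1] by simp
    also have "\<dots> \<le> X ^ 256" using X(2) by (intro power_increasing) auto
    finally show "33 * (8 * n) + 64 \<le> 2 ^ w" by (simp add: Xw)
    show "2 * (S * S * S) < 2 ^ w"
    proof -
      \<comment> \<open>\<open>S * S * S\<close> is \<open>N0 ^ 60\<close>, and
        \<open>N0 \<le> X ^ 4\<close> bounds it by \<open>X ^ 240\<close>. This requirement dictates
        the word length; the factor \<open>256\<close> leaves some slack.\<close>
      have "N0 \<le> 2 ^ 3 * X ^ 1" using N0n X(1) by simp
      also have "\<dots> \<le> X ^ 4" using Xk[of 3 1] by simp
      finally have "N0 ^ 60 \<le> (X ^ 4) ^ 60" by (intro power_mono) auto
      then have "2 * N0 ^ 60 \<le> 2 ^ 1 * X ^ 240" by (simp add: power_mult[symmetric])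
      also have "\<dots> \<le> X ^ 241" using Xk[of 1 240] by simp
      also have "\<dots> < X ^ 256" using X(2) by (intro power_strict_increasing) auto
      finally have "2 * N0 ^ 60 < 2 ^ w" by (simp add: Xw)
      then have "int (2 * N0 ^ 60) < int (2 ^ w)" by (simp only: of_nat_less_iff)
      moreover have "2 * (S * S * S) = int (2 * N0 ^ 60)" by (simp add: S_def power_add[symmetric])
      ultimately show ?thesis by simp
    qed
    show "4 \<le> N0" by (simp add: N0_def)
    show "2 * length es = 2 * (n - 1)" using les by simp
  qed (use n1 k0 N0n in \<open>auto simp: S_def N0_def arc_src_def arc_tgt_def\<close>)
  let ?s0 = "initial_config w ?xs"
  let ?m = "\<lambda>k i. if k = 0 then int (mem ?s0 i) else 0" and ?v = "\<lambda>_. 0 :: int"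
  have memlt: "mem ?s0 i < 2 ^ w" for i by (simp add: initial_config_def)
  have len: "length ?xs = 2 * n - 1" using n1 les by (simp add: length_encode_graph)
  have nw: "8 * n < 2 ^ w" by (rule B_less(1))
  have entry: "?xs ! i < 2 ^ w" if "i < length ?xs" for i
  proof (cases "i = 0")
    case True then show ?thesis using nw by (simp add: encode_graph_def)
  next
    case False
    then have "1 \<le> i" "i \<le> 2 * length es" using that by (simp_all add: length_encode_graph)
    then have "arc_tgt ?xs i < n" using arc_less by blast
    then show ?thesis using nw by (simp add: arc_tgt_def)
  qed
  have mem0: "mem ?s0 i = ?xs ! i" if "i < length ?xs" for i
    using entry[OF that] that by (simp add: initial_config_def take_bit_nat_eq_self_iff)
  have "runs solve ?v ?m (n * 1700 + (k0 + 1) * (k0 + 1) * 4000 + 3 * n * floorlog 2 n * ((k0 + 3) * 20010) + 100)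
    (\<lambda>v' m'. \<forall>i<n - 1. m' 0 i = int (distance_distribution {..<n} E (Suc i)))"
  proof (rule runs_solve)
    show "?m aIn i = int (?xs ! i)" if "i \<le> 2 * length es" for i
      using mem0[of i] that by (simp add: length_encode_graph)
    show "?xs ! 0 = n" by (simp add: encode_graph_def)
  qed simp
  then obtain v' m' where big: "big solve ?v ?m (n * 1700 + (k0 + 1) * (k0 + 1) * 4000 + 3 * n * floorlog 2 n * ((k0 + 3) * 20010) + 100) v' m'"
    and out: "\<And>i. i < n - 1 \<Longrightarrow> m' 0 i = int (distance_distribution {..<n} E (Suc i))"
    unfolding runs_def by blast
  have pro: "(step w program ^^ 5) ?s0 = straight prologue ?s0"
    using exec_straight[of program ?s0 prologue] code_at_self(1)[of prologue "ccom 5 solve"]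
    by (simp add: program_def prologue_def initial_config_def eval_nat_numeral del: funpow.simps)
  let ?s1 = "straight prologue ?s0"
  have n0: "mem ?s0 0 = n" using mem0[of 0] len n1 by (simp add: encode_graph_def)
  have s1: "pc ?s1 = 5" "mem ?s1 = mem ?s0" "regs ?s1 1 = 8 * n" "\<And>r. r \<noteq> 1 \<Longrightarrow> regs ?s1 r = 0"
  proof -
    have "n + n + (n + n) + (n + n + (n + n)) = 8 * n" by simp
    then have "take_bit w (n + n + (n + n) + (n + n + (n + n))) = 8 * n"
      using nw by (simp only: take_bit_nat_eq_self)
    then have t: "take_bit w (n + n) = n + n" "take_bit w (n + n + (n + n)) = n + n + (n + n)"
      "take_bit w (n + n + (n + n) + (n + n + (n + n))) = 8 * n"
      using nw by (simp_all add: take_bit_nat_eq_self_iff)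
    have "regs ?s0 = (\<lambda>_. 0)" "pc ?s0 = 0" by (simp_all add: initial_config_def)
    then show "pc ?s1 = 5" "mem ?s1 = mem ?s0" "regs ?s1 1 = 8 * n" "\<And>r. r \<noteq> 1 \<Longrightarrow> regs ?s1 r = 0"
      using n0 t by (simp_all add: straight_def prologue_def)
  qed
  have rel: "rel ?v ?m ?s1"
    unfolding rel_def
  proof (intro conjI allI impI)
    fix x show "regs ?s1 (2 * x) = wd 0" using s1(4)[of "2 * x"] by (simp add: wd_def)
  next
    fix k i :: nat assume "k < 32" and i: "i < 8 * n"
    show "mem ?s1 (addr k i) = wd (?m k i)"
    proof (cases "k = 0")
      case True
      have "int (mem ?s0 i) < 2 ^ w" using memlt[of i] by (metis of_nat_less_iff of_nat_numeral of_nat_power)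
      then have "wd (int (mem ?s0 i)) = mem ?s0 i" by (simp add: wd_small)
      then show ?thesis using True s1(2) by (simp add: addr_def)
    next
      case False
      then have "length ?xs \<le> addr k i" using len by (simp add: addr_def)
      then show ?thesis using False s1(2) by (simp add: initial_config_def wd_def)
    qed
  qed (rule s1(3))
  have "length prologue = 5" by (simp add: prologue_def)
  then have "code_at program 5 (ccom 5 solve)"
    using code_at_self(2)[of prologue "ccom 5 solve"] by (simp only: program_def)
  from ccom_correct[OF big this rel s1(1)]
  obtain k s2 where s2: "k \<le> n * 1700 + (k0 + 1) * (k0 + 1) * 4000 + 3 * n * floorlog 2 n * ((k0 + 3) * 20010) + 100"
    "(step w program ^^ k) ?s1 = s2" "pc s2 = 5 + csize solve" "rel v' m' s2"
    unfolding reach_def by blast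
  have h: "halted program s2" using s2(3) by (simp add: halted_def program_def prologue_def)
  have "5 + k \<le> run_time n"
    using s2(1) time_bound[OF n1 l1 \<open>k0 \<le> l\<close>] unfolding run_time_def l_def by linarith
  then obtain j where j: "run_time n = 5 + k + j" using le_Suc_ex by blast
  have fin: "(step w program ^^ run_time n) ?s0 = s2"
    unfolding j steps_add pro s2(2) by (rule halted_steps[OF h])
  have res: "mem s2 i = map (distance_distribution {..<n} E) [1..<n] ! i" if "i < n - 1" for i
  proof -
    have "i < 8 * n" using that by linarith
    then have "mem s2 (addr 0 i) = wd (m' 0 i)" using s2(4) unfolding rel_def by auto
    then have "mem s2 i = wd (int (distance_distribution {..<n} E (Suc i)))"
      using out[OF that] by (simp add: addr_def)
    moreover have "int (distance_distribution {..<n} E (Suc i)) < 2 ^ w"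
      using pairs_at_less[of "Suc i"] pairs_at_distribution[of "Suc i"] by linarith
    ultimately show ?thesis using that by (simp add: wd_small)
  qed
  have lw: "log_word_length 256 n = w" by (simp add: log_word_length_def w_def l_def)
  show ?thesis unfolding ram_computes_def Let_def lw fin
  proof (intro conjI allI impI h)
    fix i assume "i < length (map (distance_distribution {..<n} E) [1..<n])"
    then show "mem s2 i = map (distance_distribution {..<n} E) [1..<n] ! i"
      by (intro res) (simp only: length_map length_upt)
  qed
qed

theorem theorem3:
  shows "\<exists>(P :: instr list) (k :: nat) (T :: nat \<Rightarrow> nat).
    k \<ge> 1 \<and>
    (\<lambda>n. real (T n)) \<in> O(\<lambda>n. real n * (log 2 (real n))\<^sup>2) \<and>
    (\<forall>(n :: nat) (E :: nat set set) (es :: (nat \<times> nat) list).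
       is_tree {..<n} E \<and> edge_list E es \<longrightarrow>
       ram_computes (log_word_length k n) P (encode_graph n es)
         (map (distance_distribution {..<n} E) [1..<n]) (T n))"
proof (intro exI conjI allI impI)
  show "(1::nat) \<le> 256" by simp
  show "(\<lambda>n. real (run_time n)) \<in> O(\<lambda>n. real n * (log 2 (real n))\<^sup>2)" by (rule run_time_bigo)
  fix n :: nat and E :: "nat set set" and es :: "(nat \<times> nat) list"
  assume "is_tree {..<n} E \<and> edge_list E es"
  then show "ram_computes (log_word_length 256 n) program (encode_graph n es)
    (map (distance_distribution {..<n} E) [1..<n]) (run_time n)" using program_correct by blast
qed

end
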